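(* Let $1\le k\le n$, let $M$ be a proper kernel, let $R(f)=\|M_f\|_{n-k}$, and let $I:\mathcal{G}'_k\cup\mathcal{S}(\mathbb{R}^n)\to\mathbb{R}^+$ be such that for any sequence $\{f_i\}\subseteq\mathcal{S}(\mathbb{R}^n)$ with $T_{f_i}\to^* f\in\mathcal{G}'_k$ one has $\lim_{i\to\infty}I(f_i)=I(f)$. If $\operatorname{Arg}\min_{f\in\mathcal{G}'_k}I(f)\subseteq\mathcal{B}_k$ and $\operatorname{rsol}(I,R)\neq\emptyset$, then $$\operatorname{rsol}(I,R)=\operatorname{Arg}\min_{f\in\mathcal{G}'_k}I(f).$$
   Context: $\mathcal{S}(\mathbb{R}^n)$ is the (complex) Schwartz space, $\mathcal{S}'(\mathbb{R}^n)$ the tempered distributions with the weak topology; $\to^*$ is weak convergence of sequences. A Schwartz function $f$ is identified with the distribution $T_f:\phi\mapsto\int f\phi$. $\mathbb{R}^+$ is the set of nonnegative reals. For $g\in\mathcal{S}'(\mathbb{R}^k)$, $g\otimes\delta^{n-k}$ is its tensor product with the $(n-k)$-dimensional Dirac delta at the origin. For $h\in\mathcal{S}'(\mathbb{R}^n)$ and orthogonal $U$, $\langle h_U,\phi\rangle=\langle h,\psi\rangle$ with $\psi(\mathbf{x})=\phi(U^T\mathbf{x})$. With $\mathcal{O}(n)=\{U\in\mathbb{R}^{n\times n}:U^TU=I_n\}$, $\mathcal{G}'_k=\{(g\otimes\delta^{n-k})_U: g\in\mathcal{S}'(\mathbb{R}^k),\ U\in\mathcal{O}(n)\}$ and $\mathcal{G}_k=\{(T_g\otimes\delta^{n-k})_U: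 g\in\mathcal{S}(\mathbb{R}^k),\ U\in\mathcal{O}(n)\}$. Proper kernel: for $M:\mathbb{R}^n\times\mathbb{R}^n\to\mathbb{C}$ let $\mathrm{O}_M[f](\mathbf{x})=\int M(\mathbf{x},\mathbf{y})f(\mathbf{y})\,d\mathbf{y}$. $M$ is a proper kernel if (1) $\mathrm{O}_M:L_2(\mathbb{R}^n)\to L_2(\mathbb{R}^n)$ is a properly defined, strictly positive, self-adjoint operator (strictly positive: $\langle f,\mathrm{O}_M[f]\rangle_{L_2}>0$ for $f\ne0$); (2) $M$ is bounded; (3) $\operatorname{Range}[\mathrm{O}_M]\cap\mathcal{S}(\mathbb{R}^n)$ is dense in $\mathcal{S}(\mathbb{R}^n)$ with its standard topology. For $f,g\in L_1(\mathbb{R}^n)$, $\langle f|M|g\rangle=\iint f(\mathbf{x})^*M(\mathbf{x},\mathbf{y})g(\mathbf{y})\,d\mathbf{x}\,d\mathbf{y}$. For $f,g\in\mathcal{S}'(\mathbb{R}^n)$, with $G^n_\epsilon(\mathbf{x})=(2\pi\epsilon^2)^{-n/2}e^{-\|\mathbf{x}\|^2/(2\epsilon^2)}$, $\langle f|M|g\rangle$ is defined if there are $f_\epsilon,g_\epsilon\in L_1(\mathbb{R}^n)$ with $T_{f_\epsilon}=f*G^n_\epsilon$, $T_{g_\epsilon}=g*G^n_\epsilon$ and $\lim_{\epsilon\to0}\langle f_\epsilon|M|g_\epsilon\rangle$ exists and is finite; its value is that limit. $M_f=[\operatorname{Re}\langle x_if|M|x_jf\rangle]_{1\le i,j\le n}$.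 For a positive semidefinite $A\in\mathbb{R}^{n\times n}$ with eigenvalues $\lambda_1\ge\dots\ge\lambda_n$ (with multiplicities), the Ky Fan $m$-anti-norm is $\|A\|_m=\sum_{i=1}^m\lambda_{n+1-i}$. $\mathcal{B}_k=\bigcup_{C>0}\overline{\{f\in\mathcal{G}_k:\operatorname{Tr}(M_f)\le C\}}^*$, where $\overline{\Omega}^*$ is the sequential closure (the set of weak limits of sequences from $\Omega$) in $\mathcal{S}'(\mathbb{R}^n)$, and only $f$ for which $M_f$ is defined are considered. A sequence $\{f_i\}_{i\ge1}\subseteq\mathcal{S}(\mathbb{R}^n)$ regularly solves the penalized problem if there are $\epsilon_i\to+0$ and $\lambda_i\to+\infty$ with $I(f_i)+\lambda_iR(f_i)\le\inf_{f\in\mathcal{S}(\mathbb{R}^n)}\big(I(f)+\lambda_iR(f)\big)+\epsilon_i$ for all $i$, and $\operatorname{Tr}(M_{f_i})$ is bounded. For a sequence of distributions, $\operatorname{Lim}_{i\to\infty}h_i$ is the set of weak limits of its subsequences. $\operatorname{rsol}(I,R)=\bigcup\operatorname{Lim}_{i\to\infty}T_{f_i}$, the union being over all sequences $\{f_i\}$ that regularly solve the penalized problem. $\operatorname{Arg}\min$ denotes the set of all minimizers. *)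

theory Defs
  imports "HOL-Analysis.Analysis" "HOL-Computational_Algebra.Polynomial"
begin

section \<open>Schwartz functions\<close>

text \<open>A list of coordinates stands for an iterated partial derivative. In a Schwartz function all
  of these are required to be (Frechet) differentiable, so that they are continuous and the order of
  differentiation is irrelevant.\<close>

primrec iter_partial :: "'n list \<Rightarrow> (real^'n::finite \<Rightarrow> complex) \<Rightarrow> real^'n \<Rightarrow> complex" where
  "iter_partial [] f = f"
| "iter_partial (i # is) f = (\<lambda>x. frechet_derivative (iter_partial is f) (at x) (axis i 1))"

definition monomial_fun :: "('n \<Rightarrow> nat) \<Rightarrow> real^'n::finite \<Rightarrow> real" where
  "monomial_fun a x = (\<Prod>i\<in>UNIV. (x $ i) ^ a i)"

definition schwartz_space :: "(real^'n::finite \<Rightarrow> complex) set" where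
  "schwartz_space = {f.
     (\<forall>is x. iter_partial is f differentiable (at x)) \<and>
     (\<forall>a is. bounded (range (\<lambda>x. of_real (monomial_fun a x) * iter_partial is f x)))}"

definition schwartz_seminorm ::
    "('n \<Rightarrow> nat) \<Rightarrow> 'n list \<Rightarrow> (real^'n::finite \<Rightarrow> complex) \<Rightarrow> real" where
  "schwartz_seminorm a is f = (SUP x. norm (of_real (monomial_fun a x) * iter_partial is f x))"

definition schwartz_topology :: "(real^'n::finite \<Rightarrow> complex) topology" where
  "schwartz_topology = topology_generated_by
     {{g \<in> schwartz_space. schwartz_seminorm a is (\<lambda>x. g x - f x) < r} | a is f r.
        f \<in> schwartz_space}"


section \<open>Tempered distributions\<close>

text \<open>Distributions are functionals that are \<^const>\<open>undefined\<close> outside the Schwartz space, so that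
  equality of distributions is equality of HOL functions.\<close>

type_synonym 'n distr = "(real^'n \<Rightarrow> complex) \<Rightarrow> complex"

definition tempered :: "'n::finite distr set" where
  "tempered = {T \<in> extensional schwartz_space.
     (\<forall>\<phi>\<in>schwartz_space. \<forall>\<psi>\<in>schwartz_space. \<forall>a b.
        T (\<lambda>x. a * \<phi> x + b * \<psi> x) = a * T \<phi> + b * T \<psi>) \<and>
     continuous_map schwartz_topology euclidean T}"

text \<open>The product topology on extensional functionals is pointwise convergence on Schwartz functions.\<close>

definition weak_topology :: "'n::finite distr topology" where
  "weak_topology = subtopology (product_topology (\<lambda>_. euclidean) schwartz_space) tempered"

definition distr_of :: "(real^'n::finite \<Rightarrow> complex) \<Rightarrow> 'n distr" where
  "distr_of f = (\<lambda>\<phi>\<in>schwartz_space. LINT x|lebesgue. f x * \<phi> x)"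

definition seq_closure :: "'n::finite distr set \<Rightarrow> 'n distr set" where
  "seq_closure \<Omega> = {h. \<exists>s. (\<forall>i. s i \<in> \<Omega>) \<and> limitin weak_topology s h sequentially}"

definition Lim_set :: "(nat \<Rightarrow> 'n::finite distr) \<Rightarrow> 'n distr set" where
  "Lim_set s = {h. \<exists>r. strict_mono r \<and> limitin weak_topology (s \<circ> r) h sequentially}"

definition mult_coord :: "'n \<Rightarrow> 'n::finite distr \<Rightarrow> 'n distr" where
  "mult_coord i T = (\<lambda>\<phi>\<in>schwartz_space. T (\<lambda>x. of_real (x $ i) * \<phi> x))"

definition convolve :: "'n::finite distr \<Rightarrow> (real^'n \<Rightarrow> real) \<Rightarrow> 'n distr" where
  "convolve T G = (\<lambda>\<phi>\<in>schwartz_space. T (\<lambda>x. LINT y|lebesgue. of_real (G y) * \<phi> (x + y)))"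

definition gaussian :: "real \<Rightarrow> real^'n::finite \<Rightarrow> real" where
  "gaussian \<epsilon> x =
     (2 * pi * \<epsilon>\<^sup>2) powr (- real CARD('n) / 2) * exp (- (norm x)\<^sup>2 / (2 * \<epsilon>\<^sup>2))"

definition rotate_distr :: "real^'n^'n \<Rightarrow> 'n::finite distr \<Rightarrow> 'n distr" where
  "rotate_distr U h = (\<lambda>\<phi>\<in>schwartz_space. h (\<lambda>x. \<phi> (transpose U *v x)))"

text \<open>The injection \<open>\<iota>\<close> singles out the \<open>k\<close> coordinates of \<open>n\<close>-space that carry \<open>g\<close>; the
  delta lives on the remaining ones. By the definition of the tensor product, \<open>g \<otimes> \<delta>\<close> maps \<open>\<phi>\<close> to
  \<open>g\<close> applied to \<open>x \<mapsto> \<delta>(\<phi>(x, -)) = \<phi>(x, 0)\<close>.\<close>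

definition pad_zero :: "('k \<Rightarrow> 'n) \<Rightarrow> real^'k::finite \<Rightarrow> real^'n::finite" where
  "pad_zero \<iota> x = (\<chi> j. if j \<in> range \<iota> then x $ (inv \<iota> j) else 0)"

definition tensor_delta :: "('k \<Rightarrow> 'n) \<Rightarrow> 'k::finite distr \<Rightarrow> 'n::finite distr" where
  "tensor_delta \<iota> g = (\<lambda>\<phi>\<in>schwartz_space. g (\<lambda>x. \<phi> (pad_zero \<iota> x)))"

definition G_tempered :: "('k::finite \<Rightarrow> 'n::finite) \<Rightarrow> 'n distr set" where
  "G_tempered \<iota> = {rotate_distr U (tensor_delta \<iota> g) | g U. g \<in> tempered \<and> orthogonal_matrix U}"

definition G_schwartz :: "('k::finite \<Rightarrow> 'n::finite) \<Rightarrow> 'n distr set" where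
  "G_schwartz \<iota> = {rotate_distr U (tensor_delta \<iota> (distr_of g)) | g U.
     g \<in> schwartz_space \<and> orthogonal_matrix U}"


section \<open>Proper kernels\<close>

definition L2_space :: "(real^'n::finite \<Rightarrow> complex) set" where
  "L2_space = {f \<in> borel_measurable lebesgue. integrable lebesgue (\<lambda>x. (norm (f x))\<^sup>2)}"

definition L2_inner :: "(real^'n::finite \<Rightarrow> complex) \<Rightarrow> (real^'n \<Rightarrow> complex) \<Rightarrow> complex" where
  "L2_inner f g = (LINT x|lebesgue. cnj (f x) * g x)"

definition kernel_op ::
    "(real^'n::finite \<Rightarrow> real^'n \<Rightarrow> complex) \<Rightarrow> (real^'n \<Rightarrow> complex) \<Rightarrow> real^'n \<Rightarrow> complex" where
  "kernel_op M f x = (LINT y|lebesgue. M x y * f y)"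

text \<open>Elements of \<open>L\<^sub>2\<close> are functions up to null sets, hence the almost-everywhere clauses. Since
  \<^const>\<open>kernel_op\<close> is defined on all of \<open>L\<^sub>2\<close>, self-adjoint means symmetric.\<close>

definition proper_kernel :: "(real^'n::finite \<Rightarrow> real^'n \<Rightarrow> complex) \<Rightarrow> bool" where
  "proper_kernel M \<longleftrightarrow>
     case_prod M \<in> borel_measurable lebesgue \<and>
     (\<forall>f\<in>L2_space. (AE x in lebesgue. integrable lebesgue (\<lambda>y. M x y * f y)) \<and>
                   kernel_op M f \<in> L2_space) \<and>
     (\<forall>f\<in>L2_space. \<forall>g\<in>L2_space. L2_inner f (kernel_op M g) = L2_inner (kernel_op M f) g) \<and>
     (\<forall>f\<in>L2_space. \<not> (AE x in lebesgue. f x = 0) \<longrightarrow>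
        L2_inner f (kernel_op M f) \<in> \<real> \<and> Re (L2_inner f (kernel_op M f)) > 0) \<and>
     bounded (range (case_prod M)) \<and>
     schwartz_topology closure_of
       {\<phi> \<in> schwartz_space. \<exists>f\<in>L2_space. AE x in lebesgue. \<phi> x = kernel_op M f x}
       = schwartz_space"


section \<open>The matrix of a distribution\<close>

definition kernel_form_fun ::
    "(real^'n::finite \<Rightarrow> real^'n \<Rightarrow> complex) \<Rightarrow> (real^'n \<Rightarrow> complex) \<Rightarrow> (real^'n \<Rightarrow> complex) \<Rightarrow> complex"
  where
  "kernel_form_fun M f g = (LINT (x, y)|lebesgue. cnj (f x) * M x y * g y)"

definition has_kernel_form ::
    "(real^'n::finite \<Rightarrow> real^'n \<Rightarrow> complex) \<Rightarrow> 'n distr \<Rightarrow> 'n distr \<Rightarrow> complex \<Rightarrow> bool" where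
  "has_kernel_form M f g L \<longleftrightarrow> (\<exists>F G.
     (\<forall>\<epsilon>>0. integrable lebesgue (F \<epsilon>) \<and> distr_of (F \<epsilon>) = convolve f (gaussian \<epsilon>) \<and>
            integrable lebesgue (G \<epsilon>) \<and> distr_of (G \<epsilon>) = convolve g (gaussian \<epsilon>)) \<and>
     ((\<lambda>\<epsilon>. kernel_form_fun M (F \<epsilon>) (G \<epsilon>)) \<longlongrightarrow> L) (at_right 0))"

definition kernel_form ::
    "(real^'n::finite \<Rightarrow> real^'n \<Rightarrow> complex) \<Rightarrow> 'n distr \<Rightarrow> 'n distr \<Rightarrow> complex" where
  "kernel_form M f g = (THE L. has_kernel_form M f g L)"

definition M_defined :: "(real^'n::finite \<Rightarrow> real^'n \<Rightarrow> complex) \<Rightarrow> 'n distr \<Rightarrow> bool" where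
  "M_defined M f \<longleftrightarrow> (\<forall>i j. \<exists>L. has_kernel_form M (mult_coord i f) (mult_coord j f) L)"

definition M_matrix :: "(real^'n::finite \<Rightarrow> real^'n \<Rightarrow> complex) \<Rightarrow> 'n distr \<Rightarrow> real^'n^'n" where
  "M_matrix M f = (\<chi> i j. Re (kernel_form M (mult_coord i f) (mult_coord j f)))"

definition charpoly :: "real^'n^'n::finite \<Rightarrow> real poly" where
  "charpoly A = det (\<chi> i j. (if i = j then [:0, 1:] else 0) - [:A $ i $ j:])"

text \<open>The sum of the \<open>m\<close> smallest eigenvalues, counted with multiplicity.\<close>

definition ky_fan_antinorm :: "nat \<Rightarrow> real^'n^'n::finite \<Rightarrow> real" where
  "ky_fan_antinorm m A = sum_list (take m (sorted_list_of_multiset (proots (charpoly A))))"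

definition B_set ::
    "(real^'n::finite \<Rightarrow> real^'n \<Rightarrow> complex) \<Rightarrow> ('k::finite \<Rightarrow> 'n) \<Rightarrow> 'n distr set" where
  "B_set M \<iota> = (\<Union>C\<in>{0<..}. seq_closure
     {f \<in> G_schwartz \<iota>. M_defined M f \<and> trace (M_matrix M f) \<le> C})"


section \<open>The penalized problem\<close>

text \<open>Functionals on Schwartz functions are functionals on distributions, evaluated at
  \<^const>\<open>distr_of\<close>. The infimum is taken in the extended reals, so that it is meaningful even if
  finitely many \<open>\<lambda>\<^sub>i\<close> are negative.\<close>

definition regularly_solves ::
    "(real^'n::finite \<Rightarrow> real^'n \<Rightarrow> complex) \<Rightarrow> ('n distr \<Rightarrow> real) \<Rightarrow> ('n distr \<Rightarrow> real) \<Rightarrow>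
     (nat \<Rightarrow> real^'n \<Rightarrow> complex) \<Rightarrow> bool" where
  "regularly_solves M I R f \<longleftrightarrow>
     (\<forall>i. f i \<in> schwartz_space) \<and>
     (\<exists>eps lam. filterlim eps (at_right 0) sequentially \<and> filterlim lam at_top sequentially \<and>
        (\<forall>i. ereal (I (distr_of (f i)) + lam i * R (distr_of (f i)))
              \<le> (INF h\<in>schwartz_space. ereal (I (distr_of h) + lam i * R (distr_of h)))
                + ereal (eps i))) \<and>
     bounded (range (\<lambda>i. trace (M_matrix M (distr_of (f i)))))"

definition rsol ::
    "(real^'n::finite \<Rightarrow> real^'n \<Rightarrow> complex) \<Rightarrow> ('n distr \<Rightarrow> real) \<Rightarrow> ('n distr \<Rightarrow> real) \<Rightarrow>
     'n distr set" where
  "rsol M I R = (\<Union>f\<in>{f. regularly_solves M I R f}. Lim_set (\<lambda>i. distr_of (f i)))"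

definition Arg_min_set :: "('a \<Rightarrow> real) \<Rightarrow> 'a set \<Rightarrow> 'a set" where
  "Arg_min_set I A = {f. is_arg_min I (\<lambda>h. h \<in> A) f}"

end

theory Submission
  imports Defs "HOL-Probability.Probability"
begin

text \<open>The penalty \<open>R\<close> characterizes the distributions that live on a \<open>k\<close>-dimensional subspace: they are
  exactly the weak limits of Schwartz functions along which \<open>R\<close> tends to zero, and this convergence can be
  made as fast as desired.

  Why limits of regular solutions lie in \<open>G_tempered\<close>. Comparison with the zero function bounds
  \<open>\<lambda>\<^sub>i R(f\<^sub>i)\<close>, so \<open>R(f\<^sub>i) \<longlonglongrightarrow> 0\<close>. Since \<open>R(f\<^sub>i)\<close> is the sum of the \<open>n - k\<close> smallest eigenvalues of the positive
  semidefinite matrix of \<open>f\<^sub>i\<close>, there are \<open>n - k\<close> orthonormal directions \<open>v\<close> in which the quadratic form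
  \<open>\<langle>(v \<bullet> x) f\<^sub>i | M | (v \<bullet> x) f\<^sub>i\<rangle>\<close> is at most \<open>R(f\<^sub>i)\<close>, and by compactness these directions converge along a
  subsequence. The Cauchy-Schwarz inequality for the form of \<open>M\<close> gives \<open>\<langle>(v \<bullet> x) f\<^sub>i | M | w\<rangle> \<longlonglongrightarrow> 0\<close> for every
  \<open>w\<close> in \<open>L\<^sub>2\<close>. As the range of the operator of \<open>M\<close> is dense in the Schwartz space, the limit distribution \<open>T\<close>
  satisfies \<open>(v \<bullet> x) T = 0\<close> for the limit directions (\<open>vanishing_antinorm_limit\<close>). A Schwartz function that
  vanishes on a coordinate hyperplane is divisible by the coordinate within the Schwartz space, hence \<open>T\<close> depends only on
  the restriction of the test function to the orthogonal complement of these directions, which makes it a rotated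
  tensor product with a Dirac delta (\<open>annihilated_directions_imp_G_tempered\<close>).

  Why every element of \<open>G_tempered\<close> is the limit of Schwartz functions with negligible penalty. Schwartz
  functions are sequentially dense in the tempered distributions (\<open>schwartz_sequentially_dense\<close>), so
  \<open>G_schwartz\<close> is sequentially dense in \<open>G_tempered\<close>. Smoothing an element of \<open>G_schwartz\<close> by a Gaussian of
  width \<open>\<epsilon>\<close> yields a Schwartz function whose penalty is \<open>O(\<epsilon>\<^sup>2)\<close>, because in the directions of the delta
  only the first moment of the Gaussian is seen, and because by Ky Fan's principle every choice of \<open>n - k\<close>
  orthonormal directions bounds the sum of the smallest eigenvalues from above (\<open>smoothing_G_schwartz\<close>). Given
  \<open>\<lambda>\<^sub>i\<close>, the width can be chosen so small that \<open>\<lambda>\<^sub>i R\<close> tends to zero and the traces grow by at most 1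
  (\<open>recovery_sequence\<close>).

  Both inclusions follow. Comparing a regular solution with a recovery sequence of an arbitrary element of
  \<open>G_tempered\<close>, and passing to the limit with the continuity of \<open>I\<close>, shows that its limits are minimizers.
  Conversely, a minimizer in \<open>B_set\<close> has a recovery sequence with bounded traces; the given regular solution has
  a limit in \<open>G_tempered\<close>, so it shows that the infima of the penalized problems are asymptotically no smaller
  than the minimum of \<open>I\<close>, and therefore the recovery sequence is itself a regular solution.\<close>

section \<open>Symmetric matrices and the Ky Fan anti-norm\<close>

lemma linear_le_quadratic_imp_zero:
  fixes a b :: real
  assumes "\<And>t. 2 * t * a \<le> t\<^sup>2 * b"
  shows "a = 0"
proof (rule ccontr)
  assume a: "a \<noteq> 0"
  define c where "c = \<bar>b\<bar> + 1"
  have c: "c > 0" "b \<le> c" by (auto simp: c_def)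
  have "2 * (a / c) * a \<le> (a / c)\<^sup>2 * b" by (rule assms)
  also have "\<dots> \<le> (a / c)\<^sup>2 * c" by (intro mult_left_mono c) auto
  also have "\<dots> = a\<^sup>2 / c" using c by (simp add: power2_eq_square field_simps)
  finally have "2 * (a\<^sup>2 / c) \<le> a\<^sup>2 / c" by (simp add: power2_eq_square)
  moreover have "a\<^sup>2 / c > 0" using a c by simp
  ultimately show False by simp
qed

lemma symmetric_matrix_inner:
  fixes A :: "real^'n^'n"
  assumes "transpose A = A"
  shows "x \<bullet> (A *v y) = (A *v x) \<bullet> y"
  by (metis assms dot_lmul_matrix vector_transpose_matrix)

text \<open>The quadratic form attains its maximum on the unit sphere of the subspace; there the first
  variation vanishes, which is the eigenvector equation.\<close>

lemma symmetric_eigenvector_in_invariant_subspace: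
  fixes A :: "real^'n^'n"
  assumes sym: "transpose A = A" and S: "subspace S" "dim S > 0"
    and inv: "\<And>x. x \<in> S \<Longrightarrow> A *v x \<in> S"
  shows "\<exists>v d. v \<in> S \<and> norm v = 1 \<and> A *v v = d *\<^sub>R v"
proof -
  let ?K = "S \<inter> sphere 0 1"
  let ?f = "\<lambda>x. x \<bullet> (A *v x)"
  have "compact ?K"
    using closed_subspace[OF S(1)] by (simp add: closed_Int_compact)
  moreover have "?K \<noteq> {}"
  proof -
    have "\<not> S \<subseteq> {0}" using S(2) by (metis dim_eq_0 less_irrefl)
    then obtain x where x: "x \<in> S" "x \<noteq> 0" by auto
    have "inverse (norm x) *\<^sub>R x \<in> ?K"
      using x S(1) by (auto simp: subspace_scale)
    thus ?thesis by blast
  qed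
  moreover have "continuous_on ?K ?f"
    by (intro continuous_on_inner continuous_on_id matrix_vector_mult_linear_continuous_on)
  ultimately obtain v where v: "v \<in> ?K" and max: "\<And>x. x \<in> ?K \<Longrightarrow> ?f x \<le> ?f v"
    using continuous_attains_sup[of ?K ?f] by blast
  define d where "d = ?f v"
  have nv: "v \<bullet> v = 1" using v by (simp add: dot_square_norm)
  have le: "?f w \<le> d * (w \<bullet> w)" if w: "w \<in> S" for w
  proof (cases "w = 0")
    case False
    have "?f (inverse (norm w) *\<^sub>R w) \<le> d" unfolding d_def
      using w False S(1) by (intro max) (auto simp: subspace_scale)
    hence "(inverse (norm w))\<^sup>2 * ?f w \<le> d"
      by (simp add: matrix_vector_mult_scaleR power2_eq_square)
    hence "(norm w)\<^sup>2 * ((inverse (norm w))\<^sup>2 * ?f w) \<le> (norm w)\<^sup>2 * d"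
      by (intro mult_left_mono) auto
    moreover have "(norm w)\<^sup>2 * ((inverse (norm w))\<^sup>2 * ?f w) = ?f w"
      using False by (simp add: power_inverse)
    ultimately have "?f w \<le> d * (norm w)\<^sup>2" by (simp only: mult.commute)
    thus ?thesis by (simp only: dot_square_norm)
  qed auto
  define w where "w = A *v v - d *\<^sub>R v"
  have wS: "w \<in> S" unfolding w_def
    using v inv S(1) by (auto intro: subspace_diff subspace_scale)
  have "w \<bullet> (A *v v) - d * (w \<bullet> v) = 0"
  proof (rule linear_le_quadratic_imp_zero[where b = "d * (w \<bullet> w) - ?f w"])
    fix t :: real
    have "v + t *\<^sub>R w \<in> S" using v wS S(1) by (auto intro: subspace_add subspace_scale)
    from le[OF this] show "2 * t * (w \<bullet> (A *v v) - d * (w \<bullet> v)) \<le> t\<^sup>2 * (d * (w \<bullet> w) - ?f w)"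
      using nv symmetric_matrix_inner[OF sym, of v w]
      by (simp add: matrix_vector_right_distrib matrix_vector_mult_scaleR inner_add_left
          inner_add_right inner_commute d_def[symmetric] power2_eq_square algebra_simps)
  qed
  hence "w \<bullet> w = 0" by (simp add: w_def inner_diff_right)
  hence "A *v v = d *\<^sub>R v" by (simp add: w_def)
  thus ?thesis using v by auto
qed

text \<open>Induction on the dimension: the orthogonal complement of an eigenvector in an invariant
  subspace is again invariant.\<close>

lemma symmetric_orthonormal_eigenvectors:
  fixes A :: "real^'n^'n"
  assumes sym: "transpose A = A"
  shows "subspace S \<Longrightarrow> (\<And>x. x \<in> S \<Longrightarrow> A *v x \<in> S) \<Longrightarrow> dim S = m \<Longrightarrow>
    \<exists>B \<subseteq> S. finite B \<and> card B = m \<and> pairwise orthogonal B \<and>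
      (\<forall>b\<in>B. norm b = 1 \<and> (\<exists>d. A *v b = d *\<^sub>R b))"
proof (induction m arbitrary: S)
  case 0
  thus ?case by (intro exI[of _ "{}"]) auto
next
  case (Suc m)
  obtain v d where v: "v \<in> S" "norm v = 1" "A *v v = d *\<^sub>R v"
    using symmetric_eigenvector_in_invariant_subspace[OF sym Suc.prems(1) _ Suc.prems(2)] Suc.prems(3)
    by auto
  let ?S = "{y \<in> S. \<forall>x\<in>span {v}. orthogonal x y}"
  have orth: "(\<forall>x\<in>span {v}. orthogonal x y) \<longleftrightarrow> v \<bullet> y = 0" for y
    by (auto simp: span_singleton orthogonal_def intro: span_base)
  have S': "?S = S \<inter> {y. v \<bullet> y = 0}" using orth by auto
  have sub: "subspace ?S" unfolding S'
    by (intro subspace_inter Suc.prems(1) subspace_hyperplane)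
  have inv: "A *v y \<in> ?S" if "y \<in> ?S" for y
    using that Suc.prems(2) symmetric_matrix_inner[OF sym, of v y] v unfolding S' by auto
  have vn0: "v \<noteq> 0" using v by auto
  have "dim ?S + dim (span {v}) = dim S"
    by (intro dim_subspace_orthogonal_to_vectors Suc.prems(1) subspace_span)
       (use v Suc.prems(1) span_minimal[of "{v}" S] in auto)
  moreover have "dim (span {v}) = 1" using vn0 by (simp add: dim_insert)
  ultimately have "dim ?S = m" using Suc.prems(3) by simp
  from Suc.IH[OF sub inv this] obtain B where B: "B \<subseteq> ?S" "finite B" "card B = m"
    "pairwise orthogonal B" "\<forall>b\<in>B. norm b = 1 \<and> (\<exists>d. A *v b = d *\<^sub>R b)" by auto
  have "v \<notin> B" using B(1) v(2) unfolding S' by (auto simp: dot_square_norm)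
  moreover have "pairwise orthogonal (insert v B)"
    using B(1,4) unfolding S' pairwise_insert by (auto simp: orthogonal_def inner_commute)
  ultimately show ?case using B v
    by (intro exI[of _ "insert v B"]) auto
qed

theorem symmetric_matrix_spectral:
  fixes A :: "real^'n^'n"
  assumes sym: "transpose A = A"
  shows "\<exists>U d. orthogonal_matrix U \<and> (\<forall>i. A *v row i U = d i *\<^sub>R row i U)"
proof -
  obtain B where B: "finite B" "card B = CARD('n)" "pairwise orthogonal B"
    "\<forall>b\<in>B. norm b = 1 \<and> (\<exists>d. A *v b = d *\<^sub>R b)"
    using symmetric_orthonormal_eigenvectors[OF sym, of UNIV "CARD('n)"] by auto
  obtain f where f: "bij_betw f (UNIV :: 'n set) B"
    using finite_same_card_bij[of "UNIV :: 'n set" B] B by auto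
  define U :: "real^'n^'n" where "U = (\<chi> i. f i)"
  have row: "row i U = f i" for i by (simp add: U_def row_def vec_eq_iff)
  have fB: "f i \<in> B" for i using f by (auto simp: bij_betw_def)
  have "orthogonal_matrix U"
    unfolding orthogonal_matrix_orthonormal_rows row
    using B(3,4) fB bij_betw_imp_inj_on[OF f] by (metis UNIV_I inj_onD pairwiseD)
  moreover have "\<exists>d. \<forall>i. A *v row i U = d i *\<^sub>R row i U"
    unfolding row using B(4) fB by (intro choice) auto
  ultimately show ?thesis by blast
qed

lemma poly_charpoly: "poly (charpoly A) x = det (x *\<^sub>R mat 1 - A)"
proof -
  have "poly (charpoly A) x = (\<Sum>p | p permutes UNIV. of_int (sign p) *
     (\<Prod>i\<in>UNIV. poly ((if i = p i then [:0, 1:] else 0) - [:A $ i $ p i:]) x))"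
    by (simp add: charpoly_def det_def poly_sum poly_prod)
  also have "\<dots> = det (x *\<^sub>R mat 1 - A)"
    unfolding det_def by (intro sum.cong refl arg_cong2[of _ _ _ _ "(*)"] prod.cong)
      (auto simp: mat_def)
  finally show ?thesis .
qed

lemma proots_linear_prod:
  fixes d :: "'n \<Rightarrow> real"
  assumes "finite J"
  shows "proots (\<Prod>i\<in>J. [:- d i, 1:]) = image_mset d (mset_set J)"
  using assms
proof (induction J rule: finite_induct)
  case (insert j J)
  have "(\<Prod>i\<in>J. [:- d i, 1:]) \<noteq> 0" using insert by (simp add: prod_zero_iff)
  moreover have "proots [:- d j, 1:] = {#d j#}"
    using proots_linear_factor[of "- d j"] by simp
  moreover have "[:- d j, 1:] \<noteq> 0" by simp
  ultimately have "proots ([:- d j, 1:] * (\<Prod>i\<in>J. [:- d i, 1:])) =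
      {#d j#} + proots (\<Prod>i\<in>J. [:- d i, 1:])" by (metis proots_mult)
  thus ?case using insert by (simp only: prod.insert insert.IH mset_set.insert) simp
qed simp

text \<open>In an orthonormal eigenbasis the matrix is diagonal, so the characteristic polynomial factors
  into the linear polynomials of the eigenvalues.\<close>

lemma proots_charpoly:
  fixes A :: "real^'n^'n"
  assumes U: "orthogonal_matrix U" and ev: "\<And>i. A *v row i U = d i *\<^sub>R row i U"
  shows "proots (charpoly A) = image_mset d (mset_set UNIV)"
proof -
  have "poly (charpoly A) x = poly (\<Prod>i\<in>UNIV. [:- d i, 1:]) x" for x
  proof -
    let ?D = "\<chi> i j. if i = j then x - d i else 0"
    have "((x *\<^sub>R mat 1 - A) ** transpose U) $ i $ j = (transpose U ** ?D) $ i $ j" for i j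
    proof -
      have "((x *\<^sub>R mat 1 - A) ** transpose U) $ i $ j = ((x *\<^sub>R mat 1 - A) *v row j U) $ i"
        by (simp add: matrix_matrix_mult_def matrix_vector_mult_def transpose_def row_def)
      also have "\<dots> = (x - d j) * U $ j $ i"
        by (simp add: matrix_vector_mult_diff_rdistrib scaleR_matrix_vector_assoc[symmetric] ev
            algebra_simps) (simp add: row_def)
      also have "\<dots> = (transpose U ** ?D) $ i $ j"
        by (simp add: matrix_matrix_mult_def transpose_def if_distrib cong: if_cong)
      finally show ?thesis .
    qed
    hence "(x *\<^sub>R mat 1 - A) ** transpose U = transpose U ** ?D" by (simp add: vec_eq_iff)
    from arg_cong[OF this, of det] have "det (x *\<^sub>R mat 1 - A) * det U = det U * det ?D"
      by (simp add: det_mul)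
    moreover have "det U \<noteq> 0" using det_orthogonal_matrix[OF U] by auto
    ultimately have "det (x *\<^sub>R mat 1 - A) = det ?D" by simp
    also have "\<dots> = (\<Prod>i\<in>UNIV. x - d i)" by (subst det_diagonal) auto
    finally show ?thesis by (simp add: poly_charpoly poly_prod)
  qed
  hence "charpoly A = (\<Prod>i\<in>UNIV. [:- d i, 1:])" by (intro poly_ext) auto
  thus ?thesis by (simp add: proots_linear_prod)
qed

lemma sum_of_smallest:
  fixes d :: "'n::finite \<Rightarrow> real"
  assumes "m \<le> CARD('n)"
  shows "\<exists>J. card J = m \<and> (\<forall>i\<in>J. \<forall>j\<in>-J. d i \<le> d j) \<and>
    sum_list (take m (sorted_list_of_multiset (image_mset d (mset_set UNIV)))) = sum d J"
proof -
  obtain xs where xs: "set xs = (UNIV :: 'n set)" "distinct xs"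
    using finite_distinct_list[of "UNIV :: 'n set"] by auto
  define ys where "ys = sort_key d xs"
  have ys: "set ys = UNIV" "distinct ys" "sorted (map d ys)" using xs by (auto simp: ys_def)
  have "image_mset d (mset_set UNIV) = mset (map d ys)"
    using ys mset_set_set[of ys] by simp
  hence srt: "sorted_list_of_multiset (image_mset d (mset_set UNIV)) = map d ys"
    using sorted_sort_id[OF ys(3)] by (simp only: sorted_list_of_multiset_mset)
  have len: "length ys = CARD('n)" using ys distinct_card by fastforce
  let ?J = "set (take m ys)"
  have "card ?J = m" using distinct_card[OF distinct_take[OF ys(2)]] len assms by simp
  moreover have "d i \<le> d j" if "i \<in> ?J" "j \<in> - ?J" for i j
  proof -
    from that(2) ys(1) have "j \<in> set (drop m ys)"
      by (metis Compl_iff UNIV_I Un_iff append_take_drop_id set_append)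
    moreover have "sorted (map d (take m ys) @ map d (drop m ys))"
      using ys(3) by (metis append_take_drop_id map_append)
    ultimately show ?thesis using that(1) by (auto simp: sorted_append)
  qed
  moreover have "sum_list (take m (map d ys)) = sum d ?J"
    using sum_list_distinct_conv_sum_set[OF distinct_take[OF ys(2)]] by (simp add: take_map)
  ultimately show ?thesis unfolding srt by blast
qed

lemma ky_fan_antinorm_eigenvalues:
  fixes A :: "real^'n^'n"
  assumes "transpose A = A" "m \<le> CARD('n)"
  obtains U d J where "orthogonal_matrix U" "\<And>i. A *v row i U = d i *\<^sub>R row i U"
    "card J = m" "\<And>i j. i \<in> J \<Longrightarrow> j \<notin> J \<Longrightarrow> d i \<le> d j" "ky_fan_antinorm m A = sum d J"
proof -
  obtain U d where U: "orthogonal_matrix U" "\<forall>i. A *v row i U = d i *\<^sub>R row i U"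
    using symmetric_matrix_spectral[OF assms(1)] by auto
  obtain J where J: "card J = m" "\<forall>i\<in>J. \<forall>j\<in>-J. d i \<le> d j"
    "sum_list (take m (sorted_list_of_multiset (image_mset d (mset_set UNIV)))) = sum d J"
    using sum_of_smallest[OF assms(2), of d] by auto
  show ?thesis
    by (rule that[of U d J]) (use U J proots_charpoly[of U A d] in \<open>auto simp: ky_fan_antinorm_def\<close>)
qed

lemma eigenvalue_nonneg:
  fixes A :: "real^'n^'n"
  assumes U: "orthogonal_matrix U" and ev: "\<And>i. A *v row i U = d i *\<^sub>R row i U"
    and psd: "\<And>x. 0 \<le> x \<bullet> (A *v x)"
  shows "0 \<le> d i"
proof -
  have "row i U \<bullet> row i U = 1" using U by (simp add: orthogonal_matrix_orthonormal_rows dot_square_norm)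
  thus ?thesis using psd[of "row i U"] ev[of i] by simp
qed

lemma ky_fan_antinorm_nonneg:
  fixes A :: "real^'n^'n"
  assumes "transpose A = A" "m \<le> CARD('n)" and psd: "\<And>x. 0 \<le> x \<bullet> (A *v x)"
  shows "0 \<le> ky_fan_antinorm m A"
proof -
  obtain U d J where U: "orthogonal_matrix U" "\<And>i. A *v row i U = d i *\<^sub>R row i U"
    and "ky_fan_antinorm m A = sum d J"
    using ky_fan_antinorm_eigenvalues[OF assms(1,2)] by metis
  thus ?thesis by (auto intro!: sum_nonneg eigenvalue_nonneg[OF U psd])
qed

text \<open>The rows of \<open>V\<close> are the eigenvectors, permuted so that those of the smallest eigenvalues sit
  at the positions in \<open>K\<close>. Each of these eigenvalues is at most their sum, since all are
  nonnegative.\<close>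

lemma ky_fan_antinorm_small_directions:
  fixes A :: "real^'n^'n"
  assumes sym: "transpose A = A" and psd: "\<And>x. 0 \<le> x \<bullet> (A *v x)"
  shows "\<exists>V. orthogonal_matrix V \<and> (\<forall>j\<in>K. row j V \<bullet> (A *v row j V) \<le> ky_fan_antinorm (card K) A)"
proof -
  have "card K \<le> CARD('n)" by (rule card_mono) auto
  from ky_fan_antinorm_eigenvalues[OF sym this] obtain U d J
    where U: "orthogonal_matrix U" "\<And>i. A *v row i U = d i *\<^sub>R row i U"
      and J: "card J = card K" "ky_fan_antinorm (card K) A = sum d J" by metis
  obtain s where s: "bij_betw s K J" using J finite_same_card_bij[of K J] by auto
  obtain t where t: "bij_betw t (-K) (-J)"
    using finite_same_card_bij[of "-K" "-J"] J
    by (auto simp: Compl_eq_Diff_UNIV card_Diff_subset)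
  define p where "p i = (if i \<in> K then s i else t i)" for i
  have "bij_betw p (K \<union> -K) (J \<union> -J)" unfolding p_def
    using bij_betw_disjoint_Un[OF s t] by auto
  hence p: "inj p" by (auto simp: bij_betw_def)
  define V :: "real^'n^'n" where "V = (\<chi> i. row (p i) U)"
  have row: "row i V = row (p i) U" for i by (simp add: V_def row_def vec_eq_iff)
  have "orthogonal_matrix V"
    using U(1) p unfolding orthogonal_matrix_orthonormal_rows row by (auto simp: inj_eq)
  moreover have "row j V \<bullet> (A *v row j V) \<le> ky_fan_antinorm (card K) A" if "j \<in> K" for j
  proof -
    have "p j \<in> J" using that s by (auto simp: p_def bij_betw_def)
    hence "d (p j) \<le> sum d J"
      by (intro member_le_sum) (auto intro: eigenvalue_nonneg[OF U psd])
    moreover have "row (p j) U \<bullet> row (p j) U = 1"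
      using U(1) by (simp add: orthogonal_matrix_orthonormal_rows dot_square_norm)
    ultimately show ?thesis by (simp add: row U(2) J(2))
  qed
  ultimately show ?thesis by blast
qed

text \<open>Ky Fan's minimum principle: in the eigenbasis, the right-hand side is an average of the
  eigenvalues with weights in the unit interval that add up to the number of summands, and such an
  average is smallest when the weights sit on the smallest eigenvalues.\<close>

lemma ky_fan_antinorm_le:
  fixes A :: "real^'n^'n"
  assumes sym: "transpose A = A" and V: "orthogonal_matrix V"
  shows "ky_fan_antinorm (card K) A \<le> (\<Sum>j\<in>K. row j V \<bullet> (A *v row j V))"
proof -
  have "card K \<le> CARD('n)" by (rule card_mono) auto
  from ky_fan_antinorm_eigenvalues[OF sym this] obtain U d J
    where U: "orthogonal_matrix U" "\<And>i. A *v row i U = d i *\<^sub>R row i U"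
      and J: "card J = card K" "\<And>i j. i \<in> J \<Longrightarrow> j \<notin> J \<Longrightarrow> d i \<le> d j"
        "ky_fan_antinorm (card K) A = sum d J" by metis
  have iso: "(\<Sum>i\<in>UNIV. (row i W \<bullet> x) * (row i W \<bullet> y)) = x \<bullet> y"
    if "orthogonal_matrix W" for W :: "real^'n^'n" and x y
  proof -
    have "(\<Sum>i\<in>UNIV. (row i W \<bullet> x) * (row i W \<bullet> y)) = (W *v x) \<bullet> (W *v y)"
      by (simp add: inner_vec_def matrix_vector_mult_def row_def)
    also have "\<dots> = x \<bullet> y"
      using that orthogonal_transformation_matrix[of "(*v) W"] matrix_of_matrix_vector_mul[of W]
      by (auto simp: orthogonal_transformation_def)
    finally show ?thesis .
  qed
  \<comment> \<open>The weight of the eigenvector \<open>i\<close> in the span of the rows in \<open>K\<close>.\<close>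
  define c where "c i = (\<Sum>j\<in>K. (row i U \<bullet> row j V)\<^sup>2)" for i
  have nU: "row i U \<bullet> row i U = 1" "row i V \<bullet> row i V = 1" for i
    using U(1) V by (simp_all add: orthogonal_matrix_orthonormal_rows dot_square_norm)
  have c1: "c i \<le> 1" for i
  proof -
    have "c i \<le> (\<Sum>j\<in>UNIV. (row i U \<bullet> row j V)\<^sup>2)" unfolding c_def by (intro sum_mono2) auto
    also have "\<dots> = 1"
      using iso[OF V, of "row i U" "row i U"] nU by (simp add: power2_eq_square inner_commute)
    finally show ?thesis .
  qed
  have c0: "0 \<le> c i" for i unfolding c_def by (intro sum_nonneg) auto
  have csum: "sum c UNIV = card K"
  proof -
    have "sum c UNIV = (\<Sum>j\<in>K. \<Sum>i\<in>UNIV. (row i U \<bullet> row j V) * (row i U \<bullet> row j V))"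
      unfolding c_def power2_eq_square by (rule sum.swap)
    also have "\<dots> = (\<Sum>j\<in>K. 1)" by (intro sum.cong refl) (simp add: iso[OF U(1)] nU)
    finally show ?thesis by simp
  qed
  have quad: "x \<bullet> (A *v x) = (\<Sum>i\<in>UNIV. d i * (row i U \<bullet> x)\<^sup>2)" for x
  proof -
    have "x \<bullet> (A *v x) = (\<Sum>i\<in>UNIV. (row i U \<bullet> x) * (row i U \<bullet> (A *v x)))"
      by (simp add: iso[OF U(1)])
    also have "\<dots> = (\<Sum>i\<in>UNIV. d i * (row i U \<bullet> x)\<^sup>2)"
      by (intro sum.cong refl) (simp add: symmetric_matrix_inner[OF sym] U(2) power2_eq_square)
    finally show ?thesis .
  qed
  have "(\<Sum>j\<in>K. row j V \<bullet> (A *v row j V)) = (\<Sum>j\<in>K. \<Sum>i\<in>UNIV. d i * (row i U \<bullet> row j V)\<^sup>2)"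
    by (simp add: quad)
  also have "\<dots> = (\<Sum>i\<in>UNIV. d i * c i)"
    unfolding c_def sum_distrib_left by (rule sum.swap)
  also have "\<dots> = (\<Sum>i\<in>J. d i * c i) + (\<Sum>i\<in>-J. d i * c i)"
    by (subst sum.union_disjoint[symmetric]) auto
  finally have eq: "(\<Sum>j\<in>K. row j V \<bullet> (A *v row j V)) =
    (\<Sum>i\<in>J. d i * c i) + (\<Sum>i\<in>-J. d i * c i)" .
  have cJ: "(\<Sum>i\<in>J. 1 - c i) = (\<Sum>i\<in>-J. c i)"
  proof -
    have "sum c J + sum c (-J) = card J"
      using csum J(1) by (subst sum.union_disjoint[symmetric]) auto
    thus ?thesis by (simp add: sum_subtractf)
  qed
  \<comment> \<open>A threshold between the selected eigenvalues and the others: moving weight across it can only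
    increase the average.\<close>
  have "\<exists>\<tau>. (\<forall>i\<in>J. d i \<le> \<tau>) \<and> (\<forall>i\<in>-J. \<tau> \<le> d i)"
  proof (cases "J = {}")
    case True
    thus ?thesis by (intro exI[of _ "Min (range d)"]) auto
  next
    case False
    thus ?thesis using J(2) by (intro exI[of _ "Max (d ` J)"]) auto
  qed
  then obtain \<tau> where \<tau>: "\<And>i. i \<in> J \<Longrightarrow> d i \<le> \<tau>" "\<And>i. i \<in> -J \<Longrightarrow> \<tau> \<le> d i" by blast
  have "sum d J - (\<Sum>i\<in>J. d i * c i) = (\<Sum>i\<in>J. d i * (1 - c i))"
    by (simp add: sum_subtractf algebra_simps)
  also have "\<dots> \<le> (\<Sum>i\<in>J. \<tau> * (1 - c i))"
    using \<tau> c1 by (intro sum_mono mult_right_mono) auto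
  also have "\<dots> = (\<Sum>i\<in>-J. \<tau> * c i)" unfolding sum_distrib_left[symmetric] cJ ..
  also have "\<dots> \<le> (\<Sum>i\<in>-J. d i * c i)"
    using \<tau> c0 by (intro sum_mono mult_right_mono) auto
  finally show ?thesis unfolding eq J(3) by simp
qed

section \<open>Closure properties of the Schwartz space\<close>

text \<open>A single step of \<^const>\<open>iter_partial\<close>, given a name so that differentiation can be treated as an
  operator; the defining equation of \<^const>\<open>iter_partial\<close> is replaced accordingly.\<close>

definition partial_deriv :: "'n \<Rightarrow> (real^'n::finite \<Rightarrow> complex) \<Rightarrow> real^'n \<Rightarrow> complex" where
  "partial_deriv i f = (\<lambda>x. frechet_derivative f (at x) (axis i 1))"

lemma iter_partial_Cons [simp]: "iter_partial (i # is) f = partial_deriv i (iter_partial is f)"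
  by (simp add: partial_deriv_def)

declare iter_partial.simps(2) [simp del]

lemma iter_partial_append: "iter_partial (is @ js) f = iter_partial is (iter_partial js f)"
  by (induction "is") auto

lemma partial_derivI: "(f has_derivative D) (at x) \<Longrightarrow> partial_deriv i f x = D (axis i 1)"
  unfolding partial_deriv_def by (metis frechet_derivative_at)

lemma linear_axis_expansion:
  fixes D :: "real^'n \<Rightarrow> 'a::real_vector"
  assumes "linear D"
  shows "D u = (\<Sum>i\<in>UNIV. (u $ i) *\<^sub>R D (axis i 1))"
proof -
  have "D u = D (\<Sum>i\<in>UNIV. (u $ i) *\<^sub>R axis i 1)"
    using basis_expansion[of u] by (simp add: scalar_mult_eq_scaleR)
  also have "\<dots> = (\<Sum>i\<in>UNIV. (u $ i) *\<^sub>R D (axis i 1))"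
    by (simp add: linear_sum[OF assms] linear_scale[OF assms])
  finally show ?thesis .
qed

lemma has_derivative_partial_deriv:
  fixes f :: "real^'n \<Rightarrow> complex"
  assumes "f differentiable (at x)"
  shows "(f has_derivative (\<lambda>u. \<Sum>i\<in>UNIV. (u $ i) *\<^sub>R partial_deriv i f x)) (at x)"
proof -
  have D: "(f has_derivative frechet_derivative f (at x)) (at x)"
    using assms by (simp add: frechet_derivative_works)
  hence "linear (frechet_derivative f (at x))" by (rule has_derivative_linear)
  from linear_axis_expansion[OF this]
  have "frechet_derivative f (at x) = (\<lambda>u. \<Sum>i\<in>UNIV. (u $ i) *\<^sub>R partial_deriv i f x)"
    unfolding partial_deriv_def by blast
  with D show ?thesis by simp
qed

lemma partial_deriv_add:
  assumes "f differentiable (at x)" "g differentiable (at x)"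
  shows "partial_deriv i (\<lambda>x. f x + g x) x = partial_deriv i f x + partial_deriv i g x"
  using partial_derivI[OF has_derivative_add[OF assms[unfolded frechet_derivative_works]]]
  by (simp add: partial_deriv_def)

lemma partial_deriv_cmult:
  assumes "f differentiable (at x)"
  shows "partial_deriv i (\<lambda>x. c * f x) x = c * partial_deriv i f x"
  using partial_derivI[OF has_derivative_mult_right[OF assms[unfolded frechet_derivative_works]]]
  by (simp add: partial_deriv_def)

lemma has_derivative_real_mult:
  fixes p :: "real^'n \<Rightarrow> real" and f :: "real^'n \<Rightarrow> complex"
  assumes "(p has_derivative p') (at x)" "(f has_derivative f') (at x)"
  shows "((\<lambda>x. of_real (p x) * f x) has_derivative
    (\<lambda>u. of_real (p x) * f' u + of_real (p' u) * f x)) (at x)"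
  by (intro has_derivative_mult assms has_derivative_of_real)

lemma partial_deriv_real_mult:
  fixes p :: "real^'n \<Rightarrow> real" and f :: "real^'n \<Rightarrow> complex"
  assumes "(p has_derivative p') (at x)" "f differentiable (at x)"
  shows "partial_deriv i (\<lambda>x. of_real (p x) * f x) x =
    of_real (p x) * partial_deriv i f x + of_real (p' (axis i 1)) * f x"
  using partial_derivI[OF has_derivative_real_mult[OF assms(1) assms(2)[unfolded frechet_derivative_works]]]
  by (simp add: partial_deriv_def)

lemma has_derivative_coord: "((\<lambda>x::real^'n. x $ i) has_derivative (\<lambda>u. u $ i)) (at x)"
  using bounded_linear_imp_has_derivative bounded_linear_vec_nth by blast

lemma partial_deriv_coord_mult:
  fixes f :: "real^'n \<Rightarrow> complex"
  assumes "f differentiable (at x)"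
  shows "partial_deriv i (\<lambda>x. of_real (x $ j) * f x) x =
    of_real (x $ j) * partial_deriv i f x + (if i = j then f x else 0)"
  using partial_deriv_real_mult[OF has_derivative_coord[of j x] assms, of i]
  by (simp add: axis_def)

lemma monomial_fun_upd:
  "monomial_fun (a(i := Suc (a i))) x = x $ i * monomial_fun a x"
proof -
  have "monomial_fun (a(i := Suc (a i))) x =
    x $ i ^ Suc (a i) * (\<Prod>j\<in>UNIV - {i}. x $ j ^ a j)"
    unfolding monomial_fun_def by (subst prod.remove[of _ i]) auto
  also have "\<dots> = x $ i * monomial_fun a x"
    unfolding monomial_fun_def by (subst (2) prod.remove[of _ i]) auto
  finally show ?thesis .
qed

lemma abs_monomial_fun_le: "\<bar>monomial_fun a x\<bar> \<le> (1 + norm x) ^ sum a UNIV"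
proof -
  have "\<bar>monomial_fun a x\<bar> = (\<Prod>i\<in>UNIV. \<bar>x $ i\<bar> ^ a i)"
    by (simp add: monomial_fun_def abs_prod power_abs)
  also have "\<dots> \<le> (\<Prod>i\<in>UNIV. (1 + norm x) ^ a i)"
    by (intro prod_mono conjI power_mono) (auto intro: order_trans[OF component_le_norm_cart])
  finally show ?thesis by (simp add: power_sum)
qed

text \<open>The Schwartz space is the largest set of bounded differentiable functions that is closed under
  partial differentiation and multiplication by coordinates. This is the form in which membership is
  established below: one exhibits such a set.\<close>

lemma schwartz_coinduct:
  fixes F :: "(real^'n \<Rightarrow> complex) set"
  assumes f: "f \<in> F"
    and diff: "\<And>f x. f \<in> F \<Longrightarrow> f differentiable (at x)"
    and bdd: "\<And>f. f \<in> F \<Longrightarrow> bounded (range f)"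
    and partial: "\<And>f i. f \<in> F \<Longrightarrow> partial_deriv i f \<in> F"
    and coord: "\<And>f i. f \<in> F \<Longrightarrow> (\<lambda>x. of_real (x $ i) * f x) \<in> F"
  shows "f \<in> schwartz_space"
proof -
  have ip: "iter_partial js f \<in> F" for js by (induction js) (auto intro: f partial)
  have pow: "(\<lambda>x. of_real (x $ i ^ m) * g x) \<in> F" if "g \<in> F" for g i m
  proof (induction m)
    case (Suc m)
    from coord[OF this, of i] show ?case by (simp add: mult.assoc)
  qed (use that in simp)
  have "(\<lambda>x. of_real (\<Prod>i\<in>J. x $ i ^ a i) * g x) \<in> F" if "g \<in> F" for g a J
  proof -
    have "finite J" by simp
    thus ?thesis
    proof (induction J rule: finite_induct)
      case (insert j J)
      from pow[OF insert.IH, of j "a j"] insert show ?case by (simp add: mult.assoc)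
    qed (use that in simp)
  qed
  hence "(\<lambda>x. of_real (monomial_fun a x) * g x) \<in> F" if "g \<in> F" for g a
    unfolding monomial_fun_def using that by blast
  thus ?thesis unfolding schwartz_space_def using ip diff bdd by blast
qed

text \<open>The product rule turns one product into a sum of two, so sets of products are closed under
  differentiation only up to finite sums.\<close>

inductive_set sums_of :: "('a \<Rightarrow> complex) set \<Rightarrow> ('a \<Rightarrow> complex) set" for G where
  base: "f \<in> G \<Longrightarrow> f \<in> sums_of G"
| add: "f \<in> sums_of G \<Longrightarrow> g \<in> sums_of G \<Longrightarrow> (\<lambda>x. f x + g x) \<in> sums_of G"

lemma schwartz_coinduct_upto_sums:
  fixes G :: "(real^'n \<Rightarrow> complex) set"
  assumes diff: "\<And>f x. f \<in> G \<Longrightarrow> f differentiable (at x)"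
    and bdd: "\<And>f. f \<in> G \<Longrightarrow> bounded (range f)"
    and partial: "\<And>f i. f \<in> G \<Longrightarrow> partial_deriv i f \<in> sums_of G"
    and coord: "\<And>f i. f \<in> G \<Longrightarrow> (\<lambda>x. of_real (x $ i) * f x) \<in> sums_of G"
  shows "sums_of G \<subseteq> schwartz_space"
proof
  fix f assume "f \<in> sums_of G"
  moreover have d: "f differentiable (at x)" if "f \<in> sums_of G" for f x
    using that by induction (auto intro: diff)
  moreover have "bounded (range f)" if "f \<in> sums_of G" for f
    using that by induction (auto intro: bdd bounded_plus_comp)
  moreover have "partial_deriv i f \<in> sums_of G" if "f \<in> sums_of G" for f i
    using that
  proof induction
    case (add f g)
    have "partial_deriv i (\<lambda>x. f x + g x) = (\<lambda>x. partial_deriv i f x + partial_deriv i g x)"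
      using add by (auto intro!: partial_deriv_add d)
    thus ?case using add by (auto intro: sums_of.add)
  qed (auto intro: partial)
  moreover have "(\<lambda>x. of_real (x $ i) * f x) \<in> sums_of G" if "f \<in> sums_of G" for f i
    using that
  proof induction
    case (add f g)
    thus ?case by (auto simp: distrib_left intro: sums_of.add)
  qed (auto intro: coord)
  ultimately show "f \<in> schwartz_space" by (rule schwartz_coinduct)
qed

inductive_set coord_poly :: "'n set \<Rightarrow> (real^'n::finite \<Rightarrow> real) set" for J where
  const: "(\<lambda>x. c) \<in> coord_poly J"
| coord: "p \<in> coord_poly J \<Longrightarrow> i \<in> J \<Longrightarrow> (\<lambda>x. x $ i * p x) \<in> coord_poly J"
| add: "p \<in> coord_poly J \<Longrightarrow> q \<in> coord_poly J \<Longrightarrow> (\<lambda>x. p x + q x) \<in> coord_poly J"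

lemma coord_poly_has_derivative:
  assumes "p \<in> coord_poly J"
  shows "\<exists>q. (\<forall>i. q i \<in> coord_poly J) \<and> (\<forall>i. i \<notin> J \<longrightarrow> q i = (\<lambda>x. 0)) \<and>
    (\<forall>x. (p has_derivative (\<lambda>u. \<Sum>i\<in>UNIV. u $ i * q i x)) (at x))"
  using assms
proof induction
  case (const c)
  show ?case by (intro exI[of _ "\<lambda>i x. 0"]) (auto intro: coord_poly.const)
next
  case (coord p j)
  from coord.IH obtain q where "\<forall>i. q i \<in> coord_poly J" "\<forall>i. i \<notin> J \<longrightarrow> q i = (\<lambda>x. 0)"
    "\<forall>x. (p has_derivative (\<lambda>u. \<Sum>i\<in>UNIV. u $ i * q i x)) (at x)" by blast
  note q = this[rule_format]
  define q' where "q' i = (if i = j then (\<lambda>x. x $ j * q j x + p x) else (\<lambda>x. x $ j * q i x))" for i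
  have "q' i \<in> coord_poly J" for i
    unfolding q'_def
    using coord_poly.add[OF coord_poly.coord[OF q(1) coord.hyps(2)] coord.hyps(1)]
      coord_poly.coord[OF q(1) coord.hyps(2)] by auto
  moreover have "q' i = (\<lambda>x. 0)" if "i \<notin> J" for i
    using that coord.hyps q(2) unfolding q'_def by auto
  moreover have "((\<lambda>x. x $ j * p x) has_derivative (\<lambda>u. \<Sum>i\<in>UNIV. u $ i * q' i x)) (at x)" for x
  proof -
    have "(\<Sum>i\<in>UNIV. u $ i * q' i x) = x $ j * (\<Sum>i\<in>UNIV. u $ i * q i x) + u $ j * p x" for u
    proof -
      have "(\<Sum>i\<in>UNIV. u $ i * q' i x) =
        (\<Sum>i\<in>UNIV. x $ j * (u $ i * q i x) + (if i = j then u $ j * p x else 0))"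
        by (intro sum.cong) (auto simp: q'_def algebra_simps)
      thus ?thesis by (simp add: sum.distrib sum_distrib_left)
    qed
    thus ?thesis using has_derivative_mult[OF has_derivative_coord[of j x] q(3)[of x]] by simp
  qed
  ultimately show ?case by blast
next
  case (add p1 p2)
  from add.IH(1) obtain q1 where "\<forall>i. q1 i \<in> coord_poly J" "\<forall>i. i \<notin> J \<longrightarrow> q1 i = (\<lambda>x. 0)"
    "\<forall>x. (p1 has_derivative (\<lambda>u. \<Sum>i\<in>UNIV. u $ i * q1 i x)) (at x)" by blast
  note q1 = this[rule_format]
  from add.IH(2) obtain q2 where "\<forall>i. q2 i \<in> coord_poly J" "\<forall>i. i \<notin> J \<longrightarrow> q2 i = (\<lambda>x. 0)"
    "\<forall>x. (p2 has_derivative (\<lambda>u. \<Sum>i\<in>UNIV. u $ i * q2 i x)) (at x)" by blast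
  note q2 = this[rule_format]
  have "((\<lambda>x. p1 x + p2 x) has_derivative (\<lambda>u. \<Sum>i\<in>UNIV. u $ i * (q1 i x + q2 i x))) (at x)" for x
    using has_derivative_add[OF q1(3) q2(3), of x] by (simp add: distrib_left sum.distrib)
  thus ?case using q1(1,2) q2(1,2)
    by (intro exI[of _ "\<lambda>i x. q1 i x + q2 i x"]) (auto intro: coord_poly.add)
qed

text \<open>Closure of the Schwartz space under multiplication by coordinates is not built into its
  definition. It follows by applying the coinduction principle to all sums of products of a polynomial
  and an iterated partial derivative.\<close>

lemma schwartz_sums_of_products:
  "sums_of {\<lambda>x. of_real (p x) * iter_partial is f x | p is f. p \<in> coord_poly UNIV \<and> f \<in> schwartz_space}
    \<subseteq> schwartz_space" (is "sums_of ?G \<subseteq> _")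
proof (rule schwartz_coinduct_upto_sums)
  fix g x assume "g \<in> ?G"
  then obtain p "is" f where g: "g = (\<lambda>x. of_real (p x) * iter_partial is f x)"
    "p \<in> coord_poly UNIV" "f \<in> schwartz_space" by auto
  obtain q where q: "\<And>x. (p has_derivative (\<lambda>u. \<Sum>i\<in>UNIV. u $ i * q i x)) (at x)"
    using coord_poly_has_derivative[OF g(2)] by blast
  have "iter_partial is f differentiable (at x)" using g(3) by (auto simp: schwartz_space_def)
  thus "g differentiable (at x)"
    unfolding g(1) using has_derivative_real_mult[OF q] unfolding differentiable_def by blast
next
  fix g assume "g \<in> ?G"
  then obtain p "is" f where g: "g = (\<lambda>x. of_real (p x) * iter_partial is f x)"
    "p \<in> coord_poly UNIV" "f \<in> schwartz_space" by auto
  \<comment> \<open>The additional monomial makes the induction on the polynomial go through.\<close>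
  have "\<forall>a. bounded (range (\<lambda>x. of_real (p x * monomial_fun a x) * iter_partial is f x))"
    using g(2)
  proof induction
    case (const c)
    show ?case
    proof
      fix a
      have "bounded (range (\<lambda>x. of_real (monomial_fun a x) * iter_partial is f x))"
        using g(3) by (auto simp: schwartz_space_def)
      from bounded_scaleR_comp[OF this, of c]
      show "bounded (range (\<lambda>x. of_real (c * monomial_fun a x) * iter_partial is f x))"
        by (simp add: scaleR_conv_of_real mult.assoc)
    qed
  next
    case (coord p i)
    show ?case
    proof
      fix a
      from coord.IH[rule_format, of "a(i := Suc (a i))"]
      show "bounded (range (\<lambda>x. of_real (x $ i * p x * monomial_fun a x) * iter_partial is f x))"
        by (simp add: monomial_fun_upd mult_ac)
    qed
  next
    case (add p q)
    show ?case
    proof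
      fix a
      from bounded_plus_comp[OF add.IH(1)[rule_format, of a] add.IH(2)[rule_format, of a]]
      show "bounded (range (\<lambda>x. of_real ((p x + q x) * monomial_fun a x) * iter_partial is f x))"
        by (simp add: algebra_simps)
    qed
  qed
  from this[rule_format, of "\<lambda>_. 0"] show "bounded (range g)"
    by (simp add: g(1) monomial_fun_def)
next
  fix g i assume "g \<in> ?G"
  then obtain p "is" f where g: "g = (\<lambda>x. of_real (p x) * iter_partial is f x)"
    "p \<in> coord_poly UNIV" "f \<in> schwartz_space" by auto
  show "(\<lambda>x. of_real (x $ i) * g x) \<in> sums_of ?G"
    using g(2,3) unfolding g(1)
    by (intro sums_of.base CollectI exI[of _ "\<lambda>x. x $ i * p x"] exI[of _ "is"] exI[of _ f])
       (auto simp: mult.assoc intro: coord_poly.coord)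
  obtain q where q: "\<And>i. q i \<in> coord_poly UNIV"
      "\<And>x. (p has_derivative (\<lambda>u. \<Sum>i\<in>UNIV. u $ i * q i x)) (at x)"
    using coord_poly_has_derivative[OF g(2)] by blast
  have "partial_deriv i g = (\<lambda>x. of_real (p x) * iter_partial (i # is) f x + of_real (q i x) * iter_partial is f x)"
  proof
    fix x
    have "iter_partial is f differentiable (at x)" using g(3) by (auto simp: schwartz_space_def)
    from partial_deriv_real_mult[OF q(2) this, of i]
    show "partial_deriv i g x =
      of_real (p x) * iter_partial (i # is) f x + of_real (q i x) * iter_partial is f x"
      by (simp add: g(1) axis_def if_distrib[of "\<lambda>c. c * _"] cong: if_cong)
  qed
  moreover have "(\<lambda>x. of_real (p x) * iter_partial (i # is) f x) \<in> sums_of ?G"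
      "(\<lambda>x. of_real (q i x) * iter_partial is f x) \<in> sums_of ?G"
    using g q(1) by (blast intro: sums_of.base)+
  ultimately show "partial_deriv i g \<in> sums_of ?G"
    using sums_of.add by fastforce
qed

lemma schwartz_differentiable: "f \<in> schwartz_space \<Longrightarrow> f differentiable (at x)"
  unfolding schwartz_space_def by (auto dest: spec[of _ "[]"])

lemma schwartz_bounded: "f \<in> schwartz_space \<Longrightarrow> bounded (range f)"
proof -
  assume "f \<in> schwartz_space"
  hence "bounded (range (\<lambda>x. of_real (monomial_fun (\<lambda>_. 0) x) * iter_partial [] f x))"
    unfolding schwartz_space_def by blast
  thus ?thesis by (simp add: monomial_fun_def)
qed

lemma schwartz_partial_deriv [intro]: "f \<in> schwartz_space \<Longrightarrow> partial_deriv i f \<in> schwartz_space"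
  using iter_partial_append[of _ "[i]" f] unfolding schwartz_space_def by simp metis

lemma schwartz_iter_partial [intro]: "f \<in> schwartz_space \<Longrightarrow> iter_partial is f \<in> schwartz_space"
  by (induction "is") auto

lemma schwartz_coord_mult [intro]:
  assumes "f \<in> schwartz_space"
  shows "(\<lambda>x. of_real (x $ i) * f x) \<in> schwartz_space"
proof -
  have "(\<lambda>x. of_real (x $ i * 1) * iter_partial [] f x) \<in> schwartz_space"
    using assms coord_poly.coord[OF coord_poly.const UNIV_I, of i 1]
    by (intro schwartz_sums_of_products[THEN subsetD] sums_of.base CollectI exI[of _ "\<lambda>x. x $ i * 1"]
        exI[of _ "[]"] exI[of _ f]) auto
  thus ?thesis by simp
qed

lemma schwartz_cmult [intro]:
  assumes "f \<in> schwartz_space"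
  shows "(\<lambda>x. c * f x) \<in> schwartz_space"
proof (rule schwartz_coinduct[where F = "{\<lambda>x. c * f x | f. f \<in> schwartz_space}"])
  fix g i assume "g \<in> {\<lambda>x. c * f x | f. f \<in> schwartz_space}"
  then obtain f where f: "g = (\<lambda>x. c * f x)" "f \<in> schwartz_space" by auto
  have "(g has_derivative (\<lambda>u. c * frechet_derivative f (at x) u)) (at x)" for x
    unfolding f(1) using schwartz_differentiable[OF f(2)]
    by (intro has_derivative_mult_right) (simp add: frechet_derivative_works)
  thus "g differentiable (at x)" for x using differentiableI by blast
  show "bounded (range g)"
  proof -
    obtain C where "\<And>x. norm (f x) \<le> C" using schwartz_bounded[OF f(2)] by (auto simp: bounded_iff)
    hence "norm (g x) \<le> norm c * C" for x by (simp add: f(1) norm_mult mult_left_mono)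
    thus ?thesis by (auto simp: bounded_iff)
  qed
  have "partial_deriv i g = (\<lambda>x. c * partial_deriv i f x)"
    unfolding f by (auto intro!: partial_deriv_cmult schwartz_differentiable f)
  thus "partial_deriv i g \<in> {\<lambda>x. c * f x | f. f \<in> schwartz_space}" using f by auto
  have "(\<lambda>x. of_real (x $ i) * g x) = (\<lambda>x. c * (of_real (x $ i) * f x))"
    by (simp add: f algebra_simps)
  thus "(\<lambda>x. of_real (x $ i) * g x) \<in> {\<lambda>x. c * f x | f. f \<in> schwartz_space}" using f(2)
    by (intro CollectI exI[of _ "\<lambda>x. of_real (x $ i) * f x"] conjI schwartz_coord_mult) auto
qed (use assms in auto)

lemma schwartz_add [intro]:
  assumes "f \<in> schwartz_space" "g \<in> schwartz_space"
  shows "(\<lambda>x. f x + g x) \<in> schwartz_space"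
proof -
  have "sums_of schwartz_space \<subseteq> schwartz_space"
    by (rule schwartz_coinduct_upto_sums)
       (auto intro: sums_of.base schwartz_differentiable schwartz_bounded)
  thus ?thesis using assms by (auto intro: sums_of.intros)
qed

lemma schwartz_zero [simp, intro]: "(\<lambda>x. 0) \<in> schwartz_space"
proof (rule schwartz_coinduct[where F = "{\<lambda>x. 0}"])
  fix i
  have "partial_deriv i (\<lambda>x::real^'n. 0) = (\<lambda>x. 0)"
    by (rule ext, subst partial_derivI[OF has_derivative_const]) simp
  thus "\<And>f. f \<in> {\<lambda>x. 0} \<Longrightarrow> partial_deriv i f \<in> {\<lambda>x. 0}" by simp
qed auto

lemma schwartz_uminus [intro]: "f \<in> schwartz_space \<Longrightarrow> (\<lambda>x. - f x) \<in> schwartz_space"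
  using schwartz_cmult[of f "-1"] by simp

lemma schwartz_diff [intro]:
  "f \<in> schwartz_space \<Longrightarrow> g \<in> schwartz_space \<Longrightarrow> (\<lambda>x. f x - g x) \<in> schwartz_space"
  using schwartz_add[OF _ schwartz_uminus, of f g] by simp

lemma schwartz_sum [intro]:
  "(\<And>k. k \<in> K \<Longrightarrow> f k \<in> schwartz_space) \<Longrightarrow> (\<lambda>x. \<Sum>k\<in>K. f k x) \<in> schwartz_space"
proof (induction K rule: infinite_finite_induct)
  case (insert k K)
  thus ?case by (simp add: schwartz_add)
qed auto

lemma schwartz_inner_mult [intro]:
  assumes "f \<in> schwartz_space"
  shows "(\<lambda>x. of_real (v \<bullet> x) * f x) \<in> schwartz_space"
proof -
  have "(\<lambda>x. of_real (v \<bullet> x) * f x) = (\<lambda>x. \<Sum>i\<in>UNIV. of_real (v $ i) * (of_real (x $ i) * f x))"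
    by (simp add: inner_vec_def sum_distrib_right mult.assoc)
  also have "\<dots> \<in> schwartz_space"
    by (intro schwartz_sum schwartz_cmult schwartz_coord_mult assms)
  finally show ?thesis .
qed

lemma schwartz_cnj [intro]:
  assumes "f \<in> schwartz_space"
  shows "(\<lambda>x. cnj (f x)) \<in> schwartz_space"
proof (rule schwartz_coinduct[where F = "{\<lambda>x. cnj (f x) | f. f \<in> schwartz_space}"])
  fix g i assume "g \<in> {\<lambda>x. cnj (f x) | f. f \<in> schwartz_space}"
  then obtain f where f: "g = (\<lambda>x. cnj (f x))" "f \<in> schwartz_space" by auto
  have D: "(g has_derivative (\<lambda>u. cnj (frechet_derivative f (at x) u))) (at x)" for x
    unfolding f using schwartz_differentiable[OF f(2), of x]
    by (intro has_derivative_cnj) (simp add: frechet_derivative_works)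
  show "g differentiable (at x)" for x using D differentiableI by blast
  show "bounded (range g)" using schwartz_bounded[OF f(2)] by (auto simp: f bounded_iff)
  have "partial_deriv i g = (\<lambda>x. cnj (partial_deriv i f x))"
    using partial_derivI[OF D] by (auto simp: partial_deriv_def)
  thus "partial_deriv i g \<in> {\<lambda>x. cnj (f x) | f. f \<in> schwartz_space}" using f by auto
  have "(\<lambda>x. of_real (x $ i) * g x) = (\<lambda>x. cnj (of_real (x $ i) * f x))"
    by (simp add: f)
  thus "(\<lambda>x. of_real (x $ i) * g x) \<in> {\<lambda>x. cnj (f x) | f. f \<in> schwartz_space}"
    using f(2) by (intro CollectI exI[of _ "\<lambda>x. of_real (x $ i) * f x"] conjI schwartz_coord_mult) auto
qed (use assms in auto)

lemma partial_deriv_schwartz_add: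
  "f \<in> schwartz_space \<Longrightarrow> g \<in> schwartz_space \<Longrightarrow>
    partial_deriv i (\<lambda>x. f x + g x) = (\<lambda>x. partial_deriv i f x + partial_deriv i g x)"
  by (auto intro!: partial_deriv_add schwartz_differentiable)

lemma iter_partial_add:
  assumes "f \<in> schwartz_space" "g \<in> schwartz_space"
  shows "iter_partial is (\<lambda>x. f x + g x) = (\<lambda>x. iter_partial is f x + iter_partial is g x)"
  by (induction "is") (use assms in \<open>auto simp: partial_deriv_schwartz_add schwartz_iter_partial\<close>)

lemma iter_partial_cmult:
  assumes "f \<in> schwartz_space"
  shows "iter_partial is (\<lambda>x. c * f x) = (\<lambda>x. c * iter_partial is f x)"
  by (induction "is")
     (use assms in \<open>auto intro!: partial_deriv_cmult schwartz_differentiable\<close>)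

lemma iter_partial_diff:
  assumes "f \<in> schwartz_space" "g \<in> schwartz_space"
  shows "iter_partial is (\<lambda>x. f x - g x) = (\<lambda>x. iter_partial is f x - iter_partial is g x)"
proof -
  have "iter_partial is (\<lambda>x. f x + (-1) * g x) = (\<lambda>x. iter_partial is f x + (-1) * iter_partial is g x)"
    using iter_partial_add[OF assms(1) schwartz_cmult[OF assms(2), of "-1"], of "is"]
    by (simp only: iter_partial_cmult[OF assms(2)])
  thus ?thesis by simp
qed

lemma iter_partial_cnj:
  assumes "f \<in> schwartz_space"
  shows "iter_partial is (\<lambda>x. cnj (f x)) = (\<lambda>x. cnj (iter_partial is f x))"
proof (induction "is")
  case (Cons i "is")
  have "partial_deriv i (\<lambda>x. cnj (iter_partial is f x)) x = cnj (partial_deriv i (iter_partial is f) x)" for x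
  proof -
    have "((\<lambda>x. cnj (iter_partial is f x)) has_derivative
        (\<lambda>u. cnj (frechet_derivative (iter_partial is f) (at x) u))) (at x)"
      using schwartz_differentiable[OF schwartz_iter_partial[OF assms]]
      by (intro has_derivative_cnj) (simp add: frechet_derivative_works)
    from partial_derivI[OF this] show ?thesis by (simp add: partial_deriv_def)
  qed
  thus ?case using Cons by auto
qed auto

subsection \<open>Decay and regularity\<close>

lemma schwartz_decay:
  fixes f :: "real^'n \<Rightarrow> complex"
  assumes "f \<in> schwartz_space"
  shows "\<exists>C\<ge>0. \<forall>x. (1 + norm x) ^ N * norm (f x) \<le> C"
  using assms
proof (induction N arbitrary: f)
  case 0
  then obtain C where "\<forall>x. norm (f x) \<le> C" using schwartz_bounded[of f] by (auto simp: bounded_iff)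
  thus ?case by (intro exI[of _ "max C 0"]) (auto simp: le_max_iff_disj)
next
  case (Suc N)
  obtain C where C: "C \<ge> 0" "\<And>x. (1 + norm x) ^ N * norm (f x) \<le> C" using Suc by blast
  have "\<forall>i. \<exists>C\<ge>0. \<forall>x. (1 + norm x) ^ N * norm (of_real (x $ i) * f x) \<le> C"
    using Suc by blast
  then obtain D where D: "\<And>i. D i \<ge> 0"
    "\<And>i x. (1 + norm x) ^ N * norm (of_real (x $ i) * f x) \<le> D i" by metis
  have "(1 + norm x) ^ Suc N * norm (f x) \<le> C + (\<Sum>i\<in>UNIV. D i)" for x
  proof -
    have "(1 + norm x) ^ Suc N * norm (f x) = (1 + norm x) ^ N * norm (f x) * (1 + norm x)"
      by simp
    also have "\<dots> \<le> (1 + norm x) ^ N * norm (f x) * (1 + (\<Sum>i\<in>UNIV. \<bar>x $ i\<bar>))"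
      by (intro mult_left_mono add_left_mono norm_le_l1_cart) auto
    also have "\<dots> = (1 + norm x) ^ N * norm (f x) +
        (\<Sum>i\<in>UNIV. (1 + norm x) ^ N * norm (of_real (x $ i) * f x))"
      by (simp add: distrib_left sum_distrib_left norm_mult mult_ac)
    also have "\<dots> \<le> C + (\<Sum>i\<in>UNIV. D i)" by (intro add_mono sum_mono C D)
    finally show ?thesis .
  qed
  moreover have "0 \<le> C + (\<Sum>i\<in>UNIV. D i)" by (intro add_nonneg_nonneg sum_nonneg C D)
  ultimately show ?case by blast
qed

lemma schwartz_continuous_on: "f \<in> schwartz_space \<Longrightarrow> continuous_on A f"
  by (meson continuous_at_imp_continuous_on differentiable_imp_continuous_within schwartz_differentiable)

lemma schwartz_borel_measurable: "f \<in> schwartz_space \<Longrightarrow> f \<in> borel_measurable borel"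
  by (intro borel_measurable_continuous_onI schwartz_continuous_on)

lemma schwartz_partial_bound:
  fixes f :: "real^'n \<Rightarrow> complex"
  assumes "f \<in> schwartz_space"
  obtains B where "B \<ge> 0" "\<And>i x. (1 + norm x) ^ N * norm (partial_deriv i f x) \<le> B"
proof -
  have "\<forall>i. \<exists>C\<ge>0. \<forall>x. (1 + norm x) ^ N * norm (partial_deriv i f x) \<le> C"
    using assms schwartz_decay by blast
  then obtain C where C: "\<And>i. C i \<ge> 0" "\<And>i x. (1 + norm x) ^ N * norm (partial_deriv i f x) \<le> C i"
    by metis
  show ?thesis
  proof (rule that[of "sum C UNIV"])
    fix i x
    have "C i \<le> sum C UNIV" by (rule member_le_sum) (auto simp: C)
    thus "(1 + norm x) ^ N * norm (partial_deriv i f x) \<le> sum C UNIV" using C(2)[of x i] by linarith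
  qed (auto intro: sum_nonneg C)
qed

lemma norm_partial_sum_le:
  fixes u :: "real^'n" and w :: "'n \<Rightarrow> complex"
  assumes "\<And>i. norm (w i) \<le> B"
  shows "norm (\<Sum>i\<in>UNIV. (u $ i) *\<^sub>R w i) \<le> real CARD('n) * B * norm u"
proof -
  have "norm (\<Sum>i\<in>UNIV. (u $ i) *\<^sub>R w i) \<le> (\<Sum>i\<in>(UNIV::'n set). norm u * B)"
    by (rule sum_norm_le)
       (auto intro!: mult_mono component_le_norm_cart assms)
  thus ?thesis by (simp add: mult_ac)
qed

text \<open>The mean value inequality, with the polynomial weight moved from the endpoint to the points of the
  segment by the submultiplicative estimate \<open>1 + \<bar>x\<bar> \<le> (1 + \<bar>x + t u\<bar>) (1 + \<bar>u\<bar>)\<close>.\<close>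

lemma schwartz_weighted_lipschitz:
  fixes f :: "real^'n \<Rightarrow> complex"
  assumes "f \<in> schwartz_space"
  obtains B where "B \<ge> 0" "\<And>x u. (1 + norm x) ^ N * norm (f (x + u) - f x) \<le> B * (norm u * (1 + norm u) ^ N)"
proof -
  obtain B where B: "B \<ge> 0" "\<And>i x. (1 + norm x) ^ N * norm (partial_deriv i f x) \<le> B"
    using schwartz_partial_bound[OF assms] by blast
  show ?thesis
  proof (rule that[of "CARD('n) * B"])
    fix x u :: "real^'n"
    let ?b = "B * (1 + norm u) ^ N / (1 + norm x) ^ N"
    have pos: "(1 + norm x) ^ N > 0" by (intro zero_less_power add_pos_nonneg) auto
    have pb: "norm (partial_deriv i f (x + t *\<^sub>R u)) \<le> ?b" if "t \<in> {0..1}" for i t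
    proof -
      let ?z = "x + t *\<^sub>R u"
      have "norm x \<le> norm ?z + norm (t *\<^sub>R u)" using norm_triangle_ineq4[of ?z "t *\<^sub>R u"] by simp
      also have "norm (t *\<^sub>R u) \<le> norm u" using that by (simp add: mult_left_le_one_le)
      finally have "1 + norm x \<le> (1 + norm ?z) + (norm u + norm ?z * norm u)"
        using mult_nonneg_nonneg[OF norm_ge_zero norm_ge_zero, of ?z u] by linarith
      also have "\<dots> = (1 + norm ?z) * (1 + norm u)" by (simp add: algebra_simps)
      finally have "1 + norm x \<le> (1 + norm ?z) * (1 + norm u)" .
      hence "(1 + norm x) ^ N \<le> (1 + norm ?z) ^ N * (1 + norm u) ^ N"
        by (metis power_mono power_mult_distrib add_nonneg_nonneg norm_ge_zero zero_le_one)
      hence "(1 + norm x) ^ N * norm (partial_deriv i f ?z) \<le>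
          (1 + norm ?z) ^ N * (1 + norm u) ^ N * norm (partial_deriv i f ?z)"
        by (rule mult_right_mono) auto
      also have "\<dots> \<le> B * (1 + norm u) ^ N"
        using mult_right_mono[OF B(2)[of ?z i], of "(1 + norm u) ^ N"] by (simp add: mult_ac)
      finally show ?thesis using pos by (simp add: field_simps)
    qed
    have "norm (f (x + u) - f x) \<le> norm u * (CARD('n) * ?b)"
    proof (rule differentiable_bound_segment[where G = UNIV])
      fix t :: real assume t: "t \<in> {0..1}"
      show "onorm (\<lambda>v. \<Sum>i\<in>UNIV. (v $ i) *\<^sub>R partial_deriv i f (x + t *\<^sub>R u)) \<le> CARD('n) * ?b"
        by (intro onorm_le norm_partial_sum_le pb t)
    qed (auto intro: has_derivative_partial_deriv schwartz_differentiable assms)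
    moreover have "W * (a * (c * (b * d / W))) = c * b * (a * d)" if "W > 0" for W a b c d :: real
      using that by simp
    note this[OF pos]
    ultimately
    show "(1 + norm x) ^ N * norm (f (x + u) - f x) \<le> CARD('n) * B * (norm u * (1 + norm u) ^ N)"
      using pos mult_left_mono by (metis less_imp_le)
  qed (use B in auto)
qed

lemma schwartz_taylor:
  fixes f :: "real^'n \<Rightarrow> complex"
  assumes "f \<in> schwartz_space"
  obtains B where "B \<ge> 0"
    "\<And>x u. norm (f (x + u) - f x - (\<Sum>i\<in>UNIV. (u $ i) *\<^sub>R partial_deriv i f x)) \<le> B * (norm u)\<^sup>2"
proof -
  have "\<forall>i. \<exists>B\<ge>0. \<forall>x u. norm (partial_deriv i f (x + u) - partial_deriv i f x) \<le> B * norm u"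
    using schwartz_weighted_lipschitz[OF schwartz_partial_deriv[OF assms], where N = 0]
    by (simp add: Bex_def) metis
  then obtain L where L: "\<And>i. L i \<ge> 0"
    "\<And>i x u. norm (partial_deriv i f (x + u) - partial_deriv i f x) \<le> L i * norm u" by metis
  define B where "B = CARD('n) * sum L UNIV"
  have Li: "L i \<le> sum L UNIV" for i by (rule member_le_sum) (auto simp: L)
  have L0: "sum L UNIV \<ge> 0" by (intro sum_nonneg L)
  let ?D = "\<lambda>x v. \<Sum>i\<in>UNIV. (v $ i) *\<^sub>R partial_deriv i f x"
  show ?thesis
  proof (rule that[of B])
    fix x u :: "real^'n"
    have "norm (f (x + u) - f x - ?D x (x + u - x)) \<le> norm (x + u - x) * (B * norm u)"
    proof (rule differentiable_bound_linearization[where S = "closed_segment x (x + u)" and f' = ?D])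
      show "\<And>t. t \<in> {0..1} \<Longrightarrow> x + t *\<^sub>R (x + u - x) \<in> closed_segment x (x + u)"
        by (auto simp: closed_segment_def algebra_simps)
    next
      fix y assume "y \<in> closed_segment x (x + u)"
      then obtain t where t: "0 \<le> t" "t \<le> 1" "y = x + t *\<^sub>R u"
        by (auto simp: closed_segment_def algebra_simps)
      have pd: "norm (partial_deriv i f y - partial_deriv i f x) \<le> sum L UNIV * norm u" for i
      proof -
        have "norm (partial_deriv i f y - partial_deriv i f x) \<le> L i * (t * norm u)"
          using L(2)[of i x "t *\<^sub>R u"] t by simp
        also have "\<dots> \<le> sum L UNIV * (1 * norm u)"
          using t L0 by (intro mult_mono Li) auto
        finally show ?thesis by simp
      qed
      have "onorm (\<lambda>v. \<Sum>i\<in>UNIV. (v $ i) *\<^sub>R (partial_deriv i f y - partial_deriv i f x)) \<le>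
          CARD('n) * (sum L UNIV * norm u)"
        by (intro onorm_le norm_partial_sum_le pd)
      thus "onorm (?D y - ?D x) \<le> B * norm u"
        by (simp add: B_def fun_diff_def sum_subtractf[symmetric] scaleR_diff_right mult_ac)
    qed (auto intro!: has_derivative_at_withinI has_derivative_partial_deriv schwartz_differentiable assms)
    thus "norm (f (x + u) - f x - ?D x u) \<le> B * (norm u)\<^sup>2" by (simp add: power2_eq_square mult_ac)
  qed (simp add: B_def L0)
qed

section \<open>Continuous operators and tempered distributions\<close>

lemma schwartz_seminorm_upper:
  assumes "f \<in> schwartz_space"
  shows "norm (of_real (monomial_fun a x) * iter_partial is f x) \<le> schwartz_seminorm a is f"
proof -
  have "bounded (range (\<lambda>x. of_real (monomial_fun a x) * iter_partial is f x))"
    using assms unfolding schwartz_space_def by blast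
  hence "bdd_above (range (\<lambda>x. norm (of_real (monomial_fun a x) * iter_partial is f x)))"
    by (auto simp: bounded_iff bdd_above_def)
  thus ?thesis unfolding schwartz_seminorm_def by (intro cSUP_upper) auto
qed

lemma schwartz_seminorm_le:
  assumes "\<And>x. norm (of_real (monomial_fun a x) * iter_partial is f x) \<le> b"
  shows "schwartz_seminorm a is f \<le> b"
  unfolding schwartz_seminorm_def by (intro cSUP_least assms) auto

lemma schwartz_seminorm_nonneg: "f \<in> schwartz_space \<Longrightarrow> 0 \<le> schwartz_seminorm a is f"
  using schwartz_seminorm_upper[of f a undefined "is"] norm_ge_zero order_trans by blast

lemma schwartz_seminorm_triangle:
  assumes "f \<in> schwartz_space" "g \<in> schwartz_space"
  shows "schwartz_seminorm a is (\<lambda>x. f x + g x) \<le> schwartz_seminorm a is f + schwartz_seminorm a is g"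
proof (rule schwartz_seminorm_le)
  fix x
  have "norm (of_real (monomial_fun a x) * iter_partial is f x + of_real (monomial_fun a x) * iter_partial is g x)
      \<le> schwartz_seminorm a is f + schwartz_seminorm a is g"
    by (intro norm_triangle_mono schwartz_seminorm_upper assms)
  thus "norm (of_real (monomial_fun a x) * iter_partial is (\<lambda>x. f x + g x) x)
      \<le> schwartz_seminorm a is f + schwartz_seminorm a is g"
    by (simp add: iter_partial_add[OF assms] distrib_left)
qed

lemma schwartz_seminorm_cmult_le:
  assumes "f \<in> schwartz_space"
  shows "schwartz_seminorm a is (\<lambda>x. c * f x) \<le> norm c * schwartz_seminorm a is f"
proof (rule schwartz_seminorm_le)
  fix x
  have "norm c * norm (of_real (monomial_fun a x) * iter_partial is f x) \<le> norm c * schwartz_seminorm a is f"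
    by (intro mult_left_mono schwartz_seminorm_upper assms) auto
  thus "norm (of_real (monomial_fun a x) * iter_partial is (\<lambda>x. c * f x) x) \<le> norm c * schwartz_seminorm a is f"
    by (simp add: iter_partial_cmult[OF assms] norm_mult mult_ac)
qed

lemma schwartz_seminorm_zero: "schwartz_seminorm a is (\<lambda>x. 0) = 0"
  using schwartz_seminorm_cmult_le[OF schwartz_zero, of a "is" 0] schwartz_seminorm_nonneg[OF schwartz_zero, of a "is"]
  by simp

lemma schwartz_seminorm_cnj:
  assumes "f \<in> schwartz_space"
  shows "schwartz_seminorm a is (\<lambda>x. cnj (f x)) = schwartz_seminorm a is f"
  unfolding schwartz_seminorm_def iter_partial_cnj[OF assms] by (simp add: norm_mult)

text \<open>For seminorms this is continuity with respect to the Schwartz topology. The finite set is a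
  set of index pairs, so that bounds can be added by taking unions.\<close>

definition schwartz_dominated :: "((real^'n::finite \<Rightarrow> complex) \<Rightarrow> real) \<Rightarrow> bool" where
  "schwartz_dominated q \<longleftrightarrow> (\<exists>C\<ge>0. \<exists>F. finite F \<and>
     (\<forall>\<phi>\<in>schwartz_space. q \<phi> \<le> C * (\<Sum>(a, is)\<in>F. schwartz_seminorm a is \<phi>)))"

lemma schwartz_dominated_seminorm: "schwartz_dominated (schwartz_seminorm a is)"
  unfolding schwartz_dominated_def by (intro exI[of _ 1] conjI exI[of _ "{(a, is)}"]) auto

lemma schwartz_dominated_mono:
  "schwartz_dominated q \<Longrightarrow> (\<And>\<phi>. \<phi> \<in> schwartz_space \<Longrightarrow> p \<phi> \<le> q \<phi>) \<Longrightarrow> schwartz_dominated p"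
  unfolding schwartz_dominated_def by (meson order_trans)

lemma schwartz_dominated_add:
  assumes "schwartz_dominated p" "schwartz_dominated q"
  shows "schwartz_dominated (\<lambda>\<phi>. p \<phi> + q \<phi>)"
proof -
  from assms obtain C F D G where C: "C \<ge> 0" "finite F"
      "\<And>\<phi>. \<phi> \<in> schwartz_space \<Longrightarrow> p \<phi> \<le> C * (\<Sum>(a, is)\<in>F. schwartz_seminorm a is \<phi>)"
    and D: "D \<ge> 0" "finite G"
      "\<And>\<phi>. \<phi> \<in> schwartz_space \<Longrightarrow> q \<phi> \<le> D * (\<Sum>(a, is)\<in>G. schwartz_seminorm a is \<phi>)"
    unfolding schwartz_dominated_def by auto
  have "p \<phi> + q \<phi> \<le> (C + D) * (\<Sum>(a, is)\<in>F \<union> G. schwartz_seminorm a is \<phi>)"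
    if "\<phi> \<in> schwartz_space" for \<phi>
  proof -
    have "C * (\<Sum>(a, is)\<in>F. schwartz_seminorm a is \<phi>) \<le> C * (\<Sum>(a, is)\<in>F \<union> G. schwartz_seminorm a is \<phi>)"
      by (intro mult_left_mono sum_mono2) (use C D that in \<open>auto intro: schwartz_seminorm_nonneg\<close>)
    moreover have "D * (\<Sum>(a, is)\<in>G. schwartz_seminorm a is \<phi>) \<le> D * (\<Sum>(a, is)\<in>F \<union> G. schwartz_seminorm a is \<phi>)"
      by (intro mult_left_mono sum_mono2) (use C D that in \<open>auto intro: schwartz_seminorm_nonneg\<close>)
    ultimately show ?thesis using C(3)[OF that] D(3)[OF that] by (simp add: distrib_right)
  qed
  thus ?thesis unfolding schwartz_dominated_def
    using C D by (intro exI[of _ "C + D"] conjI exI[of _ "F \<union> G"]) auto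
qed

lemma schwartz_dominated_cmult:
  assumes "schwartz_dominated p" "c \<ge> 0"
  shows "schwartz_dominated (\<lambda>\<phi>. c * p \<phi>)"
proof -
  from assms obtain C F where C: "C \<ge> 0" "finite F"
      "\<And>\<phi>. \<phi> \<in> schwartz_space \<Longrightarrow> p \<phi> \<le> C * (\<Sum>(a, is)\<in>F. schwartz_seminorm a is \<phi>)"
    unfolding schwartz_dominated_def by auto
  thus ?thesis unfolding schwartz_dominated_def
    using assms(2) mult_left_mono[OF C(3) assms(2)]
    by (intro exI[of _ "c * C"] conjI exI[of _ F]) (auto simp: mult.assoc)
qed

lemma schwartz_dominated_zero: "schwartz_dominated (\<lambda>\<phi>. 0)"
  using schwartz_dominated_cmult[OF schwartz_dominated_seminorm, of 0] by simp

lemma schwartz_dominated_sum: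
  "(\<And>k. k \<in> K \<Longrightarrow> schwartz_dominated (p k)) \<Longrightarrow> schwartz_dominated (\<lambda>\<phi>. \<Sum>k\<in>K. p k \<phi>)"
  by (induction K rule: infinite_finite_induct)
     (auto intro: schwartz_dominated_zero schwartz_dominated_add)

definition continuous_op :: "((real^'m::finite \<Rightarrow> complex) \<Rightarrow> real^'n::finite \<Rightarrow> complex) \<Rightarrow> bool" where
  "continuous_op E \<longleftrightarrow> (\<forall>\<phi>\<in>schwartz_space. E \<phi> \<in> schwartz_space) \<and>
     (\<forall>a is. schwartz_dominated (\<lambda>\<phi>. schwartz_seminorm a is (E \<phi>)))"

lemma continuous_op_mem: "continuous_op E \<Longrightarrow> \<phi> \<in> schwartz_space \<Longrightarrow> E \<phi> \<in> schwartz_space"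
  by (simp add: continuous_op_def)

lemma continuous_op_dominated:
  "continuous_op E \<Longrightarrow> schwartz_dominated (\<lambda>\<phi>. schwartz_seminorm a is (E \<phi>))"
  by (simp add: continuous_op_def)

lemma continuous_opI:
  assumes "\<And>\<phi>. \<phi> \<in> schwartz_space \<Longrightarrow> E \<phi> \<in> schwartz_space"
    and "\<And>a is. schwartz_dominated (\<lambda>\<phi>. schwartz_seminorm a is (E \<phi>))"
  shows "continuous_op E"
  using assms by (simp add: continuous_op_def)

lemma schwartz_dominated_compose:
  assumes "schwartz_dominated q" "continuous_op E"
  shows "schwartz_dominated (\<lambda>\<phi>. q (E \<phi>))"
proof -
  from assms(1) obtain C F where C: "C \<ge> 0" "finite F"
      "\<And>\<phi>. \<phi> \<in> schwartz_space \<Longrightarrow> q \<phi> \<le> C * (\<Sum>(a, is)\<in>F. schwartz_seminorm a is \<phi>)"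
    unfolding schwartz_dominated_def by auto
  have "schwartz_dominated (\<lambda>\<phi>. C * (\<Sum>k\<in>F. schwartz_seminorm (fst k) (snd k) (E \<phi>)))"
    by (rule schwartz_dominated_cmult[OF schwartz_dominated_sum[OF continuous_op_dominated[OF assms(2)]] C(1)])
  thus ?thesis
    by (rule schwartz_dominated_mono)
       (use C(3) continuous_op_mem[OF assms(2)] in \<open>simp add: case_prod_beta\<close>)
qed

lemma continuous_op_compose:
  assumes "continuous_op D" "continuous_op E"
  shows "continuous_op (\<lambda>\<phi>. D (E \<phi>))"
  by (intro continuous_opI continuous_op_mem[OF assms(1)] continuous_op_mem[OF assms(2)]
      schwartz_dominated_compose[OF continuous_op_dominated[OF assms(1)] assms(2)])

lemma continuous_op_id: "continuous_op (\<lambda>\<phi>. \<phi>)"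
  by (intro continuous_opI schwartz_dominated_seminorm)

lemma continuous_op_add:
  assumes "continuous_op D" "continuous_op E"
  shows "continuous_op (\<lambda>\<phi> x. D \<phi> x + E \<phi> x)"
proof (rule continuous_opI)
  show "schwartz_dominated (\<lambda>\<phi>. schwartz_seminorm a is (\<lambda>x. D \<phi> x + E \<phi> x))" for a "is"
    by (rule schwartz_dominated_mono[OF schwartz_dominated_add[OF
          continuous_op_dominated[OF assms(1), of a "is"] continuous_op_dominated[OF assms(2), of a "is"]]])
       (rule schwartz_seminorm_triangle[OF continuous_op_mem[OF assms(1)] continuous_op_mem[OF assms(2)]])
  show "(\<lambda>x. D \<phi> x + E \<phi> x) \<in> schwartz_space" if "\<phi> \<in> schwartz_space" for \<phi>
    by (rule schwartz_add[OF continuous_op_mem[OF assms(1) that] continuous_op_mem[OF assms(2) that]])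
qed

lemma continuous_op_cmult:
  assumes "continuous_op E"
  shows "continuous_op (\<lambda>\<phi> x. c * E \<phi> x)"
proof (rule continuous_opI)
  show "schwartz_dominated (\<lambda>\<phi>. schwartz_seminorm a is (\<lambda>x. c * E \<phi> x))" for a "is"
    by (rule schwartz_dominated_mono[OF schwartz_dominated_cmult[OF
          continuous_op_dominated[OF assms, of a "is"], of "norm c"]])
       (auto intro: schwartz_seminorm_cmult_le continuous_op_mem[OF assms])
  show "(\<lambda>x. c * E \<phi> x) \<in> schwartz_space" if "\<phi> \<in> schwartz_space" for \<phi>
    by (rule schwartz_cmult[OF continuous_op_mem[OF assms that]])
qed

lemma continuous_op_zero: "continuous_op (\<lambda>\<phi> x. 0)"
  by (intro continuous_opI) (auto simp: schwartz_seminorm_zero schwartz_dominated_zero)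

lemma continuous_op_sum:
  "(\<And>k. k \<in> K \<Longrightarrow> continuous_op (E k)) \<Longrightarrow> continuous_op (\<lambda>\<phi> x. \<Sum>k\<in>K. E k \<phi> x)"
  by (induction K rule: infinite_finite_induct)
     (auto intro: continuous_op_zero continuous_op_add)

lemma continuous_op_cnj: "continuous_op (\<lambda>\<phi> x. cnj (\<phi> x))"
proof (rule continuous_opI)
  fix a :: "'a \<Rightarrow> nat" and "is" :: "'a list"
  show "schwartz_dominated (\<lambda>\<phi>. schwartz_seminorm a is (\<lambda>x. cnj (\<phi> x)))"
    by (rule schwartz_dominated_mono[OF schwartz_dominated_seminorm[of a "is"]])
       (simp add: schwartz_seminorm_cnj)
qed auto

lemma continuous_op_partial: "continuous_op (partial_deriv i)"
proof (rule continuous_opI)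
  fix a :: "'a \<Rightarrow> nat" and "is" :: "'a list"
  show "schwartz_dominated (\<lambda>\<phi>. schwartz_seminorm a is (partial_deriv i \<phi>))"
    by (rule schwartz_dominated_mono[OF schwartz_dominated_seminorm[of a "is @ [i]"]])
       (simp add: schwartz_seminorm_def iter_partial_append)
qed auto

lemma continuous_op_coord: "continuous_op (\<lambda>\<phi> x. of_real (x $ j) * \<phi> x)"
proof -
  have "schwartz_dominated (\<lambda>\<phi>. schwartz_seminorm a is (\<lambda>x. of_real (x $ j) * \<phi> x))" for a "is"
  proof (induction "is" rule: rev_induct)
    case Nil
    show ?case
      by (rule schwartz_dominated_mono[OF schwartz_dominated_seminorm[of "a(j := Suc (a j))" "[]"]])
         (simp add: schwartz_seminorm_def monomial_fun_upd mult_ac)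
  next
    case (snoc i "is")
    have "schwartz_dominated (\<lambda>\<phi>. schwartz_seminorm a is (\<lambda>x. of_real (x $ j) * partial_deriv i \<phi> x)
        + schwartz_seminorm a is \<phi>)"
      by (intro schwartz_dominated_add schwartz_dominated_seminorm
          schwartz_dominated_compose[OF snoc continuous_op_partial])
    thus ?case
    proof (rule schwartz_dominated_mono)
      fix \<phi> :: "real^'a \<Rightarrow> complex" assume \<phi>: "\<phi> \<in> schwartz_space"
      let ?d = "\<lambda>x. (if i = j then 1 else 0) * \<phi> x"
      have "partial_deriv i (\<lambda>x. of_real (x $ j) * \<phi> x) = (\<lambda>x. of_real (x $ j) * partial_deriv i \<phi> x + ?d x)"
        using partial_deriv_coord_mult[OF schwartz_differentiable[OF \<phi>]] by auto
      hence "schwartz_seminorm a (is @ [i]) (\<lambda>x. of_real (x $ j) * \<phi> x) =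
          schwartz_seminorm a is (\<lambda>x. of_real (x $ j) * partial_deriv i \<phi> x + ?d x)"
        by (simp add: schwartz_seminorm_def iter_partial_append)
      also have "\<dots> \<le> schwartz_seminorm a is (\<lambda>x. of_real (x $ j) * partial_deriv i \<phi> x) + schwartz_seminorm a is ?d"
        using \<phi> by (intro schwartz_seminorm_triangle) auto
      also have "schwartz_seminorm a is ?d \<le> schwartz_seminorm a is \<phi>"
        using schwartz_seminorm_nonneg[OF \<phi>] by (auto simp: schwartz_seminorm_zero)
      finally show "schwartz_seminorm a (is @ [i]) (\<lambda>x. of_real (x $ j) * \<phi> x) \<le>
          schwartz_seminorm a is (\<lambda>x. of_real (x $ j) * partial_deriv i \<phi> x) + schwartz_seminorm a is \<phi>"
        by simp
    qed
  qed
  thus ?thesis by (intro continuous_opI schwartz_coord_mult)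
qed

text \<open>The continuous counterpart of the coinduction principle for the Schwartz space: the bounds are
  now required to be uniform in the argument of the operator.\<close>

lemma continuous_op_coinduct:
  fixes \<E> :: "((real^'m \<Rightarrow> complex) \<Rightarrow> real^'n \<Rightarrow> complex) set"
  assumes E: "E \<in> \<E>"
    and diff: "\<And>E \<phi> x. E \<in> \<E> \<Longrightarrow> \<phi> \<in> schwartz_space \<Longrightarrow> E \<phi> differentiable (at x)"
    and bdd: "\<And>E. E \<in> \<E> \<Longrightarrow> \<exists>q. schwartz_dominated q \<and> (\<forall>\<phi>\<in>schwartz_space. \<forall>x. norm (E \<phi> x) \<le> q \<phi>)"
    and partial: "\<And>E i. E \<in> \<E> \<Longrightarrow> \<exists>E'\<in>\<E>. \<forall>\<phi>\<in>schwartz_space. partial_deriv i (E \<phi>) = E' \<phi>"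
    and coord: "\<And>E i. E \<in> \<E> \<Longrightarrow>
      \<exists>E'\<in>\<E>. \<forall>\<phi>\<in>schwartz_space. (\<lambda>x. of_real (x $ i) * E \<phi> x) = E' \<phi>"
  shows "continuous_op E"
proof -
  have ip: "\<exists>E'\<in>\<E>. \<forall>\<phi>\<in>schwartz_space. iter_partial js (E \<phi>) = E' \<phi>" for js
  proof (induction js)
    case Nil
    show ?case using E by (intro bexI[of _ E]) auto
  next
    case (Cons i js)
    then obtain E' where "E' \<in> \<E>" "\<forall>\<phi>\<in>schwartz_space. iter_partial js (E \<phi>) = E' \<phi>" by blast
    moreover from this(1) partial obtain E'' where
      "E'' \<in> \<E>" "\<forall>\<phi>\<in>schwartz_space. partial_deriv i (E' \<phi>) = E'' \<phi>" by blast
    ultimately show ?case by (intro bexI[of _ E'']) auto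
  qed
  have pow: "\<exists>E''\<in>\<E>. \<forall>\<phi>\<in>schwartz_space. (\<lambda>x. of_real (x $ i ^ m) * E' \<phi> x) = E'' \<phi>"
    if "E' \<in> \<E>" for E' i m
  proof (induction m)
    case 0
    show ?case using that by (intro bexI[of _ E']) auto
  next
    case (Suc m)
    then obtain E1 where "E1 \<in> \<E>" and
      1: "\<And>\<phi>. \<phi> \<in> schwartz_space \<Longrightarrow> (\<lambda>x. of_real (x $ i ^ m) * E' \<phi> x) = E1 \<phi>" by blast
    moreover from this(1) coord obtain E2 where "E2 \<in> \<E>" and
      2: "\<And>\<phi>. \<phi> \<in> schwartz_space \<Longrightarrow> (\<lambda>x. of_real (x $ i) * E1 \<phi> x) = E2 \<phi>" by blast
    have "(\<lambda>x. of_real (x $ i ^ Suc m) * E' \<phi> x) = E2 \<phi>" if "\<phi> \<in> schwartz_space" for \<phi>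
      using 2[OF that] unfolding 1[OF that, symmetric] by (simp add: mult.assoc)
    with \<open>E2 \<in> \<E>\<close> show ?case by blast
  qed
  have prd: "\<exists>E''\<in>\<E>. \<forall>\<phi>\<in>schwartz_space. (\<lambda>x. of_real (\<Prod>i\<in>J. x $ i ^ a i) * E' \<phi> x) = E'' \<phi>"
    if "E' \<in> \<E>" "finite J" for E' a J
    using that(2)
  proof (induction J rule: finite_induct)
    case empty
    show ?case using that by (intro bexI[of _ E']) auto
  next
    case (insert j J)
    then obtain E1 where "E1 \<in> \<E>" and
      1: "\<And>\<phi>. \<phi> \<in> schwartz_space \<Longrightarrow> (\<lambda>x. of_real (\<Prod>i\<in>J. x $ i ^ a i) * E' \<phi> x) = E1 \<phi>" by blast
    moreover from pow[OF this(1), of j "a j"] obtain E2 where "E2 \<in> \<E>" and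
      2: "\<And>\<phi>. \<phi> \<in> schwartz_space \<Longrightarrow> (\<lambda>x. of_real (x $ j ^ a j) * E1 \<phi> x) = E2 \<phi>" by blast
    have "(\<lambda>x. of_real (\<Prod>i\<in>insert j J. x $ i ^ a i) * E' \<phi> x) = E2 \<phi>" if "\<phi> \<in> schwartz_space" for \<phi>
      using 2[OF that] insert(1,2) unfolding 1[OF that, symmetric] by (simp add: mult.assoc)
    with \<open>E2 \<in> \<E>\<close> show ?case by blast
  qed
  have both: "\<exists>E'\<in>\<E>. \<forall>\<phi>\<in>schwartz_space. (\<lambda>x. of_real (monomial_fun a x) * iter_partial is (E \<phi>) x) = E' \<phi>"
    for a "is"
  proof -
    from ip obtain E1 where E1: "E1 \<in> \<E>" "\<And>\<phi>. \<phi> \<in> schwartz_space \<Longrightarrow> iter_partial is (E \<phi>) = E1 \<phi>" by blast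
    from prd[OF E1(1), of UNIV a] show ?thesis using E1(2) by (simp add: monomial_fun_def)
  qed
  have bd: "\<exists>q. schwartz_dominated q \<and>
      (\<forall>\<phi>\<in>schwartz_space. \<forall>x. norm (of_real (monomial_fun a x) * iter_partial is (E \<phi>) x) \<le> q \<phi>)" for a "is"
  proof -
    from both[of a "is"] obtain E' where "E' \<in> \<E>"
      and E': "\<And>\<phi>. \<phi> \<in> schwartz_space \<Longrightarrow> (\<lambda>x. of_real (monomial_fun a x) * iter_partial is (E \<phi>) x) = E' \<phi>"
      by blast
    with bdd obtain q where "schwartz_dominated q" "\<forall>\<phi>\<in>schwartz_space. \<forall>x. norm (E' \<phi> x) \<le> q \<phi>" by blast
    thus ?thesis using fun_cong[OF E'] by (intro exI[of _ q]) auto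
  qed
  show ?thesis
  proof (rule continuous_opI)
    fix \<phi> :: "real^'m \<Rightarrow> complex" assume \<phi>: "\<phi> \<in> schwartz_space"
    show "E \<phi> \<in> schwartz_space"
      unfolding schwartz_space_def
    proof (intro CollectI conjI allI)
      show "iter_partial is (E \<phi>) differentiable (at x)" for "is" x
        using ip[of "is"] diff \<phi> by metis
      show "bounded (range (\<lambda>x. of_real (monomial_fun a x) * iter_partial is (E \<phi>) x))" for a "is"
        using bd[of a "is"] \<phi> by (auto simp: bounded_iff)
    qed
  next
    fix a "is"
    from bd[of a "is"] obtain q where q: "schwartz_dominated q"
      "\<And>\<phi> x. \<phi> \<in> schwartz_space \<Longrightarrow> norm (of_real (monomial_fun a x) * iter_partial is (E \<phi>) x) \<le> q \<phi>" by blast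
    show "schwartz_dominated (\<lambda>\<phi>. schwartz_seminorm a is (E \<phi>))"
      by (rule schwartz_dominated_mono[OF q(1)]) (intro schwartz_seminorm_le q(2))
  qed
qed

subsection \<open>Tempered distributions\<close>

lemma topspace_schwartz_topology: "topspace schwartz_topology = schwartz_space"
proof
  show "topspace schwartz_topology \<subseteq> schwartz_space"
    unfolding schwartz_topology_def topology_generated_by_topspace by auto
next
  show "schwartz_space \<subseteq> topspace (schwartz_topology :: (real^'a \<Rightarrow> complex) topology)"
  proof
    fix f :: "real^'a \<Rightarrow> complex" assume f: "f \<in> schwartz_space"
    hence "f \<in> {g \<in> schwartz_space. schwartz_seminorm (\<lambda>_. 0) [] (\<lambda>x. g x - f x) < 1}"
      by (simp add: schwartz_seminorm_zero)
    thus "f \<in> topspace schwartz_topology"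
      unfolding schwartz_topology_def topology_generated_by_topspace using f by blast
  qed
qed

lemma openin_schwartz_ball:
  fixes f :: "real^'n \<Rightarrow> complex"
  assumes f: "f \<in> schwartz_space" and F: "finite F"
  shows "openin schwartz_topology
    {g \<in> schwartz_space. \<forall>(a, is)\<in>F. schwartz_seminorm a is (\<lambda>x. g x - f x) < r}"
  using F
proof (induction F rule: finite_induct)
  case empty
  show ?case using openin_topspace[of schwartz_topology] by (simp add: topspace_schwartz_topology)
next
  case (insert k F)
  have "openin schwartz_topology
      {g \<in> schwartz_space. schwartz_seminorm (fst k) (snd k) (\<lambda>x. g x - f x) < r}"
    unfolding schwartz_topology_def using f by (intro topology_generated_by_Basis) blast
  from openin_Int[OF this insert.IH] show ?case
    by (rule back_subst[of "openin schwartz_topology"]) (auto simp: case_prod_beta)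
qed

lemma schwartz_ball_in_open:
  fixes \<psi> :: "real^'n \<Rightarrow> complex"
  assumes "openin schwartz_topology U" "\<psi> \<in> U"
  shows "\<exists>F r. finite F \<and> r > 0 \<and>
    {\<phi> \<in> schwartz_space. \<forall>(a, is)\<in>F. schwartz_seminorm a is (\<lambda>x. \<phi> x - \<psi> x) < r} \<subseteq> U"
proof -
  let ?B = "{{g \<in> schwartz_space. schwartz_seminorm a is (\<lambda>x. g x - f x) < r} | a is (f :: real^'n \<Rightarrow> complex) r.
        f \<in> schwartz_space}"
  have "generate_topology_on ?B U"
    using assms(1) unfolding schwartz_topology_def openin_topology_generated_by_iff .
  thus ?thesis using assms(2)
  proof induction
    case (Int U V)
    from Int obtain F r where *: "finite F" "r > 0"
      "{\<phi> \<in> schwartz_space. \<forall>(a, is)\<in>F. schwartz_seminorm a is (\<lambda>x. \<phi> x - \<psi> x) < r} \<subseteq> U" by blast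
    from Int obtain G s where **: "finite G" "s > 0"
      "{\<phi> \<in> schwartz_space. \<forall>(a, is)\<in>G. schwartz_seminorm a is (\<lambda>x. \<phi> x - \<psi> x) < s} \<subseteq> V" by blast
    have "{\<phi> \<in> schwartz_space. \<forall>(a, is)\<in>F \<union> G. schwartz_seminorm a is (\<lambda>x. \<phi> x - \<psi> x) < min r s} \<subseteq> U \<inter> V"
      using *(3) **(3) by fastforce
    thus ?case using *(1,2) **(1,2) by (intro exI[of _ "F \<union> G"] exI[of _ "min r s"]) auto
  next
    case (UN K)
    thus ?case by (meson Union_iff Union_upper subset_trans)
  next
    case (Basis s)
    then obtain a "is" f r where s: "s = {g \<in> schwartz_space. schwartz_seminorm a is (\<lambda>x. g x - f x) < r}"
      "f \<in> schwartz_space" by blast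
    with Basis have \<psi>: "\<psi> \<in> schwartz_space" "schwartz_seminorm a is (\<lambda>x. \<psi> x - f x) < r" by auto
    let ?r = "r - schwartz_seminorm a is (\<lambda>x. \<psi> x - f x)"
    have "\<phi> \<in> s" if \<phi>: "\<phi> \<in> schwartz_space" "schwartz_seminorm a is (\<lambda>x. \<phi> x - \<psi> x) < ?r" for \<phi>
    proof -
      have "schwartz_seminorm a is (\<lambda>x. (\<phi> x - \<psi> x) + (\<psi> x - f x)) < r"
        using schwartz_seminorm_triangle[OF schwartz_diff[OF \<phi>(1) \<psi>(1)] schwartz_diff[OF \<psi>(1) s(2)], of a "is"] \<phi>(2)
        by linarith
      thus ?thesis using \<phi>(1) by (simp add: s)
    qed
    thus ?case using \<psi> by (intro exI[of _ "{(a, is)}"] exI[of _ ?r]) auto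
  qed auto
qed

lemma schwartz_closure_approx:
  assumes "\<psi> \<in> schwartz_topology closure_of D" "finite F" "r > 0"
  shows "\<exists>\<phi>\<in>D. \<phi> \<in> schwartz_space \<and> (\<forall>(a, is)\<in>F. schwartz_seminorm a is (\<lambda>x. \<phi> x - \<psi> x) < r)"
proof -
  have \<psi>: "\<psi> \<in> schwartz_space" using assms(1) by (auto simp: in_closure_of topspace_schwartz_topology)
  let ?B = "{g \<in> schwartz_space. \<forall>(a, is)\<in>F. schwartz_seminorm a is (\<lambda>x. g x - \<psi> x) < r}"
  have "\<psi> \<in> ?B" using \<psi> assms(3) by (auto simp: schwartz_seminorm_zero)
  moreover have "\<forall>T. \<psi> \<in> T \<and> openin schwartz_topology T \<longrightarrow> (\<exists>y. y \<in> D \<and> y \<in> T)"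
    using assms(1) by (simp add: in_closure_of)
  ultimately have "\<exists>y. y \<in> D \<and> y \<in> ?B"
    using openin_schwartz_ball[OF \<psi> assms(2), of r] by (elim allE[of _ ?B]) simp
  thus ?thesis by auto
qed

lemma tempered_linear:
  assumes "T \<in> tempered" "\<phi> \<in> schwartz_space" "\<psi> \<in> schwartz_space"
  shows "T (\<lambda>x. a * \<phi> x + b * \<psi> x) = a * T \<phi> + b * T \<psi>"
  using assms unfolding tempered_def by auto

lemma tempered_add:
  assumes "T \<in> tempered" "\<phi> \<in> schwartz_space" "\<psi> \<in> schwartz_space"
  shows "T (\<lambda>x. \<phi> x + \<psi> x) = T \<phi> + T \<psi>"
  using tempered_linear[OF assms, of 1 1] by simp

lemma tempered_diff:
  assumes "T \<in> tempered" "\<phi> \<in> schwartz_space" "\<psi> \<in> schwartz_space"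
  shows "T (\<lambda>x. \<phi> x - \<psi> x) = T \<phi> - T \<psi>"
  using tempered_linear[OF assms, of 1 "-1"] by simp

lemma tempered_cmult:
  assumes "T \<in> tempered" "\<phi> \<in> schwartz_space"
  shows "T (\<lambda>x. c * \<phi> x) = c * T \<phi>"
  using tempered_linear[OF assms(1,2,2), of c 0] by simp

lemma tempered_zero: "T \<in> tempered \<Longrightarrow> T (\<lambda>x. 0) = 0"
  using tempered_cmult[of T "\<lambda>x. 0" 0] by simp

lemma tempered_sum:
  assumes "T \<in> tempered" "\<And>k. k \<in> K \<Longrightarrow> \<phi> k \<in> schwartz_space"
  shows "T (\<lambda>x. \<Sum>k\<in>K. \<phi> k x) = (\<Sum>k\<in>K. T (\<phi> k))"
  using assms(2)
proof (induction K rule: infinite_finite_induct)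
  case (insert k K)
  have "T (\<lambda>x. \<phi> k x + (\<Sum>k\<in>K. \<phi> k x)) = T (\<phi> k) + T (\<lambda>x. \<Sum>k\<in>K. \<phi> k x)"
    using insert by (intro tempered_add[OF assms(1)]) auto
  thus ?case using insert by simp
qed (auto simp: tempered_zero[OF assms(1)])

lemma tempered_extensional: "T \<in> tempered \<Longrightarrow> T \<in> extensional schwartz_space"
  by (simp add: tempered_def)

text \<open>The preimage of the unit disc contains a ball of finitely many seminorms around zero; scaling
  a test function into that ball gives the bound.\<close>

lemma tempered_dominated:
  fixes T :: "'n::finite distr"
  assumes T: "T \<in> tempered"
  shows "schwartz_dominated (\<lambda>\<phi>. norm (T \<phi>))"
proof -
  have "continuous_map schwartz_topology euclidean T" using T by (simp add: tempered_def)
  moreover have "openin euclidean (ball 0 1 :: complex set)" by (rule open_openin[THEN iffD1]) simp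
  ultimately have op: "openin schwartz_topology {\<phi> \<in> topspace schwartz_topology. T \<phi> \<in> ball 0 1}"
    by (rule openin_continuous_map_preimage)
  have z: "(\<lambda>x. 0) \<in> {\<phi> \<in> topspace schwartz_topology. T \<phi> \<in> ball 0 1}"
    by (simp add: topspace_schwartz_topology tempered_zero[OF T])
  from schwartz_ball_in_open[OF op z] obtain F r where F: "finite F" "r > 0"
    "{\<phi> \<in> schwartz_space. \<forall>(a, is)\<in>F. schwartz_seminorm a is (\<lambda>x. \<phi> x - 0) < r} \<subseteq>
      {\<phi> \<in> topspace schwartz_topology. T \<phi> \<in> ball 0 1}"
    by (elim exE conjE) (rule that)
  hence F3: "norm (T \<phi>) < 1"
    if "\<phi> \<in> schwartz_space" "\<And>a is. (a, is) \<in> F \<Longrightarrow> schwartz_seminorm a is \<phi> < r" for \<phi>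
    using that by (auto simp: subset_iff)
  have "norm (T \<phi>) \<le> (1 / r) * (\<Sum>(a, is)\<in>F. schwartz_seminorm a is \<phi>)" if \<phi>: "\<phi> \<in> schwartz_space" for \<phi>
  proof (rule field_le_epsilon)
    fix e :: real assume e: "e > 0"
    let ?s = "\<Sum>(a, is)\<in>F. schwartz_seminorm a is \<phi>"
    have s0: "?s \<ge> 0" using \<phi> by (auto intro!: sum_nonneg schwartz_seminorm_nonneg)
    \<comment> \<open>The summand \<open>r * e\<close> covers the case that all seminorms vanish.\<close>
    define c where "c = r / (?s + r * e)"
    have pos: "?s + r * e > 0" using s0 e F(2) by (simp add: add_nonneg_pos)
    have c: "c > 0" using pos F(2) by (simp add: c_def)
    have "norm (T (\<lambda>x. of_real c * \<phi> x)) < 1"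
    proof (rule F3)
      fix a "is" assume k: "(a, is) \<in> F"
      have "schwartz_seminorm a is (\<lambda>x. of_real c * \<phi> x) \<le> c * schwartz_seminorm a is \<phi>"
        using schwartz_seminorm_cmult_le[OF \<phi>, of a "is" "of_real c"] c by simp
      also have "schwartz_seminorm a is \<phi> \<le> ?s"
        using member_le_sum[OF k _ F(1), of "\<lambda>(a, is). schwartz_seminorm a is \<phi>"]
        by (auto intro: schwartz_seminorm_nonneg[OF \<phi>])
      also have "c * ?s < c * (?s + r * e)" using c e F(2) by simp
      also have "\<dots> = r" using pos by (simp add: c_def)
      finally show "schwartz_seminorm a is (\<lambda>x. of_real c * \<phi> x) < r" using c by simp
    qed (use \<phi> in auto)
    hence "c * norm (T \<phi>) < 1" using c by (simp add: tempered_cmult[OF T \<phi>] norm_mult)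
    hence "norm (T \<phi>) < 1 / c" using c by (simp add: field_simps)
    also have "1 / c = 1 / r * ?s + e" using F(2) by (simp add: c_def field_simps)
    finally show "norm (T \<phi>) \<le> 1 / r * ?s + e" by simp
  qed
  thus ?thesis unfolding schwartz_dominated_def using F(1,2)
    by (intro exI[of _ "1 / r"] conjI exI[of _ F]) auto
qed

lemma temperedI:
  fixes T :: "'n::finite distr"
  assumes ext: "T \<in> extensional schwartz_space"
    and lin: "\<And>\<phi> \<psi> a b. \<phi> \<in> schwartz_space \<Longrightarrow> \<psi> \<in> schwartz_space \<Longrightarrow>
      T (\<lambda>x. a * \<phi> x + b * \<psi> x) = a * T \<phi> + b * T \<psi>"
    and dom: "schwartz_dominated (\<lambda>\<phi>. norm (T \<phi>))"
  shows "T \<in> tempered"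
proof -
  from dom obtain C F where C: "C \<ge> 0" "finite F"
    "\<And>\<phi>. \<phi> \<in> schwartz_space \<Longrightarrow> norm (T \<phi>) \<le> C * (\<Sum>(a, is)\<in>F. schwartz_seminorm a is \<phi>)"
    unfolding schwartz_dominated_def by auto
  have "continuous_map schwartz_topology euclidean T"
    unfolding continuous_map_def
  proof (intro conjI allI impI)
    fix U :: "complex set" assume "openin euclidean U"
    hence U: "open U" by (rule open_openin[THEN iffD2])
    show "openin schwartz_topology {\<phi> \<in> topspace schwartz_topology. T \<phi> \<in> U}"
    proof (subst openin_subopen, intro ballI)
      fix \<phi> assume "\<phi> \<in> {\<phi> \<in> topspace schwartz_topology. T \<phi> \<in> U}"
      hence \<phi>: "\<phi> \<in> schwartz_space" "T \<phi> \<in> U" by (auto simp: topspace_schwartz_topology)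
      then obtain e where e: "e > 0" "ball (T \<phi>) e \<subseteq> U" using U open_contains_ball by blast
      define r where "r = e / (C * card F + 1)"
      have den: "C * card F + 1 > 0" using C(1) by (simp add: add_nonneg_pos)
      have r: "r > 0" using e den by (simp add: r_def)
      let ?B = "{g \<in> schwartz_space. \<forall>(a, is)\<in>F. schwartz_seminorm a is (\<lambda>x. g x - \<phi> x) < r}"
      have "T g \<in> U" if g: "g \<in> ?B" for g
      proof -
        have gs: "g \<in> schwartz_space" using g by auto
        have "T (\<lambda>x. g x - \<phi> x) = T g - T \<phi>" using lin[OF gs \<phi>(1), of 1 "-1"] by simp
        hence "norm (T g - T \<phi>) \<le> C * (\<Sum>(a, is)\<in>F. schwartz_seminorm a is (\<lambda>x. g x - \<phi> x))"
          using C(3)[OF schwartz_diff[OF gs \<phi>(1)]] by simp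
        also have "\<dots> \<le> C * (\<Sum>(a, is)\<in>F. r)"
          using g by (intro mult_left_mono sum_mono C(1)) (auto intro: less_imp_le)
        also have "\<dots> = (C * card F) * r" by simp
        also have "\<dots> < (C * card F + 1) * r" using r by simp
        also have "\<dots> = e" using den by (simp add: r_def)
        finally show ?thesis using e(2) by (auto simp: dist_norm norm_minus_commute)
      qed
      moreover have "\<phi> \<in> ?B" using \<phi> r by (auto simp: schwartz_seminorm_zero)
      ultimately show "\<exists>B. openin schwartz_topology B \<and> \<phi> \<in> B \<and> B \<subseteq> {\<phi> \<in> topspace schwartz_topology. T \<phi> \<in> U}"
        using openin_schwartz_ball[OF \<phi>(1) C(2), of r]
        by (intro exI[of _ ?B]) (auto simp: topspace_schwartz_topology)
    qed
  qed auto
  thus ?thesis using ext lin unfolding tempered_def by auto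
qed

lemma tempered_compose:
  fixes T :: "'n::finite distr" and E :: "(real^'m \<Rightarrow> complex) \<Rightarrow> real^'n \<Rightarrow> complex"
  assumes T: "T \<in> tempered" and E: "continuous_op E"
    and lin: "\<And>\<phi> \<psi> a b. \<phi> \<in> schwartz_space \<Longrightarrow> \<psi> \<in> schwartz_space \<Longrightarrow>
      E (\<lambda>x. a * \<phi> x + b * \<psi> x) = (\<lambda>x. a * E \<phi> x + b * E \<psi> x)"
  shows "(\<lambda>\<phi>\<in>schwartz_space. T (E \<phi>)) \<in> tempered"
proof (rule temperedI)
  fix \<phi> \<psi> :: "real^'m \<Rightarrow> complex" and a b
  assume *: "\<phi> \<in> schwartz_space" "\<psi> \<in> schwartz_space"
  hence "(\<lambda>x. a * \<phi> x + b * \<psi> x) \<in> schwartz_space" by auto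
  thus "(\<lambda>\<phi>\<in>schwartz_space. T (E \<phi>)) (\<lambda>x. a * \<phi> x + b * \<psi> x) =
      a * (\<lambda>\<phi>\<in>schwartz_space. T (E \<phi>)) \<phi> + b * (\<lambda>\<phi>\<in>schwartz_space. T (E \<phi>)) \<psi>"
    using * continuous_op_mem[OF E] by (simp add: lin tempered_linear[OF T])
next
  show "schwartz_dominated (\<lambda>\<phi>. norm ((\<lambda>\<phi>\<in>schwartz_space. T (E \<phi>)) \<phi>))"
    by (rule schwartz_dominated_mono[OF schwartz_dominated_compose[OF tempered_dominated[OF T] E]]) simp
qed auto

lemma limitin_weak_topology:
  "limitin weak_topology s h sequentially \<longleftrightarrow>
    h \<in> tempered \<and> (\<forall>\<^sub>F i in sequentially. s i \<in> tempered) \<and>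
    (\<forall>\<phi>\<in>schwartz_space. (\<lambda>i. s i \<phi>) \<longlonglongrightarrow> h \<phi>)"
proof -
  have "\<forall>\<^sub>F i in sequentially. s i \<in> extensional schwartz_space"
    if "\<forall>\<^sub>F i in sequentially. s i \<in> tempered"
    using that by eventually_elim (rule tempered_extensional)
  thus ?thesis
    unfolding weak_topology_def limitin_subtopology limitin_componentwise
    by (auto simp: tempered_extensional PiE_def)
qed

section \<open>Integrals of rapidly decreasing functions\<close>

text \<open>The exponent is twice the dimension: the power then dominates the product of \<open>1 + x\<^sub>i\<^sup>2\<close> over
  all coordinates, which makes the weight integrable by Fubini's theorem.\<close>

definition decay_weight :: "real^'n::finite \<Rightarrow> real" where
  "decay_weight x = inverse ((1 + norm x) ^ (2 * CARD('n)))"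

lemma one_plus_norm_pos: "0 < (1 + norm x) ^ N" for x :: "'a::real_normed_vector"
  by (intro zero_less_power add_pos_nonneg) auto

lemma decay_weight_pos: "0 < decay_weight x"
  unfolding decay_weight_def by (intro positive_imp_inverse_positive one_plus_norm_pos)

lemma decay_weight_borel [measurable]: "decay_weight \<in> borel_measurable borel"
  unfolding decay_weight_def[abs_def] by measurable

lemma integrable_decay_weight: "integrable lborel (decay_weight :: real^'n::finite \<Rightarrow> real)"
proof (rule integrableI_bounded)
  let ?g = "\<lambda>t::real. inverse (1 + t\<^sup>2)"
  have g: "integrable lborel ?g"
    using integrable_inverse_1_plus_square by (simp add: set_integrable_def einterval_def)
  have le: "decay_weight x \<le> (\<Prod>b\<in>Basis. ?g (x \<bullet> b))" for x :: "real^'n"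
  proof -
    have "(\<Prod>b\<in>Basis. 1 + (x \<bullet> b)\<^sup>2) \<le> (\<Prod>b\<in>(Basis::(real^'n) set). (1 + norm x)\<^sup>2)"
    proof (intro prod_mono conjI)
      fix b :: "real^'n" assume b: "b \<in> Basis"
      have "(x \<bullet> b)\<^sup>2 \<le> (norm x)\<^sup>2" using Basis_le_norm[OF b, of x] by (metis abs_ge_zero power2_abs power_mono)
      thus "1 + (x \<bullet> b)\<^sup>2 \<le> (1 + norm x)\<^sup>2" unfolding power2_sum
        using norm_ge_zero[of x] by (simp del: norm_ge_zero)
    qed (simp add: add_nonneg_nonneg)
    also have "\<dots> = (1 + norm x) ^ (2 * CARD('n))" by (simp add: power_mult)
    finally have "inverse ((1 + norm x) ^ (2 * CARD('n))) \<le> inverse (\<Prod>b\<in>Basis. 1 + (x \<bullet> b)\<^sup>2)"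
      by (intro le_imp_inverse_le prod_pos) (auto intro: add_pos_nonneg)
    thus ?thesis by (simp add: decay_weight_def prod_inversef[symmetric] comp_def)
  qed
  have "(\<integral>\<^sup>+x. ennreal (norm (decay_weight (x::real^'n))) \<partial>lborel) \<le>
      (\<integral>\<^sup>+(x::real^'n). (\<Prod>b\<in>Basis. ennreal (?g (x \<bullet> b))) \<partial>lborel)"
  proof (intro nn_integral_mono)
    fix x :: "real^'n"
    have "(\<Prod>b\<in>Basis. ennreal (?g (x \<bullet> b))) = ennreal (\<Prod>b\<in>Basis. ?g (x \<bullet> b))"
      by (intro prod_ennreal) auto
    thus "ennreal (norm (decay_weight x)) \<le> (\<Prod>b\<in>Basis. ennreal (?g (x \<bullet> b)))"
      using le[of x] decay_weight_pos[of x] by (simp add: ennreal_leI)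
  qed
  also have "\<dots> = (\<Prod>b\<in>(Basis::(real^'n) set). \<integral>\<^sup>+t. ennreal (?g t) \<partial>lborel)"
    by (rule nn_integral_lborel_prod) auto
  also have "\<dots> < \<infinity>"
  proof -
    have "(\<integral>\<^sup>+t. ennreal (?g t) \<partial>lborel) = ennreal (LINT t|lborel. ?g t)"
      by (rule nn_integral_eq_integral[OF g]) auto
    thus ?thesis by (simp add: ennreal_power)
  qed
  finally show "(\<integral>\<^sup>+x. ennreal (norm (decay_weight (x::real^'n))) \<partial>lborel) < \<infinity>" .
qed simp

lemma integrable_weighted_sup:
  fixes f :: "real^'n \<Rightarrow> 'b::{banach, second_countable_topology}"
  assumes f: "f \<in> borel_measurable borel"
    and b: "\<And>x. (1 + norm x) ^ (2 * CARD('n)) * norm (f x) \<le> c"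
  shows "integrable lborel f" "(LINT x|lborel. norm (f x)) \<le> c * (LINT x|lborel. decay_weight (x::real^'n))"
proof -
  have le: "norm (f x) \<le> c * decay_weight x" for x
    using b[of x] one_plus_norm_pos[of x "2 * CARD('n)"] by (simp add: decay_weight_def field_simps)
  have i: "integrable lborel (\<lambda>x. c * decay_weight (x::real^'n))"
    by (intro integrable_mult_right integrable_decay_weight)
  show "integrable lborel f"
  proof (rule Bochner_Integration.integrable_bound[OF i])
    show "AE x in lborel. norm (f x) \<le> norm (c * decay_weight x)"
      by (intro AE_I2 order_trans[OF le]) simp
  qed (use f in simp)
  hence "(LINT x|lborel. norm (f x)) \<le> (LINT x|lborel. c * decay_weight (x::real^'n))"
    by (intro integral_mono i le integrable_norm)
  thus "(LINT x|lborel. norm (f x)) \<le> c * (LINT x|lborel. decay_weight (x::real^'n))" by simp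
qed

text \<open>Measurable functions whose moments are all finite: besides the Schwartz functions these
  include the indicator functions of bounded sets.\<close>

definition rapid :: "(real^'k::finite \<Rightarrow> complex) \<Rightarrow> bool" where
  "rapid f \<longleftrightarrow> f \<in> borel_measurable borel \<and> (\<forall>N. integrable lborel (\<lambda>y. (1 + norm y) ^ N *\<^sub>R f y))"

lemma rapid_integrable: "rapid f \<Longrightarrow> integrable lborel f"
  unfolding rapid_def by (auto dest: spec[of _ 0])

lemma rapid_moment: "rapid f \<Longrightarrow> integrable lborel (\<lambda>y. (1 + norm y) ^ N * norm (f y))"
proof -
  assume "rapid f"
  hence "integrable lborel (\<lambda>y. (1 + norm y) ^ N *\<^sub>R f y)" by (simp add: rapid_def)
  from integrable_norm[OF this] show ?thesis by simp
qed

lemma rapidI: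
  fixes f :: "real^'k \<Rightarrow> complex"
  assumes f: "f \<in> borel_measurable borel" and b: "\<And>N. \<exists>c. \<forall>x. (1 + norm x) ^ N * norm (f x) \<le> c"
  shows "rapid f"
  unfolding rapid_def
proof (intro conjI allI f)
  fix N
  obtain c where c: "\<And>x. (1 + norm x) ^ (2 * CARD('k) + N) * norm (f x) \<le> c" using b by blast
  show "integrable lborel (\<lambda>y. (1 + norm y) ^ N *\<^sub>R f y)"
  proof (rule integrable_weighted_sup(1)[of _ c])
    show "(\<lambda>y. (1 + norm y) ^ N *\<^sub>R f y) \<in> borel_measurable borel"
      by (intro borel_measurable_scaleR f borel_measurable_continuous_onI continuous_intros)
    show "(1 + norm y) ^ (2 * CARD('k)) * norm ((1 + norm y) ^ N *\<^sub>R f y) \<le> c" for y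
      using c[of y] by (simp add: power_add mult.assoc)
  qed
qed

lemma schwartz_rapid: "f \<in> schwartz_space \<Longrightarrow> rapid f"
  by (intro rapidI schwartz_borel_measurable) (use schwartz_decay in \<open>blast+\<close>)

lemma schwartz_integrable: "f \<in> schwartz_space \<Longrightarrow> integrable lborel f"
  by (intro rapid_integrable schwartz_rapid)

lemma integrable_mult_bounded:
  fixes f g :: "'a \<Rightarrow> complex"
  assumes "integrable M f" "g \<in> borel_measurable M" "\<And>x. norm (g x) \<le> C"
  shows "integrable M (\<lambda>x. f x * g x)"
proof (rule Bochner_Integration.integrable_bound[of M "\<lambda>x. C * norm (f x)"])
  show "AE x in M. norm (f x * g x) \<le> norm (C * norm (f x))"
  proof (intro AE_I2)
    fix x
    have "norm (f x * g x) \<le> norm (f x) * C" unfolding norm_mult by (intro mult_left_mono assms) auto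
    thus "norm (f x * g x) \<le> norm (C * norm (f x))" by (simp add: mult.commute abs_le_iff)
  qed
qed (use assms in auto)

lemma integral_norm_le_integral:
  fixes f :: "'a \<Rightarrow> complex"
  assumes "integrable M f" "integrable M g" "\<And>x. norm (f x) \<le> g x"
  shows "norm (LINT x|M. f x) \<le> (LINT x|M. g x)"
  using integral_norm_bound[of M f] integral_mono[OF integrable_norm[OF assms(1)] assms(2)] assms(3)
  by (meson order_trans)

lemma integral_bound_mult:
  fixes f g :: "'a \<Rightarrow> complex"
  assumes "integrable M f" "g \<in> borel_measurable M" "\<And>x. norm (g x) \<le> C"
  shows "norm (LINT x|M. f x * g x) \<le> (LINT x|M. norm (f x)) * C"
proof -
  have "norm (LINT x|M. f x * g x) \<le> (LINT x|M. norm (f x) * C)"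
    by (rule integral_norm_le_integral[OF integrable_mult_bounded[OF assms]])
       (use assms in \<open>auto simp: norm_mult intro: mult_left_mono\<close>)
  thus ?thesis by simp
qed

text \<open>Differentiation under the integral sign, for integrands that depend on the variable through a
  family of affine maps. The remainder in the first-order expansion of a Schwartz function is
  bounded by a multiple of the square of the increment, uniformly in the base point, so the remainders
  can simply be integrated.\<close>

lemma has_derivative_integral_schwartz:
  fixes A :: "'a \<Rightarrow> real^'n \<Rightarrow> real^'n" and b :: "'a \<Rightarrow> real^'n"
  assumes \<phi>: "\<phi> \<in> schwartz_space" and f: "integrable M f"
    and lin: "\<And>y. linear (A y)" and le: "\<And>y u. norm (A y u) \<le> norm u"
    and meas: "\<And>x. (\<lambda>y. A y x + b y) \<in> borel_measurable M"
  shows "((\<lambda>x. LINT y|M. f y * \<phi> (A y x + b y)) has_derivative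
    (\<lambda>u. LINT y|M. f y * (\<Sum>i\<in>UNIV. (A y u $ i) *\<^sub>R partial_deriv i \<phi> (A y x + b y)))) (at x)"
proof -
  have m1 [measurable]: "(\<lambda>y. \<psi> (A y x + b y)) \<in> borel_measurable M" if "\<psi> \<in> schwartz_space" for \<psi> x
    using measurable_compose[OF meas schwartz_borel_measurable[OF that]] .
  have "(\<lambda>y. A y u + b y - (A y 0 + b y)) \<in> borel_measurable M" for u
    by (intro borel_measurable_diff meas)
  hence m2: "(\<lambda>y. A y u) \<in> borel_measurable M" for u
    by (simp add: linear_0[OF lin])
  have m3 [measurable]: "(\<lambda>y. A y u $ i) \<in> borel_measurable M" for u i
    using borel_measurable_inner[OF m2 borel_measurable_const, of u "axis i 1"] by (simp add: inner_axis)
  define D where "D u y = (\<Sum>i\<in>UNIV. (A y u $ i) *\<^sub>R partial_deriv i \<phi> (A y x + b y))" for u y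
  have Dm: "D u \<in> borel_measurable M" for u
    unfolding D_def[abs_def] by (intro borel_measurable_sum borel_measurable_scaleR m3 m1 schwartz_partial_deriv \<phi>)
  obtain P where P: "P \<ge> 0" "\<And>i x. norm (partial_deriv i \<phi> x) \<le> P"
    using schwartz_partial_bound[OF \<phi>, where N = 0] by auto
  have Dle: "norm (D u y) \<le> real CARD('n) * P * norm u" for u y
  proof -
    have "norm (D u y) \<le> real CARD('n) * P * norm (A y u)"
      unfolding D_def by (intro norm_partial_sum_le P)
    also have "\<dots> \<le> real CARD('n) * P * norm u" using P by (intro mult_left_mono le) auto
    finally show ?thesis .
  qed
  have Di: "integrable M (\<lambda>y. f y * D u y)" for u
    by (rule integrable_mult_bounded[OF f Dm Dle])
  obtain S where S: "\<And>x. norm (\<phi> x) \<le> S"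
    using schwartz_bounded[OF \<phi>] by (auto simp: bounded_iff)
  have \<phi>i: "integrable M (\<lambda>y. f y * \<phi> (A y x + b y))" for x
    by (rule integrable_mult_bounded[OF f m1[OF \<phi>] S])
  obtain B where B: "B \<ge> 0"
    "\<And>x u. norm (\<phi> (x + u) - \<phi> x - (\<Sum>i\<in>UNIV. (u $ i) *\<^sub>R partial_deriv i \<phi> x)) \<le> B * (norm u)\<^sup>2"
    using schwartz_taylor[OF \<phi>] by blast
  define h where "h x = (LINT y|M. f y * \<phi> (A y x + b y))" for x
  define h' where "h' u = (LINT y|M. f y * D u y)" for u
  define K where "K = (LINT y|M. norm (f y)) * B"
  have bl: "bounded_linear h'"
  proof (rule bounded_linear_intro[where K = "(LINT y|M. norm (f y)) * (real CARD('n) * P)"])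
    fix u v r
    have "h' (u + v) = (LINT y|M. f y * D u y + f y * D v y)"
      unfolding h'_def D_def
      by (simp add: linear_add[OF lin] scaleR_add_left sum.distrib distrib_left)
    thus "h' (u + v) = h' u + h' v" unfolding h'_def using Di by simp
    have "h' (r *\<^sub>R u) = (LINT y|M. r *\<^sub>R (f y * D u y))"
      unfolding h'_def D_def
      by (simp add: linear_scale[OF lin] scaleR_sum_right[symmetric] scaleR_scaleR[symmetric] del: scaleR_scaleR)
    thus "h' (r *\<^sub>R u) = r *\<^sub>R h' u" unfolding h'_def by simp
    show "norm (h' u) \<le> norm u * ((LINT y|M. norm (f y)) * (real CARD('n) * P))"
      using integral_bound_mult[OF f Dm Dle, of u] by (simp add: h'_def mult_ac)
  qed
  have rem: "norm (h (x + u) - h x - h' u) \<le> K * (norm u)\<^sup>2" for u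
  proof -
    have "h (x + u) - h x - h' u = (LINT y|M. f y * (\<phi> (A y (x + u) + b y) - \<phi> (A y x + b y) - D u y))"
      unfolding h_def h'_def right_diff_distrib using \<phi>i Di by simp
    also have "norm \<dots> \<le> (LINT y|M. norm (f y)) * (B * (norm u)\<^sup>2)"
    proof (rule integral_bound_mult[OF f])
      show "(\<lambda>y. \<phi> (A y (x + u) + b y) - \<phi> (A y x + b y) - D u y) \<in> borel_measurable M"
        by (intro borel_measurable_diff m1[OF \<phi>] Dm)
      fix y
      have "norm (\<phi> (A y (x + u) + b y) - \<phi> (A y x + b y) - D u y) \<le> B * (norm (A y u))\<^sup>2"
        using B(2)[of "A y x + b y" "A y u"] by (simp add: D_def linear_add[OF lin] add_ac)
      also have "\<dots> \<le> B * (norm u)\<^sup>2" by (intro mult_left_mono power_mono le B) auto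
      finally show "norm (\<phi> (A y (x + u) + b y) - \<phi> (A y x + b y) - D u y) \<le> B * (norm u)\<^sup>2" .
    qed
    finally show ?thesis by (simp add: K_def mult_ac)
  qed
  have "(h has_derivative h') (at x)"
    unfolding has_derivative_at
  proof (intro conjI bl)
    show "(\<lambda>u. norm (h (x + u) - h x - h' u) / norm u) \<midarrow>0\<rightarrow> 0"
    proof (rule Lim_null_comparison)
      show "\<forall>\<^sub>F u in at 0. norm (norm (h (x + u) - h x - h' u) / norm u) \<le> K * norm u"
        using rem by (intro always_eventually allI) (auto simp: divide_simps power2_eq_square mult.assoc)
      have "((\<lambda>u::real^'n. K * norm u) \<longlongrightarrow> K * norm (0::real^'n)) (at 0)" by (intro tendsto_intros)
      thus "((\<lambda>u::real^'n. K * norm u) \<longlongrightarrow> 0) (at 0)" by simp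
    qed
  qed
  moreover have "h = (\<lambda>x. LINT y|M. f y * \<phi> (A y x + b y))" by (rule ext) (rule h_def)
  moreover have "h' = (\<lambda>u. LINT y|M. f y * (\<Sum>i\<in>UNIV. (A y u $ i) *\<^sub>R partial_deriv i \<phi> (A y x + b y)))"
    by (rule ext) (simp only: h'_def D_def)
  ultimately show ?thesis by (simp only:)
qed

section \<open>Generalized convolution\<close>

text \<open>With \<open>L\<close> the identity, its negative, or an isometric embedding of a smaller space, this integral
  is a correlation, a convolution, or the convolution with a density that lives on a subspace.\<close>

definition conv :: "(real^'k::finite \<Rightarrow> real^'n::finite) \<Rightarrow> (real^'k \<Rightarrow> complex) \<Rightarrow>
    (real^'n \<Rightarrow> complex) \<Rightarrow> real^'n \<Rightarrow> complex" where
  "conv L f \<phi> x = (LINT y|lborel. f y * \<phi> (x + L y))"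

lemma linear_borel_measurable:
  fixes L :: "real^'k \<Rightarrow> real^'n"
  assumes "linear L"
  shows "L \<in> borel_measurable borel"
  using assms by (intro borel_measurable_continuous_onI linear_continuous_on linear_conv_bounded_linear[THEN iffD1])

lemma conv_integrand_measurable:
  fixes L :: "real^'k \<Rightarrow> real^'n"
  assumes "linear L" "\<phi> \<in> borel_measurable borel"
  shows "(\<lambda>y. \<phi> (x + L y)) \<in> borel_measurable borel"
proof (rule measurable_compose[OF _ assms(2)])
  show "(\<lambda>y. x + L y) \<in> borel_measurable borel"
    by (rule borel_measurable_add[OF borel_measurable_const linear_borel_measurable[OF assms(1)]])
qed

lemma conv_has_derivative:
  fixes L :: "real^'k \<Rightarrow> real^'n"
  assumes L: "linear L" and f: "integrable lborel f" and \<phi>: "\<phi> \<in> schwartz_space"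
  shows "(conv L f \<phi> has_derivative
    (\<lambda>u. LINT y|lborel. f y * (\<Sum>i\<in>UNIV. (u $ i) *\<^sub>R partial_deriv i \<phi> (x + L y)))) (at x)"
proof -
  have "(\<lambda>y. x + L y) \<in> borel_measurable lborel" for x
    using linear_borel_measurable[OF L] by simp
  from has_derivative_integral_schwartz[OF \<phi> f, of "\<lambda>_ x. x" L, OF _ _ this]
  show ?thesis unfolding conv_def[abs_def] by (simp add: linear_id[unfolded id_def])
qed

lemma conv_partial:
  fixes L :: "real^'k \<Rightarrow> real^'n"
  assumes "linear L" "integrable lborel f" "\<phi> \<in> schwartz_space"
  shows "partial_deriv i (conv L f \<phi>) = conv L f (partial_deriv i \<phi>)"
proof
  fix x
  show "partial_deriv i (conv L f \<phi>) x = conv L f (partial_deriv i \<phi>) x"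
    unfolding partial_derivI[OF conv_has_derivative[OF assms]] conv_def
    by (simp add: axis_def if_distrib[of "\<lambda>c. c *\<^sub>R _"] cong: if_cong)
qed

lemma conv_iter_partial:
  fixes L :: "real^'k \<Rightarrow> real^'n"
  assumes "linear L" "integrable lborel f" "\<phi> \<in> schwartz_space"
  shows "iter_partial is (conv L f \<phi>) = conv L f (iter_partial is \<phi>)"
  by (induction "is") (use assms in \<open>auto intro: conv_partial\<close>)

lemma conv_weighted_bound:
  fixes L :: "real^'k \<Rightarrow> real^'n"
  assumes L: "linear L" "\<And>y. norm (L y) \<le> norm y" and f: "rapid f"
    and \<phi>: "\<phi> \<in> borel_measurable borel" "\<And>z. (1 + norm z) ^ N * norm (\<phi> z) \<le> C"
  shows "(1 + norm x) ^ N * norm (conv L f \<phi> x) \<le> (LINT y|lborel. (1 + norm y) ^ N * norm (f y)) * C"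
proof -
  have le: "(1 + norm x) ^ N * norm (\<phi> (x + L y)) \<le> (1 + norm y) ^ N * C" for y
  proof -
    have "norm x \<le> norm (x + L y) + norm y"
      using norm_triangle_ineq4[of "x + L y" "L y"] L(2)[of y] by simp
    hence "1 + norm x \<le> (1 + norm (x + L y)) + (norm y + norm (x + L y) * norm y)"
      using mult_nonneg_nonneg[OF norm_ge_zero norm_ge_zero, of "x + L y" y] by linarith
    also have "\<dots> = (1 + norm y) * (1 + norm (x + L y))" by (simp add: algebra_simps)
    finally have "(1 + norm x) ^ N \<le> ((1 + norm y) * (1 + norm (x + L y))) ^ N"
      by (intro power_mono) auto
    hence "(1 + norm x) ^ N * norm (\<phi> (x + L y)) \<le>
        (1 + norm y) ^ N * ((1 + norm (x + L y)) ^ N * norm (\<phi> (x + L y)))"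
      by (simp add: power_mult_distrib mult.assoc[symmetric] mult_right_mono)
    also have "\<dots> \<le> (1 + norm y) ^ N * C"
      by (intro mult_left_mono \<phi>(2)) (auto intro: less_imp_le[OF one_plus_norm_pos])
    finally show ?thesis .
  qed
  define w where "w = (1 + norm x) ^ N"
  have w: "w > 0" by (simp add: w_def one_plus_norm_pos)
  have "norm (LINT y|lborel. f y * (of_real w * \<phi> (x + L y))) \<le>
      (LINT y|lborel. ((1 + norm y) ^ N * norm (f y)) * C)"
  proof (rule integral_norm_le_integral)
    have C0: "\<exists>B. \<forall>z. norm (\<phi> z) \<le> B"
    proof (intro exI allI)
      fix z
      have "1 * norm (\<phi> z) \<le> (1 + norm z) ^ N * norm (\<phi> z)"
        by (intro mult_right_mono one_le_power) auto
      thus "norm (\<phi> z) \<le> C" using \<phi>(2)[of z] by linarith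
    qed
    then obtain B where "\<And>z. norm (\<phi> z) \<le> B" by blast
    hence "norm (of_real w * \<phi> (x + L y)) \<le> w * B" for y using w by (simp add: norm_mult)
    thus "integrable lborel (\<lambda>y. f y * (of_real w * \<phi> (x + L y)))"
      using conv_integrand_measurable[OF L(1) \<phi>(1), of x]
      by (intro integrable_mult_bounded[OF rapid_integrable[OF f]]) auto
    show "integrable lborel (\<lambda>y. ((1 + norm y) ^ N * norm (f y)) * C)"
      by (intro integrable_mult_left rapid_moment f)
    fix y
    have "norm (f y) * (w * norm (\<phi> (x + L y))) \<le> norm (f y) * ((1 + norm y) ^ N * C)"
      unfolding w_def by (intro mult_left_mono le) auto
    thus "norm (f y * (of_real w * \<phi> (x + L y))) \<le> ((1 + norm y) ^ N * norm (f y)) * C"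
      using w by (simp add: norm_mult mult_ac)
  qed
  moreover have "(LINT y|lborel. f y * (of_real w * \<phi> (x + L y))) = of_real w * conv L f \<phi> x"
    unfolding conv_def by (subst integral_mult_right_zero[symmetric]) (simp add: mult_ac)
  ultimately show ?thesis using w unfolding w_def[symmetric] by (simp add: norm_mult)
qed

text \<open>Partial derivatives fall on the second factor. A polynomial weight in \<open>x\<close> is at most the
  product of the weights in \<open>x + L y\<close> and in \<open>y\<close>, and these are absorbed by the two factors.\<close>

lemma conv_schwartz:
  fixes L :: "real^'k \<Rightarrow> real^'n"
  assumes L: "linear L" "\<And>y. norm (L y) \<le> norm y" and f: "rapid f" and \<phi>: "\<phi> \<in> schwartz_space"
  shows "conv L f \<phi> \<in> schwartz_space"
proof -
  have ip: "iter_partial is (conv L f \<phi>) = conv L f (iter_partial is \<phi>)" for "is"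
    by (rule conv_iter_partial[OF L(1) rapid_integrable[OF f] \<phi>])
  show ?thesis unfolding schwartz_space_def
  proof (intro CollectI conjI allI)
    show "iter_partial is (conv L f \<phi>) differentiable (at x)" for "is" x
      unfolding ip using conv_has_derivative[OF L(1) rapid_integrable[OF f] schwartz_iter_partial[OF \<phi>]]
      by (rule differentiableI)
    fix a :: "'n \<Rightarrow> nat" and "is" :: "'n list"
    let ?N = "sum a UNIV"
    obtain C where C: "\<And>x. (1 + norm x) ^ ?N * norm (iter_partial is \<phi> x) \<le> C"
      using schwartz_decay[OF schwartz_iter_partial[OF \<phi>]] by blast
    have "norm (of_real (monomial_fun a x) * iter_partial is (conv L f \<phi>) x) \<le>
        (LINT y|lborel. (1 + norm y) ^ ?N * norm (f y)) * C" for x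
    proof -
      have "norm (of_real (monomial_fun a x) * iter_partial is (conv L f \<phi>) x) \<le>
          (1 + norm x) ^ ?N * norm (conv L f (iter_partial is \<phi>) x)"
        unfolding ip norm_mult norm_of_real by (intro mult_right_mono abs_monomial_fun_le) auto
      also have "\<dots> \<le> (LINT y|lborel. (1 + norm y) ^ ?N * norm (f y)) * C"
        by (intro conv_weighted_bound L f C schwartz_borel_measurable schwartz_iter_partial \<phi>)
      finally show ?thesis .
    qed
    thus "bounded (range (\<lambda>x. of_real (monomial_fun a x) * iter_partial is (conv L f \<phi>) x))"
      by (auto simp: bounded_iff)
  qed
qed

section \<open>Gaussian factors\<close>

definition coord_gauss :: "real \<Rightarrow> 'n set \<Rightarrow> real^'n::finite \<Rightarrow> real" where
  "coord_gauss c J z = exp (- (c * (\<Sum>j\<in>J. (z $ j)\<^sup>2)))"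

lemma power_times_exp_bounded:
  fixes c :: real
  assumes "c > 0"
  shows "\<exists>K\<ge>0. \<forall>s\<ge>0. (1 + s) ^ N * exp (- (c * s)) \<le> K"
proof (cases "N = 0")
  case True
  thus ?thesis using assms by (intro exI[of _ 1]) auto
next
  case False
  define k where "k = max 1 (N / c)"
  have "(1 + s) ^ N * exp (- (c * s)) \<le> k ^ N" if s: "s \<ge> 0" for s
  proof -
    have kc: "1 \<le> k * (c / N)" "1 \<le> k"
      using assms False by (auto simp: k_def field_simps max_def)
    have "1 + s \<le> k * (1 + c * s / N)"
    proof -
      have "s * 1 \<le> s * (k * (c / N))" by (intro mult_left_mono kc s)
      thus ?thesis using kc(2) by (simp add: algebra_simps)
    qed
    hence "(1 + s) ^ N \<le> (k * (1 + c * s / N)) ^ N" using s by (intro power_mono) auto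
    also have "\<dots> = k ^ N * (1 + c * s / N) ^ N" by (simp add: power_mult_distrib)
    also have "\<dots> \<le> k ^ N * exp (c * s)"
      using kc(2) s assms False
      by (intro mult_left_mono exp_ge_one_plus_x_over_n_power_n) (auto intro: order_trans[of _ 0])
    finally show ?thesis by (simp add: exp_minus divide_simps)
  qed
  thus ?thesis by (intro exI[of _ "k ^ N"]) (auto simp: k_def)
qed

lemma coord_poly_growth:
  assumes "p \<in> coord_poly J"
  shows "\<exists>C\<ge>0. \<exists>N. \<forall>z. \<bar>p z\<bar> \<le> C * (1 + (\<Sum>j\<in>J. (z $ j)\<^sup>2)) ^ N"
  using assms
proof induction
  case (const c)
  show ?case by (intro exI[of _ "\<bar>c\<bar>"] conjI exI[of _ 0]) auto
next
  case (coord p i)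
  then obtain C N where C: "C \<ge> 0" "\<And>z. \<bar>p z\<bar> \<le> C * (1 + (\<Sum>j\<in>J. (z $ j)\<^sup>2)) ^ N" by blast
  have "\<bar>z $ i * p z\<bar> \<le> C * (1 + (\<Sum>j\<in>J. (z $ j)\<^sup>2)) ^ Suc N" for z
  proof -
    have "0 \<le> (\<bar>z $ i\<bar> - 1)\<^sup>2" by simp
    hence "2 * \<bar>z $ i\<bar> \<le> 1 + (z $ i)\<^sup>2" by (simp add: power2_diff)
    hence "\<bar>z $ i\<bar> \<le> 1 + (z $ i)\<^sup>2" using zero_le_power2[of "z $ i"] by linarith
    also have "(z $ i)\<^sup>2 \<le> (\<Sum>j\<in>J. (z $ j)\<^sup>2)"
      using coord.hyps(2) by (intro member_le_sum) auto
    finally have "\<bar>z $ i\<bar> * \<bar>p z\<bar> \<le> (1 + (\<Sum>j\<in>J. (z $ j)\<^sup>2)) * (C * (1 + (\<Sum>j\<in>J. (z $ j)\<^sup>2)) ^ N)"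
      by (intro mult_mono C) (auto intro: add_nonneg_nonneg sum_nonneg)
    thus ?thesis by (simp add: abs_mult mult_ac)
  qed
  thus ?case using C(1) by blast
next
  case (add p q)
  from add.IH obtain C N where C: "C \<ge> 0" "\<And>z. \<bar>p z\<bar> \<le> C * (1 + (\<Sum>j\<in>J. (z $ j)\<^sup>2)) ^ N" by blast
  from add.IH obtain D M where D: "D \<ge> 0" "\<And>z. \<bar>q z\<bar> \<le> D * (1 + (\<Sum>j\<in>J. (z $ j)\<^sup>2)) ^ M" by blast
  have "\<bar>p z + q z\<bar> \<le> (C + D) * (1 + (\<Sum>j\<in>J. (z $ j)\<^sup>2)) ^ (N + M)" for z
  proof -
    let ?s = "1 + (\<Sum>j\<in>J. (z $ j)\<^sup>2)"
    have s: "?s \<ge> 1" by (simp add: sum_nonneg)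
    have "\<bar>p z\<bar> \<le> C * ?s ^ (N + M)"
      by (rule order_trans[OF C(2)]) (intro mult_left_mono power_increasing s C, simp)
    moreover have "\<bar>q z\<bar> \<le> D * ?s ^ (N + M)"
      by (rule order_trans[OF D(2)]) (intro mult_left_mono power_increasing s D, simp)
    ultimately show ?thesis by (simp add: distrib_right)
  qed
  thus ?case using C(1) D(1) by (intro exI[of _ "C + D"] conjI exI[of _ "N + M"]) auto
qed

lemma coord_poly_gauss_bounded:
  assumes "p \<in> coord_poly J" "c > 0"
  shows "\<exists>K\<ge>0. \<forall>z. \<bar>p z * coord_gauss c J z\<bar> \<le> K"
proof -
  obtain C N where C: "C \<ge> 0" "\<And>z. \<bar>p z\<bar> \<le> C * (1 + (\<Sum>j\<in>J. (z $ j)\<^sup>2)) ^ N"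
    using coord_poly_growth[OF assms(1)] by blast
  obtain K where K: "K \<ge> 0" "\<And>s. s \<ge> 0 \<Longrightarrow> (1 + s) ^ N * exp (- (c * s)) \<le> K"
    using power_times_exp_bounded[OF assms(2), of N] by blast
  have "\<bar>p z * coord_gauss c J z\<bar> \<le> C * K" for z
  proof -
    have "\<bar>p z * coord_gauss c J z\<bar> \<le> C * (1 + (\<Sum>j\<in>J. (z $ j)\<^sup>2)) ^ N * coord_gauss c J z"
      unfolding abs_mult by (simp add: coord_gauss_def C mult_right_mono)
    also have "\<dots> \<le> C * K"
      unfolding mult.assoc coord_gauss_def by (intro mult_left_mono K C sum_nonneg) auto
    finally show ?thesis .
  qed
  thus ?thesis using C(1) K(1) by (intro exI[of _ "C * K"]) auto
qed

lemma coord_gauss_has_derivative: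
  "(coord_gauss c J has_derivative
    (\<lambda>u. \<Sum>i\<in>UNIV. u $ i * ((if i \<in> J then - 2 * c * z $ i else 0) * coord_gauss c J z))) (at z)"
proof -
  have "(coord_gauss c J has_derivative
      (\<lambda>u. exp (- (c * (\<Sum>j\<in>J. (z $ j)\<^sup>2))) * - (c * (\<Sum>j\<in>J. 2 * z $ j * u $ j)))) (at z)"
    unfolding coord_gauss_def[abs_def]
    by (auto intro!: derivative_eq_intros has_derivative_coord sum.cong simp: sum_distrib_left
        power2_eq_square algebra_simps)
  moreover have "exp (- (c * (\<Sum>j\<in>J. (z $ j)\<^sup>2))) * - (c * (\<Sum>j\<in>J. 2 * z $ j * u $ j)) =
      (\<Sum>i\<in>UNIV. u $ i * ((if i \<in> J then - 2 * c * z $ i else 0) * coord_gauss c J z))" for u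
  proof -
    have "(\<Sum>i\<in>UNIV. u $ i * ((if i \<in> J then - 2 * c * z $ i else 0) * coord_gauss c J z)) =
        (\<Sum>i\<in>J. u $ i * (- 2 * c * z $ i * coord_gauss c J z))"
      by (rule sum.mono_neutral_cong_right) auto
    thus ?thesis by (simp add: coord_gauss_def sum_distrib_left sum_negf[symmetric] mult_ac)
  qed
  ultimately show ?thesis by simp
qed

lemma coord_poly_scale: "p \<in> coord_poly J \<Longrightarrow> (\<lambda>z. k * p z) \<in> coord_poly J"
proof (induction rule: coord_poly.induct)
  case (coord p i)
  thus ?case using coord_poly.coord[OF coord.IH coord.hyps(2)] by (simp add: mult_ac)
next
  case (add p q)
  thus ?case using coord_poly.add[OF add.IH] by (simp add: distrib_left)
qed (rule coord_poly.const)

text \<open>The coefficients of the derivative are again polynomials in the coordinates in \<open>J\<close>, and the derivative in the other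
  directions vanishes. This is what keeps the coinduction for tensor products with a Gaussian within one
  family of operators.\<close>

lemma coord_poly_gauss_has_derivative:
  assumes "p \<in> coord_poly J"
  shows "\<exists>q. (\<forall>i. q i \<in> coord_poly J) \<and> (\<forall>i. i \<notin> J \<longrightarrow> q i = (\<lambda>x. 0)) \<and>
    (\<forall>z. ((\<lambda>z. p z * coord_gauss c J z) has_derivative
      (\<lambda>u. \<Sum>i\<in>UNIV. u $ i * (q i z * coord_gauss c J z))) (at z))"
proof -
  obtain r where "\<forall>i. r i \<in> coord_poly J" "\<forall>i. i \<notin> J \<longrightarrow> r i = (\<lambda>x. 0)"
    "\<forall>z. (p has_derivative (\<lambda>u. \<Sum>i\<in>UNIV. u $ i * r i z)) (at z)"
    using coord_poly_has_derivative[OF assms] by blast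
  note r = this[rule_format]
  define q where "q i = (if i \<in> J then (\<lambda>z. r i z + z $ i * (- 2 * c * p z)) else (\<lambda>z. 0))" for i
  have "q i \<in> coord_poly J" for i
    using coord_poly.add[OF r(1)[of i] coord_poly.coord[OF coord_poly_scale[OF assms, of "- 2 * c"], of i]]
      coord_poly.const[of 0 J] unfolding q_def by auto
  moreover have "((\<lambda>z. p z * coord_gauss c J z) has_derivative
      (\<lambda>u. \<Sum>i\<in>UNIV. u $ i * (q i z * coord_gauss c J z))) (at z)" for z
  proof -
    have "p z * (\<Sum>i\<in>UNIV. u $ i * ((if i \<in> J then - 2 * c * z $ i else 0) * coord_gauss c J z)) +
        (\<Sum>i\<in>UNIV. u $ i * r i z) * coord_gauss c J z =
        (\<Sum>i\<in>UNIV. u $ i * (q i z * coord_gauss c J z))" for u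
      unfolding sum_distrib_left sum_distrib_right sum.distrib[symmetric]
      by (intro sum.cong refl) (auto simp: q_def r(2) algebra_simps)
    thus ?thesis using has_derivative_mult[OF r(3)[of z] coord_gauss_has_derivative[of c J z]] by simp
  qed
  ultimately show ?thesis by (intro exI[of _ q]) (auto simp: q_def)
qed

lemma coord_gauss_schwartz:
  assumes "c > 0"
  shows "(\<lambda>z::real^'n. of_real (coord_gauss c UNIV z)) \<in> schwartz_space"
proof (rule schwartz_coinduct[where F = "{\<lambda>z. of_real (p z * coord_gauss c UNIV z) | p. p \<in> coord_poly UNIV}"])
  show "(\<lambda>z::real^'n. of_real (coord_gauss c UNIV z)) \<in> {\<lambda>z. of_real (p z * coord_gauss c UNIV z) | p. p \<in> coord_poly UNIV}"
    by (intro CollectI exI[of _ "\<lambda>z. 1"] conjI coord_poly.const) auto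
next
  fix f :: "real^'n \<Rightarrow> complex" and i
  assume "f \<in> {\<lambda>z. of_real (p z * coord_gauss c UNIV z) | p. p \<in> coord_poly UNIV}"
  then obtain p where p: "f = (\<lambda>z. of_real (p z * coord_gauss c UNIV z))" "p \<in> coord_poly UNIV" by blast
  obtain q where "\<forall>i. q i \<in> coord_poly UNIV"
    "\<forall>z. ((\<lambda>z. p z * coord_gauss c UNIV z) has_derivative
      (\<lambda>u. \<Sum>i\<in>UNIV. u $ i * (q i z * coord_gauss c UNIV z))) (at z)"
    using coord_poly_gauss_has_derivative[OF p(2), of c] by blast
  note q = this[rule_format]
  have D: "(f has_derivative (\<lambda>u. of_real (\<Sum>i\<in>UNIV. u $ i * (q i z * coord_gauss c UNIV z)))) (at z)" for z
    unfolding p(1) by (rule has_derivative_of_real[OF q(2)])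
  show "f differentiable (at z)" for z using D by (rule differentiableI)
  obtain K where "\<And>z. \<bar>p z * coord_gauss c UNIV z\<bar> \<le> K"
    using coord_poly_gauss_bounded[OF p(2) assms] by blast
  thus "bounded (range f)" unfolding p(1) bounded_iff by (intro exI[of _ K]) (auto simp del: of_real_mult)
  have "partial_deriv i f = (\<lambda>z. of_real (q i z * coord_gauss c UNIV z))"
    by (rule ext, subst partial_derivI[OF D]) (simp add: axis_def if_distrib[of "\<lambda>c. c * _"] cong: if_cong)
  thus "partial_deriv i f \<in> {\<lambda>z. of_real (p z * coord_gauss c UNIV z) | p. p \<in> coord_poly UNIV}"
    using q(1) by blast
  show "(\<lambda>z. of_real (z $ i) * f z) \<in> {\<lambda>z. of_real (p z * coord_gauss c UNIV z) | p. p \<in> coord_poly UNIV}"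
    by (intro CollectI exI[of _ "\<lambda>z. z $ i * p z"] conjI coord_poly.coord p UNIV_I) (simp add: p(1) mult.assoc)
qed

text \<open>With a projection \<open>P\<close> along the coordinates in \<open>J\<close> this extends a Schwartz function from a
  subspace to the whole space, where a Gaussian factor provides the decay that is missing in the
  directions of \<open>J\<close>. With empty \<open>J\<close> it is the composition with an injective linear map.\<close>

lemma continuous_op_tensor_gauss:
  fixes P :: "real^'n \<Rightarrow> real^'m" and B :: "real^'m \<Rightarrow> real^'n"
  assumes P: "linear P" "\<And>j. j \<in> J \<Longrightarrow> P (axis j 1) = 0"
    and B: "linear B" "\<And>z i. i \<notin> J \<Longrightarrow> z $ i = B (P z) $ i" and c: "c > 0"
  shows "continuous_op (\<lambda>\<phi> z. of_real (coord_gauss c J z) * \<phi> (P z))"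
proof -
  let ?t = "\<lambda>p D \<phi> z. of_real (p z * coord_gauss c J z) * (D :: (real^'m \<Rightarrow> complex) \<Rightarrow> _) \<phi> (P z)"
  \<comment> \<open>Derivatives and coordinates in \<open>J\<close> act on the polynomial factor, all others act on the argument
    through the operator \<open>D\<close>.\<close>
  let ?\<E> = "{?t p D | p D. p \<in> coord_poly J \<and> continuous_op D}"
  have D: "(?t p D \<phi> has_derivative
      (\<lambda>u. of_real (p z * coord_gauss c J z) * (\<Sum>l\<in>UNIV. (P u $ l) *\<^sub>R partial_deriv l (D \<phi>) (P z))
        + of_real (\<Sum>i\<in>UNIV. u $ i * (q i z * coord_gauss c J z)) * D \<phi> (P z))) (at z)"
    if "continuous_op D" "\<phi> \<in> schwartz_space"
      "((\<lambda>z. p z * coord_gauss c J z) has_derivative (\<lambda>u. \<Sum>i\<in>UNIV. u $ i * (q i z * coord_gauss c J z))) (at z)"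
    for p D \<phi> q z
  proof (rule has_derivative_real_mult[OF that(3)])
    have "(P has_derivative P) (at z)"
      using P(1) by (simp add: linear_imp_has_derivative)
    from has_derivative_compose[OF this
        has_derivative_partial_deriv[OF schwartz_differentiable[OF continuous_op_mem[OF that(1,2)]]]]
    show "((\<lambda>z. D \<phi> (P z)) has_derivative (\<lambda>u. \<Sum>l\<in>UNIV. (P u $ l) *\<^sub>R partial_deriv l (D \<phi>) (P z))) (at z)" .
  qed
  have "continuous_op (?t (\<lambda>z. 1) (\<lambda>\<phi>. \<phi>))"
  proof (rule continuous_op_coinduct[where \<E> = ?\<E>])
    show "?t (\<lambda>z. 1) (\<lambda>\<phi>. \<phi>) \<in> ?\<E>"
      by (intro CollectI exI[of _ "\<lambda>z. 1"] exI[of _ "\<lambda>\<phi>. \<phi>"] conjI refl coord_poly.const continuous_op_id)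
  next
    fix E i assume "E \<in> ?\<E>"
    then obtain p D where E: "E = ?t p D" "p \<in> coord_poly J" "continuous_op D" by blast
    obtain q where "\<forall>i. q i \<in> coord_poly J" "\<forall>i. i \<notin> J \<longrightarrow> q i = (\<lambda>x. 0)"
      "\<forall>z. ((\<lambda>z. p z * coord_gauss c J z) has_derivative
        (\<lambda>u. \<Sum>i\<in>UNIV. u $ i * (q i z * coord_gauss c J z))) (at z)"
      using coord_poly_gauss_has_derivative[OF E(2), of c] by blast
    note q = this[rule_format]
    show "E \<phi> differentiable (at z)" if "\<phi> \<in> schwartz_space" for \<phi> z
      unfolding E(1) using D[OF E(3) that q(3)] by (rule differentiableI)
    obtain K where K: "K \<ge> 0" "\<And>z. \<bar>p z * coord_gauss c J z\<bar> \<le> K"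
      using coord_poly_gauss_bounded[OF E(2) c] by blast
    have "schwartz_dominated (\<lambda>\<phi>. K * schwartz_seminorm (\<lambda>_. 0) [] (D \<phi>))"
      by (intro schwartz_dominated_cmult continuous_op_dominated E K)
    moreover have "norm (E \<phi> z) \<le> K * schwartz_seminorm (\<lambda>_. 0) [] (D \<phi>)" if "\<phi> \<in> schwartz_space" for \<phi> z
      using schwartz_seminorm_upper[OF continuous_op_mem[OF E(3) that], of "\<lambda>_. 0" "P z" "[]"] K(1)
      unfolding E(1) norm_mult norm_of_real
      by (intro mult_mono K) (auto simp: monomial_fun_def)
    ultimately show "\<exists>q. schwartz_dominated q \<and> (\<forall>\<phi>\<in>schwartz_space. \<forall>z. norm (E \<phi> z) \<le> q \<phi>)" by blast
    have pd: "partial_deriv i (E \<phi>) z =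
        of_real (p z * coord_gauss c J z) * (\<Sum>l\<in>UNIV. of_real (P (axis i 1) $ l) * partial_deriv l (D \<phi>) (P z))
        + of_real (q i z * coord_gauss c J z) * D \<phi> (P z)" if "\<phi> \<in> schwartz_space" for \<phi> z
    proof -
      have "(\<Sum>k\<in>UNIV. axis i 1 $ k * X k) = X i" for X :: "'n \<Rightarrow> real"
        by (simp add: axis_def if_distrib[of "\<lambda>c. c * _"] cong: if_cong)
      moreover have "partial_deriv i (?t p D \<phi>) z =
          of_real (p z * coord_gauss c J z) * (\<Sum>l\<in>UNIV. (P (axis i 1) $ l) *\<^sub>R partial_deriv l (D \<phi>) (P z))
          + of_real (\<Sum>k\<in>UNIV. axis i 1 $ k * (q k z * coord_gauss c J z)) * D \<phi> (P z)"
        by (rule partial_derivI) (rule D[OF E(3) that q(3)])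
      ultimately show ?thesis unfolding E(1) by (simp only: scaleR_conv_of_real)
    qed
    show "\<exists>E'\<in>?\<E>. \<forall>\<phi>\<in>schwartz_space. partial_deriv i (E \<phi>) = E' \<phi>"
    proof (cases "i \<in> J")
      case True
      have "?t (q i) D \<in> ?\<E>" using q(1) E(3)
        by (intro CollectI exI[of _ "q i"] exI[of _ D] conjI refl)
      moreover have "partial_deriv i (E \<phi>) = ?t (q i) D \<phi>" if "\<phi> \<in> schwartz_space" for \<phi>
        using pd[OF that] P(2)[OF True] by auto
      ultimately show ?thesis by (intro bexI[of _ "?t (q i) D"]) auto
    next
      case False
      let ?D = "\<lambda>\<phi> w. \<Sum>l\<in>UNIV. of_real (P (axis i 1) $ l) * partial_deriv l (D \<phi>) w"
      have "continuous_op ?D"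
        by (intro continuous_op_sum continuous_op_cmult continuous_op_compose[OF continuous_op_partial E(3)])
      hence "?t p ?D \<in> ?\<E>"
        using E(2) by (intro CollectI exI[of _ p] exI[of _ ?D] conjI refl)
      moreover have "partial_deriv i (E \<phi>) = ?t p ?D \<phi>" if "\<phi> \<in> schwartz_space" for \<phi>
        using pd[OF that] q(2)[OF False] by auto
      ultimately show ?thesis by (intro bexI[of _ "?t p ?D"]) auto
    qed
    show "\<exists>E'\<in>?\<E>. \<forall>\<phi>\<in>schwartz_space. (\<lambda>z. of_real (z $ i) * E \<phi> z) = E' \<phi>"
    proof (cases "i \<in> J")
      case True
      have "?t (\<lambda>z. z $ i * p z) D \<in> ?\<E>" using coord_poly.coord[OF E(2) True] E(3)
        by (intro CollectI exI[of _ "\<lambda>z. z $ i * p z"] exI[of _ D] conjI refl)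
      thus ?thesis by (intro bexI[of _ "?t (\<lambda>z. z $ i * p z) D"]) (auto simp: E(1) mult.assoc)
    next
      case False
      let ?D = "\<lambda>\<phi> w. \<Sum>l\<in>UNIV. of_real (B (axis l 1) $ i) * (of_real (w $ l) * D \<phi> w)"
      have "continuous_op ?D"
        by (intro continuous_op_sum continuous_op_cmult continuous_op_compose[OF continuous_op_coord E(3)])
      hence "?t p ?D \<in> ?\<E>"
        using E(2) by (intro CollectI exI[of _ p] exI[of _ ?D] conjI refl)
      moreover have "of_real (z $ i) * E \<phi> z = ?t p ?D \<phi> z" for \<phi> z
      proof -
        have "z $ i = (\<Sum>l\<in>UNIV. B (axis l 1) $ i * P z $ l)"
          using B(2)[OF False, of z] linear_axis_expansion[OF B(1), of "P z"] by (simp add: mult.commute)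
        hence "of_real (z $ i) * D \<phi> (P z) = ?D \<phi> (P z)"
          by (simp add: sum_distrib_right mult.assoc)
        thus ?thesis by (simp add: E(1) mult_ac)
      qed
      ultimately show ?thesis by (intro bexI[of _ "?t p ?D"]) auto
    qed
  qed
  thus ?thesis by simp
qed

lemma continuous_op_linear_compose:
  fixes A :: "real^'n \<Rightarrow> real^'m" and B :: "real^'m \<Rightarrow> real^'n"
  assumes "linear A" "linear B" "\<And>z. B (A z) = z"
  shows "continuous_op (\<lambda>\<phi> z. \<phi> (A z))"
  using continuous_op_tensor_gauss[of A "{}" B 1] assms by (simp add: coord_gauss_def)

section \<open>Division by a coordinate\<close>

text \<open>\<open>shrink j t\<close> scales the coordinate \<open>j\<close> by \<open>t\<close>, where \<open>t\<close> is clamped to the unit interval so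
  that the map is a contraction for every \<open>t\<close>.\<close>

definition shrink :: "'n \<Rightarrow> real \<Rightarrow> real^'n::finite \<Rightarrow> real^'n" where
  "shrink j t z = (\<chi> i. if i = j then max 0 (min 1 t) * z $ i else z $ i)"

text \<open>A weighted average over the segment from a point to its projection onto a coordinate
  hyperplane. For \<open>m = 0\<close> and \<open>\<eta>\<close> a partial derivative this is the quotient of Hadamard's lemma.\<close>

definition shrink_avg :: "'n \<Rightarrow> nat \<Rightarrow> (real^'n::finite \<Rightarrow> complex) \<Rightarrow> real^'n \<Rightarrow> complex" where
  "shrink_avg j m \<eta> z = (LINT t|lborel. of_real (indicat_real {0..1} t * t ^ m) * \<eta> (shrink j t z))"

lemma linear_shrink: "linear (shrink j t)"
  by (rule linearI) (auto simp: shrink_def vec_eq_iff distrib_left)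

lemma norm_shrink_le: "norm (shrink j t z) \<le> norm z"
  unfolding norm_vec_def
proof (rule L2_set_mono)
  fix i
  have "\<bar>max 0 (min 1 t)\<bar> * \<bar>z $ i\<bar> \<le> 1 * \<bar>z $ i\<bar>" by (intro mult_right_mono) auto
  thus "norm (shrink j t z $ i) \<le> norm (z $ i)" by (auto simp: shrink_def abs_mult)
qed auto

lemma shrink_eq: "shrink j t z = z + ((max 0 (min 1 t) - 1) * z $ j) *\<^sub>R axis j 1"
  by (auto simp: shrink_def vec_eq_iff axis_def algebra_simps)

lemma shrink_measurable: "(\<lambda>t. shrink j t z) \<in> borel_measurable borel"
  unfolding shrink_eq by measurable

lemma integrable_unit_power: "integrable lborel (\<lambda>t. complex_of_real (indicat_real {0..1} t * t ^ m))"
proof (rule Bochner_Integration.integrable_bound[of lborel "indicat_real {0..1}"])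
  show "AE t in lborel. norm (complex_of_real (indicat_real {0..1} t * t ^ m)) \<le> norm (indicat_real {0..1} t)"
    by (intro AE_I2) (auto simp: indicator_def norm_mult norm_power power_le_one)
qed (auto simp: integrable_indicator_iff)

lemma shrink_avg_has_derivative:
  assumes "\<eta> \<in> schwartz_space"
  shows "(shrink_avg j m \<eta> has_derivative
    (\<lambda>u. LINT t|lborel. of_real (indicat_real {0..1} t * t ^ m) *
      (\<Sum>i\<in>UNIV. (shrink j t u $ i) *\<^sub>R partial_deriv i \<eta> (shrink j t z)))) (at z)"
proof -
  have "(\<lambda>t. shrink j t x + 0) \<in> borel_measurable lborel" for x
    using shrink_measurable[of j x] by simp
  from has_derivative_integral_schwartz[OF assms integrable_unit_power linear_shrink norm_shrink_le this, of m z]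
  show ?thesis unfolding shrink_avg_def[abs_def] by simp
qed

lemma shrink_avg_partial:
  assumes "\<eta> \<in> schwartz_space"
  shows "partial_deriv i (shrink_avg j m \<eta>) =
    (if i = j then shrink_avg j (Suc m) (partial_deriv j \<eta>) else shrink_avg j m (partial_deriv i \<eta>))"
proof
  fix z
  have "(\<Sum>l\<in>UNIV. (shrink j t (axis i 1) $ l) *\<^sub>R partial_deriv l \<eta> w) =
      (if i = j then max 0 (min 1 t) else 1) *\<^sub>R partial_deriv i \<eta> w" for t w
  proof -
    have "(\<Sum>l\<in>UNIV. (shrink j t (axis i 1) $ l) *\<^sub>R partial_deriv l \<eta> w) =
        (\<Sum>l\<in>UNIV. if l = i then (if i = j then max 0 (min 1 t) else 1) *\<^sub>R partial_deriv i \<eta> w else 0)"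
      by (intro sum.cong) (auto simp: shrink_def axis_def)
    thus ?thesis by simp
  qed
  hence "partial_deriv i (shrink_avg j m \<eta>) z = (LINT t|lborel. of_real (indicat_real {0..1} t * t ^ m) *
      ((if i = j then max 0 (min 1 t) else 1) *\<^sub>R partial_deriv i \<eta> (shrink j t z)))"
    unfolding partial_derivI[OF shrink_avg_has_derivative[OF assms]] by simp
  also have "\<dots> = (if i = j then shrink_avg j (Suc m) (partial_deriv j \<eta>) else shrink_avg j m (partial_deriv i \<eta>)) z"
    unfolding shrink_avg_def
    by (auto intro!: Bochner_Integration.integral_cong simp: indicator_def scaleR_conv_of_real)
  finally show "partial_deriv i (shrink_avg j m \<eta>) z = \<dots>" .
qed

lemma shrink_avg_coord:
  "i \<noteq> j \<Longrightarrow> of_real (z $ i) * shrink_avg j m \<eta> z = shrink_avg j m (\<lambda>x. of_real (x $ i) * \<eta> x) z"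
  "of_real (z $ j) * shrink_avg j (Suc m) \<eta> z = shrink_avg j m (\<lambda>x. of_real (x $ j) * \<eta> x) z"
proof -
  show "i \<noteq> j \<Longrightarrow> of_real (z $ i) * shrink_avg j m \<eta> z = shrink_avg j m (\<lambda>x. of_real (x $ i) * \<eta> x) z"
    unfolding shrink_avg_def integral_mult_right_zero[symmetric]
    by (intro Bochner_Integration.integral_cong refl) (simp add: shrink_def)
  show "of_real (z $ j) * shrink_avg j (Suc m) \<eta> z = shrink_avg j m (\<lambda>x. of_real (x $ j) * \<eta> x) z"
    unfolding shrink_avg_def integral_mult_right_zero[symmetric]
  proof (intro Bochner_Integration.integral_cong refl)
    fix t :: real
    show "of_real (z $ j) * (of_real (indicat_real {0..1} t * t ^ Suc m) * \<eta> (shrink j t z)) =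
        of_real (indicat_real {0..1} t * t ^ m) * (of_real (shrink j t z $ j) * \<eta> (shrink j t z))"
      by (cases "t \<in> {0..1}") (auto simp: shrink_def)
  qed
qed

text \<open>A single average cannot be handled in isolation, since its derivative in the direction of the
  coordinate is an average with a higher weight. The averages with weight \<open>m\<close> whose product with the
  power \<open>m + 1\<close> of the coordinate is a Schwartz function form, together with the Schwartz functions,
  a set to which the coinduction principle applies.\<close>

lemma shrink_avg_schwartz:
  assumes \<eta>: "\<eta> \<in> schwartz_space" and mult: "(\<lambda>z. of_real (z $ j) * shrink_avg j 0 \<eta> z) \<in> schwartz_space"
  shows "shrink_avg j 0 \<eta> \<in> schwartz_space"
proof -
  let ?p = "\<lambda>m f z. of_real (z $ j ^ m) * f z"
  let ?K = "{shrink_avg j m \<eta> | m \<eta>. \<eta> \<in> schwartz_space \<and> ?p (Suc m) (shrink_avg j m \<eta>) \<in> schwartz_space}"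
  have d: "shrink_avg j m \<eta> differentiable (at z)" if "\<eta> \<in> schwartz_space" for m \<eta> z
    using shrink_avg_has_derivative[OF that] by (rule differentiableI)
  show ?thesis
  proof (rule schwartz_coinduct[where F = "schwartz_space \<union> ?K"])
    show "shrink_avg j 0 \<eta> \<in> schwartz_space \<union> ?K"
      using \<eta> mult by (intro UnI2 CollectI exI[of _ 0] exI[of _ \<eta>]) auto
  next
    fix f z assume "f \<in> schwartz_space \<union> ?K"
    thus "f differentiable (at z)" by (auto intro: schwartz_differentiable d)
  next
    fix f assume "f \<in> schwartz_space \<union> ?K"
    thus "bounded (range f)"
    proof
      assume "f \<in> ?K"
      then obtain m \<eta> where f: "f = shrink_avg j m \<eta>" "\<eta> \<in> schwartz_space" by blast
      obtain C where "\<And>x. norm (\<eta> x) \<le> C" using schwartz_bounded[OF f(2)] by (auto simp: bounded_iff)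
      hence "norm (f z) \<le> (LINT t|lborel. norm (complex_of_real (indicat_real {0..1} t * t ^ m))) * C" for z
        unfolding f(1) shrink_avg_def
        using measurable_compose[OF shrink_measurable schwartz_borel_measurable[OF f(2)]]
        by (intro integral_bound_mult integrable_unit_power) auto
      thus ?thesis by (auto simp: bounded_iff)
    qed (rule schwartz_bounded)
  next
    fix f i assume "f \<in> schwartz_space \<union> ?K"
    thus "partial_deriv i f \<in> schwartz_space \<union> ?K"
    proof
      assume "f \<in> ?K"
      then obtain m \<eta> where f: "f = shrink_avg j m \<eta>" "\<eta> \<in> schwartz_space"
        "?p (Suc m) (shrink_avg j m \<eta>) \<in> schwartz_space" by blast
      let ?k = "if i = j then Suc m else m"
      have pd: "partial_deriv i (shrink_avg j m \<eta>) = shrink_avg j ?k (partial_deriv i \<eta>)"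
        using shrink_avg_partial[OF f(2), of i j m] by auto
      have "?p (Suc ?k) (shrink_avg j ?k (partial_deriv i \<eta>)) \<in> schwartz_space"
      proof -
        have "partial_deriv i (?p (Suc m) (shrink_avg j m \<eta>)) z =
            of_real (z $ j ^ Suc m) * shrink_avg j ?k (partial_deriv i \<eta>) z +
            of_real (if i = j then of_nat (Suc m) * z $ j ^ m else 0) * shrink_avg j m \<eta> z" for z
        proof -
          have "((\<lambda>z. z $ j ^ Suc m) has_derivative (\<lambda>u. of_nat (Suc m) * u $ j * z $ j ^ m)) (at z)"
            using has_derivative_power[OF has_derivative_coord[of j z], of "Suc m"] by (simp add: mult_ac)
          from partial_deriv_real_mult[OF this d[OF f(2)], of i] show ?thesis
            unfolding pd[symmetric] by (simp add: axis_def)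
        qed
        \<comment> \<open>The product rule expresses the average of the derivative by the derivative of the product
          with the power, which is a Schwartz function by assumption.\<close>
        hence eq: "of_real (z $ j ^ Suc m) * shrink_avg j ?k (partial_deriv i \<eta>) z =
            partial_deriv i (?p (Suc m) (shrink_avg j m \<eta>)) z -
            of_real (if i = j then of_nat (Suc m) * z $ j ^ m else 0) * shrink_avg j m \<eta> z" for z
          by (simp add: eq_diff_eq)
        show ?thesis
        proof (cases "i = j")
          case True
          have "?p (Suc ?k) (shrink_avg j ?k (partial_deriv i \<eta>)) =
              (\<lambda>z. of_real (z $ j) * partial_deriv i (?p (Suc m) (shrink_avg j m \<eta>)) z -
                of_nat (Suc m) * ?p (Suc m) (shrink_avg j m \<eta>) z)"
          proof
            fix z
            have "?p (Suc ?k) (shrink_avg j ?k (partial_deriv i \<eta>)) z =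
                of_real (z $ j) * (of_real (z $ j ^ Suc m) * shrink_avg j ?k (partial_deriv i \<eta>) z)"
              using True by (simp add: mult.assoc)
            thus "?p (Suc ?k) (shrink_avg j ?k (partial_deriv i \<eta>)) z =
                of_real (z $ j) * partial_deriv i (?p (Suc m) (shrink_avg j m \<eta>)) z -
                of_nat (Suc m) * ?p (Suc m) (shrink_avg j m \<eta>) z"
              unfolding eq using True by (simp add: right_diff_distrib mult_ac)
          qed
          thus ?thesis using f(3) by (auto intro!: schwartz_diff schwartz_coord_mult schwartz_cmult)
        next
          case False
          thus ?thesis using eq schwartz_partial_deriv[OF f(3), of i] by simp
        qed
      qed
      thus ?thesis unfolding f(1) pd using schwartz_partial_deriv[OF f(2)] by blast
    qed (auto intro: schwartz_partial_deriv)
  next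
    fix f i assume "f \<in> schwartz_space \<union> ?K"
    thus "(\<lambda>z. of_real (z $ i) * f z) \<in> schwartz_space \<union> ?K"
    proof
      assume "f \<in> ?K"
      then obtain m \<eta> where f: "f = shrink_avg j m \<eta>" "\<eta> \<in> schwartz_space"
        "?p (Suc m) (shrink_avg j m \<eta>) \<in> schwartz_space" by blast
      let ?\<eta> = "\<lambda>x. of_real (x $ i) * \<eta> x"
      have \<eta>': "?\<eta> \<in> schwartz_space" using f(2) by auto
      show ?thesis
      proof (cases "i = j")
        case False
        have eq: "(\<lambda>z. of_real (z $ i) * f z) = shrink_avg j m ?\<eta>"
          unfolding f(1) using shrink_avg_coord(1)[OF False] by blast
        have "?p (Suc m) (shrink_avg j m ?\<eta>) = (\<lambda>z. of_real (z $ i) * ?p (Suc m) (shrink_avg j m \<eta>) z)"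
          unfolding eq[symmetric] f(1) by (simp add: mult_ac)
        also have "\<dots> \<in> schwartz_space" using f(3) by (rule schwartz_coord_mult)
        finally show ?thesis unfolding eq using \<eta>' by blast
      next
        case True
        show ?thesis
        proof (cases m)
          case 0
          thus ?thesis using f True by simp
        next
          case (Suc m')
          have eq: "(\<lambda>z. of_real (z $ i) * f z) = shrink_avg j m' ?\<eta>"
            unfolding f(1) Suc True using shrink_avg_coord(2) by blast
          have "?p (Suc m') (shrink_avg j m' ?\<eta>) = ?p (Suc m) (shrink_avg j m \<eta>)"
          proof
            fix z
            show "?p (Suc m') (shrink_avg j m' ?\<eta>) z = ?p (Suc m) (shrink_avg j m \<eta>) z"
              unfolding fun_cong[OF eq, of z, symmetric] unfolding f(1) Suc True by (simp add: mult_ac)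
          qed
          thus ?thesis unfolding eq using \<eta>' f(3) by (intro UnI2 CollectI exI[of _ m'] exI[of _ ?\<eta>]) auto
        qed
      qed
    qed (auto intro: schwartz_coord_mult)
  qed
qed

text \<open>By the fundamental theorem of calculus along the segment that joins \<open>z\<close> to the hyperplane of
  the coordinate.\<close>

lemma shrink_avg_deriv:
  assumes \<xi>: "\<xi> \<in> schwartz_space" and z: "\<And>z. z $ j = 0 \<Longrightarrow> \<xi> z = 0"
  shows "of_real (z $ j) * shrink_avg j 0 (partial_deriv j \<xi>) z = \<xi> z"
proof -
  let ?c = "\<lambda>t. z + ((t - 1) * z $ j) *\<^sub>R axis j 1"
  let ?f = "\<lambda>t. of_real (z $ j) * partial_deriv j \<xi> (?c t)"
  have "has_bochner_integral lborel (\<lambda>t. indicat_real {0..1} t *\<^sub>R ?f t) (\<xi> (?c 1) - \<xi> (?c 0))"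
  proof (rule has_bochner_integral_FTC_Icc)
    fix t :: real
    have "(?c has_derivative (\<lambda>h. (h * z $ j) *\<^sub>R axis j 1)) (at t)"
      by (auto intro!: derivative_eq_intros)
    from has_derivative_compose[OF this has_derivative_partial_deriv[OF schwartz_differentiable[OF \<xi>]]]
    have "((\<lambda>t. \<xi> (?c t)) has_derivative
        (\<lambda>h. \<Sum>i\<in>UNIV. (((h * z $ j) *\<^sub>R axis j 1) $ i) *\<^sub>R partial_deriv i \<xi> (?c t))) (at t)" .
    moreover have "(\<Sum>i\<in>UNIV. (((h * z $ j) *\<^sub>R axis j 1) $ i) *\<^sub>R partial_deriv i \<xi> (?c t)) = h *\<^sub>R ?f t" for h
    proof -
      have "(\<Sum>i\<in>UNIV. (((h * z $ j) *\<^sub>R axis j 1) $ i) *\<^sub>R partial_deriv i \<xi> (?c t)) =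
          (\<Sum>i\<in>UNIV. if i = j then (h * z $ j) *\<^sub>R partial_deriv j \<xi> (?c t) else 0)"
        by (intro sum.cong) (auto simp: axis_def)
      thus ?thesis by (simp add: scaleR_conv_of_real)
    qed
    ultimately show "((\<lambda>t. \<xi> (?c t)) has_vector_derivative ?f t) (at t within {0..1})"
      unfolding has_vector_derivative_def by (auto intro: has_derivative_at_withinI)
  next
    have "continuous_on {0..1} ?c" by (intro continuous_intros)
    from continuous_on_compose2[OF schwartz_continuous_on[OF schwartz_partial_deriv[OF \<xi>], of UNIV] this]
    show "continuous_on {0..1} ?f" by (intro continuous_intros) auto
  qed auto
  hence "(LINT t|lborel. indicat_real {0..1} t *\<^sub>R ?f t) = \<xi> (?c 1) - \<xi> (?c 0)"
    by (rule has_bochner_integral_integral_eq)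
  also have "\<dots> = \<xi> z" using z[of "?c 0"] by (simp add: axis_def)
  also have "(LINT t|lborel. indicat_real {0..1} t *\<^sub>R ?f t) = of_real (z $ j) * shrink_avg j 0 (partial_deriv j \<xi>) z"
    unfolding shrink_avg_def integral_mult_right_zero[symmetric]
    by (intro Bochner_Integration.integral_cong) (auto simp: indicator_def shrink_eq)
  finally show ?thesis .
qed

text \<open>Hadamard's lemma in the Schwartz space: the quotient is an average of partial derivatives, and
  its product with the coordinate is the given Schwartz function, so the quotient is a Schwartz
  function too.\<close>

lemma schwartz_divide_coord:
  assumes "\<xi> \<in> schwartz_space" "\<And>z. z $ j = 0 \<Longrightarrow> \<xi> z = 0"
  shows "\<exists>\<psi>\<in>schwartz_space. \<xi> = (\<lambda>z. of_real (z $ j) * \<psi> z)"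
proof (rule bexI)
  show "\<xi> = (\<lambda>z. of_real (z $ j) * shrink_avg j 0 (partial_deriv j \<xi>) z)"
    using shrink_avg_deriv[OF assms] by auto
  thus "shrink_avg j 0 (partial_deriv j \<xi>) \<in> schwartz_space"
    using assms(1) by (intro shrink_avg_schwartz schwartz_partial_deriv) auto
qed

section \<open>Distributions supported on a subspace\<close>

definition zero_coords :: "'n set \<Rightarrow> real^'n::finite \<Rightarrow> real^'n" where
  "zero_coords J z = (\<chi> i. if i \<in> J then 0 else z $ i)"

lemma linear_zero_coords: "linear (zero_coords J)"
  by (rule linearI) (auto simp: zero_coords_def vec_eq_iff)

lemma schwartz_zero_coords_gauss:
  assumes "\<phi> \<in> schwartz_space"
  shows "(\<lambda>z. of_real (coord_gauss 1 J z) * \<phi> (zero_coords J z)) \<in> schwartz_space"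
proof -
  have "continuous_op (\<lambda>\<phi> z. of_real (coord_gauss 1 J z) * \<phi> (zero_coords J z))"
    by (rule continuous_op_tensor_gauss[where B = "\<lambda>z. z", OF linear_zero_coords])
       (auto simp: linear_id[unfolded id_def] zero_coords_def vec_eq_iff axis_def)
  from continuous_op_mem[OF this assms] show ?thesis .
qed

text \<open>One coordinate is treated after the other: the difference between a test function and the
  extension of its restriction to the hyperplane of a coordinate vanishes on that hyperplane, so it
  is divisible by that coordinate and is annihilated.\<close>

lemma annihilated_coords_restrict:
  fixes S :: "(real^'n \<Rightarrow> complex) \<Rightarrow> complex"
  assumes diff: "\<And>\<phi> \<psi>. \<phi> \<in> schwartz_space \<Longrightarrow> \<psi> \<in> schwartz_space \<Longrightarrow> S (\<lambda>x. \<phi> x - \<psi> x) = S \<phi> - S \<psi>"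
    and zero: "\<And>j \<psi>. j \<in> J \<Longrightarrow> \<psi> \<in> schwartz_space \<Longrightarrow> S (\<lambda>z. of_real (z $ j) * \<psi> z) = 0"
    and \<phi>: "\<phi> \<in> schwartz_space"
  shows "S \<phi> = S (\<lambda>z. of_real (coord_gauss 1 J z) * \<phi> (zero_coords J z))"
proof -
  have "finite J" by simp
  thus ?thesis using zero
  proof (induction J rule: finite_induct)
    case empty
    thus ?case by (simp add: coord_gauss_def zero_coords_def)
  next
    case (insert j J)
    let ?f = "\<lambda>z. of_real (coord_gauss 1 J z) * \<phi> (zero_coords J z)"
    \<comment> \<open>The Gaussian factor turns the extension from the hyperplane into a Schwartz function without
      changing it there.\<close>
    let ?g = "\<lambda>z. of_real (coord_gauss 1 {j} z) * ?f (zero_coords {j} z)"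
    have f: "?f \<in> schwartz_space" by (rule schwartz_zero_coords_gauss[OF \<phi>])
    have g: "?g \<in> schwartz_space" by (rule schwartz_zero_coords_gauss[OF f])
    have "?f z - ?g z = 0" if "z $ j = 0" for z
    proof -
      have "zero_coords {j} z = z" using that by (auto simp: zero_coords_def vec_eq_iff)
      thus ?thesis using that by (simp add: coord_gauss_def[of 1 "{j}"])
    qed
    from schwartz_divide_coord[OF schwartz_diff[OF f g] this] obtain \<psi>
      where \<psi>: "\<psi> \<in> schwartz_space" "(\<lambda>z. ?f z - ?g z) = (\<lambda>z. of_real (z $ j) * \<psi> z)" by blast
    have "S (\<lambda>z. ?f z - ?g z) = 0" unfolding \<psi>(2) by (rule insert.prems[OF insertI1 \<psi>(1)])
    hence "S ?f = S ?g" using diff[OF f g] by simp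
    moreover have "?g = (\<lambda>z. of_real (coord_gauss 1 (insert j J) z) * \<phi> (zero_coords (insert j J) z))"
    proof
      fix z
      have "(\<Sum>i\<in>J. (zero_coords {j} z $ i)\<^sup>2) = (\<Sum>i\<in>J. (z $ i)\<^sup>2)"
        using insert(2) by (intro sum.cong) (auto simp: zero_coords_def)
      hence "coord_gauss 1 {j} z * coord_gauss 1 J (zero_coords {j} z) = coord_gauss 1 (insert j J) z"
        using insert(1,2) by (simp add: coord_gauss_def exp_add[symmetric])
      moreover have "zero_coords J (zero_coords {j} z) = zero_coords (insert j J) z"
        by (auto simp: zero_coords_def vec_eq_iff)
      ultimately show "?g z = of_real (coord_gauss 1 (insert j J) z) * \<phi> (zero_coords (insert j J) z)"
        by (simp add: mult.assoc[symmetric] of_real_mult[symmetric] del: of_real_mult)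
    qed
    moreover have "S \<phi> = S ?f" using insert by blast
    ultimately show ?case by simp
  qed
qed

definition restrict_coords :: "('k \<Rightarrow> 'n) \<Rightarrow> real^'n::finite \<Rightarrow> real^'k::finite" where
  "restrict_coords \<iota> z = (\<chi> l. z $ \<iota> l)"

lemma linear_restrict_coords: "linear (restrict_coords \<iota>)"
  by (rule linearI) (auto simp: restrict_coords_def vec_eq_iff)

lemma linear_pad_zero: "linear (pad_zero \<iota>)"
  by (rule linearI) (auto simp: pad_zero_def vec_eq_iff)

lemma restrict_pad_zero: "inj \<iota> \<Longrightarrow> restrict_coords \<iota> (pad_zero \<iota> y) = y"
  by (auto simp: restrict_coords_def pad_zero_def vec_eq_iff)

lemma pad_zero_restrict: "inj \<iota> \<Longrightarrow> pad_zero \<iota> (restrict_coords \<iota> z) = zero_coords (- range \<iota>) z"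
  by (auto simp: restrict_coords_def pad_zero_def zero_coords_def vec_eq_iff)

lemma orthogonal_matrix_inverse:
  fixes U :: "real^'n^'n"
  assumes "orthogonal_matrix U"
  shows "transpose U *v (U *v x) = x" "U *v (transpose U *v x) = x"
proof -
  show "transpose U *v (U *v x) = x"
    unfolding matrix_vector_mul_assoc using assms by (simp add: orthogonal_matrix_def)
  show "U *v (transpose U *v x) = x"
    unfolding matrix_vector_mul_assoc using assms by (simp add: orthogonal_matrix_def)
qed

lemma continuous_op_rotate:
  fixes U :: "real^'n^'n"
  assumes "orthogonal_matrix U"
  shows "continuous_op (\<lambda>\<phi> z. \<phi> (U *v z))" "continuous_op (\<lambda>\<phi> z. \<phi> (transpose U *v z))"
  by (rule continuous_op_linear_compose[OF matrix_vector_mul_linear matrix_vector_mul_linear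
        orthogonal_matrix_inverse(1)[OF assms]],
      rule continuous_op_linear_compose[OF matrix_vector_mul_linear matrix_vector_mul_linear
        orthogonal_matrix_inverse(2)[OF assms]])

lemma continuous_op_pad_zero:
  assumes "inj \<iota>"
  shows "continuous_op (\<lambda>\<phi> y. \<phi> (pad_zero \<iota> y))"
  by (rule continuous_op_linear_compose[OF linear_pad_zero linear_restrict_coords restrict_pad_zero[OF assms]])

lemma G_tempered_tempered:
  assumes \<iota>: "inj \<iota>" and h: "h \<in> G_tempered \<iota>"
  shows "h \<in> tempered"
proof -
  obtain g U where g: "h = rotate_distr U (tensor_delta \<iota> g)" "g \<in> tempered" "orthogonal_matrix U"
    using h unfolding G_tempered_def by blast
  have "tensor_delta \<iota> g \<in> tempered"
    unfolding tensor_delta_def by (rule tempered_compose[OF g(2) continuous_op_pad_zero[OF \<iota>]]) auto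
  thus ?thesis
    unfolding g(1) rotate_distr_def
    by (rule tempered_compose[OF _ continuous_op_rotate(2)[OF g(3)]]) auto
qed

text \<open>After rotation by \<open>V\<close> the annihilating linear forms are the coordinates outside the range of
  \<open>\<iota>\<close>. The rotated functional only sees the restriction to the remaining coordinates, so it is the
  tensor product of a Dirac delta with the functional \<open>g\<close> that first extends a test function by a
  Gaussian factor.\<close>

theorem annihilated_directions_imp_G_tempered:
  fixes \<iota> :: "'k::finite \<Rightarrow> 'n::finite" and T :: "'n distr"
  assumes \<iota>: "inj \<iota>" and T: "T \<in> tempered" and V: "orthogonal_matrix V"
    and zero: "\<And>j \<psi>. j \<notin> range \<iota> \<Longrightarrow> \<psi> \<in> schwartz_space \<Longrightarrow> T (\<lambda>x. of_real (row j V \<bullet> x) * \<psi> x) = 0"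
  shows "T \<in> G_tempered \<iota>"
proof -
  let ?J = "- range \<iota>"
  define S where "S \<phi> = T (\<lambda>x. \<phi> (V *v x))" for \<phi>
  have rot: "(\<lambda>x. \<phi> (V *v x)) \<in> schwartz_space" "(\<lambda>x. \<phi> (transpose V *v x)) \<in> schwartz_space"
    if "\<phi> \<in> schwartz_space" for \<phi> :: "real^'n \<Rightarrow> complex"
    using continuous_op_mem[OF continuous_op_rotate(1)[OF V] that]
      continuous_op_mem[OF continuous_op_rotate(2)[OF V] that] by auto
  have S: "S \<phi> = S (\<lambda>z. of_real (coord_gauss 1 ?J z) * \<phi> (zero_coords ?J z))" if "\<phi> \<in> schwartz_space" for \<phi>
  proof (rule annihilated_coords_restrict[OF _ _ that])
    show "S (\<lambda>x. \<phi> x - \<psi> x) = S \<phi> - S \<psi>" if "\<phi> \<in> schwartz_space" "\<psi> \<in> schwartz_space" for \<phi> \<psi>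
      unfolding S_def by (rule tempered_diff[OF T rot(1)[OF that(1)] rot(1)[OF that(2)]])
    fix j \<psi> assume j: "j \<in> ?J" and \<psi>: "\<psi> \<in> (schwartz_space :: (real^'n \<Rightarrow> complex) set)"
    have "(V *v x) $ j = row j V \<bullet> x" for x by (simp add: matrix_vector_mult_def row_def inner_vec_def)
    thus "S (\<lambda>z. of_real (z $ j) * \<psi> z) = 0" unfolding S_def using zero[OF _ rot(1)[OF \<psi>], of j] j by simp
  qed
  \<comment> \<open>The extension of a test function from the subspace, in rotated coordinates.\<close>
  define E :: "(real^'k \<Rightarrow> complex) \<Rightarrow> real^'n \<Rightarrow> complex"
    where "E = (\<lambda>\<psi> x. of_real (coord_gauss 1 ?J (V *v x)) * \<psi> (restrict_coords \<iota> (V *v x)))"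
  have "continuous_op (\<lambda>(\<psi> :: real^'k \<Rightarrow> complex) z. of_real (coord_gauss 1 ?J z) * \<psi> (restrict_coords \<iota> z))"
  proof (rule continuous_op_tensor_gauss[OF linear_restrict_coords _ linear_pad_zero[of \<iota>]])
    show "restrict_coords \<iota> (axis j 1) = 0" if "j \<in> ?J" for j
      using that by (auto simp: restrict_coords_def vec_eq_iff axis_def)
    show "z $ i = pad_zero \<iota> (restrict_coords \<iota> z) $ i" if "i \<notin> ?J" for z i
      using that by (simp add: pad_zero_restrict[OF \<iota>] zero_coords_def)
  qed simp
  from continuous_op_compose[OF continuous_op_rotate(1)[OF V] this]
  have E: "continuous_op E" by (simp add: E_def)
  define g where "g = (\<lambda>\<psi>\<in>schwartz_space. T (E \<psi>))"
  have g: "g \<in> tempered"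
    unfolding g_def by (rule tempered_compose[OF T E]) (auto simp: E_def algebra_simps)
  have "T = rotate_distr V (tensor_delta \<iota> g)"
  proof (rule extensionalityI[OF tempered_extensional[OF T]])
    fix \<phi> :: "real^'n \<Rightarrow> complex" assume \<phi>: "\<phi> \<in> schwartz_space"
    let ?\<phi> = "\<lambda>x. \<phi> (transpose V *v x)"
    have p: "(\<lambda>y. ?\<phi> (pad_zero \<iota> y)) \<in> schwartz_space"
      by (rule continuous_op_mem[OF continuous_op_pad_zero[OF \<iota>] rot(2)[OF \<phi>]])
    have "T \<phi> = S ?\<phi>" unfolding S_def orthogonal_matrix_inverse(1)[OF V] ..
    also have "\<dots> = S (\<lambda>z. of_real (coord_gauss 1 ?J z) * ?\<phi> (zero_coords ?J z))"
      by (rule S[OF rot(2)[OF \<phi>]])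
    also have "\<dots> = g (\<lambda>y. ?\<phi> (pad_zero \<iota> y))"
      using p by (simp add: g_def S_def E_def pad_zero_restrict[OF \<iota>])
    also have "\<dots> = rotate_distr V (tensor_delta \<iota> g) \<phi>"
      using \<phi> rot(2)[OF \<phi>] by (simp add: rotate_distr_def tensor_delta_def)
    finally show "T \<phi> = rotate_distr V (tensor_delta \<iota> g) \<phi>" .
  qed (simp add: rotate_distr_def)
  thus ?thesis unfolding G_tempered_def using g V by blast
qed

section \<open>Gaussian mollification\<close>

abbreviation gauss :: "real \<Rightarrow> real^'n::finite \<Rightarrow> complex" where
  "gauss \<epsilon> x \<equiv> of_real (gaussian \<epsilon> x)"

lemma norm_power2_eq_sum: "(norm x)\<^sup>2 = (\<Sum>i\<in>UNIV. (x $ i)\<^sup>2)" for x :: "real^'n"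
  unfolding power2_norm_eq_inner inner_vec_def by (simp add: power2_eq_square)

lemma gaussian_nonneg: "0 \<le> gaussian \<epsilon> x"
  by (simp add: gaussian_def)

lemma gaussian_minus [simp]: "gaussian \<epsilon> (- x) = gaussian \<epsilon> x"
  by (simp add: gaussian_def)

lemma gauss_schwartz [intro]:
  assumes "\<epsilon> > 0"
  shows "(gauss \<epsilon> :: real^'n \<Rightarrow> complex) \<in> schwartz_space"
proof -
  let ?K = "(2 * pi * \<epsilon>\<^sup>2) powr (- real CARD('n) / 2)"
  have "(\<lambda>x::real^'n. of_real ?K * of_real (coord_gauss (1 / (2 * \<epsilon>\<^sup>2)) UNIV x)) \<in> schwartz_space"
    using assms by (intro schwartz_cmult coord_gauss_schwartz) auto
  thus ?thesis by (simp add: gaussian_def coord_gauss_def norm_power2_eq_sum)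
qed

lemma gaussian_measurable [measurable]: "gaussian \<epsilon> \<in> borel_measurable borel"
  unfolding gaussian_def[abs_def] by measurable

lemma gaussian_eq_prod:
  fixes x :: "real^'n"
  assumes "\<epsilon> > 0"
  shows "gaussian \<epsilon> x = (\<Prod>b\<in>Basis. normal_density 0 \<epsilon> (x \<bullet> b))"
proof -
  have "(\<Prod>b\<in>(Basis :: (real^'n) set). normal_density 0 \<epsilon> (x \<bullet> b)) =
      (1 / sqrt (2 * pi * \<epsilon>\<^sup>2)) ^ CARD('n) * (\<Prod>b\<in>Basis. exp (- (x \<bullet> b)\<^sup>2 / (2 * \<epsilon>\<^sup>2)))"
    by (simp add: normal_density_def prod.distrib prod_dividef power_divide)
  also have "(\<Prod>b\<in>Basis. exp (- (x \<bullet> b)\<^sup>2 / (2 * \<epsilon>\<^sup>2))) = exp (- (norm x)\<^sup>2 / (2 * \<epsilon>\<^sup>2))"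
  proof -
    have "(norm x)\<^sup>2 = (\<Sum>b\<in>Basis. (x \<bullet> b)\<^sup>2)"
      unfolding power2_norm_eq_inner euclidean_inner[of x x] by (simp add: power2_eq_square)
    thus ?thesis by (simp only: exp_sum[symmetric] finite_Basis sum_divide_distrib sum_negf[symmetric])
  qed
  also have "(1 / sqrt (2 * pi * \<epsilon>\<^sup>2)) ^ CARD('n) = (2 * pi * \<epsilon>\<^sup>2) powr (- real CARD('n) / 2)"
  proof -
    have pos: "0 < 2 * pi * \<epsilon>\<^sup>2" using assms by simp
    have "1 / sqrt (2 * pi * \<epsilon>\<^sup>2) = (2 * pi * \<epsilon>\<^sup>2) powr (- 1 / 2)"
      using powr_half_sqrt[of "2 * pi * \<epsilon>\<^sup>2"] pos assms by (simp add: powr_minus_divide)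
    hence "(1 / sqrt (2 * pi * \<epsilon>\<^sup>2)) ^ CARD('n) = ((2 * pi * \<epsilon>\<^sup>2) powr (- 1 / 2)) ^ CARD('n)"
      by (simp only:)
    also have "\<dots> = ((2 * pi * \<epsilon>\<^sup>2) powr (- 1 / 2)) powr (real CARD('n))"
      using pos assms by (intro powr_realpow[symmetric]) simp
    also have "\<dots> = (2 * pi * \<epsilon>\<^sup>2) powr (- real CARD('n) / 2)" by (simp add: powr_powr)
    finally show ?thesis .
  qed
  finally show ?thesis by (simp add: gaussian_def)
qed

lemma gaussian_integral:
  assumes "\<epsilon> > 0"
  shows "integrable lborel (gaussian \<epsilon> :: real^'n \<Rightarrow> real)" "(LINT x|lborel. gaussian \<epsilon> (x :: real^'n)) = 1"
proof -
  have "(\<integral>\<^sup>+(x::real^'n). ennreal (gaussian \<epsilon> x) \<partial>lborel) =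
      (\<integral>\<^sup>+(x::real^'n). (\<Prod>b\<in>Basis. ennreal (normal_density 0 \<epsilon> (x \<bullet> b))) \<partial>lborel)"
    by (intro nn_integral_cong) (simp add: gaussian_eq_prod[OF assms] prod_ennreal)
  also have "\<dots> = (\<Prod>b\<in>(Basis :: (real^'n) set). \<integral>\<^sup>+t. ennreal (normal_density 0 \<epsilon> t) \<partial>lborel)"
    by (rule nn_integral_lborel_prod) auto
  also have "\<dots> = 1"
    using nn_integral_eq_integral[OF integrable_normal_density[OF assms, of 0]] assms by simp
  finally have n: "(\<integral>\<^sup>+(x::real^'n). ennreal (gaussian \<epsilon> x) \<partial>lborel) = ennreal 1" by simp
  have "has_bochner_integral lborel (gaussian \<epsilon> :: real^'n \<Rightarrow> real) 1"
    by (rule has_bochner_integral_nn_integral[OF _ _ _ n]) (auto simp: gaussian_nonneg)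
  thus "integrable lborel (gaussian \<epsilon> :: real^'n \<Rightarrow> real)" "(LINT x|lborel. gaussian \<epsilon> (x :: real^'n)) = 1"
    by (auto simp: has_bochner_integral_iff)
qed

text \<open>After scaling by \<open>\<epsilon>\<close> the factor \<open>norm y\<close> contributes \<open>\<epsilon>\<close>, and the remaining powers are
  absorbed by passing to a slightly wider Gaussian.\<close>

lemma gaussian_moment_le:
  "\<exists>C\<ge>0. \<forall>\<epsilon> y. 0 < \<epsilon> \<and> \<epsilon> \<le> 1 \<longrightarrow>
    norm y * (1 + norm y) ^ N * gaussian \<epsilon> (y :: real^'n) \<le> C * \<epsilon> * gaussian (sqrt 2 * \<epsilon>) y"
proof -
  obtain K :: real where K: "K \<ge> 0" "\<And>s. s \<ge> 0 \<Longrightarrow> (1 + s) ^ Suc N * exp (- (1 * s)) \<le> K"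
    using power_times_exp_bounded[OF zero_less_one, of "Suc N"] by blast
  define k where "k = 2 powr (real CARD('n) / 2)"
  have "norm y * (1 + norm y) ^ N * gaussian \<epsilon> y \<le> (K * exp 1 * k) * \<epsilon> * gaussian (sqrt 2 * \<epsilon>) y"
    if e: "0 < \<epsilon>" "\<epsilon> \<le> 1" for \<epsilon> and y :: "real^'n"
  proof -
    define t where "t = norm y / \<epsilon>"
    have t: "t \<ge> 0" "norm y = \<epsilon> * t" using e by (auto simp: t_def)
    have "gaussian (sqrt 2 * \<epsilon>) y =
        (2 * (2 * pi * \<epsilon>\<^sup>2)) powr (- real CARD('n) / 2) * exp (- (norm y)\<^sup>2 / (4 * \<epsilon>\<^sup>2))"
      by (simp add: gaussian_def power_mult_distrib mult_ac)
    also have "(2 * (2 * pi * \<epsilon>\<^sup>2)) powr (- real CARD('n) / 2) =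
        2 powr (- real CARD('n) / 2) * (2 * pi * \<epsilon>\<^sup>2) powr (- real CARD('n) / 2)"
      by (rule powr_mult)
    also have "2 powr (- real CARD('n) / 2) = inverse k" unfolding k_def by (simp add: powr_minus)
    finally have g: "k * gaussian (sqrt 2 * \<epsilon>) y = (2 * pi * \<epsilon>\<^sup>2) powr (- real CARD('n) / 2) * exp (- (norm y)\<^sup>2 / (4 * \<epsilon>\<^sup>2))"
      by (simp add: k_def)
    \<comment> \<open>The Gaussian splits into the wider one and a factor that absorbs every power of \<open>t\<close>.\<close>
    have "exp (- (norm y)\<^sup>2 / (2 * \<epsilon>\<^sup>2)) = exp (- (norm y)\<^sup>2 / (4 * \<epsilon>\<^sup>2)) * exp (- t\<^sup>2 / 4)"
      using e unfolding t_def by (simp add: exp_add[symmetric] field_simps)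
    hence g2: "gaussian \<epsilon> y = k * gaussian (sqrt 2 * \<epsilon>) y * exp (- t\<^sup>2 / 4)"
      unfolding g unfolding gaussian_def by simp
    have "norm y * (1 + norm y) ^ N \<le> (\<epsilon> * t) * (1 + t) ^ N"
    proof -
      have "norm y \<le> t" using t e by (simp add: mult_left_le_one_le)
      hence "(1 + norm y) ^ N \<le> (1 + t) ^ N" by (intro power_mono) auto
      thus ?thesis unfolding t(2)[symmetric] by (intro mult_left_mono) auto
    qed
    also have "\<dots> \<le> \<epsilon> * (1 + t) ^ Suc N"
      using e t by (simp add: mult.assoc mult_right_mono)
    finally have "norm y * (1 + norm y) ^ N * exp (- t\<^sup>2 / 4) \<le> \<epsilon> * (1 + t) ^ Suc N * (exp 1 * exp (- t))"
    proof (rule mult_mono)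
      \<comment> \<open>This compares the remaining quadratic exponent with a linear one.\<close>
      have "0 \<le> (t / 2 - 1)\<^sup>2" by simp
      hence "- t\<^sup>2 / 4 \<le> 1 + - t" by (simp add: power2_eq_square field_simps)
      hence "exp (- t\<^sup>2 / 4) \<le> exp (1 + - t)" by simp
      thus "exp (- t\<^sup>2 / 4) \<le> exp 1 * exp (- t)" by (simp only: exp_add)
    qed (use e t in auto)
    also have "\<dots> = \<epsilon> * exp 1 * ((1 + t) ^ Suc N * exp (- (1 * t)))" by simp
    also have "\<dots> \<le> \<epsilon> * exp 1 * K" using e by (intro mult_left_mono K t) auto
    finally have le: "norm y * (1 + norm y) ^ N * exp (- t\<^sup>2 / 4) \<le> \<epsilon> * exp 1 * K" .
    have "norm y * (1 + norm y) ^ N * gaussian \<epsilon> y =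
        (norm y * (1 + norm y) ^ N * exp (- t\<^sup>2 / 4)) * (k * gaussian (sqrt 2 * \<epsilon>) y)"
      unfolding g2 by (simp add: mult_ac)
    also have "\<dots> \<le> (\<epsilon> * exp 1 * K) * (k * gaussian (sqrt 2 * \<epsilon>) y)"
      by (intro mult_right_mono le mult_nonneg_nonneg gaussian_nonneg) (simp add: k_def)
    finally show ?thesis by (simp add: mult_ac)
  qed
  moreover have "K * exp 1 * k \<ge> 0" using K by (simp add: k_def)
  ultimately show ?thesis by blast
qed

lemma gaussian_moment:
  "\<exists>C\<ge>0. \<forall>\<epsilon>. 0 < \<epsilon> \<and> \<epsilon> \<le> 1 \<longrightarrow>
    integrable lborel (\<lambda>y::real^'n. norm y * (1 + norm y) ^ N * gaussian \<epsilon> y) \<and>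
    (LINT y|lborel. norm (y::real^'n) * (1 + norm y) ^ N * gaussian \<epsilon> y) \<le> C * \<epsilon>"
proof -
  obtain C where C: "C \<ge> 0" "\<And>\<epsilon> y. 0 < \<epsilon> \<Longrightarrow> \<epsilon> \<le> 1 \<Longrightarrow>
      norm y * (1 + norm y) ^ N * gaussian \<epsilon> (y :: real^'n) \<le> C * \<epsilon> * gaussian (sqrt 2 * \<epsilon>) y"
    using gaussian_moment_le by blast
  have "integrable lborel (\<lambda>y::real^'n. norm y * (1 + norm y) ^ N * gaussian \<epsilon> y) \<and>
    (LINT y|lborel. norm (y::real^'n) * (1 + norm y) ^ N * gaussian \<epsilon> y) \<le> C * \<epsilon>"
    if e: "0 < \<epsilon>" "\<epsilon> \<le> 1" for \<epsilon>
  proof -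
    have se: "sqrt 2 * \<epsilon> > 0" using e by simp
    have i: "integrable lborel (\<lambda>y::real^'n. C * \<epsilon> * gaussian (sqrt 2 * \<epsilon>) y)"
      by (intro integrable_mult_right gaussian_integral(1) se)
    have I: "integrable lborel (\<lambda>y::real^'n. norm y * (1 + norm y) ^ N * gaussian \<epsilon> y)"
    proof (rule Bochner_Integration.integrable_bound[OF i])
      show "(\<lambda>y::real^'n. norm y * (1 + norm y) ^ N * gaussian \<epsilon> y) \<in> borel_measurable lborel"
        by measurable
      show "AE y::real^'n in lborel. norm (norm y * (1 + norm y) ^ N * gaussian \<epsilon> y) \<le>
          norm (C * \<epsilon> * gaussian (sqrt 2 * \<epsilon>) y)"
      proof (intro AE_I2)
        fix y :: "real^'n"
        have "0 \<le> norm y * (1 + norm y) ^ N * gaussian \<epsilon> y"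
          by (intro mult_nonneg_nonneg gaussian_nonneg) auto
        thus "norm (norm y * (1 + norm y) ^ N * gaussian \<epsilon> y) \<le> norm (C * \<epsilon> * gaussian (sqrt 2 * \<epsilon>) y)"
          using C(2)[OF e, of y] by simp
      qed
    qed
    have "(LINT y|lborel. norm (y::real^'n) * (1 + norm y) ^ N * gaussian \<epsilon> y) \<le>
        (LINT y::real^'n|lborel. C * \<epsilon> * gaussian (sqrt 2 * \<epsilon>) y)"
      by (intro integral_mono I i C(2) e)
    thus ?thesis using I gaussian_integral(2)[OF se, where 'n = 'n] by simp
  qed
  thus ?thesis using C(1) by blast
qed

definition mollify :: "real \<Rightarrow> (real^'n::finite \<Rightarrow> complex) \<Rightarrow> real^'n \<Rightarrow> complex" where
  "mollify \<epsilon> \<phi> = conv (\<lambda>y. y) (gauss \<epsilon>) \<phi>"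

lemma mollify_schwartz:
  assumes "\<epsilon> > 0" "\<phi> \<in> schwartz_space"
  shows "mollify \<epsilon> \<phi> \<in> schwartz_space"
  unfolding mollify_def using assms
  by (intro conv_schwartz schwartz_rapid gauss_schwartz) (auto simp: linear_id[unfolded id_def])

lemma iter_partial_mollify:
  assumes "\<epsilon> > 0" "\<phi> \<in> schwartz_space"
  shows "iter_partial is (mollify \<epsilon> \<phi>) = mollify \<epsilon> (iter_partial is \<phi>)"
  unfolding mollify_def using assms
  by (intro conv_iter_partial schwartz_integrable gauss_schwartz) (auto simp: linear_id[unfolded id_def])

text \<open>The mean value inequality bounds the integrand by the first weighted moment of the Gaussian,
  which is of the order of its width.\<close>

lemma mollify_weighted_close:
  fixes \<phi> :: "real^'n \<Rightarrow> complex"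
  assumes \<phi>: "\<phi> \<in> schwartz_space"
  shows "\<exists>C\<ge>0. \<forall>\<epsilon> x. 0 < \<epsilon> \<and> \<epsilon> \<le> 1 \<longrightarrow> (1 + norm x) ^ N * norm (mollify \<epsilon> \<phi> x - \<phi> x) \<le> C * \<epsilon>"
proof -
  obtain B where B: "B \<ge> 0"
    "\<And>x u. (1 + norm x) ^ N * norm (\<phi> (x + u) - \<phi> x) \<le> B * (norm u * (1 + norm u) ^ N)"
    using schwartz_weighted_lipschitz[OF \<phi>] by blast
  from gaussian_moment[of N, where 'n = 'n] obtain C where C0: "C \<ge> 0" and "\<forall>\<epsilon>. 0 < \<epsilon> \<and> \<epsilon> \<le> 1 \<longrightarrow>
    integrable lborel (\<lambda>y::real^'n. norm y * (1 + norm y) ^ N * gaussian \<epsilon> y) \<and>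
    (LINT y|lborel. norm (y::real^'n) * (1 + norm y) ^ N * gaussian \<epsilon> y) \<le> C * \<epsilon>"
    by (elim exE conjE) (rule that)
  hence C: "C \<ge> 0" "integrable lborel (\<lambda>y::real^'n. norm y * (1 + norm y) ^ N * gaussian \<epsilon> y)"
    "(LINT y|lborel. norm (y::real^'n) * (1 + norm y) ^ N * gaussian \<epsilon> y) \<le> C * \<epsilon>"
    if "0 < \<epsilon>" "\<epsilon> \<le> 1" for \<epsilon>
    using that by simp_all
  have "(1 + norm x) ^ N * norm (mollify \<epsilon> \<phi> x - \<phi> x) \<le> (B * C) * \<epsilon>" if e: "0 < \<epsilon>" "\<epsilon> \<le> 1" for \<epsilon> x
  proof -
    let ?w = "(1 + norm x) ^ N"
    have w: "?w > 0" by (rule one_plus_norm_pos)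
    obtain S where S: "\<And>x. norm (\<phi> x) \<le> S" using schwartz_bounded[OF \<phi>] by (auto simp: bounded_iff)
    have gi: "integrable lborel (gauss \<epsilon> :: real^'n \<Rightarrow> complex)"
      by (intro schwartz_integrable gauss_schwartz e)
    have m: "(\<lambda>y. \<phi> (x + y)) \<in> borel_measurable borel"
      using conv_integrand_measurable[OF linear_id[unfolded id_def] schwartz_borel_measurable[OF \<phi>]] .
    have i1: "integrable lborel (\<lambda>y. gauss \<epsilon> y * \<phi> (x + y))"
      using m by (intro integrable_mult_bounded[OF gi _ S]) auto
    have i2: "integrable lborel (\<lambda>y::real^'n. gauss \<epsilon> y * \<phi> x)" by (intro integrable_mult_left gi)
    have "(LINT y::real^'n|lborel. gauss \<epsilon> y * \<phi> x) = \<phi> x"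
      using gaussian_integral(2)[OF e(1), where 'n = 'n] by simp
    hence "mollify \<epsilon> \<phi> x - \<phi> x = (LINT y|lborel. gauss \<epsilon> y * \<phi> (x + y) - gauss \<epsilon> y * \<phi> x)"
      unfolding mollify_def conv_def using i1 i2 by simp
    hence "of_real ?w * (mollify \<epsilon> \<phi> x - \<phi> x) =
        (LINT y|lborel. of_real ?w * (gauss \<epsilon> y * \<phi> (x + y) - gauss \<epsilon> y * \<phi> x))"
      by simp
    also have "norm \<dots> \<le> (LINT y|lborel. B * (norm (y::real^'n) * (1 + norm y) ^ N * gaussian \<epsilon> y))"
    proof (rule integral_norm_le_integral)
      show "integrable lborel (\<lambda>y. of_real ?w * (gauss \<epsilon> y * \<phi> (x + y) - gauss \<epsilon> y * \<phi> x))"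
        by (intro integrable_mult_right Bochner_Integration.integrable_diff i1 i2)
      show "integrable lborel (\<lambda>y::real^'n. B * (norm y * (1 + norm y) ^ N * gaussian \<epsilon> y))"
        by (intro integrable_mult_right C(2) e)
      fix y :: "real^'n"
      have "of_real ?w * (gauss \<epsilon> y * \<phi> (x + y) - gauss \<epsilon> y * \<phi> x) =
          gauss \<epsilon> y * (of_real ?w * (\<phi> (x + y) - \<phi> x))" by (simp add: algebra_simps)
      also have "norm \<dots> = gaussian \<epsilon> y * (?w * norm (\<phi> (x + y) - \<phi> x))"
        using w by (simp add: norm_mult gaussian_nonneg abs_of_pos del: of_real_power)
      also have "\<dots> \<le> gaussian \<epsilon> y * (B * (norm y * (1 + norm y) ^ N))"
        by (intro mult_left_mono B gaussian_nonneg)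
      finally show "norm (of_real ?w * (gauss \<epsilon> y * \<phi> (x + y) - gauss \<epsilon> y * \<phi> x)) \<le>
          B * (norm y * (1 + norm y) ^ N * gaussian \<epsilon> y)" by (simp add: mult_ac)
    qed
    also have "\<dots> \<le> B * (C * \<epsilon>)"
      using C(3)[OF e] B(1) by (simp add: mult_left_mono)
    finally show ?thesis using w by (simp add: norm_mult abs_of_pos mult.assoc del: of_real_power)
  qed
  thus ?thesis using B(1) C0 by (intro exI[of _ "B * C"]) auto
qed

lemma mollify_seminorm_close:
  fixes \<phi> :: "real^'n \<Rightarrow> complex"
  assumes \<phi>: "\<phi> \<in> schwartz_space"
  shows "\<exists>C\<ge>0. \<forall>\<epsilon>. 0 < \<epsilon> \<and> \<epsilon> \<le> 1 \<longrightarrow> schwartz_seminorm a is (\<lambda>x. mollify \<epsilon> \<phi> x - \<phi> x) \<le> C * \<epsilon>"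
proof -
  obtain C where C: "C \<ge> 0" "\<And>\<epsilon> x. 0 < \<epsilon> \<Longrightarrow> \<epsilon> \<le> 1 \<Longrightarrow>
      (1 + norm x) ^ sum a UNIV * norm (mollify \<epsilon> (iter_partial is \<phi>) x - iter_partial is \<phi> x) \<le> C * \<epsilon>"
    using mollify_weighted_close[OF schwartz_iter_partial[OF \<phi>]] by blast
  have "schwartz_seminorm a is (\<lambda>x. mollify \<epsilon> \<phi> x - \<phi> x) \<le> C * \<epsilon>" if e: "0 < \<epsilon>" "\<epsilon> \<le> 1" for \<epsilon>
  proof (rule schwartz_seminorm_le)
    fix x
    have "norm (of_real (monomial_fun a x) * iter_partial is (\<lambda>x. mollify \<epsilon> \<phi> x - \<phi> x) x) \<le>
        (1 + norm x) ^ sum a UNIV * norm (mollify \<epsilon> (iter_partial is \<phi>) x - iter_partial is \<phi> x)"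
      unfolding iter_partial_diff[OF mollify_schwartz[OF e(1) \<phi>] \<phi>] iter_partial_mollify[OF e(1) \<phi>]
        norm_mult norm_of_real
      by (intro mult_right_mono abs_monomial_fun_le) auto
    also have "\<dots> \<le> C * \<epsilon>" by (rule C(2)[OF e])
    finally show "norm (of_real (monomial_fun a x) * iter_partial is (\<lambda>x. mollify \<epsilon> \<phi> x - \<phi> x) x) \<le> C * \<epsilon>" .
  qed
  thus ?thesis using C(1) by blast
qed

lemma tempered_mollify_close:
  fixes T :: "'n::finite distr"
  assumes T: "T \<in> tempered" and \<phi>: "\<phi> \<in> schwartz_space"
  shows "\<exists>C\<ge>0. \<forall>\<epsilon>. 0 < \<epsilon> \<and> \<epsilon> \<le> 1 \<longrightarrow> norm (T (mollify \<epsilon> \<phi>) - T \<phi>) \<le> C * \<epsilon>"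
proof -
  obtain D F where D: "D \<ge> 0" "finite F"
    "\<And>\<phi>. \<phi> \<in> schwartz_space \<Longrightarrow> norm (T \<phi>) \<le> D * (\<Sum>(a, is)\<in>F. schwartz_seminorm a is \<phi>)"
    using tempered_dominated[OF T] unfolding schwartz_dominated_def by auto
  have "\<forall>k. \<exists>C\<ge>0. \<forall>\<epsilon>. 0 < \<epsilon> \<and> \<epsilon> \<le> 1 \<longrightarrow>
      schwartz_seminorm (fst k) (snd k) (\<lambda>x. mollify \<epsilon> \<phi> x - \<phi> x) \<le> C * \<epsilon>"
    using mollify_seminorm_close[OF \<phi>] by blast
  then obtain C where C: "\<And>k. C k \<ge> 0" "\<And>k \<epsilon>. 0 < \<epsilon> \<Longrightarrow> \<epsilon> \<le> 1 \<Longrightarrow>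
      schwartz_seminorm (fst k) (snd k) (\<lambda>x. mollify \<epsilon> \<phi> x - \<phi> x) \<le> C k * \<epsilon>" by metis
  have "norm (T (mollify \<epsilon> \<phi>) - T \<phi>) \<le> (D * sum C F) * \<epsilon>" if e: "0 < \<epsilon>" "\<epsilon> \<le> 1" for \<epsilon>
  proof -
    have m: "mollify \<epsilon> \<phi> \<in> schwartz_space" by (rule mollify_schwartz[OF e(1) \<phi>])
    have "norm (T (mollify \<epsilon> \<phi>) - T \<phi>) \<le> D * (\<Sum>(a, is)\<in>F. schwartz_seminorm a is (\<lambda>x. mollify \<epsilon> \<phi> x - \<phi> x))"
      using D(3)[OF schwartz_diff[OF m \<phi>]] by (simp add: tempered_diff[OF T m \<phi>])
    also have "\<dots> \<le> D * (\<Sum>k\<in>F. C k * \<epsilon>)"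
      unfolding case_prod_beta by (intro mult_left_mono sum_mono C e D)
    finally show ?thesis by (simp add: sum_distrib_right mult.assoc)
  qed
  moreover have "0 \<le> D * sum C F" by (intro mult_nonneg_nonneg sum_nonneg C D)
  ultimately show ?thesis by blast
qed

section \<open>Schwartz functions as distributions\<close>

lemma integral_lebesgue_lborel:
  fixes f :: "real^'n \<Rightarrow> complex"
  assumes "f \<in> borel_measurable borel"
  shows "(LINT x|lebesgue. f x) = (LINT x|lborel. f x)"
  using assms by (intro integral_completion) simp

lemma integral_lborel_translate:
  fixes f :: "real^'n \<Rightarrow> complex"
  assumes "f \<in> borel_measurable borel"
  shows "(LINT x|lborel. f (c + x)) = (LINT x|lborel. f x)"
proof -
  have "(LINT x|lborel. f x) = (LINT x|distr lborel borel ((+) c). f x)" by (simp add: lborel_distr_plus)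
  also have "\<dots> = (LINT x|lborel. f (c + x))" using assms by (intro integral_distr) auto
  finally show ?thesis ..
qed

text \<open>In this form derivatives can be moved to the Gaussian, which is what makes mollification
  regularize.\<close>

lemma mollify_eq_conv:
  fixes \<phi> :: "real^'n \<Rightarrow> complex"
  assumes "\<epsilon> > 0" "\<phi> \<in> schwartz_space"
  shows "mollify \<epsilon> \<phi> = conv (\<lambda>y. - y) \<phi> (gauss \<epsilon>)"
proof
  fix x
  let ?f = "\<lambda>y. gauss \<epsilon> (y - x) * \<phi> y"
  have [measurable]: "\<phi> \<in> borel_measurable borel" by (rule schwartz_borel_measurable[OF assms(2)])
  have "mollify \<epsilon> \<phi> x = (LINT y|lborel. ?f (x + y))" by (simp add: mollify_def conv_def)
  also have "\<dots> = (LINT y|lborel. ?f y)" by (rule integral_lborel_translate) measurable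
  also have "\<dots> = conv (\<lambda>y. - y) \<phi> (gauss \<epsilon>) x"
    unfolding conv_def using gaussian_minus[of \<epsilon> "x - y" for y] by (simp add: mult.commute)
  finally show "mollify \<epsilon> \<phi> x = conv (\<lambda>y. - y) \<phi> (gauss \<epsilon>) x" .
qed

lemma convolve_gaussian:
  assumes "\<epsilon> > 0" "\<phi> \<in> schwartz_space"
  shows "convolve T (gaussian \<epsilon>) \<phi> = T (mollify \<epsilon> \<phi>)"
proof -
  have [measurable]: "\<phi> \<in> borel_measurable borel" by (rule schwartz_borel_measurable[OF assms(2)])
  have "(\<lambda>x. LINT y|lebesgue. gauss \<epsilon> y * \<phi> (x + y)) = mollify \<epsilon> \<phi>"
    by (rule ext) (simp add: mollify_def conv_def integral_lebesgue_lborel)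
  thus ?thesis using assms by (simp add: convolve_def)
qed

lemma distr_of_apply:
  assumes "f \<in> borel_measurable borel" "\<phi> \<in> schwartz_space"
  shows "distr_of f \<phi> = (LINT x|lborel. f x * \<phi> x)"
proof -
  have "(\<lambda>x. f x * \<phi> x) \<in> borel_measurable borel"
    by (intro borel_measurable_times assms schwartz_borel_measurable)
  thus ?thesis using assms(2) by (simp add: distr_of_def integral_lebesgue_lborel)
qed

lemma integrable_mult_schwartz:
  assumes "integrable lborel f" "\<phi> \<in> schwartz_space"
  shows "integrable lborel (\<lambda>x. f x * \<phi> x)"
proof -
  obtain S where S: "\<And>x. norm (\<phi> x) \<le> S" using schwartz_bounded[OF assms(2)] by (auto simp: bounded_iff)
  show ?thesis using schwartz_borel_measurable[OF assms(2)]
    by (intro integrable_mult_bounded[OF assms(1) _ S]) auto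
qed

lemma distr_of_tempered:
  fixes f :: "real^'n \<Rightarrow> complex"
  assumes f: "f \<in> schwartz_space"
  shows "distr_of f \<in> tempered"
proof (rule temperedI)
  have fb: "f \<in> borel_measurable borel" by (rule schwartz_borel_measurable[OF f])
  have fi: "integrable lborel f" by (rule schwartz_integrable[OF f])
  show "distr_of f (\<lambda>x. a * \<phi> x + b * \<psi> x) = a * distr_of f \<phi> + b * distr_of f \<psi>"
    if *: "\<phi> \<in> schwartz_space" "\<psi> \<in> schwartz_space" for \<phi> \<psi> a b
  proof -
    have i: "integrable lborel (\<lambda>x. f x * \<phi> x)" "integrable lborel (\<lambda>x. f x * \<psi> x)"
      using * by (auto intro: integrable_mult_schwartz[OF fi])
    have "(\<lambda>x. a * \<phi> x + b * \<psi> x) \<in> schwartz_space" using * by auto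
    hence "distr_of f (\<lambda>x. a * \<phi> x + b * \<psi> x) = (LINT x|lborel. a * (f x * \<phi> x) + b * (f x * \<psi> x))"
      by (simp add: distr_of_apply[OF fb] algebra_simps)
    also have "\<dots> = a * distr_of f \<phi> + b * distr_of f \<psi>"
      using * i by (simp add: distr_of_apply[OF fb])
    finally show ?thesis .
  qed
  have "schwartz_dominated (\<lambda>\<phi>. (LINT x|lborel. norm (f x)) * schwartz_seminorm (\<lambda>_. 0) [] \<phi>)"
    by (intro schwartz_dominated_cmult schwartz_dominated_seminorm) simp
  thus "schwartz_dominated (\<lambda>\<phi>. norm (distr_of f \<phi>))"
  proof (rule schwartz_dominated_mono)
    fix \<phi> :: "real^'n \<Rightarrow> complex" assume \<phi>: "\<phi> \<in> schwartz_space"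
    have "norm (\<phi> x) \<le> schwartz_seminorm (\<lambda>_. 0) [] \<phi>" for x
      using schwartz_seminorm_upper[OF \<phi>, of "\<lambda>_. 0" x "[]"] by (simp add: monomial_fun_def)
    thus "norm (distr_of f \<phi>) \<le> (LINT x|lborel. norm (f x)) * schwartz_seminorm (\<lambda>_. 0) [] \<phi>"
      unfolding distr_of_apply[OF fb \<phi>] using schwartz_borel_measurable[OF \<phi>]
      by (intro integral_bound_mult[OF fi]) auto
  qed
qed (simp add: distr_of_def)

section \<open>Density of Schwartz functions in the tempered distributions\<close>

text \<open>The seminorms of a mollified function only involve derivatives of the Gaussian, so that the
  function itself enters through a weighted integral. The weight depends on the seminorms that
  control \<open>T\<close>, but not on the width \<open>\<delta>\<close>.\<close>

lemma tempered_mollify_bound: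
  fixes T :: "'n::finite distr"
  assumes T: "T \<in> tempered"
  shows "\<exists>N. \<forall>\<delta>>0. \<exists>C\<ge>0. \<forall>\<phi>\<in>schwartz_space.
    norm (T (mollify \<delta> \<phi>)) \<le> C * (LINT y|lborel. (1 + norm y) ^ N * norm (\<phi> y))"
proof -
  obtain D F where D: "D \<ge> 0" "finite F"
    "\<And>\<phi>. \<phi> \<in> schwartz_space \<Longrightarrow> norm (T \<phi>) \<le> D * (\<Sum>(a, is)\<in>F. schwartz_seminorm a is \<phi>)"
    using tempered_dominated[OF T] unfolding schwartz_dominated_def by auto
  define N where "N = (\<Sum>k\<in>F. sum (fst k) UNIV)"
  have N: "sum (fst k) UNIV \<le> N" if "k \<in> F" for k
    unfolding N_def using that D(2) by (intro member_le_sum) auto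
  have "\<exists>C\<ge>0. \<forall>\<phi>\<in>schwartz_space. norm (T (mollify \<delta> \<phi>)) \<le> C * (LINT y|lborel. (1 + norm y) ^ N * norm (\<phi> y))"
    if \<delta>: "\<delta> > 0" for \<delta>
  proof -
    have "\<forall>is. \<exists>c\<ge>0. \<forall>z. (1 + norm z) ^ N * norm (iter_partial is (gauss \<delta> :: real^'n \<Rightarrow> complex) z) \<le> c"
      using schwartz_decay[OF schwartz_iter_partial[OF gauss_schwartz[OF \<delta>]]] by blast
    then obtain c where c: "\<And>is. c is \<ge> 0"
      "\<And>is z. (1 + norm z) ^ N * norm (iter_partial is (gauss \<delta> :: real^'n \<Rightarrow> complex) z) \<le> c is" by metis
    have "norm (T (mollify \<delta> \<phi>)) \<le> (D * (\<Sum>k\<in>F. c (snd k))) * (LINT y|lborel. (1 + norm y) ^ N * norm (\<phi> y))"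
      if \<phi>: "\<phi> \<in> schwartz_space" for \<phi>
    proof -
      let ?I = "LINT y|lborel. (1 + norm y) ^ N * norm (\<phi> y)"
      have "schwartz_seminorm (fst k) (snd k) (mollify \<delta> \<phi>) \<le> c (snd k) * ?I" if k: "k \<in> F" for k
      proof (rule schwartz_seminorm_le)
        fix x
        let ?G = "iter_partial (snd k) (gauss \<delta> :: real^'n \<Rightarrow> complex)"
        have "iter_partial (snd k) (mollify \<delta> \<phi>) = conv (\<lambda>y. - y) \<phi> ?G"
          unfolding mollify_eq_conv[OF \<delta> \<phi>]
          by (intro conv_iter_partial schwartz_integrable \<phi> gauss_schwartz \<delta>) (auto intro: linearI)
        hence "norm (of_real (monomial_fun (fst k) x) * iter_partial (snd k) (mollify \<delta> \<phi>) x) \<le>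
            (1 + norm x) ^ sum (fst k) UNIV * norm (conv (\<lambda>y. - y) \<phi> ?G x)"
          unfolding norm_mult norm_of_real by (auto intro!: mult_right_mono abs_monomial_fun_le)
        also have "\<dots> \<le> (1 + norm x) ^ N * norm (conv (\<lambda>y. - y) \<phi> ?G x)"
          by (intro mult_right_mono power_increasing N k) auto
        also have "\<dots> \<le> ?I * c (snd k)"
          by (intro conv_weighted_bound schwartz_rapid \<phi> c schwartz_borel_measurable schwartz_iter_partial
              gauss_schwartz \<delta>) (auto intro: linearI)
        finally show "norm (of_real (monomial_fun (fst k) x) * iter_partial (snd k) (mollify \<delta> \<phi>) x) \<le> c (snd k) * ?I"
          by (simp add: mult.commute)
      qed
      hence "(\<Sum>k\<in>F. schwartz_seminorm (fst k) (snd k) (mollify \<delta> \<phi>)) \<le> (\<Sum>k\<in>F. c (snd k) * ?I)"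
        by (rule sum_mono)
      from order_trans[OF D(3)[OF mollify_schwartz[OF \<delta> \<phi>], unfolded case_prod_beta] mult_left_mono[OF this D(1)]]
      show ?thesis by (simp add: sum_distrib_right mult.assoc)
    qed
    moreover have "D * (\<Sum>k\<in>F. c (snd k)) \<ge> 0" using D(1) c(1) by (intro mult_nonneg_nonneg sum_nonneg) auto
    ultimately show ?thesis by blast
  qed
  thus ?thesis by blast
qed

text \<open>A weight that is a polynomial in the coordinates, so that multiplication by it preserves the
  Schwartz space.\<close>

definition poly_weight :: "nat \<Rightarrow> real^'n::finite \<Rightarrow> real" where
  "poly_weight p y = (1 + (norm y)\<^sup>2) ^ p"

lemma poly_weight_pos: "poly_weight p y > 0"
  unfolding poly_weight_def by (intro zero_less_power add_pos_nonneg) auto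

lemma poly_weight_mult_schwartz:
  "\<phi> \<in> schwartz_space \<Longrightarrow> (\<lambda>y. of_real (poly_weight p y) * \<phi> y) \<in> schwartz_space"
proof (induction p)
  case (Suc p)
  let ?f = "\<lambda>y. of_real (poly_weight p y) * \<phi> y"
  have "(\<lambda>y. ?f y + (\<Sum>i\<in>UNIV. of_real (y $ i) * (of_real (y $ i) * ?f y))) \<in> schwartz_space"
    by (intro schwartz_add schwartz_sum schwartz_coord_mult Suc)
  also have "(\<lambda>y. ?f y + (\<Sum>i\<in>UNIV. of_real (y $ i) * (of_real (y $ i) * ?f y))) =
      (\<lambda>y. of_real (poly_weight (Suc p) y) * \<phi> y)"
  proof
    fix y :: "real^'a"
    have "poly_weight (Suc p) y = poly_weight p y + (\<Sum>i\<in>UNIV. y $ i * (y $ i * poly_weight p y))"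
      unfolding poly_weight_def norm_power2_eq_sum
      by (simp add: distrib_right sum_distrib_right power2_eq_square mult.assoc)
    thus "?f y + (\<Sum>i\<in>UNIV. of_real (y $ i) * (of_real (y $ i) * ?f y)) = of_real (poly_weight (Suc p) y) * \<phi> y"
      by (simp add: distrib_right sum_distrib_right mult.assoc)
  qed
  finally show ?case .
qed (simp add: poly_weight_def)

lemma unit_rotation_to_real: "\<exists>c::complex. norm c = 1 \<and> c * z = of_real (norm z)"
proof (intro exI conjI)
  have "cis (- Arg z) * z = cis (- Arg z) * (of_real (norm z) * cis (Arg z))"
    using rcis_cmod_Arg[of z] by (simp add: rcis_def)
  also have "\<dots> = of_real (norm z) * (cis (- Arg z) * cis (Arg z))" by (simp only: mult.left_commute)
  finally show "cis (- Arg z) * z = of_real (norm z)" by (simp add: cis_mult)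
qed simp

text \<open>Minimize \<open>u \<mapsto> Q(u) / 2 - Re (\<Lambda> u)\<close>, where \<open>Q\<close> is the square of a weighted \<open>L\<^sub>2\<close> norm; the
  weighted \<open>L\<^sub>1\<close> bound makes this bounded from below. As in the proof of the Riesz representation
  theorem, at a minimizer the functional would be the weighted inner product with \<open>u\<close>; an
  approximate minimizer represents it up to an error that is controlled by \<open>Q\<close>, and no completeness
  is needed.\<close>

lemma approximate_riesz:
  fixes \<Lambda> :: "(real^'n \<Rightarrow> complex) \<Rightarrow> complex"
  assumes lin: "\<And>\<phi> \<psi> a b. \<phi> \<in> schwartz_space \<Longrightarrow> \<psi> \<in> schwartz_space \<Longrightarrow>
      \<Lambda> (\<lambda>x. a * \<phi> x + b * \<psi> x) = a * \<Lambda> \<phi> + b * \<Lambda> \<psi>"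
    and bnd: "\<And>\<phi>. \<phi> \<in> schwartz_space \<Longrightarrow> norm (\<Lambda> \<phi>) \<le> C * (LINT y|lborel. (1 + norm y) ^ N * norm (\<phi> y))"
    and C: "C \<ge> 0" and e: "e > 0"
  shows "\<exists>s\<in>schwartz_space. \<forall>\<phi>\<in>schwartz_space.
    norm (\<Lambda> \<phi> - (LINT y|lborel. s y * \<phi> y)) \<le>
      e * (1 + (LINT y|lborel. poly_weight (N + CARD('n)) y * (norm (\<phi> y))\<^sup>2) / 2)"
proof -
  let ?p = "N + CARD('n)"
  let ?w = "poly_weight ?p :: real^'n \<Rightarrow> real"
  define Q where "Q \<phi> = (LINT y|lborel. ?w y * (norm (\<phi> y))\<^sup>2)" for \<phi> :: "real^'n \<Rightarrow> complex"
  define J where "J u = Q u / 2 - Re (\<Lambda> u)" for u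
  have wi: "integrable lborel (\<lambda>y. of_real (?w y) * cnj (u y) * \<phi> y)"
    if "u \<in> schwartz_space" "\<phi> \<in> schwartz_space" for u \<phi>
    by (intro integrable_mult_schwartz schwartz_integrable poly_weight_mult_schwartz schwartz_cnj that)
  have sq: "of_real (?w y) * cnj (u y) * u y = of_real (?w y * (norm (u y))\<^sup>2)" for u y
    using complex_norm_square[of "u y"] by (simp add: mult_ac)
  have Qi: "integrable lborel (\<lambda>y. ?w y * (norm (u y))\<^sup>2)" if "u \<in> schwartz_space" for u
    using wi[OF that that] unfolding sq by (rule complex_of_real_integrable_eq[THEN iffD1])
  define A where "A = C\<^sup>2 * 2 ^ ?p * (LINT y|lborel. decay_weight (y :: real^'n)) / 2"
  have lower: "- A \<le> J u" if u: "u \<in> schwartz_space" for u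
  proof -
    \<comment> \<open>Young's inequality, with the polynomial weight split between the two factors so that the
      remainder is integrable.\<close>
    have pt: "C * ((1 + norm y) ^ N * norm (u y)) \<le> ?w y * (norm (u y))\<^sup>2 / 2 + C\<^sup>2 * 2 ^ ?p * decay_weight y / 2" for y
    proof -
      let ?r = "(1 + norm y) ^ N"
      have "(1 + norm y)\<^sup>2 \<le> 2 * (1 + (norm y)\<^sup>2)"
        using zero_le_power2[of "1 - norm y"] by (simp add: power2_eq_square algebra_simps)
      hence "((1 + norm y)\<^sup>2) ^ ?p \<le> (2 * (1 + (norm y)\<^sup>2)) ^ ?p" by (intro power_mono) auto
      moreover have "((1 + norm y)\<^sup>2) ^ ?p = ?r\<^sup>2 * (1 + norm y) ^ (2 * CARD('n))"
        by (simp only: power_mult[symmetric] power_add[symmetric] distrib_left mult.commute[of N])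
      moreover have "(2 * (1 + (norm y)\<^sup>2)) ^ ?p = 2 ^ ?p * ?w y"
        by (simp only: poly_weight_def power_mult_distrib)
      ultimately have "?r\<^sup>2 * (1 + norm y) ^ (2 * CARD('n)) \<le> 2 ^ ?p * ?w y" by (simp only:)
      hence "?r\<^sup>2 \<le> 2 ^ ?p * ?w y * decay_weight y"
        using one_plus_norm_pos[of y "2 * CARD('n)"] by (simp add: decay_weight_def field_simps)
      hence "(C * ?r)\<^sup>2 \<le> C\<^sup>2 * (2 ^ ?p * ?w y * decay_weight y)"
        by (simp add: power_mult_distrib mult_left_mono)
      moreover have "2 * (C * ?r) * (?w y * norm (u y)) \<le> (C * ?r)\<^sup>2 + (?w y * norm (u y))\<^sup>2"
        using zero_le_power2[of "C * ?r - ?w y * norm (u y)"] by (simp add: power2_diff)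
      ultimately have "?w y * (C * (?r * norm (u y))) \<le>
          ?w y * (?w y * (norm (u y))\<^sup>2 / 2 + C\<^sup>2 * 2 ^ ?p * decay_weight y / 2)"
        by (simp add: power2_eq_square algebra_simps)
      thus ?thesis using poly_weight_pos[of ?p y] by (simp only: mult_le_cancel_left_pos)
    qed
    have i1: "integrable lborel (\<lambda>y. ?w y * (norm (u y))\<^sup>2 / 2)"
      by (intro integrable_divide Qi u)
    have i2: "integrable lborel (\<lambda>y::real^'n. C\<^sup>2 * 2 ^ ?p * decay_weight y / 2)"
      by (intro integrable_divide integrable_mult_right integrable_decay_weight)
    have "Re (\<Lambda> u) \<le> C * (LINT y|lborel. (1 + norm y) ^ N * norm (u y))"
      using bnd[OF u] complex_Re_le_cmod[of "\<Lambda> u"] by linarith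
    also have "\<dots> = (LINT y|lborel. C * ((1 + norm y) ^ N * norm (u y)))" by simp
    also have "\<dots> \<le> (LINT y|lborel. ?w y * (norm (u y))\<^sup>2 / 2 + C\<^sup>2 * 2 ^ ?p * decay_weight y / 2)"
      by (intro integral_mono integrable_mult_right rapid_moment schwartz_rapid u pt
          Bochner_Integration.integrable_add i1 i2)
    also have "\<dots> = Q u / 2 + A"
      unfolding Bochner_Integration.integral_add[OF i1 i2] by (simp add: Q_def A_def)
    finally show ?thesis by (simp add: J_def)
  qed
  have bdd: "bdd_below (J ` schwartz_space)" using lower by (auto simp: bdd_below_def)
  have "Inf (J ` schwartz_space) < Inf (J ` schwartz_space) + e\<^sup>2" using e by simp
  from cInf_lessD[OF _ this] obtain u where u: "u \<in> schwartz_space" "J u < Inf (J ` schwartz_space) + e\<^sup>2"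
    using schwartz_zero by blast
  let ?s = "\<lambda>y. of_real (?w y) * cnj (u y)"
  have s: "?s \<in> schwartz_space" by (intro poly_weight_mult_schwartz schwartz_cnj u)
  have re: "Re (\<Lambda> \<phi> - (LINT y|lborel. ?s y * \<phi> y)) \<le> e * (1 + Q \<phi> / 2)" if \<phi>: "\<phi> \<in> schwartz_space" for \<phi>
  proof -
    \<comment> \<open>A step of length \<open>e\<close> from the approximate minimizer improves the value by at most the square
      of \<open>e\<close>, which bounds the first variation by a multiple of \<open>e\<close>.\<close>
    let ?v = "\<lambda>x. 1 * u x + of_real e * \<phi> x"
    have v: "?v \<in> schwartz_space" using u(1) \<phi> by auto
    have a: "J u - e\<^sup>2 < J ?v" using u(2) cInf_lower[OF imageI[OF v] bdd] by linarith
    have q: "Q ?v = Q u + 2 * e * Re (LINT y|lborel. ?s y * \<phi> y) + e\<^sup>2 * Q \<phi>"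
    proof -
      have eq: "?w y * (norm (?v y))\<^sup>2 =
          ?w y * (norm (u y))\<^sup>2 + 2 * e * Re (?s y * \<phi> y) + e\<^sup>2 * (?w y * (norm (\<phi> y))\<^sup>2)" for y
      proof -
        have gen: "(norm (1 * a + of_real e * b))\<^sup>2 = (norm a)\<^sup>2 + 2 * e * Re (cnj a * b) + e\<^sup>2 * (norm b)\<^sup>2"
          for a b :: complex
          unfolding cmod_power2 by (simp add: power2_eq_square) algebra
        have "Re (?s y * \<phi> y) = ?w y * Re (cnj (u y) * \<phi> y)"
          by (simp add: mult.assoc right_diff_distrib)
        thus ?thesis unfolding gen by (simp only: distrib_left mult.left_commute)
      qed
      have "Q ?v = (LINT y|lborel. ?w y * (norm (u y))\<^sup>2) + (LINT y|lborel. 2 * e * Re (?s y * \<phi> y)) +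
          (LINT y|lborel. e\<^sup>2 * (?w y * (norm (\<phi> y))\<^sup>2))"
      proof -
        have j: "integrable lborel (\<lambda>y. 2 * e * Re (?s y * \<phi> y))"
          by (intro integrable_mult_right integrable_Re wi u \<phi>)
        have q: "integrable lborel (\<lambda>y. e\<^sup>2 * (?w y * (norm (\<phi> y))\<^sup>2))"
          by (intro integrable_mult_right Qi \<phi>)
        show ?thesis
          unfolding Q_def eq Bochner_Integration.integral_add[OF Bochner_Integration.integrable_add[OF Qi[OF u(1)] j] q]
            Bochner_Integration.integral_add[OF Qi[OF u(1)] j] ..
      qed
      also have "(LINT y|lborel. 2 * e * Re (?s y * \<phi> y)) = 2 * e * Re (LINT y|lborel. ?s y * \<phi> y)"
        unfolding integral_mult_right_zero integral_Re[OF wi[OF u(1) \<phi>]] ..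
      also have "(LINT y|lborel. e\<^sup>2 * (?w y * (norm (\<phi> y))\<^sup>2)) = e\<^sup>2 * Q \<phi>"
        unfolding integral_mult_right_zero Q_def ..
      finally show ?thesis by (simp only: Q_def)
    qed
    have l: "Re (\<Lambda> ?v) = Re (\<Lambda> u) + e * Re (\<Lambda> \<phi>)"
      unfolding lin[OF u(1) \<phi>, of 1 "of_real e"] by simp
    have "e * Re (\<Lambda> \<phi>) \<le> e * Re (LINT y|lborel. ?s y * \<phi> y) + e\<^sup>2 * Q \<phi> / 2 + e\<^sup>2"
      using a q l unfolding J_def by linarith
    hence "e * (Re (\<Lambda> \<phi>) - Re (LINT y|lborel. ?s y * \<phi> y)) \<le> e * (e * (1 + Q \<phi> / 2))"
      by (simp add: power2_eq_square algebra_simps)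
    thus ?thesis using e by simp
  qed
  have fin: "norm (\<Lambda> \<phi> - (LINT y|lborel. ?s y * \<phi> y)) \<le> e * (1 + Q \<phi> / 2)" if \<phi>: "\<phi> \<in> schwartz_space" for \<phi>
  proof -
    let ?z = "\<Lambda> \<phi> - (LINT y|lborel. ?s y * \<phi> y)"
    \<comment> \<open>Rotating the test function makes the error real and nonnegative.\<close>
    obtain c where c: "norm c = 1" "c * ?z = of_real (norm ?z)" using unit_rotation_to_real by blast
    have c\<phi>: "(\<lambda>x. c * \<phi> x) \<in> schwartz_space" using \<phi> by auto
    have "\<Lambda> (\<lambda>x. c * \<phi> x) = c * \<Lambda> \<phi>" using lin[OF \<phi> \<phi>, of c 0] by simp
    moreover have "(LINT y|lborel. ?s y * (c * \<phi> y)) = c * (LINT y|lborel. ?s y * \<phi> y)"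
      by (subst integral_mult_right_zero[symmetric]) (simp add: mult_ac)
    ultimately have "Re (c * ?z) \<le> e * (1 + Q (\<lambda>x. c * \<phi> x) / 2)"
      using re[OF c\<phi>] by (simp add: right_diff_distrib)
    thus ?thesis unfolding c(2) using c(1) by (simp add: Q_def norm_mult)
  qed
  show ?thesis by (rule bexI[OF _ s], rule ballI, rule fin[unfolded Q_def])
qed

text \<open>Mollified at scale \<open>\<delta>\<close>, a tempered distribution is bounded by a weighted \<open>L\<^sub>1\<close> norm, hence it
  is represented by a Schwartz function up to an error \<open>\<delta>\<close>. Since the weight is the same for all
  scales, one sequence of such functions serves all test functions.\<close>

theorem schwartz_sequentially_dense:
  fixes T :: "'n::finite distr"
  assumes T: "T \<in> tempered"
  shows "\<exists>s. (\<forall>j. s j \<in> schwartz_space) \<and> limitin weak_topology (\<lambda>j. distr_of (s j)) T sequentially"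
proof -
  obtain N where N: "\<And>\<delta>. \<delta> > 0 \<Longrightarrow> \<exists>C\<ge>0. \<forall>\<phi>\<in>schwartz_space.
      norm (T (mollify \<delta> \<phi>)) \<le> C * (LINT y|lborel. (1 + norm y) ^ N * norm (\<phi> y))"
    using tempered_mollify_bound[OF T] by blast
  let ?Q = "\<lambda>\<phi>. LINT y|lborel. poly_weight (N + CARD('n)) (y :: real^'n) * (norm (\<phi> y :: complex))\<^sup>2"
  let ?\<delta> = "\<lambda>j::nat. inverse (real (Suc j))"
  have \<delta>: "0 < ?\<delta> j" "?\<delta> j \<le> 1" for j by (auto simp: divide_simps)
  have ex: "\<exists>s\<in>schwartz_space. \<forall>\<phi>\<in>schwartz_space.
      norm (T (mollify (?\<delta> j) \<phi>) - (LINT y|lborel. s y * \<phi> y)) \<le> ?\<delta> j * (1 + ?Q \<phi> / 2)" for j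
  proof -
    obtain C where C: "C \<ge> 0" "\<And>\<phi>. \<phi> \<in> schwartz_space \<Longrightarrow>
        norm (T (mollify (?\<delta> j) \<phi>)) \<le> C * (LINT y|lborel. (1 + norm y) ^ N * norm (\<phi> y))"
      using N[OF \<delta>(1)[of j]] by blast
    show ?thesis
    proof (rule approximate_riesz[OF _ C(2,1) \<delta>(1)])
      fix \<phi> \<psi> :: "real^'n \<Rightarrow> complex" and a b
      assume *: "\<phi> \<in> schwartz_space" "\<psi> \<in> schwartz_space"
      have g: "integrable lborel (gauss (?\<delta> j) :: real^'n \<Rightarrow> complex)"
        by (intro schwartz_integrable gauss_schwartz \<delta>)
      have i: "integrable lborel (\<lambda>y. gauss (?\<delta> j) y * \<psi> (x + y))" if \<psi>: "\<psi> \<in> schwartz_space" for \<psi> and x :: "real^'n"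
      proof -
        obtain S where S: "\<And>x. norm (\<psi> x) \<le> S" using schwartz_bounded[OF \<psi>] by (auto simp: bounded_iff)
        show ?thesis using conv_integrand_measurable[OF linear_id[unfolded id_def] schwartz_borel_measurable[OF \<psi>]]
          by (intro integrable_mult_bounded[OF g _ S]) auto
      qed
      have "mollify (?\<delta> j) (\<lambda>x. a * \<phi> x + b * \<psi> x) = (\<lambda>x. a * mollify (?\<delta> j) \<phi> x + b * mollify (?\<delta> j) \<psi> x)"
      proof
        fix x
        have "mollify (?\<delta> j) (\<lambda>x. a * \<phi> x + b * \<psi> x) x =
            (LINT y|lborel. a * (gauss (?\<delta> j) y * \<phi> (x + y)) + b * (gauss (?\<delta> j) y * \<psi> (x + y)))"
          by (simp add: mollify_def conv_def algebra_simps)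
        also have "\<dots> = a * mollify (?\<delta> j) \<phi> x + b * mollify (?\<delta> j) \<psi> x"
          using i[OF *(1), of x] i[OF *(2), of x] by (simp add: mollify_def conv_def)
        finally show "mollify (?\<delta> j) (\<lambda>x. a * \<phi> x + b * \<psi> x) x = a * mollify (?\<delta> j) \<phi> x + b * mollify (?\<delta> j) \<psi> x" .
      qed
      thus "T (mollify (?\<delta> j) (\<lambda>x. a * \<phi> x + b * \<psi> x)) = a * T (mollify (?\<delta> j) \<phi>) + b * T (mollify (?\<delta> j) \<psi>)"
        using tempered_linear[OF T mollify_schwartz[OF \<delta>(1) *(1)] mollify_schwartz[OF \<delta>(1) *(2)]] by (simp only:)
    qed
  qed
  define P where "P j s \<longleftrightarrow> s \<in> schwartz_space \<and> (\<forall>\<phi>\<in>schwartz_space.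
      norm (T (mollify (?\<delta> j) \<phi>) - (LINT y|lborel. s y * \<phi> y)) \<le> ?\<delta> j * (1 + ?Q \<phi> / 2))" for j s
  have "\<exists>s. P j s" for j using ex[of j] unfolding P_def by blast
  then obtain s where Ps: "\<And>j. P j (s j)" by metis
  hence s: "s j \<in> schwartz_space" for j by (simp add: P_def)
  have s': "norm (T (mollify (?\<delta> j) \<phi>) - (LINT y|lborel. s j y * \<phi> y)) \<le> ?\<delta> j * (1 + ?Q \<phi> / 2)"
    if "\<phi> \<in> schwartz_space" for j \<phi>
    using Ps[of j] that unfolding P_def by blast
  have "(\<lambda>j. distr_of (s j) \<phi>) \<longlonglongrightarrow> T \<phi>" if \<phi>: "\<phi> \<in> schwartz_space" for \<phi>
  proof -
    obtain C where C: "C \<ge> 0" "\<And>\<epsilon>. 0 < \<epsilon> \<Longrightarrow> \<epsilon> \<le> 1 \<Longrightarrow> norm (T (mollify \<epsilon> \<phi>) - T \<phi>) \<le> C * \<epsilon>"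
      using tempered_mollify_close[OF T \<phi>] by blast
    define K where "K = C + (1 + ?Q \<phi> / 2)"
    have bnd: "norm (distr_of (s j) \<phi> - T \<phi>) \<le> K * ?\<delta> j" for j
    proof -
      have "distr_of (s j) \<phi> - T \<phi> = (T (mollify (?\<delta> j) \<phi>) - T \<phi>) - (T (mollify (?\<delta> j) \<phi>) - distr_of (s j) \<phi>)"
        by simp
      also have "norm \<dots> \<le> C * ?\<delta> j + ?\<delta> j * (1 + ?Q \<phi> / 2)"
        unfolding distr_of_apply[OF schwartz_borel_measurable[OF s] \<phi>]
        by (intro norm_triangle_le_diff add_mono C \<delta> s' \<phi>)
      also have "\<dots> = K * ?\<delta> j" unfolding K_def distrib_right mult.commute[of "?\<delta> j"] by simp
      finally show ?thesis .
    qed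
    have "(\<lambda>j. K * ?\<delta> j) \<longlonglongrightarrow> K * 0" by (intro tendsto_mult tendsto_const LIMSEQ_inverse_real_of_nat)
    hence lim: "(\<lambda>j. K * ?\<delta> j) \<longlonglongrightarrow> 0" by (simp only: mult_zero_right)
    have "(\<lambda>j. distr_of (s j) \<phi> - T \<phi>) \<longlonglongrightarrow> 0"
      by (rule Lim_null_comparison[OF always_eventually lim]) (rule allI, rule bnd)
    thus ?thesis by (simp add: LIM_zero_iff)
  qed
  thus ?thesis using s T distr_of_tempered
    by (intro exI[of _ s]) (auto simp: limitin_weak_topology intro!: always_eventually)
qed

section \<open>Integrable functions are determined by their distributions\<close>

lemma bounded_indicator_rapid:
  fixes A :: "(real^'n) set"
  assumes "bounded A" "A \<in> sets borel"
  shows "rapid (indicator A)"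
proof (rule rapidI)
  obtain R where R: "\<And>x. x \<in> A \<Longrightarrow> norm x \<le> R" using assms(1) by (auto simp: bounded_iff)
  fix N
  have "(1 + norm x) ^ N * norm (indicator A x :: complex) \<le> (1 + \<bar>R\<bar>) ^ N" for x
  proof (cases "x \<in> A")
    case True
    hence "(1 + norm x) ^ N \<le> (1 + \<bar>R\<bar>) ^ N" using R[of x] by (intro power_mono) auto
    thus ?thesis using True by simp
  qed simp
  thus "\<exists>c. \<forall>x. (1 + norm x) ^ N * norm (indicator A x :: complex) \<le> c" by blast
qed (use assms(2) in simp)

text \<open>Off the frontier the indicator is constant near the point, so the difference is at most the
  distance divided by the radius of a ball of constancy, and the first moment of the Gaussian
  applies.\<close>

lemma smoothed_indicator_tendsto:
  fixes A :: "(real^'n) set"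
  assumes A: "A \<in> sets borel" and x: "x \<notin> frontier A"
  shows "(\<lambda>j. conv (\<lambda>y. - y) (indicator A) (gauss (inverse (real (Suc j)))) x) \<longlonglongrightarrow> (indicator A x :: complex)"
proof -
  have "\<exists>d>0. \<forall>z. norm z < d \<longrightarrow> (indicator A (x + z) :: complex) = indicator A x"
  proof (cases "x \<in> interior A")
    case True
    then obtain d where "d > 0" "ball x d \<subseteq> A" using mem_interior by blast
    thus ?thesis using True interior_subset[of A]
      by (intro exI[of _ d]) (auto simp: indicator_def dist_norm subset_iff)
  next
    case False
    hence "x \<in> - closure A" using x by (simp add: frontier_def)
    then obtain d where d: "d > 0" "ball x d \<subseteq> - closure A"
      using open_contains_ball[of "- closure A"] by (auto simp: open_Compl)
    have "x + z \<notin> A" if "norm z < d" for z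
      using d(2) that closure_subset[of A] by (auto simp: dist_norm subset_iff)
    from this this[of 0] show ?thesis using d(1) by (intro exI[of _ d]) (auto simp: indicator_def)
  qed
  then obtain d where d: "d > 0" "\<And>z. norm z < d \<Longrightarrow> (indicator A (x + z) :: complex) = indicator A x" by blast
  from gaussian_moment[of 0, where 'n = 'n] obtain C where C0: "C \<ge> 0" and "\<forall>\<epsilon>. 0 < \<epsilon> \<and> \<epsilon> \<le> 1 \<longrightarrow>
    integrable lborel (\<lambda>y::real^'n. norm y * (1 + norm y) ^ 0 * gaussian \<epsilon> y) \<and>
    (LINT y|lborel. norm (y::real^'n) * (1 + norm y) ^ 0 * gaussian \<epsilon> y) \<le> C * \<epsilon>"
    by (elim exE conjE) (rule that)
  hence C: "integrable lborel (\<lambda>y::real^'n. norm y * gaussian \<epsilon> y)"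
    "(LINT y|lborel. norm (y::real^'n) * gaussian \<epsilon> y) \<le> C * \<epsilon>"
    if "0 < \<epsilon>" "\<epsilon> \<le> 1" for \<epsilon>
    using that by simp_all
  have le: "norm (conv (\<lambda>y. - y) (indicator A) (gauss \<epsilon>) x - indicator A x) \<le> (C / d) * \<epsilon>"
    if e: "0 < \<epsilon>" "\<epsilon> \<le> 1" for \<epsilon>
  proof -
    have gi: "integrable lborel (gauss \<epsilon> :: real^'n \<Rightarrow> complex)"
      by (intro schwartz_integrable gauss_schwartz e)
    have m: "(\<lambda>z. indicator A (x + z) :: complex) \<in> borel_measurable borel"
      using A by measurable
    have i1: "integrable lborel (\<lambda>z. gauss \<epsilon> z * indicator A (x + z))"
      using m by (intro integrable_mult_bounded[OF gi, where C = 1]) (auto simp: indicator_def)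
    have i2: "integrable lborel (\<lambda>z::real^'n. gauss \<epsilon> z * indicator A x)" by (intro integrable_mult_left gi)
    let ?f = "\<lambda>y. indicator A y * gauss \<epsilon> (x - y)"
    have "conv (\<lambda>y. - y) (indicator A) (gauss \<epsilon>) x = (LINT y|lborel. ?f y)"
      by (simp add: conv_def)
    also have "\<dots> = (LINT z|lborel. ?f (x + z))"
      by (rule integral_lborel_translate[symmetric]) (use A in measurable)
    also have "\<dots> = (LINT z|lborel. gauss \<epsilon> z * indicator A (x + z))"
      by (simp add: mult.commute)
    moreover have "(LINT z::real^'n|lborel. gauss \<epsilon> z * indicator A x) = indicator A x"
      using gaussian_integral(2)[OF e(1), where 'n = 'n] by simp
    ultimately have "conv (\<lambda>y. - y) (indicator A) (gauss \<epsilon>) x - indicator A x =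
        (LINT z|lborel. gauss \<epsilon> z * indicator A (x + z) - gauss \<epsilon> z * indicator A x)"
      using i1 i2 by simp
    also have "norm \<dots> \<le> (LINT z::real^'n|lborel. (norm z * gaussian \<epsilon> z) / d)"
    proof (rule integral_norm_le_integral)
      show "integrable lborel (\<lambda>z. gauss \<epsilon> z * indicator A (x + z) - gauss \<epsilon> z * indicator A x)"
        by (intro Bochner_Integration.integrable_diff i1 i2)
      show "integrable lborel (\<lambda>z::real^'n. (norm z * gaussian \<epsilon> z) / d)" by (intro integrable_divide C e)
      fix z :: "real^'n"
      have "norm (indicator A (x + z) - indicator A x :: complex) \<le> norm z / d"
      proof (cases "norm z < d")
        case True
        thus ?thesis using d(1) d(2)[OF True] by simp
      next
        case False
        hence "1 \<le> norm z / d" using d(1) by simp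
        thus ?thesis using d(1) by (auto simp: indicator_def)
      qed
      from mult_left_mono[OF this gaussian_nonneg[of \<epsilon> z]]
      show "norm (gauss \<epsilon> z * indicator A (x + z) - gauss \<epsilon> z * indicator A x) \<le> norm z * gaussian \<epsilon> z / d"
        unfolding right_diff_distrib[symmetric] norm_mult norm_of_real by (simp add: gaussian_nonneg mult.commute)
    qed
    also have "\<dots> = (LINT z::real^'n|lborel. norm z * gaussian \<epsilon> z) / d" by simp
    also have "\<dots> \<le> C * \<epsilon> / d" using C(2)[OF e] d(1) by (intro divide_right_mono) auto
    finally show ?thesis by simp
  qed
  let ?\<delta> = "\<lambda>j::nat. inverse (real (Suc j))"
  have \<delta>: "0 < ?\<delta> j" "?\<delta> j \<le> 1" for j by (auto simp: divide_simps)
  have "(\<lambda>j. (C / d) * ?\<delta> j) \<longlonglongrightarrow> (C / d) * 0" by (intro tendsto_mult tendsto_const LIMSEQ_inverse_real_of_nat)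
  hence lim: "(\<lambda>j. (C / d) * ?\<delta> j) \<longlonglongrightarrow> 0" by (simp only: mult_zero_right)
  have "(\<lambda>j. conv (\<lambda>y. - y) (indicator A) (gauss (?\<delta> j)) x - indicator A x) \<longlonglongrightarrow> 0"
    by (rule Lim_null_comparison[OF always_eventually lim]) (rule allI, rule le[OF \<delta>])
  thus ?thesis by (simp only: LIM_zero_iff)
qed

text \<open>The fundamental lemma of the calculus of variations. Smoothed indicators show that the integral
  over every box vanishes, and the boxes generate the Borel sets.\<close>

lemma annihilates_schwartz_imp_AE_zero:
  fixes H :: "real^'n \<Rightarrow> complex"
  assumes H: "integrable lborel H" and z: "\<And>\<phi>. \<phi> \<in> schwartz_space \<Longrightarrow> (LINT x|lborel. H x * \<phi> x) = 0"
  shows "AE x in lborel. H x = 0"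
proof -
  have [measurable]: "H \<in> borel_measurable borel" using borel_measurable_integrable[OF H] by simp
  let ?\<delta> = "\<lambda>j::nat. inverse (real (Suc j))"
  have \<delta>: "0 < ?\<delta> j" for j by simp
  have conv0: "(LINT x|lborel. H x * f x) = 0"
    if \<psi>: "\<And>j. \<psi> j \<in> schwartz_space" and le: "\<And>j x. norm (\<psi> j x) \<le> 1"
      and lim: "AE x in lborel. (\<lambda>j. \<psi> j x) \<longlonglongrightarrow> f x" and f[measurable]: "f \<in> borel_measurable borel"
    for \<psi> :: "nat \<Rightarrow> real^'n \<Rightarrow> complex" and f
  proof -
    have "(\<lambda>j. LINT x|lborel. H x * \<psi> j x) \<longlonglongrightarrow> (LINT x|lborel. H x * f x)"
    proof (rule integral_dominated_convergence[where w = "\<lambda>x. norm (H x)"])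
      show "(\<lambda>x. H x * \<psi> j x) \<in> borel_measurable lborel" for j
        using schwartz_borel_measurable[OF \<psi>[of j]] by measurable
      show "AE x in lborel. (\<lambda>j. H x * \<psi> j x) \<longlonglongrightarrow> H x * f x"
        using lim by eventually_elim (intro tendsto_mult tendsto_const)
      show "AE x in lborel. norm (H x * \<psi> j x) \<le> norm (H x)" for j
        using le[of j] by (intro AE_I2) (auto simp: norm_mult intro: mult_left_le)
    qed (use H in auto)
    thus ?thesis unfolding z[OF \<psi>] using LIMSEQ_unique[OF tendsto_const] by metis
  qed
  have box: "(LINT x|lborel. H x * indicator (box a b) x) = 0" for a b :: "real^'n"
  proof (rule conv0)
    let ?\<psi> = "\<lambda>j. conv (\<lambda>y. - y) (indicator (box a b)) (gauss (?\<delta> j))"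
    have r: "rapid (indicator (box a b) :: real^'n \<Rightarrow> complex)"
      by (intro bounded_indicator_rapid) auto
    show "?\<psi> j \<in> schwartz_space" for j
      by (intro conv_schwartz r gauss_schwartz \<delta>) (auto intro: linearI)
    show "norm (?\<psi> j x) \<le> 1" for j x
    proof -
      let ?f = "\<lambda>y. indicator (box a b) y * gauss (?\<delta> j) (x - y)"
      have gi: "integrable lborel (gauss (?\<delta> j) :: real^'n \<Rightarrow> complex)"
        by (intro schwartz_integrable gauss_schwartz \<delta>)
      have "?\<psi> j x = (LINT y|lborel. ?f y)" by (simp add: conv_def)
      also have "\<dots> = (LINT z|lborel. ?f (x + z))"
        by (rule integral_lborel_translate[symmetric]) measurable
      also have "\<dots> = (LINT z|lborel. gauss (?\<delta> j) z * indicator (box a b) (x + z))"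
        by (simp add: mult.commute)
      also have "norm \<dots> \<le> (LINT z::real^'n|lborel. norm (gauss (?\<delta> j) z)) * 1"
        by (intro integral_bound_mult gi) (measurable, auto simp: indicator_def)
      also have "\<dots> = 1" using gaussian_integral(2)[OF \<delta>[of j], where 'n = 'n] by (simp add: gaussian_nonneg)
      finally show ?thesis .
    qed
    have "negligible (frontier (box a b))" by (intro negligible_convex_frontier convex_box)
    hence "AE x in lebesgue. x \<notin> frontier (box a b)"
      by (simp add: negligible_iff_null_sets AE_not_in)
    hence "AE x in lborel. x \<notin> frontier (box a b)" by (simp add: AE_completion_iff)
    thus "AE x in lborel. (\<lambda>j. ?\<psi> j x) \<longlonglongrightarrow> indicator (box a b) x"
      by eventually_elim (intro smoothed_indicator_tendsto, auto)
  qed simp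
  \<comment> \<open>The integral over the whole space is needed for complements, and a box is bounded.\<close>
  have total: "(LINT x|lborel. H x * 1) = 0"
  proof (rule conv0)
    show "(\<lambda>x::real^'n. of_real (coord_gauss (?\<delta> j) UNIV x)) \<in> schwartz_space" for j
      by (rule coord_gauss_schwartz[OF \<delta>])
    show "norm (complex_of_real (coord_gauss (?\<delta> j) UNIV (x::real^'n))) \<le> 1" for j x
      using \<delta>[of j] by (simp add: coord_gauss_def sum_nonneg)
    have "(\<lambda>j. coord_gauss (?\<delta> j) UNIV x) \<longlonglongrightarrow> exp (- (0 * (\<Sum>j\<in>UNIV. (x $ j)\<^sup>2)))" for x :: "real^'n"
      unfolding coord_gauss_def by (intro tendsto_intros LIMSEQ_inverse_real_of_nat)
    hence "(\<lambda>j. complex_of_real (coord_gauss (?\<delta> j) UNIV x)) \<longlonglongrightarrow> of_real 1" for x :: "real^'n"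
      by (intro tendsto_of_real) simp
    thus "AE x::real^'n in lborel. (\<lambda>j. complex_of_real (coord_gauss (?\<delta> j) UNIV x)) \<longlonglongrightarrow> 1"
      by (intro AE_I2) simp
  qed simp
  have si: "set_integrable lborel A H" if "A \<in> sets borel" for A
    unfolding set_integrable_def using that H by (intro integrable_mult_indicator) auto
  have all: "(LINT x:A|lborel. H x) = 0" if "A \<in> sets borel" for A
  proof -
    let ?G = "range (\<lambda>(a, b). box a b :: (real^'n) set)"
    have "Int_stable ?G" by (auto simp: Int_stable_def box_Int_box)
    moreover have "?G \<subseteq> Pow UNIV" by auto
    moreover have "A \<in> sigma_sets UNIV ?G" using that unfolding borel_eq_box by simp
    ultimately show ?thesis
    proof (induction rule: sigma_sets_induct_disjoint)
      case (basic A)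
      then obtain a b where "A = box a b" by auto
      moreover have "(LINT x|lborel. indicat_real (box a b) x *\<^sub>R H x) = (LINT x|lborel. H x * indicator (box a b) x)"
        by (intro Bochner_Integration.integral_cong) (auto simp: indicator_def)
      ultimately show ?case using box[of a b] by (simp add: set_lebesgue_integral_def)
    next
      case (compl A)
      hence A: "A \<in> sets borel" unfolding borel_eq_box by simp
      have "(LINT x:UNIV - A|lborel. H x) = (LINT x|lborel. H x - indicat_real A x *\<^sub>R H x)"
        unfolding set_lebesgue_integral_def
        by (intro Bochner_Integration.integral_cong) (auto simp: indicator_def)
      also have "\<dots> = 0"
        using H si[OF A] total compl by (simp add: set_integrable_def set_lebesgue_integral_def)
      finally show ?case .
    next
      case (union f)
      have "f i \<in> sigma_sets UNIV ?G" for i using union(2) by blast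
      hence f: "f i \<in> sets borel" for i unfolding borel_eq_box by simp
      have "(LINT x:(\<Union>i. f i)|lborel. H x) = (\<Sum>i. LINT x:f i|lborel. H x)"
        using union(1) f by (intro lebesgue_integral_countable_add si) (auto simp: disjoint_family_on_def)
      thus ?case using union by simp
    qed (simp add: set_lebesgue_integral_def)
  qed
  have "AE x in lborel. Re (H x) = 0"
  proof (rule density_unique_real)
    fix A :: "(real^'n) set" assume "A \<in> sets lborel"
    hence A: "A \<in> sets borel" by simp
    have "(LINT x:A|lborel. Re (H x)) = (LINT x|lborel. Re (indicat_real A x *\<^sub>R H x))"
      by (simp add: set_lebesgue_integral_def)
    also have "\<dots> = Re (LINT x|lborel. indicat_real A x *\<^sub>R H x)"
      by (rule integral_Re[OF si[OF A, unfolded set_integrable_def]])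
    also have "\<dots> = 0" using all[OF A] by (simp add: set_lebesgue_integral_def)
    finally show "(LINT x:A|lborel. Re (H x)) = (LINT x:A|lborel. 0)" by (simp add: set_lebesgue_integral_def)
  qed (use H in auto)
  moreover have "AE x in lborel. Im (H x) = 0"
  proof (rule density_unique_real)
    fix A :: "(real^'n) set" assume "A \<in> sets lborel"
    hence A: "A \<in> sets borel" by simp
    have "(LINT x:A|lborel. Im (H x)) = (LINT x|lborel. Im (indicat_real A x *\<^sub>R H x))"
      by (simp add: set_lebesgue_integral_def)
    also have "\<dots> = Im (LINT x|lborel. indicat_real A x *\<^sub>R H x)"
      by (rule integral_Im[OF si[OF A, unfolded set_integrable_def]])
    also have "\<dots> = 0" using all[OF A] by (simp add: set_lebesgue_integral_def)
    finally show "(LINT x:A|lborel. Im (H x)) = (LINT x:A|lborel. 0)" by (simp add: set_lebesgue_integral_def)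
  qed (use H in auto)
  ultimately show ?thesis by eventually_elim (simp add: complex_eq_iff)
qed

lemma lebesgue_measurable_ex_borel:
  fixes g :: "'a::euclidean_space \<Rightarrow> complex"
  assumes "g \<in> borel_measurable lebesgue"
  shows "\<exists>g'\<in>borel_measurable borel. AE x in lborel. g x = g' x"
proof -
  have "(\<lambda>x. Re (g x)) \<in> borel_measurable lebesgue" "(\<lambda>x. Im (g x)) \<in> borel_measurable lebesgue"
    using assms by auto
  then obtain r i where ri: "r \<in> borel_measurable lborel" "AE x in lborel. Re (g x) = r x"
    "i \<in> borel_measurable lborel" "AE x in lborel. Im (g x) = i x"
    using completion_ex_borel_measurable_real by metis
  have "(\<lambda>x. Complex (r x) (i x)) \<in> borel_measurable borel"
    unfolding Complex_eq using ri(1,3) by measurable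
  moreover have "AE x in lborel. g x = Complex (r x) (i x)"
    using ri(2,4) by eventually_elim (simp add: complex_eq_iff)
  ultimately show ?thesis by (intro bexI[of _ "\<lambda>x. Complex (r x) (i x)"])
qed

text \<open>The first function is integrable for the completed measure only, so it is replaced by a Borel
  function that agrees with it almost everywhere.\<close>

lemma distr_of_eq_imp_AE_eq:
  fixes F G :: "real^'n \<Rightarrow> complex"
  assumes F: "integrable lebesgue F" and G: "integrable lborel G" and eq: "distr_of F = distr_of G"
  shows "AE x in lborel. F x = G x"
proof -
  obtain F' where F': "F' \<in> borel_measurable borel" "AE x in lborel. F x = F' x"
    using lebesgue_measurable_ex_borel[OF borel_measurable_integrable[OF F]] by blast
  have Gb: "G \<in> borel_measurable borel" using borel_measurable_integrable[OF G] by simp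
  have F'l: "F' \<in> borel_measurable lebesgue" using F'(1) by (simp add: measurable_completion)
  have ae: "AE x in lebesgue. F x = F' x" using F'(2) by (rule AE_completion)
  have "integrable lebesgue F'"
    using F integrable_cong_AE[OF borel_measurable_integrable[OF F] F'l ae] by simp
  hence F'i: "integrable lborel F'" using F'(1) integrable_completion[of F' lborel] by simp
  have "AE x in lborel. F' x - G x = 0"
  proof (rule annihilates_schwartz_imp_AE_zero)
    show "integrable lborel (\<lambda>x. F' x - G x)" using F'i G by simp
    fix \<phi> :: "real^'n \<Rightarrow> complex" assume \<phi>: "\<phi> \<in> schwartz_space"
    have \<phi>m: "\<phi> \<in> borel_measurable lebesgue"
      using schwartz_borel_measurable[OF \<phi>] by (simp add: measurable_completion)
    have "distr_of F \<phi> = (LINT x|lebesgue. F' x * \<phi> x)"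
      unfolding distr_of_def restrict_apply using \<phi>
    proof (simp, intro integral_cong_AE)
      show "AE x in lebesgue. F x * \<phi> x = F' x * \<phi> x" using ae by eventually_elim simp
    qed (use borel_measurable_integrable[OF F] F'l \<phi>m in measurable)
    also have "\<dots> = (LINT x|lborel. F' x * \<phi> x)"
      by (intro integral_lebesgue_lborel borel_measurable_times F' schwartz_borel_measurable \<phi>)
    finally have "(LINT x|lborel. F' x * \<phi> x) = (LINT x|lborel. G x * \<phi> x)"
      unfolding eq distr_of_apply[OF Gb \<phi>] ..
    thus "(LINT x|lborel. (F' x - G x) * \<phi> x) = 0"
      using integrable_mult_schwartz[OF F'i \<phi>] integrable_mult_schwartz[OF G \<phi>]
      by (simp add: left_diff_distrib)
  qed
  with F'(2) show ?thesis by eventually_elim simp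
qed

section \<open>Convolution and integration\<close>

lemma conv_integrable_pair:
  fixes L :: "real^'k \<Rightarrow> real^'n" and g :: "real^'k \<Rightarrow> complex" and \<phi> :: "real^'n \<Rightarrow> complex"
  assumes L: "linear L" and g: "integrable lborel g" and \<phi>: "integrable lborel \<phi>"
  shows "integrable (lborel \<Otimes>\<^sub>M lborel) (\<lambda>(y, x). g y * \<phi> (x + L y))"
proof (rule lborel_pair.Fubini_integrable)
  have [measurable]: "g \<in> borel_measurable borel" "\<phi> \<in> borel_measurable borel" "L \<in> borel_measurable borel"
    using borel_measurable_integrable[OF g] borel_measurable_integrable[OF \<phi>] linear_borel_measurable[OF L]
    by simp_all
  show "(\<lambda>(y, x). g y * \<phi> (x + L y)) \<in> borel_measurable (lborel \<Otimes>\<^sub>M lborel)"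
    by measurable
  have tr: "integrable lborel (\<lambda>x. \<phi> (x + c))" for c
    using \<phi> by (subst (asm) lborel_distr_plus[symmetric, of c], subst (asm) integrable_distr_eq)
      (auto simp: add.commute)
  have nrm: "(LINT x|lborel. norm (g y * \<phi> (x + L y))) = norm (g y) * (LINT x|lborel. norm (\<phi> x))" for y
  proof -
    have "(LINT x|lborel. complex_of_real (norm (\<phi> (L y + x)))) = (LINT x|lborel. complex_of_real (norm (\<phi> x)))"
      by (rule integral_lborel_translate) measurable
    hence "(LINT x|lborel. norm (\<phi> (x + L y))) = (LINT x|lborel. norm (\<phi> x))"
      by (simp only: integral_complex_of_real of_real_eq_iff add.commute)
    thus ?thesis by (simp add: norm_mult)
  qed
  show "integrable lborel (\<lambda>y. LINT x|lborel. norm (case (y, x) of (y, x) \<Rightarrow> g y * \<phi> (x + L y)))"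
    using g by (simp add: nrm)
  show "AE y in lborel. integrable lborel (\<lambda>x. case (y, x) of (y, x) \<Rightarrow> g y * \<phi> (x + L y))"
    by (intro AE_I2) (simp add: tr)
qed

lemma conv_L1_le:
  fixes L :: "real^'k \<Rightarrow> real^'n"
  assumes L: "linear L" and g: "integrable lborel g" and \<phi>: "integrable lborel \<phi>"
  shows "integrable lborel (conv L g \<phi>)"
    "(LINT x|lborel. norm (conv L g \<phi> x)) \<le> (LINT y|lborel. norm (g y)) * (LINT x|lborel. norm (\<phi> x))"
proof -
  note i = conv_integrable_pair[OF assms]
  let ?h = "\<lambda>y x. g y * \<phi> (x + L y)"
  have i': "integrable (lborel \<Otimes>\<^sub>M lborel) (\<lambda>(y, x). norm (?h y x))"
    using integrable_norm[OF i] by (simp add: case_prod_beta')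
  show ci: "integrable lborel (conv L g \<phi>)"
    using lborel_pair.integrable_snd[OF i] unfolding conv_def[abs_def] .
  have \<phi>b: "\<phi> \<in> borel_measurable borel" using borel_measurable_integrable[OF \<phi>] by simp
  have nrm: "(LINT x|lborel. norm (?h y x)) = norm (g y) * (LINT x|lborel. norm (\<phi> x))" for y
  proof -
    have "(LINT x|lborel. complex_of_real (norm (\<phi> (L y + x)))) = (LINT x|lborel. complex_of_real (norm (\<phi> x)))"
      by (rule integral_lborel_translate) (use \<phi>b in measurable)
    hence "(LINT x|lborel. norm (\<phi> (x + L y))) = (LINT x|lborel. norm (\<phi> x))"
      by (simp only: integral_complex_of_real of_real_eq_iff add.commute)
    thus ?thesis by (simp add: norm_mult)
  qed
  have "(LINT x|lborel. norm (conv L g \<phi> x)) \<le> (LINT x|lborel. LINT y|lborel. norm (?h y x))"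
    unfolding conv_def
    by (intro integral_mono integrable_norm lborel_pair.integrable_snd[OF i] lborel_pair.integrable_snd[OF i'] integral_norm_bound)
  also have "\<dots> = (LINT y|lborel. LINT x|lborel. norm (?h y x))"
    by (rule lborel_pair.Fubini_integral[OF i'])
  also have "\<dots> = (LINT y|lborel. norm (g y)) * (LINT x|lborel. norm (\<phi> x))"
    by (simp add: nrm)
  finally show "(LINT x|lborel. norm (conv L g \<phi> x)) \<le> (LINT y|lborel. norm (g y)) * (LINT x|lborel. norm (\<phi> x))" .
qed

lemma integral_conv_gauss_mult:
  fixes L :: "real^'k \<Rightarrow> real^'n"
  assumes L: "linear L" and g: "integrable lborel g" and e: "\<epsilon> > 0" and \<phi>: "\<phi> \<in> schwartz_space"
  shows "(LINT x|lborel. conv (\<lambda>y. - L y) g (gauss \<epsilon>) x * \<phi> x) = (LINT y|lborel. g y * mollify \<epsilon> \<phi> (L y))"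
proof -
  have L': "linear (\<lambda>y. - L y)" by (intro linear_compose_neg L)
  have gi: "integrable lborel (gauss \<epsilon> :: real^'n \<Rightarrow> complex)"
    by (intro schwartz_integrable gauss_schwartz e)
  have \<phi>b [measurable]: "\<phi> \<in> borel_measurable borel" by (rule schwartz_borel_measurable[OF \<phi>])
  obtain S where S: "\<And>x. norm (\<phi> x) \<le> S" using schwartz_bounded[OF \<phi>] by (auto simp: bounded_iff)
  let ?h = "\<lambda>y x. g y * gauss \<epsilon> (x + - L y) * \<phi> x"
  have "integrable (lborel \<Otimes>\<^sub>M lborel) (\<lambda>z. (case z of (y, x) \<Rightarrow> g y * gauss \<epsilon> (x + - L y)) * \<phi> (snd z))"
    by (rule integrable_mult_bounded[OF conv_integrable_pair[OF L' g gi] _ S]) measurable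
  hence i: "integrable (lborel \<Otimes>\<^sub>M lborel) (\<lambda>(y, x). ?h y x)" by (simp add: case_prod_beta')
  have "(LINT x|lborel. conv (\<lambda>y. - L y) g (gauss \<epsilon>) x * \<phi> x) = (LINT x|lborel. LINT y|lborel. ?h y x)"
    by (simp add: conv_def)
  also have "\<dots> = (LINT y|lborel. LINT x|lborel. ?h y x)" by (rule lborel_pair.Fubini_integral[OF i])
  also have "\<dots> = (LINT y|lborel. g y * mollify \<epsilon> \<phi> (L y))"
  proof (intro Bochner_Integration.integral_cong refl)
    fix y
    let ?f = "\<lambda>x. gauss \<epsilon> (x - L y) * \<phi> x"
    have "(LINT x|lborel. ?h y x) = g y * (LINT x|lborel. ?f x)"
      by (simp add: mult.assoc)
    also have "(LINT x|lborel. ?f x) = (LINT z|lborel. ?f (L y + z))"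
      by (rule integral_lborel_translate[symmetric]) measurable
    also have "\<dots> = mollify \<epsilon> \<phi> (L y)" by (simp add: mollify_def conv_def)
    finally show "(LINT x|lborel. ?h y x) = g y * mollify \<epsilon> \<phi> (L y)" .
  qed
  finally show ?thesis .
qed

section \<open>The sesquilinear form of a bounded kernel\<close>

lemma proper_kernel_measurable: "proper_kernel M \<Longrightarrow> case_prod M \<in> borel_measurable lebesgue"
  by (simp add: proper_kernel_def)

lemma proper_kernel_bounded:
  assumes "proper_kernel M"
  obtains B where "B \<ge> 0" "\<And>x y. norm (M x y) \<le> B"
proof -
  have "bounded (range (case_prod M))" using assms by (simp add: proper_kernel_def)
  then obtain B where "\<forall>z. norm (case_prod M z) \<le> B" by (auto simp: bounded_iff)
  hence B: "norm (M x y) \<le> B" for x y by (metis case_prod_conv)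
  from order_trans[OF norm_ge_zero B] B show ?thesis by (rule that)
qed

lemma integrable_tensor:
  fixes f :: "real^'n \<Rightarrow> complex" and g :: "real^'m \<Rightarrow> complex"
  assumes f: "integrable lborel f" and g: "integrable lborel g"
  shows "integrable lborel (\<lambda>z. f (fst z) * g (snd z))"
    "(LINT z|lborel. norm (f (fst z) * g (snd z))) = (LINT x|lborel. norm (f x)) * (LINT y|lborel. norm (g y))"
proof -
  have "integrable (lborel \<Otimes>\<^sub>M lborel) (\<lambda>(x, y). f x * g (y + 0))"
    by (rule conv_integrable_pair[OF linear_zero f g])
  hence i: "integrable (lborel \<Otimes>\<^sub>M lborel) (\<lambda>(x, y). f x * g y)" by simp
  from integrable_norm[OF i] have i': "integrable (lborel \<Otimes>\<^sub>M lborel) (\<lambda>(x, y). norm (f x * g y))"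
    by (simp add: case_prod_beta')
  show "integrable lborel (\<lambda>z. f (fst z) * g (snd z))"
    using i unfolding lborel_prod by (simp add: case_prod_beta')
  have "(LINT z|lborel. norm (f (fst z) * g (snd z))) = integral\<^sup>L (lborel \<Otimes>\<^sub>M lborel) (\<lambda>(x, y). norm (f x * g y))"
    unfolding lborel_prod by (simp add: case_prod_beta')
  also have "\<dots> = (LINT x|lborel. LINT y|lborel. norm (f x * g y))"
    by (rule lborel_pair.integral_fst[OF i', symmetric])
  finally show "(LINT z|lborel. norm (f (fst z) * g (snd z))) =
      (LINT x|lborel. norm (f x)) * (LINT y|lborel. norm (g y))"
    by (simp add: norm_mult)
qed

lemma AE_lborel_fst:
  assumes "AE x in (lborel :: (real^'n) measure). P x"
  shows "AE z in (lborel :: ((real^'n) \<times> (real^'m)) measure). P (fst z)"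
proof -
  obtain N where N: "{x. \<not> P x} \<subseteq> N" "emeasure lborel N = 0" "N \<in> sets borel"
    using AE_E[OF assms] by auto
  have "emeasure (lborel \<Otimes>\<^sub>M lborel) (N \<times> (UNIV :: (real^'m) set)) = 0"
    using N by (subst lborel.emeasure_pair_measure_Times) auto
  hence "emeasure lborel (N \<times> (UNIV :: (real^'m) set)) = 0" by (simp add: lborel_prod)
  moreover have "N \<times> (UNIV :: (real^'m) set) \<in> sets lborel"
    using N(3) by (simp add: borel_prod[symmetric])
  ultimately show ?thesis using N(1) by (intro AE_I[of _ _ "N \<times> UNIV"]) auto
qed

lemma AE_lborel_snd:
  assumes "AE x in (lborel :: (real^'m) measure). P x"
  shows "AE z in (lborel :: ((real^'n) \<times> (real^'m)) measure). P (snd z)"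
proof -
  obtain N where N: "{x. \<not> P x} \<subseteq> N" "emeasure lborel N = 0" "N \<in> sets borel"
    using AE_E[OF assms] by auto
  have "emeasure (lborel \<Otimes>\<^sub>M lborel) ((UNIV :: (real^'n) set) \<times> N) = 0"
    using N by (subst lborel.emeasure_pair_measure_Times) auto
  hence "emeasure lborel ((UNIV :: (real^'n) set) \<times> N) = 0" by (simp add: lborel_prod)
  moreover have "(UNIV :: (real^'n) set) \<times> N \<in> sets lborel"
    using N(3) by (simp add: borel_prod[symmetric])
  ultimately show ?thesis using N(1) by (intro AE_I[of _ _ "UNIV \<times> N"]) auto
qed

lemma kernel_form_fun_eq:
  "kernel_form_fun M f g = (LINT z|lebesgue. (cnj (f (fst z)) * g (snd z)) * case_prod M z)"
  unfolding kernel_form_fun_def by (intro Bochner_Integration.integral_cong refl) (auto simp: mult_ac)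

context
  fixes M :: "real^'n \<Rightarrow> real^'n \<Rightarrow> complex" and B :: real
  assumes Mm: "case_prod M \<in> borel_measurable lebesgue" and B0: "B \<ge> 0" and MB: "\<And>x y. norm (M x y) \<le> B"
begin

lemma kernel_form_fun_integrable:
  assumes "integrable lborel f" "integrable lborel g"
  shows "integrable lebesgue (\<lambda>z. (cnj (f (fst z)) * g (snd z)) * case_prod M z)"
proof (rule integrable_mult_bounded[OF _ Mm])
  have i: "integrable lborel (\<lambda>z::(real^'n) \<times> (real^'n). cnj (f (fst z)) * g (snd z))"
    using assms by (intro integrable_tensor(1)[where f = "\<lambda>x. cnj (f x)"]) auto
  show "integrable lebesgue (\<lambda>z::(real^'n) \<times> (real^'n). cnj (f (fst z)) * g (snd z))"
    using integrable_completion[OF borel_measurable_integrable[OF i]] i by simp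
  show "norm (case_prod M z) \<le> B" for z using MB by (cases z) auto
qed

lemma kernel_form_fun_bound:
  assumes f: "integrable lborel f" and g: "integrable lborel g"
  shows "norm (kernel_form_fun M f g) \<le> B * ((LINT x|lborel. norm (f x)) * (LINT y|lborel. norm (g y)))"
proof -
  have i: "integrable lborel (\<lambda>z::(real^'n) \<times> (real^'n). cnj (f (fst z)) * g (snd z))"
    using assms by (intro integrable_tensor(1)[where f = "\<lambda>x. cnj (f x)"]) auto
  note m = borel_measurable_integrable[OF i]
  have "norm (kernel_form_fun M f g) \<le> (LINT z::(real^'n) \<times> (real^'n)|lebesgue. norm (cnj (f (fst z)) * g (snd z))) * B"
    unfolding kernel_form_fun_eq
    using integrable_completion[OF m] i Mm MB by (intro integral_bound_mult) auto
  also have "(LINT z::(real^'n) \<times> (real^'n)|lebesgue. norm (cnj (f (fst z)) * g (snd z))) =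
      (LINT z::(real^'n) \<times> (real^'n)|lborel. norm (cnj (f (fst z)) * g (snd z)))"
    by (rule integral_completion[OF measurable_compose[OF m borel_measurable_norm]])
  also have "\<dots> = (LINT x|lborel. norm (f x)) * (LINT y|lborel. norm (g y))"
    using integrable_tensor(2)[of "\<lambda>x. cnj (f x)" g] f g by simp
  finally show ?thesis by (simp add: mult.commute)
qed

text \<open>A bounded kernel makes the form continuous in the \<open>L\<^sub>1\<close> norm, which is how all limits of the
  form are computed.\<close>

lemma kernel_form_fun_diff_bound:
  assumes f: "integrable lborel f" and g: "integrable lborel g"
    and f': "integrable lborel f'" and g': "integrable lborel g'"
  shows "norm (kernel_form_fun M f g - kernel_form_fun M f' g') \<le>
    B * ((LINT x|lborel. norm (f x - f' x)) * (LINT y|lborel. norm (g y))) +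
    B * ((LINT x|lborel. norm (f' x)) * (LINT y|lborel. norm (g y - g' y)))"
proof -
  have "kernel_form_fun M f g - kernel_form_fun M f' g' =
      kernel_form_fun M (\<lambda>x. f x - f' x) g + kernel_form_fun M f' (\<lambda>x. g x - g' x)"
  proof -
    have "kernel_form_fun M (\<lambda>x. f x - f' x) g = kernel_form_fun M f g - kernel_form_fun M f' g"
      unfolding kernel_form_fun_eq complex_cnj_diff left_diff_distrib
      by (intro Bochner_Integration.integral_diff kernel_form_fun_integrable f f' g)
    moreover have "kernel_form_fun M f' (\<lambda>x. g x - g' x) = kernel_form_fun M f' g - kernel_form_fun M f' g'"
      unfolding kernel_form_fun_eq right_diff_distrib left_diff_distrib
      by (intro Bochner_Integration.integral_diff kernel_form_fun_integrable f' g g')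
    ultimately show ?thesis by simp
  qed
  also have "norm \<dots> \<le> B * ((LINT x|lborel. norm (f x - f' x)) * (LINT y|lborel. norm (g y))) +
    B * ((LINT x|lborel. norm (f' x)) * (LINT y|lborel. norm (g y - g' y)))"
    by (intro norm_triangle_mono kernel_form_fun_bound Bochner_Integration.integrable_diff f f' g g')
  finally show ?thesis .
qed

lemma kernel_form_fun_cong_AE:
  assumes f: "integrable lborel f'" "AE x in lborel. f x = f' x"
    and g: "integrable lborel g'" "AE x in lborel. g x = g' x"
  shows "kernel_form_fun M f g = kernel_form_fun M f' g'"
proof -
  let ?k = "\<lambda>f g (z :: (real^'n) \<times> (real^'n)). (cnj (f (fst z)) * g (snd z)) * case_prod M z"
  have "AE z in lborel. ?k f g z = ?k f' g' z"
    using AE_lborel_fst[OF f(2), where 'm = 'n] AE_lborel_snd[OF g(2), where 'n = 'n]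
    by eventually_elim simp
  hence ae: "AE z in lebesgue. ?k f g z = ?k f' g' z" by (rule AE_completion)
  have m: "?k f' g' \<in> borel_measurable lebesgue"
    by (rule borel_measurable_integrable[OF kernel_form_fun_integrable[OF f(1) g(1)]])
  moreover have "AE z in lebesgue. ?k f' g' z = ?k f g z" using ae by eventually_elim (rule sym)
  ultimately have "?k f g \<in> borel_measurable lebesgue" by (rule borel_measurable_AE)
  thus ?thesis unfolding kernel_form_fun_eq by (intro integral_cong_AE m ae)
qed

text \<open>The smoothed densities are determined almost everywhere by their distributions, so the limit
  may be computed with any choice of them. In particular the value of the form is unique.\<close>

lemma has_kernel_form_iff:
  assumes F: "\<And>\<epsilon>. \<epsilon> > 0 \<Longrightarrow> integrable lborel (F \<epsilon>)" "\<And>\<epsilon>. \<epsilon> > 0 \<Longrightarrow> distr_of (F \<epsilon>) = convolve f (gaussian \<epsilon>)"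
    and G: "\<And>\<epsilon>. \<epsilon> > 0 \<Longrightarrow> integrable lborel (G \<epsilon>)" "\<And>\<epsilon>. \<epsilon> > 0 \<Longrightarrow> distr_of (G \<epsilon>) = convolve g (gaussian \<epsilon>)"
  shows "has_kernel_form M f g L \<longleftrightarrow> ((\<lambda>\<epsilon>. kernel_form_fun M (F \<epsilon>) (G \<epsilon>)) \<longlongrightarrow> L) (at_right 0)"
proof
  assume "has_kernel_form M f g L"
  then obtain F' G' where F': "\<forall>\<epsilon>>0. integrable lebesgue (F' \<epsilon>) \<and> distr_of (F' \<epsilon>) = convolve f (gaussian \<epsilon>) \<and>
            integrable lebesgue (G' \<epsilon>) \<and> distr_of (G' \<epsilon>) = convolve g (gaussian \<epsilon>)"
    and lim: "((\<lambda>\<epsilon>. kernel_form_fun M (F' \<epsilon>) (G' \<epsilon>)) \<longlongrightarrow> L) (at_right 0)"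
    unfolding has_kernel_form_def by blast
  have "kernel_form_fun M (F' \<epsilon>) (G' \<epsilon>) = kernel_form_fun M (F \<epsilon>) (G \<epsilon>)" if e: "\<epsilon> > 0" for \<epsilon>
    using F' e F[OF e] G[OF e]
    by (intro kernel_form_fun_cong_AE distr_of_eq_imp_AE_eq) auto
  hence "\<forall>\<^sub>F \<epsilon> in at_right 0. kernel_form_fun M (F' \<epsilon>) (G' \<epsilon>) = kernel_form_fun M (F \<epsilon>) (G \<epsilon>)"
    using eventually_at_right_less[of "0::real"] by (rule eventually_mono[rotated])
  thus "((\<lambda>\<epsilon>. kernel_form_fun M (F \<epsilon>) (G \<epsilon>)) \<longlongrightarrow> L) (at_right 0)"
    using lim by (rule Lim_transform_eventually[rotated])
next
  assume lim: "((\<lambda>\<epsilon>. kernel_form_fun M (F \<epsilon>) (G \<epsilon>)) \<longlongrightarrow> L) (at_right 0)"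
  have "integrable lebesgue f" if "integrable lborel f" for f :: "real^'n \<Rightarrow> complex"
    using integrable_completion[OF borel_measurable_integrable[OF that]] that by simp
  thus "has_kernel_form M f g L"
    unfolding has_kernel_form_def using F G lim by (intro exI[of _ F] exI[of _ G]) auto
qed

lemma kernel_form_eqI:
  assumes F: "\<And>\<epsilon>. \<epsilon> > 0 \<Longrightarrow> integrable lborel (F \<epsilon>)" "\<And>\<epsilon>. \<epsilon> > 0 \<Longrightarrow> distr_of (F \<epsilon>) = convolve f (gaussian \<epsilon>)"
    and G: "\<And>\<epsilon>. \<epsilon> > 0 \<Longrightarrow> integrable lborel (G \<epsilon>)" "\<And>\<epsilon>. \<epsilon> > 0 \<Longrightarrow> distr_of (G \<epsilon>) = convolve g (gaussian \<epsilon>)"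
    and lim: "((\<lambda>\<epsilon>. kernel_form_fun M (F \<epsilon>) (G \<epsilon>)) \<longlongrightarrow> L) (at_right 0)"
  shows "kernel_form M f g = L"
proof -
  have iff: "has_kernel_form M f g L' \<longleftrightarrow> ((\<lambda>\<epsilon>. kernel_form_fun M (F \<epsilon>) (G \<epsilon>)) \<longlongrightarrow> L') (at_right 0)" for L'
    by (rule has_kernel_form_iff[OF F G])
  show ?thesis
    unfolding kernel_form_def iff
  proof (rule the_equality)
    show "((\<lambda>\<epsilon>. kernel_form_fun M (F \<epsilon>) (G \<epsilon>)) \<longlongrightarrow> L) (at_right 0)" by (rule lim)
  next
    fix L' assume "((\<lambda>\<epsilon>. kernel_form_fun M (F \<epsilon>) (G \<epsilon>)) \<longlongrightarrow> L') (at_right 0)"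
    thus "L' = L" by (rule tendsto_unique[OF trivial_limit_at_right_real _ lim])
  qed
qed

end

subsection \<open>Schwartz functions\<close>

lemma schwartz_L1_tendsto:
  fixes f :: "real^'n \<Rightarrow> complex"
  assumes f: "f \<in> schwartz_space"
  shows "((\<lambda>\<epsilon>. LINT x|lborel. norm (mollify \<epsilon> f x - f x)) \<longlongrightarrow> 0) (at_right 0)"
proof -
  obtain C where C: "C \<ge> 0" "\<And>\<epsilon> x. 0 < \<epsilon> \<Longrightarrow> \<epsilon> \<le> 1 \<Longrightarrow>
      (1 + norm x) ^ (2 * CARD('n)) * norm (mollify \<epsilon> f x - f x) \<le> C * \<epsilon>"
    using mollify_weighted_close[OF f] by blast
  let ?W = "LINT x|lborel. decay_weight (x :: real^'n)"
  have "\<forall>\<^sub>F \<epsilon> in at_right 0. norm (LINT x|lborel. norm (mollify \<epsilon> f x - f x)) \<le> C * \<epsilon> * ?W"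
    using eventually_at_right_less[of "0::real"] eventually_at_right_real[of 0 "1::real", simplified]
  proof eventually_elim
    case (elim \<epsilon>)
    hence e: "0 < \<epsilon>" "\<epsilon> \<le> 1" by auto
    have "(LINT x|lborel. norm (mollify \<epsilon> f x - f x)) \<le> C * \<epsilon> * ?W"
      by (intro integrable_weighted_sup(2) C(2) e borel_measurable_diff schwartz_borel_measurable f mollify_schwartz)
    thus ?case by (simp add: abs_of_nonneg)
  qed
  moreover have "((\<lambda>\<epsilon>. C * \<epsilon> * ?W) \<longlongrightarrow> C * 0 * ?W) (at_right 0)"
    by (intro tendsto_intros)
  hence "((\<lambda>\<epsilon>. C * \<epsilon> * ?W) \<longlongrightarrow> 0) (at_right 0)" by simp
  ultimately show ?thesis by (rule Lim_null_comparison)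
qed

lemma distr_of_eqI:
  assumes "f \<in> borel_measurable borel" "\<And>\<phi>. \<phi> \<in> schwartz_space \<Longrightarrow> (LINT x|lborel. f x * \<phi> x) = T \<phi>"
    and "T \<in> extensional schwartz_space"
  shows "distr_of f = T"
  by (rule extensionalityI[of _ schwartz_space]) (use assms in \<open>auto simp: distr_of_apply\<close>, simp add: distr_of_def)

lemma distr_of_mollify:
  assumes e: "\<epsilon> > 0" and f: "f \<in> schwartz_space"
  shows "distr_of (mollify \<epsilon> f) = convolve (distr_of f) (gaussian \<epsilon>)"
proof (rule distr_of_eqI)
  show "mollify \<epsilon> f \<in> borel_measurable borel" by (intro schwartz_borel_measurable mollify_schwartz e f)
  fix \<phi> :: "real^'a \<Rightarrow> complex" assume \<phi>: "\<phi> \<in> schwartz_space"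
  show "(LINT x|lborel. mollify \<epsilon> f x * \<phi> x) = convolve (distr_of f) (gaussian \<epsilon>) \<phi>"
    unfolding convolve_gaussian[OF e \<phi>] distr_of_apply[OF schwartz_borel_measurable[OF f] mollify_schwartz[OF e \<phi>]]
    using integral_conv_gauss_mult[OF linear_id[unfolded id_def] schwartz_integrable[OF f] e \<phi>]
    by (simp add: mollify_eq_conv[OF e f])
qed (simp add: convolve_def)

lemma mult_coord_distr_of:
  assumes f: "f \<in> schwartz_space"
  shows "mult_coord i (distr_of f) = distr_of (\<lambda>x. of_real (x $ i) * f x)"
proof (rule distr_of_eqI[symmetric])
  show "(\<lambda>x. of_real (x $ i) * f x) \<in> borel_measurable borel"
    by (intro schwartz_borel_measurable schwartz_coord_mult f)
  fix \<phi> :: "real^'a \<Rightarrow> complex" assume \<phi>: "\<phi> \<in> schwartz_space"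
  show "(LINT x|lborel. of_real (x $ i) * f x * \<phi> x) = mult_coord i (distr_of f) \<phi>"
    using \<phi> distr_of_apply[OF schwartz_borel_measurable[OF f] schwartz_coord_mult[OF \<phi>]]
    by (simp add: mult_coord_def mult_ac)
qed (simp add: mult_coord_def)

text \<open>The smoothed densities are the mollified functions, and these converge in the \<open>L\<^sub>1\<close> norm.\<close>

lemma kernel_form_schwartz:
  fixes f g :: "real^'n \<Rightarrow> complex"
  assumes M: "proper_kernel M" and f: "f \<in> schwartz_space" and g: "g \<in> schwartz_space"
  shows "kernel_form M (distr_of f) (distr_of g) = kernel_form_fun M f g"
proof -
  obtain B where B: "B \<ge> 0" "\<And>x y. norm (M x y) \<le> B" using proper_kernel_bounded[OF M] by blast
  note Mm = proper_kernel_measurable[OF M]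
  let ?n = "\<lambda>f. LINT x|lborel. norm (f (x :: real^'n) :: complex)"
  show ?thesis
  proof (rule kernel_form_eqI[OF Mm B])
    show "integrable lborel (mollify \<epsilon> f)" "integrable lborel (mollify \<epsilon> g)" if "\<epsilon> > 0" for \<epsilon>
      using that by (intro schwartz_integrable mollify_schwartz f g; assumption)+
    show "distr_of (mollify \<epsilon> f) = convolve (distr_of f) (gaussian \<epsilon>)"
      "distr_of (mollify \<epsilon> g) = convolve (distr_of g) (gaussian \<epsilon>)" if "\<epsilon> > 0" for \<epsilon>
      using that by (intro distr_of_mollify f g; assumption)+
    have "\<forall>\<^sub>F \<epsilon> in at_right 0. norm (kernel_form_fun M (mollify \<epsilon> f) (mollify \<epsilon> g) - kernel_form_fun M f g) \<le>
        B * (?n (\<lambda>x. mollify \<epsilon> f x - f x) * (?n (\<lambda>x. mollify \<epsilon> g x - g x) + ?n g)) + B * (?n f * ?n (\<lambda>x. mollify \<epsilon> g x - g x))"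
      using eventually_at_right_less[of "0::real"]
    proof eventually_elim
      case (elim \<epsilon>)
      have i: "integrable lborel (mollify \<epsilon> f)" "integrable lborel (mollify \<epsilon> g)"
          "integrable lborel f" "integrable lborel g"
        by (intro schwartz_integrable mollify_schwartz f g elim)+
      have "?n (mollify \<epsilon> g) \<le> (LINT x|lborel. norm (mollify \<epsilon> g x - g x) + norm (g x))"
        using i norm_triangle_sub[of "mollify \<epsilon> g x" "g x" for x]
        by (intro integral_mono) (auto simp: add.commute)
      hence n: "?n (mollify \<epsilon> g) \<le> ?n (\<lambda>x. mollify \<epsilon> g x - g x) + ?n g" using i by simp
      have "norm (kernel_form_fun M (mollify \<epsilon> f) (mollify \<epsilon> g) - kernel_form_fun M f g) \<le>
          B * (?n (\<lambda>x. mollify \<epsilon> f x - f x) * ?n (mollify \<epsilon> g)) + B * (?n f * ?n (\<lambda>x. mollify \<epsilon> g x - g x))"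
        by (rule kernel_form_fun_diff_bound[OF Mm B i])
      also have "\<dots> \<le> B * (?n (\<lambda>x. mollify \<epsilon> f x - f x) * (?n (\<lambda>x. mollify \<epsilon> g x - g x) + ?n g)) +
          B * (?n f * ?n (\<lambda>x. mollify \<epsilon> g x - g x))"
        using n B(1) by (intro add_right_mono mult_left_mono) auto
      finally show ?case .
    qed
    moreover have "((\<lambda>\<epsilon>. B * (?n (\<lambda>x. mollify \<epsilon> f x - f x) * (?n (\<lambda>x. mollify \<epsilon> g x - g x) + ?n g)) +
        B * (?n f * ?n (\<lambda>x. mollify \<epsilon> g x - g x))) \<longlongrightarrow> B * (0 * (0 + ?n g)) + B * (?n f * 0)) (at_right 0)"
      by (intro tendsto_add tendsto_mult tendsto_const schwartz_L1_tendsto f g)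
    hence "((\<lambda>\<epsilon>. B * (?n (\<lambda>x. mollify \<epsilon> f x - f x) * (?n (\<lambda>x. mollify \<epsilon> g x - g x) + ?n g)) +
        B * (?n f * ?n (\<lambda>x. mollify \<epsilon> g x - g x))) \<longlongrightarrow> 0) (at_right 0)" by simp
    ultimately have "((\<lambda>\<epsilon>. kernel_form_fun M (mollify \<epsilon> f) (mollify \<epsilon> g) - kernel_form_fun M f g) \<longlongrightarrow> 0) (at_right 0)"
      by (rule Lim_null_comparison)
    thus "((\<lambda>\<epsilon>. kernel_form_fun M (mollify \<epsilon> f) (mollify \<epsilon> g)) \<longlongrightarrow> kernel_form_fun M f g) (at_right 0)"
      by (simp only: LIM_zero_iff)
  qed
qed

lemma M_matrix_schwartz:
  assumes "proper_kernel M" "f \<in> schwartz_space"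
  shows "M_matrix M (distr_of f) $ i $ j =
    Re (kernel_form_fun M (\<lambda>x. of_real (x $ i) * f x) (\<lambda>x. of_real (x $ j) * f x))"
  using assms by (simp add: M_matrix_def mult_coord_distr_of kernel_form_schwartz schwartz_coord_mult)

lemma M_matrix_quadratic_form:
  fixes f :: "real^'n \<Rightarrow> complex"
  assumes M: "proper_kernel M" and f: "f \<in> schwartz_space"
  shows "v \<bullet> (M_matrix M (distr_of f) *v v) =
    Re (kernel_form_fun M (\<lambda>x. of_real (v \<bullet> x) * f x) (\<lambda>x. of_real (v \<bullet> x) * f x))"
proof -
  obtain B where B: "B \<ge> 0" "\<And>x y. norm (M x y) \<le> B" using proper_kernel_bounded[OF M] by blast
  let ?f = "\<lambda>i x. of_real (x $ i) * f x"
  let ?k = "\<lambda>i j (z :: (real^'n) \<times> (real^'n)). (cnj (?f i (fst z)) * ?f j (snd z)) * case_prod M z"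
  have i: "integrable lebesgue (?k i j)" for i j
    by (intro kernel_form_fun_integrable[OF proper_kernel_measurable[OF M] B] schwartz_integrable schwartz_coord_mult f)
  have "kernel_form_fun M (\<lambda>x. of_real (v \<bullet> x) * f x) (\<lambda>x. of_real (v \<bullet> x) * f x) =
      (LINT z|lebesgue. (\<Sum>i\<in>UNIV. \<Sum>j\<in>UNIV. of_real (v $ i * v $ j) * ?k i j z))"
    unfolding kernel_form_fun_eq
    by (intro Bochner_Integration.integral_cong refl)
       (simp add: inner_vec_def sum_distrib_left sum_distrib_right sum_product mult_ac)
  also have "\<dots> = (\<Sum>i\<in>UNIV. \<Sum>j\<in>UNIV. of_real (v $ i * v $ j) * kernel_form_fun M (?f i) (?f j))"
    unfolding kernel_form_fun_eq using i
    by (subst Bochner_Integration.integral_sum,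
        intro Bochner_Integration.integrable_sum integrable_mult_right,
        assumption | intro sum.cong refl | subst Bochner_Integration.integral_sum | simp)+
  also have "Re \<dots> = (\<Sum>i\<in>UNIV. \<Sum>j\<in>UNIV. v $ i * v $ j * Re (kernel_form_fun M (?f i) (?f j)))"
    by simp
  also have "\<dots> = v \<bullet> (M_matrix M (distr_of f) *v v)"
    by (simp add: inner_vec_def matrix_vector_mult_def M_matrix_schwartz[OF M f] sum_distrib_left mult_ac)
  finally show ?thesis ..
qed

section \<open>Positivity\<close>

lemma cnj_measurable [measurable (raw)]:
  "f \<in> borel_measurable N \<Longrightarrow> (\<lambda>x. cnj (f x)) \<in> borel_measurable N"
  by (rule measurable_compose[OF _ borel_measurable_continuous_onI]) (auto intro: continuous_intros)

lemma L2_space_iff: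
  "f \<in> L2_space \<longleftrightarrow> f \<in> borel_measurable lebesgue \<and> integrable lebesgue (\<lambda>x. (norm (f x))\<^sup>2)"
  by (simp add: L2_space_def)

lemma L2_inner_integrable:
  assumes "f \<in> L2_space" "g \<in> L2_space"
  shows "integrable lebesgue (\<lambda>x. cnj (f x) * g x)"
proof (rule Bochner_Integration.integrable_bound[where f = "\<lambda>x. ((norm (f x))\<^sup>2 + (norm (g x))\<^sup>2)"])
  show "AE x in lebesgue. norm (cnj (f x) * g x) \<le> norm ((norm (f x))\<^sup>2 + (norm (g x))\<^sup>2)"
  proof (intro AE_I2)
    fix x
    have "0 \<le> (norm (f x) - norm (g x))\<^sup>2" by simp
    hence "2 * (norm (f x) * norm (g x)) \<le> (norm (f x))\<^sup>2 + (norm (g x))\<^sup>2" by (simp add: power2_diff)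
    moreover have "0 \<le> norm (f x) * norm (g x)" by simp
    ultimately have "norm (f x) * norm (g x) \<le> (norm (f x))\<^sup>2 + (norm (g x))\<^sup>2" by linarith
    thus "norm (cnj (f x) * g x) \<le> norm ((norm (f x))\<^sup>2 + (norm (g x))\<^sup>2)" by (simp add: norm_mult)
  qed
qed (use assms in \<open>auto simp: L2_space_iff intro!: borel_measurable_times cnj_measurable\<close>)

lemma L2_space_lincomb:
  assumes f: "f \<in> L2_space" and g: "g \<in> L2_space"
  shows "(\<lambda>x. f x + c * g x) \<in> L2_space"
proof -
  have "integrable lebesgue (\<lambda>x. (norm (f x + c * g x))\<^sup>2)"
  proof (rule Bochner_Integration.integrable_bound[where f = "\<lambda>x. 2 * (norm (f x))\<^sup>2 + 2 * (norm c)\<^sup>2 * (norm (g x))\<^sup>2"])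
    show "AE x in lebesgue. norm ((norm (f x + c * g x))\<^sup>2) \<le> norm (2 * (norm (f x))\<^sup>2 + 2 * (norm c)\<^sup>2 * (norm (g x))\<^sup>2)"
    proof (intro AE_I2)
      fix x
      have "(norm (f x + c * g x))\<^sup>2 \<le> (norm (f x) + norm (c * g x))\<^sup>2"
        by (intro power_mono norm_triangle_ineq) auto
      also have "\<dots> \<le> 2 * (norm (f x))\<^sup>2 + 2 * (norm (c * g x))\<^sup>2"
        using zero_le_power2[of "norm (f x) - norm (c * g x)"] by (simp add: power2_sum power2_diff)
      finally show "norm ((norm (f x + c * g x))\<^sup>2) \<le> norm (2 * (norm (f x))\<^sup>2 + 2 * (norm c)\<^sup>2 * (norm (g x))\<^sup>2)"
        by (simp add: norm_mult power_mult_distrib)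
    qed
  qed (use f g in \<open>auto simp: L2_space_iff\<close>)
  thus ?thesis using f g by (auto simp: L2_space_iff)
qed

lemma schwartz_L2: "f \<in> schwartz_space \<Longrightarrow> f \<in> L2_space"
proof -
  assume f: "f \<in> schwartz_space"
  have fb: "f \<in> borel_measurable borel" by (rule schwartz_borel_measurable[OF f])
  have "integrable lborel (\<lambda>x. cnj (f x) * f x)"
    by (intro integrable_mult_schwartz schwartz_integrable schwartz_cnj f)
  hence "integrable lborel (\<lambda>x. complex_of_real ((norm (f x))\<^sup>2))"
    by (simp add: complex_norm_square mult.commute del: of_real_power)
  hence "integrable lborel (\<lambda>x. (norm (f x))\<^sup>2)" by (rule complex_of_real_integrable_eq[THEN iffD1])
  moreover have m: "(\<lambda>x. (norm (f x))\<^sup>2) \<in> borel_measurable lborel" using fb by simp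
  ultimately have "integrable lebesgue (\<lambda>x. (norm (f x))\<^sup>2)" using integrable_completion[OF m] by simp
  moreover have "f \<in> borel_measurable lebesgue" using fb by (simp add: measurable_completion)
  ultimately show ?thesis by (simp add: L2_space_iff)
qed

context
  fixes M :: "real^'n \<Rightarrow> real^'n \<Rightarrow> complex"
  assumes M: "proper_kernel M"
begin

lemma kernel_op_L2: "f \<in> L2_space \<Longrightarrow> kernel_op M f \<in> L2_space"
  using M by (simp add: proper_kernel_def)

lemma kernel_op_symmetric:
  "f \<in> L2_space \<Longrightarrow> g \<in> L2_space \<Longrightarrow> L2_inner f (kernel_op M g) = L2_inner (kernel_op M f) g"
  using M by (simp add: proper_kernel_def)

lemma L2_inner_cnj: "L2_inner g f = cnj (L2_inner f g)"
  unfolding L2_inner_def by (subst Bochner_Integration.integral_cnj[symmetric]) (simp add: mult.commute)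

lemma kernel_op_nonneg:
  assumes f: "f \<in> L2_space"
  shows "0 \<le> Re (L2_inner f (kernel_op M f))"
proof (cases "AE x in lebesgue. f x = 0")
  case True
  hence "AE x in lebesgue. cnj (f x) * kernel_op M f x = 0" by eventually_elim simp
  hence "L2_inner f (kernel_op M f) = 0" unfolding L2_inner_def by (rule integral_eq_zero_AE)
  thus ?thesis by simp
next
  case False
  thus ?thesis using M f unfolding proper_kernel_def by (auto intro: less_imp_le)
qed

lemma kernel_op_lincomb:
  assumes f: "f \<in> L2_space" and g: "g \<in> L2_space"
  shows "AE x in lebesgue. kernel_op M (\<lambda>x. f x + c * g x) x = kernel_op M f x + c * kernel_op M g x"
proof -
  have "AE x in lebesgue. integrable lebesgue (\<lambda>y. M x y * f y)"
    "AE x in lebesgue. integrable lebesgue (\<lambda>y. M x y * g y)"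
    using M f g by (simp_all add: proper_kernel_def)
  thus ?thesis
  proof eventually_elim
    case (elim x)
    have "kernel_op M (\<lambda>x. f x + c * g x) x = (LINT y|lebesgue. M x y * f y + c * (M x y * g y))"
      by (simp add: kernel_op_def algebra_simps)
    thus ?case using elim by (simp add: kernel_op_def)
  qed
qed

text \<open>A weak form of the Cauchy-Schwarz inequality for the positive form of the kernel; the summand 1
  spares the case of a degenerate second argument.\<close>

lemma kernel_op_cauchy_schwarz:
  assumes u: "u \<in> L2_space" and w: "w \<in> L2_space"
  shows "(norm (L2_inner u (kernel_op M w)))\<^sup>2 \<le>
    Re (L2_inner u (kernel_op M u)) * (Re (L2_inner w (kernel_op M w)) + 1)"
proof -
  define \<alpha> \<beta> \<gamma> where "\<alpha> = Re (L2_inner u (kernel_op M u))"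
    and "\<beta> = L2_inner u (kernel_op M w)" and "\<gamma> = Re (L2_inner w (kernel_op M w)) + 1"
  have \<gamma>: "\<gamma> > 0" using kernel_op_nonneg[OF w] by (simp add: \<gamma>_def)
  \<comment> \<open>The multiple that would minimize the form of \<open>u + c w\<close> if \<open>\<gamma>\<close> were the exact value of the form
    at \<open>w\<close>.\<close>
  define c where "c = - cnj \<beta> / of_real \<gamma>"
  let ?v = "\<lambda>x. u x + c * w x"
  have v: "?v \<in> L2_space" by (rule L2_space_lincomb[OF u w])
  have i: "integrable lebesgue (\<lambda>x. cnj (a x) * kernel_op M b x)"
    if "a \<in> L2_space" "b \<in> L2_space" for a b
    by (intro L2_inner_integrable kernel_op_L2 that)
  have m: "a \<in> borel_measurable lebesgue" if "a \<in> L2_space" for a :: "real^'n \<Rightarrow> complex"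
    using that by (simp add: L2_space_iff)
  have "L2_inner ?v (kernel_op M ?v) = (LINT x|lebesgue. cnj (?v x) * (kernel_op M u x + c * kernel_op M w x))"
    unfolding L2_inner_def
  proof (rule integral_cong_AE)
    show "AE x in lebesgue. cnj (?v x) * kernel_op M ?v x = cnj (?v x) * (kernel_op M u x + c * kernel_op M w x)"
      using kernel_op_lincomb[OF u w, of c] by eventually_elim simp
    show "(\<lambda>x. cnj (?v x) * kernel_op M ?v x) \<in> borel_measurable lebesgue"
      by (rule borel_measurable_integrable[OF i[OF v v]])
    show "(\<lambda>x. cnj (?v x) * (kernel_op M u x + c * kernel_op M w x)) \<in> borel_measurable lebesgue"
      using m[OF v] m[OF kernel_op_L2[OF u]] m[OF kernel_op_L2[OF w]] by measurable
  qed
  also have "\<dots> = (LINT x|lebesgue. (cnj (u x) * kernel_op M u x + c * (cnj (u x) * kernel_op M w x)) +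
      (cnj c * (cnj (w x) * kernel_op M u x) + (cnj c * c) * (cnj (w x) * kernel_op M w x)))"
    by (simp add: algebra_simps)
  also have "\<dots> = (L2_inner u (kernel_op M u) + c * \<beta>) +
      (cnj c * L2_inner w (kernel_op M u) + (cnj c * c) * L2_inner w (kernel_op M w))"
    unfolding \<beta>_def L2_inner_def using i[OF u u] i[OF u w] i[OF w u] i[OF w w] by simp
  also have "L2_inner w (kernel_op M u) = cnj \<beta>"
    unfolding \<beta>_def kernel_op_symmetric[OF w u] by (rule L2_inner_cnj)
  finally have eq: "L2_inner ?v (kernel_op M ?v) = (L2_inner u (kernel_op M u) + c * \<beta>) +
      (cnj c * cnj \<beta> + (cnj c * c) * L2_inner w (kernel_op M w))" .
  have cc: "cnj c * c = of_real ((norm \<beta>)\<^sup>2 / \<gamma>\<^sup>2)" "c * \<beta> = of_real (- (norm \<beta>)\<^sup>2 / \<gamma>)"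
      "cnj c * cnj \<beta> = of_real (- (norm \<beta>)\<^sup>2 / \<gamma>)"
    using complex_norm_square[of \<beta>] by (simp_all add: c_def power2_eq_square mult.commute)
  have "0 \<le> Re (L2_inner ?v (kernel_op M ?v))" by (rule kernel_op_nonneg[OF v])
  also have "\<dots> = \<alpha> - 2 * ((norm \<beta>)\<^sup>2 / \<gamma>) + (norm \<beta>)\<^sup>2 / \<gamma>\<^sup>2 * (\<gamma> - 1)"
    unfolding eq cc by (simp add: \<alpha>_def \<gamma>_def)
  also have "\<dots> = \<alpha> - (norm \<beta>)\<^sup>2 / \<gamma> - (norm \<beta>)\<^sup>2 / \<gamma>\<^sup>2"
    using \<gamma> by (simp add: field_simps power2_eq_square)
  also have "\<dots> \<le> \<alpha> - (norm \<beta>)\<^sup>2 / \<gamma>" using \<gamma> by simp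
  finally have "(norm \<beta>)\<^sup>2 \<le> \<alpha> * \<gamma>" using \<gamma> by (simp add: field_simps)
  thus ?thesis by (simp add: \<alpha>_def \<beta>_def \<gamma>_def)
qed

text \<open>Fubini's theorem, for a kernel that is measurable only with respect to the completed measure:
  it is replaced by a Borel function that agrees with it almost everywhere, hence on almost every line.\<close>

lemma kernel_form_fun_eq_L2_inner:
  assumes f: "f \<in> schwartz_space" and g: "g \<in> schwartz_space"
  shows "kernel_form_fun M f g = L2_inner f (kernel_op M g)"
proof -
  obtain B where B: "B \<ge> 0" "\<And>x y. norm (M x y) \<le> B" using proper_kernel_bounded[OF M] by blast
  note Mm = proper_kernel_measurable[OF M]
  have fg [measurable]: "f \<in> borel_measurable borel" "g \<in> borel_measurable borel"
    using f g by (auto intro: schwartz_borel_measurable)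
  obtain K where K: "K \<in> borel_measurable borel" "AE z in lborel. case_prod M z = K z"
    using lebesgue_measurable_ex_borel[OF Mm] by blast
  let ?k = "\<lambda>z :: (real^'n) \<times> (real^'n). (cnj (f (fst z)) * g (snd z)) * K z"
  have km: "?k \<in> borel_measurable lborel"
  proof -
    have "(\<lambda>z :: (real^'n) \<times> (real^'n). f (fst z)) \<in> borel_measurable borel"
      "(\<lambda>z :: (real^'n) \<times> (real^'n). g (snd z)) \<in> borel_measurable borel"
      by (rule measurable_compose[of fst borel borel] measurable_compose[of snd borel borel];
          intro borel_measurable_continuous_onI continuous_intros fg)+
    hence "?k \<in> borel_measurable borel" using K(1) by (intro borel_measurable_times cnj_measurable)
    thus ?thesis by simp
  qed
  have km': "?k \<in> borel_measurable lebesgue" using km by (simp add: measurable_completion)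
  note ki = kernel_form_fun_integrable[OF Mm B schwartz_integrable[OF f] schwartz_integrable[OF g]]
  have "AE z in lborel. (cnj (f (fst z)) * g (snd z)) * case_prod M z = ?k z"
    using K(2) by eventually_elim simp
  hence ae: "AE z in lebesgue. (cnj (f (fst z)) * g (snd z)) * case_prod M z = ?k z" by (rule AE_completion)
  have "integrable lebesgue ?k"
    using ki integrable_cong_AE[OF borel_measurable_integrable[OF ki] km' ae] by simp
  hence ki': "integrable (lborel \<Otimes>\<^sub>M lborel) (\<lambda>(x, y). cnj (f x) * g y * K (x, y))"
    using integrable_completion[OF km] by (simp add: lborel_prod case_prod_beta')
  have "kernel_form_fun M f g = (LINT z|lebesgue. ?k z)"
    unfolding kernel_form_fun_eq by (rule integral_cong_AE[OF borel_measurable_integrable[OF ki] km' ae])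
  also have "\<dots> = (LINT z|lborel. ?k z)" by (rule integral_completion[OF km])
  also have "\<dots> = integral\<^sup>L (lborel \<Otimes>\<^sub>M lborel) (\<lambda>(x, y). cnj (f x) * g y * K (x, y))"
    by (simp add: lborel_prod case_prod_beta')
  also have "\<dots> = (LINT x|lborel. LINT y|lborel. cnj (f x) * g y * K (x, y))"
    by (rule lborel_pair.integral_fst[OF ki', symmetric])
  also have "\<dots> = (LINT x|lborel. cnj (f x) * (LINT y|lborel. K (x, y) * g y))"
    by (simp only: integral_mult_right_zero[symmetric] mult_ac)
  also have "\<dots> = L2_inner f (kernel_op M g)"
  proof -
    have Kx: "(\<lambda>y. K (x, y) * g y) \<in> borel_measurable borel" for x
      using K(1) by (intro borel_measurable_times measurable_compose[OF _ K(1)])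
        (auto intro: borel_measurable_continuous_onI continuous_intros)
    have om: "(\<lambda>x. cnj (f x) * (LINT y|lborel. K (x, y) * g y)) \<in> borel_measurable borel"
    proof -
      have "(\<lambda>(x, y). K (x, y) * g y) \<in> borel_measurable (lborel \<Otimes>\<^sub>M lborel)"
        using borel_measurable_times[OF K(1) measurable_compose[OF borel_measurable_continuous_onI[OF
              continuous_on_snd[OF continuous_on_id]] fg(2)]]
        unfolding lborel_prod case_prod_beta' prod.collapse by simp
      hence "(\<lambda>x. LINT y|lborel. K (x, y) * g y) \<in> borel_measurable lborel"
        by (rule lborel.borel_measurable_lebesgue_integral)
      thus ?thesis by measurable
    qed
    have "AE z in lborel \<Otimes>\<^sub>M lborel. case_prod M z = K z"
      unfolding lborel_prod by (rule K(2))
    from lborel_pair.AE_pair[OF this]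
    have "AE x in lborel. AE y in lborel. M x y = K (x, y)" by simp
    hence "AE x in lborel. (LINT y|lborel. K (x, y) * g y) = kernel_op M g x"
    proof eventually_elim
      case (elim x)
      have ae: "AE y in lebesgue. K (x, y) * g y = M x y * g y"
        by (rule AE_completion) (use elim in eventually_elim, simp)
      have m: "(\<lambda>y. K (x, y) * g y) \<in> borel_measurable lebesgue" using Kx by (simp add: measurable_completion)
      have "(LINT y|lborel. K (x, y) * g y) = (LINT y|lebesgue. K (x, y) * g y)"
        by (rule integral_lebesgue_lborel[OF Kx, symmetric])
      also have "\<dots> = kernel_op M g x"
        unfolding kernel_op_def by (rule integral_cong_AE[OF m borel_measurable_AE[OF m ae] ae])
      finally show ?case .
    qed
    hence "AE x in lborel. cnj (f x) * (LINT y|lborel. K (x, y) * g y) = cnj (f x) * kernel_op M g x"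
      by eventually_elim simp
    hence ae: "AE x in lebesgue. cnj (f x) * (LINT y|lborel. K (x, y) * g y) = cnj (f x) * kernel_op M g x"
      by (rule AE_completion)
    have om': "(\<lambda>x. cnj (f x) * (LINT y|lborel. K (x, y) * g y)) \<in> borel_measurable lebesgue"
      using om by (simp add: measurable_completion)
    have "(LINT x|lborel. cnj (f x) * (LINT y|lborel. K (x, y) * g y)) =
        (LINT x|lebesgue. cnj (f x) * (LINT y|lborel. K (x, y) * g y))"
      by (rule integral_lebesgue_lborel[OF om, symmetric])
    also have "\<dots> = L2_inner f (kernel_op M g)"
      unfolding L2_inner_def by (rule integral_cong_AE[OF om' borel_measurable_AE[OF om' ae] ae])
    finally show ?thesis .
  qed
  finally show ?thesis .
qed

lemma M_matrix_psd:
  assumes f: "f \<in> schwartz_space"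
  shows "transpose (M_matrix M (distr_of f)) = M_matrix M (distr_of f)"
    "0 \<le> v \<bullet> (M_matrix M (distr_of f) *v v)"
proof -
  have "kernel_form_fun M a b = cnj (kernel_form_fun M b a)" if "a \<in> schwartz_space" "b \<in> schwartz_space" for a b
    using that by (simp add: kernel_form_fun_eq_L2_inner kernel_op_symmetric schwartz_L2 L2_inner_cnj[of "kernel_op M a" b])
  hence "Re (kernel_form_fun M a b) = Re (kernel_form_fun M b a)" if "a \<in> schwartz_space" "b \<in> schwartz_space" for a b
    using that by (metis complex_cnj(1) complex_surj complex.sel(1))
  thus "transpose (M_matrix M (distr_of f)) = M_matrix M (distr_of f)"
    by (simp add: vec_eq_iff transpose_def M_matrix_schwartz[OF M f] schwartz_coord_mult[OF f])
  show "0 \<le> v \<bullet> (M_matrix M (distr_of f) *v v)"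
    unfolding M_matrix_quadratic_form[OF M f]
    using kernel_op_nonneg[OF schwartz_L2[OF schwartz_inner_mult[OF f]]]
    by (simp add: kernel_form_fun_eq_L2_inner schwartz_inner_mult[OF f])
qed

end

section \<open>Limits with vanishing anti-norm\<close>

lemma orthogonal_matrix_norm_le:
  fixes V :: "real^'n^'n"
  assumes "orthogonal_matrix V"
  shows "norm V \<le> CARD('n)"
proof -
  have "norm (V $ i) = 1" for i
    using assms unfolding orthogonal_matrix_orthonormal_rows by (metis row_def vec_lambda_eta)
  hence "(\<Sum>i\<in>UNIV. norm (V $ i)) = CARD('n)" by simp
  thus ?thesis unfolding norm_vec_def[of V] using L2_set_le_sum[of UNIV "\<lambda>i. norm (V $ i)"] by (metis norm_ge_zero)
qed

lemma orthogonal_matrix_limit: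
  fixes V :: "nat \<Rightarrow> real^'n^'n"
  assumes V: "\<And>i. orthogonal_matrix (V i)" and lim: "V \<longlonglongrightarrow> W"
  shows "orthogonal_matrix W"
proof -
  have row: "row i A = A $ i" for i and A :: "real^'n^'n" by (simp add: row_def vec_lambda_eta)
  have l: "(\<lambda>i. V i $ a) \<longlonglongrightarrow> W $ a" for a by (intro tendsto_vec_nth lim)
  have "norm (W $ a) = 1" for a
  proof -
    have "(\<lambda>i. norm (V i $ a)) \<longlonglongrightarrow> norm (W $ a)" by (intro tendsto_norm l)
    moreover have "norm (V i $ a) = 1" for i
      using V[of i] unfolding orthogonal_matrix_orthonormal_rows row by blast
    ultimately show ?thesis by (simp add: LIMSEQ_const_iff)
  qed
  moreover have "W $ a \<bullet> W $ b = 0" if "a \<noteq> b" for a b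
  proof -
    have "(\<lambda>i. V i $ a \<bullet> V i $ b) \<longlonglongrightarrow> W $ a \<bullet> W $ b" by (intro tendsto_inner l)
    moreover have "V i $ a \<bullet> V i $ b = 0" for i
      using V[of i] that unfolding orthogonal_matrix_orthonormal_rows row orthogonal_def by blast
    ultimately show ?thesis by (simp add: LIMSEQ_const_iff)
  qed
  ultimately show ?thesis unfolding orthogonal_matrix_orthonormal_rows row orthogonal_def by blast
qed

lemma card_compl_range:
  fixes \<iota> :: "'k::finite \<Rightarrow> 'n::finite"
  assumes "inj \<iota>"
  shows "card (- range \<iota>) = CARD('n) - CARD('k)"
  using assms by (simp add: Compl_eq_Diff_UNIV card_Diff_subset card_image)

lemma tempered_inner_mult:
  fixes f \<psi> :: "real^'n \<Rightarrow> complex"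
  assumes T: "T \<in> tempered" and \<psi>: "\<psi> \<in> schwartz_space"
  shows "T (\<lambda>x. of_real (v \<bullet> x) * \<psi> x) = (\<Sum>l\<in>UNIV. of_real (v $ l) * T (\<lambda>x. of_real (x $ l) * \<psi> x))"
proof -
  have "(\<lambda>x. of_real (v \<bullet> x) * \<psi> x) = (\<lambda>x. \<Sum>l\<in>UNIV. of_real (v $ l) * (of_real (x $ l) * \<psi> x))"
    by (simp add: inner_vec_def sum_distrib_right mult.assoc)
  thus ?thesis
    using \<psi> by (simp add: tempered_sum[OF T] tempered_cmult[OF T] schwartz_cmult schwartz_coord_mult)
qed

text \<open>Finitely many seminorms control the functional, so it suffices to approximate in these. The
  conjugation reflects that the inner product of \<open>L\<^sub>2\<close> is sesquilinear, while distributions are paired with test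
  functions bilinearly.\<close>

lemma annihilated_direction_dense:
  fixes T :: "'n::finite distr"
  assumes T: "T \<in> tempered" and D: "schwartz_topology closure_of D = schwartz_space"
    and z: "\<And>\<phi>. \<phi> \<in> D \<Longrightarrow> \<phi> \<in> schwartz_space \<Longrightarrow> T (\<lambda>x. of_real (v \<bullet> x) * cnj (\<phi> x)) = 0"
    and \<psi>: "\<psi> \<in> schwartz_space"
  shows "T (\<lambda>x. of_real (v \<bullet> x) * \<psi> x) = 0"
proof -
  let ?E = "\<lambda>\<phi> x. of_real (v \<bullet> x) * cnj (\<phi> x) :: complex"
  have "continuous_op (\<lambda>\<phi> (x::real^'n). \<Sum>i\<in>UNIV. of_real (v $ i) * (of_real (x $ i) * cnj (\<phi> x)))"
    by (intro continuous_op_sum continuous_op_cmult continuous_op_compose[OF continuous_op_coord continuous_op_cnj])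
  moreover have "(\<lambda>\<phi> (x::real^'n). \<Sum>i\<in>UNIV. of_real (v $ i) * (of_real (x $ i) * cnj (\<phi> x))) = ?E"
    by (simp add: inner_vec_def sum_distrib_right mult.assoc)
  ultimately have "continuous_op ?E" by simp
  from schwartz_dominated_compose[OF tempered_dominated[OF T] this]
  obtain C F where C: "C \<ge> 0" "finite F"
    "\<And>\<phi>. \<phi> \<in> schwartz_space \<Longrightarrow> norm (T (?E \<phi>)) \<le> C * (\<Sum>(a, is)\<in>F. schwartz_seminorm a is \<phi>)"
    unfolding schwartz_dominated_def by auto
  define \<chi>' where "\<chi>' = (\<lambda>x. cnj (\<psi> x))"
  have c: "\<chi>' \<in> schwartz_space" unfolding \<chi>'_def using \<psi> by auto
  have "norm (T (?E \<chi>')) \<le> 0"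
  proof (rule field_le_epsilon)
    fix e :: real assume e: "e > 0"
    define r where "r = e / (C * card F + 1)"
    have den: "C * card F + 1 > 0" using C(1) by (simp add: add_nonneg_pos)
    have r: "r > 0" using e den by (simp add: r_def)
    have "\<chi>' \<in> schwartz_topology closure_of D" using c D by simp
    from schwartz_closure_approx[OF this C(2) r] obtain \<phi> where \<phi>: "\<phi> \<in> D" "\<phi> \<in> schwartz_space"
      "\<And>a is. (a, is) \<in> F \<Longrightarrow> schwartz_seminorm a is (\<lambda>x. \<phi> x - \<chi>' x) < r" by blast
    have E: "?E \<phi> \<in> schwartz_space" "?E \<chi>' \<in> schwartz_space"
      using \<phi>(2) c by (auto intro!: schwartz_inner_mult)
    have "?E (\<lambda>x. \<phi> x - \<chi>' x) = (\<lambda>x. ?E \<phi> x - ?E \<chi>' x)" by (simp add: right_diff_distrib)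
    hence "T (?E (\<lambda>x. \<phi> x - \<chi>' x)) = - T (?E \<chi>')"
      using tempered_diff[OF T E] z[OF \<phi>(1,2)] by simp
    hence "norm (T (?E \<chi>')) = norm (T (?E (\<lambda>x. \<phi> x - \<chi>' x)))" by simp
    also have "\<dots> \<le> C * (\<Sum>(a, is)\<in>F. schwartz_seminorm a is (\<lambda>x. \<phi> x - \<chi>' x))"
      by (rule C(3)[OF schwartz_diff[OF \<phi>(2) c]])
    also have "\<dots> \<le> C * (\<Sum>(a, is)\<in>F. r)"
      using \<phi>(3) by (intro mult_left_mono sum_mono C(1)) (auto intro: less_imp_le)
    also have "\<dots> = (C * card F) * r" by simp
    also have "\<dots> \<le> (C * card F + 1) * r" using r by simp
    also have "\<dots> = e" using den by (simp add: r_def)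
    finally show "norm (T (?E \<chi>')) \<le> 0 + e" by simp
  qed
  thus ?thesis by (simp add: \<chi>'_def)
qed

text \<open>In the directions of the smallest eigenvalues the functions \<open>(v \<bullet> x) f\<^sub>i\<close> tend to zero in the
  norm of the kernel form, so their inner products with the range of the operator of \<open>M\<close> tend to
  zero by the Cauchy-Schwarz inequality. These inner products also converge to the limit
  distribution, evaluated in the limit of the directions.\<close>

theorem vanishing_antinorm_limit:
  fixes \<iota> :: "'k::finite \<Rightarrow> 'n::finite" and f :: "nat \<Rightarrow> real^'n \<Rightarrow> complex"
  assumes \<iota>: "inj \<iota>" and M: "proper_kernel M" and f: "\<And>i. f i \<in> schwartz_space"
    and lim: "limitin weak_topology (\<lambda>i. distr_of (f i)) T sequentially"
    and R: "(\<lambda>i. ky_fan_antinorm (CARD('n) - CARD('k)) (M_matrix M (distr_of (f i)))) \<longlonglongrightarrow> 0"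
  shows "T \<in> G_tempered \<iota>"
proof -
  let ?J = "- range \<iota>" and ?A = "\<lambda>i. M_matrix M (distr_of (f i))"
  let ?R = "\<lambda>i. ky_fan_antinorm (CARD('n) - CARD('k)) (?A i)"
  have T: "T \<in> tempered" and Tlim: "\<And>\<phi>. \<phi> \<in> schwartz_space \<Longrightarrow> (\<lambda>i. distr_of (f i) \<phi>) \<longlonglongrightarrow> T \<phi>"
    using lim by (auto simp: limitin_weak_topology)
  have "\<exists>V. orthogonal_matrix V \<and> (\<forall>j\<in>?J. row j V \<bullet> (?A i *v row j V) \<le> ?R i)" for i
    using ky_fan_antinorm_small_directions[OF M_matrix_psd(1)[OF M f[of i]] M_matrix_psd(2)[OF M f[of i]], of ?J]
    unfolding card_compl_range[OF \<iota>] .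
  then obtain V where V: "\<And>i. orthogonal_matrix (V i)"
    "\<And>i j. j \<in> ?J \<Longrightarrow> row j (V i) \<bullet> (?A i *v row j (V i)) \<le> ?R i" by metis
  have "bounded (range V)" using orthogonal_matrix_norm_le[OF V(1)] by (auto simp: bounded_iff)
  then obtain W r where r: "strict_mono (r :: nat \<Rightarrow> nat)" "(V \<circ> r) \<longlonglongrightarrow> W"
    using bounded_imp_convergent_subsequence by blast
  have W: "orthogonal_matrix W"
    by (rule orthogonal_matrix_limit[OF _ r(2)]) (simp add: V)
  let ?D = "{\<phi> \<in> schwartz_space. \<exists>w\<in>L2_space. AE x in lebesgue. \<phi> x = kernel_op M w x}"
  show ?thesis
  proof (rule annihilated_directions_imp_G_tempered[OF \<iota> T W])
    fix j and \<psi> :: "real^'n \<Rightarrow> complex" assume j: "j \<notin> range \<iota>" and \<psi>: "\<psi> \<in> schwartz_space"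
    show "T (\<lambda>x. of_real (row j W \<bullet> x) * \<psi> x) = 0"
    proof (rule annihilated_direction_dense[OF T _ _ \<psi>])
      show "schwartz_topology closure_of ?D = schwartz_space" using M by (simp add: proper_kernel_def)
      fix \<phi> assume "\<phi> \<in> ?D" and \<phi>: "\<phi> \<in> schwartz_space"
      then obtain w where w: "w \<in> L2_space" "AE x in lebesgue. \<phi> x = kernel_op M w x" by blast
      let ?v = "\<lambda>i. row j (V (r i))"
      let ?u = "\<lambda>i x. of_real (?v i \<bullet> x) * f (r i) x"
      let ?\<gamma> = "Re (L2_inner w (kernel_op M w)) + 1"
      have u: "?u i \<in> schwartz_space" for i by (intro schwartz_inner_mult f)
      have le: "(norm (L2_inner (?u i) (kernel_op M w)))\<^sup>2 \<le> ?R (r i) * ?\<gamma>" for i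
      proof -
        have "Re (L2_inner (?u i) (kernel_op M (?u i))) = ?v i \<bullet> (?A (r i) *v ?v i)"
          unfolding M_matrix_quadratic_form[OF M f] kernel_form_fun_eq_L2_inner[OF M u u] ..
        also have "\<dots> \<le> ?R (r i)" using V(2) j by simp
        finally have "Re (L2_inner (?u i) (kernel_op M (?u i))) * ?\<gamma> \<le> ?R (r i) * ?\<gamma>"
          using kernel_op_nonneg[OF M w(1)] by (intro mult_right_mono) auto
        thus ?thesis using kernel_op_cauchy_schwarz[OF M schwartz_L2[OF u] w(1), of i] by linarith
      qed
      have Rr: "(\<lambda>i. ?R (r i)) \<longlonglongrightarrow> 0" using LIMSEQ_subseq_LIMSEQ[OF R r(1)] by (simp add: comp_def)
      have "(\<lambda>i. ?R (r i) * ?\<gamma>) \<longlonglongrightarrow> 0 * ?\<gamma>" by (intro tendsto_mult Rr tendsto_const)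
      hence l: "(\<lambda>i. ?R (r i) * ?\<gamma>) \<longlonglongrightarrow> 0" by (simp only: mult_zero_left)
      have "(\<lambda>i. (norm (L2_inner (?u i) (kernel_op M w)))\<^sup>2) \<longlonglongrightarrow> 0"
      proof (rule Lim_null_comparison[OF always_eventually l], rule allI)
        show "norm ((norm (L2_inner (?u i) (kernel_op M w)))\<^sup>2) \<le> ?R (r i) * ?\<gamma>" for i
          using le[of i] by (simp only: real_norm_def abs_power2)
      qed
      from tendsto_real_sqrt[OF this]
      have "(\<lambda>i. norm (cnj (L2_inner (?u i) (kernel_op M w)))) \<longlonglongrightarrow> 0"
        by (simp only: real_sqrt_abs abs_norm_cancel real_sqrt_zero complex_mod_cnj)
      hence L2lim: "(\<lambda>i. cnj (L2_inner (?u i) (kernel_op M w))) \<longlonglongrightarrow> 0"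
        by (rule tendsto_norm_zero_cancel)
      have eq: "cnj (L2_inner (?u i) (kernel_op M w)) = distr_of (f (r i)) (\<lambda>x. of_real (?v i \<bullet> x) * cnj (\<phi> x))" for i
      proof -
        have "L2_inner (?u i) (kernel_op M w) = (LINT x|lebesgue. cnj (?u i x) * \<phi> x)"
          unfolding L2_inner_def
        proof (rule integral_cong_AE)
          show "(\<lambda>x. cnj (?u i x) * kernel_op M w x) \<in> borel_measurable lebesgue"
            by (rule borel_measurable_integrable[OF L2_inner_integrable[OF schwartz_L2[OF u] kernel_op_L2[OF M w(1)]]])
          show "(\<lambda>x. cnj (?u i x) * \<phi> x) \<in> borel_measurable lebesgue"
            by (rule borel_measurable_integrable[OF L2_inner_integrable[OF schwartz_L2[OF u] schwartz_L2[OF \<phi>]]])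
          show "AE x in lebesgue. cnj (?u i x) * kernel_op M w x = cnj (?u i x) * \<phi> x"
            using w(2) by eventually_elim simp
        qed
        also have "\<dots> = (LINT x|lborel. cnj (?u i x) * \<phi> x)"
          by (intro integral_lebesgue_lborel borel_measurable_times schwartz_borel_measurable \<phi> schwartz_cnj u)
        finally have "cnj (L2_inner (?u i) (kernel_op M w)) = cnj (LINT x|lborel. cnj (?u i x) * \<phi> x)"
          by (rule arg_cong)
        also have "\<dots> = (LINT x|lborel. cnj (cnj (?u i x) * \<phi> x))"
          by (rule Bochner_Integration.integral_cnj[symmetric])
        also have "\<dots> = distr_of (f (r i)) (\<lambda>x. of_real (?v i \<bullet> x) * cnj (\<phi> x))"
          using distr_of_apply[OF schwartz_borel_measurable[OF f] schwartz_inner_mult[OF schwartz_cnj[OF \<phi>]]]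
          by (simp add: mult_ac)
        finally show ?thesis .
      qed
      have vl: "(\<lambda>i. complex_of_real (?v i $ l)) \<longlonglongrightarrow> of_real (row j W $ l)" for l
        using r(2) unfolding row_def by (intro tendsto_of_real) (auto simp: comp_def intro!: tendsto_vec_nth)
      have "(\<lambda>i. \<Sum>l\<in>UNIV. of_real (?v i $ l) * distr_of (f (r i)) (\<lambda>x. of_real (x $ l) * cnj (\<phi> x))) \<longlonglongrightarrow>
          (\<Sum>l\<in>UNIV. of_real (row j W $ l) * T (\<lambda>x. of_real (x $ l) * cnj (\<phi> x)))"
      proof (intro tendsto_sum tendsto_mult vl)
        fix l
        have "(\<lambda>x. of_real (x $ l) * cnj (\<phi> x)) \<in> schwartz_space" using \<phi> by auto
        from LIMSEQ_subseq_LIMSEQ[OF Tlim[OF this] r(1)]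
        show "(\<lambda>i. distr_of (f (r i)) (\<lambda>x. of_real (x $ l) * cnj (\<phi> x))) \<longlonglongrightarrow> T (\<lambda>x. of_real (x $ l) * cnj (\<phi> x))"
          by (simp add: comp_def)
      qed
      hence "(\<lambda>i. distr_of (f (r i)) (\<lambda>x. of_real (?v i \<bullet> x) * cnj (\<phi> x))) \<longlonglongrightarrow> T (\<lambda>x. of_real (row j W \<bullet> x) * cnj (\<phi> x))"
        by (simp only: tempered_inner_mult[OF distr_of_tempered[OF f] schwartz_cnj[OF \<phi>]]
            tempered_inner_mult[OF T schwartz_cnj[OF \<phi>]])
      from LIMSEQ_unique[OF this L2lim[unfolded eq]]
      show "T (\<lambda>x. of_real (row j W \<bullet> x) * cnj (\<phi> x)) = 0" .
    qed
  qed
qed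

section \<open>Smoothing distributions that are concentrated on a subspace\<close>

text \<open>The convolution with a Gaussian of the distribution \<open>\<phi> \<mapsto> \<integral> g(y) \<phi>(L y) dy\<close>, which for an
  isometric embedding \<open>L\<close> has a density on the image of \<open>L\<close> only.\<close>

definition smoothing :: "(real^'k::finite \<Rightarrow> real^'n::finite) \<Rightarrow> (real^'k \<Rightarrow> complex) \<Rightarrow> real \<Rightarrow> real^'n \<Rightarrow> complex" where
  "smoothing L g \<epsilon> = conv (\<lambda>y. - L y) g (gauss \<epsilon>)"

lemma gaussian_first_moment:
  "\<exists>C\<ge>0. \<forall>\<epsilon> v. 0 < \<epsilon> \<and> \<epsilon> \<le> 1 \<and> norm v \<le> 1 \<longrightarrow>
    (LINT z|lborel. norm (of_real (v \<bullet> z) * gauss \<epsilon> (z :: real^'n))) \<le> C * \<epsilon>"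
proof -
  from gaussian_moment[of 0, where 'n = 'n] obtain C where C0: "C \<ge> 0" and "\<forall>\<epsilon>. 0 < \<epsilon> \<and> \<epsilon> \<le> 1 \<longrightarrow>
    integrable lborel (\<lambda>y::real^'n. norm y * (1 + norm y) ^ 0 * gaussian \<epsilon> y) \<and>
    (LINT y|lborel. norm (y::real^'n) * (1 + norm y) ^ 0 * gaussian \<epsilon> y) \<le> C * \<epsilon>"
    by (elim exE conjE) (rule that)
  hence C: "integrable lborel (\<lambda>y::real^'n. norm y * gaussian \<epsilon> y)"
    "(LINT y|lborel. norm (y::real^'n) * gaussian \<epsilon> y) \<le> C * \<epsilon>"
    if "0 < \<epsilon>" "\<epsilon> \<le> 1" for \<epsilon>
    using that by simp_all
  have "(LINT z|lborel. norm (of_real (v \<bullet> z) * gauss \<epsilon> (z :: real^'n))) \<le> C * \<epsilon>"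
    if e: "0 < \<epsilon>" "\<epsilon> \<le> 1" "norm v \<le> 1" for \<epsilon> v
  proof -
    have "(LINT z|lborel. norm (of_real (v \<bullet> z) * gauss \<epsilon> (z :: real^'n))) \<le> (LINT z|lborel. norm (z::real^'n) * gaussian \<epsilon> z)"
    proof (rule integral_mono)
      show "integrable lborel (\<lambda>z. norm (of_real (v \<bullet> z) * gauss \<epsilon> z))"
        by (intro integrable_norm schwartz_integrable schwartz_inner_mult gauss_schwartz e)
      show "integrable lborel (\<lambda>z::real^'n. norm z * gaussian \<epsilon> z)" by (rule C(1)[OF e(1,2)])
      fix z :: "real^'n"
      have "\<bar>v \<bullet> z\<bar> \<le> norm v * norm z" by (rule Cauchy_Schwarz_ineq2)
      also have "\<dots> \<le> 1 * norm z" by (intro mult_right_mono e) auto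
      finally have "\<bar>v \<bullet> z\<bar> * gaussian \<epsilon> z \<le> norm z * gaussian \<epsilon> z"
        by (intro mult_right_mono gaussian_nonneg) simp
      thus "norm (of_real (v \<bullet> z) * gauss \<epsilon> z) \<le> norm z * gaussian \<epsilon> z"
        by (simp add: norm_mult gaussian_nonneg)
    qed
    thus ?thesis using C(2)[OF e(1,2)] by linarith
  qed
  thus ?thesis using C0 by blast
qed

context
  fixes L :: "real^'k::finite \<Rightarrow> real^'n::finite" and g :: "real^'k \<Rightarrow> complex"
  assumes L: "linear L" and Lle: "\<And>y. norm (L y) \<le> norm y" and g: "g \<in> schwartz_space"
begin

lemma smoothing_schwartz:
  assumes "\<epsilon> > 0"
  shows "smoothing L g \<epsilon> \<in> schwartz_space"
  unfolding smoothing_def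
  by (intro conv_schwartz linear_compose_neg L schwartz_rapid g gauss_schwartz assms) (simp add: Lle)

lemma inner_mult_pullback_schwartz: "(\<lambda>y. of_real (v \<bullet> L y) * g y) \<in> schwartz_space"
proof -
  define w where "w = (\<chi> i. v \<bullet> L (axis i 1))"
  have eq: "v \<bullet> L y = w \<bullet> y" for y
  proof -
    have "v \<bullet> L y = (\<Sum>i\<in>UNIV. (y $ i) * (v \<bullet> L (axis i 1)))"
      by (subst linear_axis_expansion[OF L, of y]) (simp only: inner_sum_right inner_scaleR_right)
    also have "\<dots> = (\<Sum>i\<in>UNIV. w $ i * y $ i)" by (simp add: w_def mult.commute)
    also have "\<dots> = w \<bullet> y" by (simp add: inner_vec_def)
    finally show ?thesis .
  qed
  show ?thesis unfolding eq by (rule schwartz_inner_mult[OF g])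
qed

lemma smoothing_apply:
  assumes "\<epsilon> > 0" "\<phi> \<in> schwartz_space"
  shows "distr_of (smoothing L g \<epsilon>) \<phi> = (LINT y|lborel. g y * mollify \<epsilon> \<phi> (L y))"
  unfolding distr_of_apply[OF schwartz_borel_measurable[OF smoothing_schwartz[OF assms(1)]] assms(2)]
  unfolding smoothing_def by (rule integral_conv_gauss_mult[OF L schwartz_integrable[OF g] assms])

lemma smoothing_difference:
  assumes \<phi>: "\<phi> \<in> schwartz_space" and e: "0 < \<epsilon>" and C: "\<And>x. norm (mollify \<epsilon> \<phi> x - \<phi> x) \<le> c"
  shows "norm (distr_of (smoothing L g \<epsilon>) \<phi> - (LINT y|lborel. g y * \<phi> (L y))) \<le> (LINT y|lborel. norm (g y)) * c"
proof -
  have m: "(\<lambda>y. \<psi> (L y)) \<in> borel_measurable borel" if "\<psi> \<in> schwartz_space" for \<psi>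
    using measurable_compose[OF linear_borel_measurable[OF L] schwartz_borel_measurable[OF that]] .
  have i: "integrable lborel (\<lambda>y. g y * \<psi> (L y))" if \<psi>: "\<psi> \<in> schwartz_space" for \<psi>
  proof -
    obtain S where S: "\<And>x. norm (\<psi> x) \<le> S" using schwartz_bounded[OF \<psi>] by (auto simp: bounded_iff)
    show ?thesis using m[OF \<psi>] by (intro integrable_mult_bounded[OF schwartz_integrable[OF g] _ S]) auto
  qed
  have "distr_of (smoothing L g \<epsilon>) \<phi> - (LINT y|lborel. g y * \<phi> (L y)) =
      (LINT y|lborel. g y * (mollify \<epsilon> \<phi> (L y) - \<phi> (L y)))"
    unfolding smoothing_apply[OF e \<phi>] right_diff_distrib
    by (rule Bochner_Integration.integral_diff[OF i[OF mollify_schwartz[OF e \<phi>]] i[OF \<phi>], symmetric])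
  also have "norm \<dots> \<le> (LINT y|lborel. norm (g y)) * c"
    using m[OF mollify_schwartz[OF e \<phi>]] m[OF \<phi>]
    by (intro integral_bound_mult schwartz_integrable g C) auto
  finally show ?thesis .
qed

text \<open>Since \<open>v \<bullet> x = v \<bullet> L y + v \<bullet> (x - L y)\<close>, the difference of the two functions is the
  convolution of \<open>g\<close> with the Gaussian multiplied by the linear form.\<close>

lemma inner_mult_smoothing_L1:
  assumes e: "0 < \<epsilon>" and C: "(LINT z|lborel. norm (of_real (v \<bullet> z) * gauss \<epsilon> (z :: real^'n))) \<le> c"
  shows "(LINT x|lborel. norm (of_real (v \<bullet> x) * smoothing L g \<epsilon> x - smoothing L (\<lambda>y. of_real (v \<bullet> L y) * g y) \<epsilon> x))
    \<le> (LINT y|lborel. norm (g y)) * c"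
proof -
  let ?h = "\<lambda>z. of_real (v \<bullet> z) * gauss \<epsilon> z"
  have gs: "(gauss \<epsilon> :: real^'n \<Rightarrow> complex) \<in> schwartz_space" by (rule gauss_schwartz[OF e])
  have i: "integrable lborel (\<lambda>y. h y * gauss \<epsilon> (x + - L y))" if h: "h \<in> schwartz_space" for h x
  proof -
    obtain S where S: "\<And>x::real^'n. norm (gauss \<epsilon> x) \<le> S" using schwartz_bounded[OF gs] by (auto simp: bounded_iff)
    show ?thesis
      using conv_integrand_measurable[OF linear_compose_neg[OF L] schwartz_borel_measurable[OF gs], of x]
      by (intro integrable_mult_bounded[OF schwartz_integrable[OF h] _ S]) auto
  qed
  have "of_real (v \<bullet> x) * smoothing L g \<epsilon> x - smoothing L (\<lambda>y. of_real (v \<bullet> L y) * g y) \<epsilon> x = conv (\<lambda>y. - L y) g ?h x" for x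
  proof -
    have "of_real (v \<bullet> x) * smoothing L g \<epsilon> x - smoothing L (\<lambda>y. of_real (v \<bullet> L y) * g y) \<epsilon> x =
        (LINT y|lborel. of_real (v \<bullet> x) * (g y * gauss \<epsilon> (x + - L y))) -
        (LINT y|lborel. of_real (v \<bullet> L y) * g y * gauss \<epsilon> (x + - L y))"
      unfolding smoothing_def conv_def by simp
    also have "\<dots> = (LINT y|lborel. of_real (v \<bullet> x) * (g y * gauss \<epsilon> (x + - L y)) -
        of_real (v \<bullet> L y) * g y * gauss \<epsilon> (x + - L y))"
      by (intro Bochner_Integration.integral_diff[symmetric] integrable_mult_right i g inner_mult_pullback_schwartz)
    also have "\<dots> = conv (\<lambda>y. - L y) g ?h x"
      unfolding conv_def by (simp add: inner_diff_right algebra_simps)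
    finally show ?thesis .
  qed
  hence "(LINT x|lborel. norm (of_real (v \<bullet> x) * smoothing L g \<epsilon> x - smoothing L (\<lambda>y. of_real (v \<bullet> L y) * g y) \<epsilon> x)) =
      (LINT x|lborel. norm (conv (\<lambda>y. - L y) g ?h x))" by simp
  also have "\<dots> \<le> (LINT y|lborel. norm (g y)) * (LINT z|lborel. norm (?h z))"
    by (intro conv_L1_le linear_compose_neg L schwartz_integrable g schwartz_inner_mult gs)
  also have "\<dots> \<le> (LINT y|lborel. norm (g y)) * c" by (intro mult_left_mono C) simp
  finally show ?thesis .
qed

lemma smoothing_L1:
  assumes e: "0 < \<epsilon>" and h: "h \<in> schwartz_space"
  shows "(LINT x|lborel. norm (smoothing L h \<epsilon> x)) \<le> (LINT y|lborel. norm (h y))"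
proof -
  have "(LINT x|lborel. norm (smoothing L h \<epsilon> x)) \<le>
      (LINT y|lborel. norm (h y)) * (LINT z|lborel. norm (gauss \<epsilon> (z :: real^'n) :: complex))"
    unfolding smoothing_def by (intro conv_L1_le linear_compose_neg L schwartz_integrable h gauss_schwartz e)
  also have "(LINT z|lborel. norm (gauss \<epsilon> (z :: real^'n) :: complex)) = 1"
    using gaussian_integral(2)[OF e, where 'n = 'n] by (simp add: gaussian_nonneg)
  finally show ?thesis by simp
qed

end

section \<open>Recovery sequences\<close>

lemma norm_pad_zero: "inj \<iota> \<Longrightarrow> norm (pad_zero \<iota> y) = norm y"
proof -
  assume \<iota>: "inj \<iota>"
  have "(norm (pad_zero \<iota> y))\<^sup>2 = (\<Sum>j\<in>range \<iota>. (y $ inv \<iota> j)\<^sup>2)"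
    unfolding norm_power2_eq_sum by (rule sum.mono_neutral_cong_right) (auto simp: pad_zero_def)
  also have "\<dots> = (\<Sum>k\<in>UNIV. (y $ k)\<^sup>2)" using \<iota> by (subst sum.reindex) auto
  finally have "(norm (pad_zero \<iota> y))\<^sup>2 = (norm y)\<^sup>2" by (simp only: norm_power2_eq_sum[of y])
  thus ?thesis by simp
qed

lemma norm_transpose_orthogonal:
  fixes U :: "real^'n^'n"
  assumes "orthogonal_matrix U"
  shows "norm (transpose U *v z) = norm z"
proof -
  have "orthogonal_transformation ((*v) (transpose U))"
    unfolding orthogonal_transformation_matrix matrix_of_matrix_vector_mul
    using assms by (intro conjI matrix_vector_mul_linear) (simp only: orthogonal_matrix_transpose)
  thus ?thesis by (rule orthogonal_transformation_norm)
qed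

lemma linear_embedding: "linear (\<lambda>y. transpose U *v pad_zero \<iota> y)"
  using linear_compose[OF linear_pad_zero matrix_vector_mul_linear[of "transpose U"]] unfolding comp_def .

lemma continuous_op_embedding:
  assumes "inj \<iota>" "orthogonal_matrix U"
  shows "continuous_op (\<lambda>\<phi> y. \<phi> (transpose U *v pad_zero \<iota> y))"
  by (rule continuous_op_compose[OF continuous_op_pad_zero[OF assms(1)] continuous_op_rotate(2)[OF assms(2)]])

lemma rotate_tensor_apply:
  assumes "orthogonal_matrix U" "\<phi> \<in> schwartz_space"
  shows "rotate_distr U (tensor_delta \<iota> g) \<phi> = g (\<lambda>y. \<phi> (transpose U *v pad_zero \<iota> y))"
  using assms(2) continuous_op_mem[OF continuous_op_rotate(2)[OF assms(1)] assms(2)]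
  by (simp add: rotate_distr_def tensor_delta_def)

lemma rotate_tensor_distr_of_apply:
  assumes "inj \<iota>" "orthogonal_matrix U" "g \<in> schwartz_space" "\<phi> \<in> schwartz_space"
  shows "rotate_distr U (tensor_delta \<iota> (distr_of g)) \<phi> =
    (LINT y|lborel. g y * \<phi> (transpose U *v pad_zero \<iota> y))"
  unfolding rotate_tensor_apply[OF assms(2,4)]
  by (rule distr_of_apply[OF schwartz_borel_measurable[OF assms(3)]
      continuous_op_mem[OF continuous_op_embedding[OF assms(1,2)] assms(4)]])

lemma G_schwartz_subset: "G_schwartz \<iota> \<subseteq> G_tempered \<iota>"
  unfolding G_schwartz_def G_tempered_def using distr_of_tempered by blast

text \<open>Along the directions of the Dirac delta, multiplication by the linear form costs a factor \<open>\<epsilon>\<close>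
  in the \<open>L\<^sub>1\<close> norm of the smoothed function. Hence the quadratic form of the matrix is of order
  \<open>\<epsilon>\<^sup>2\<close> there, and so is the anti-norm by the minimum principle. Elsewhere smoothing and
  multiplication commute up to \<open>O(\<epsilon>)\<close>, so the trace converges where the matrix is defined. The
  constant \<open>G\<close> is independent of the test function, so that one width can serve all test functions.\<close>

lemma smoothing_G_schwartz:
  fixes \<iota> :: "'k::finite \<Rightarrow> 'n::finite"
  assumes \<iota>: "inj \<iota>" and M: "proper_kernel M" and h: "h \<in> G_schwartz \<iota>"
  shows "\<exists>s G C. G \<ge> 0 \<and> C \<ge> 0 \<and> (\<forall>\<epsilon>>0. s \<epsilon> \<in> schwartz_space) \<and>
    (\<forall>\<epsilon> \<phi> c. 0 < \<epsilon> \<and> \<phi> \<in> schwartz_space \<and> (\<forall>x. norm (mollify \<epsilon> \<phi> x - \<phi> x) \<le> c) \<longrightarrow>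
      norm (distr_of (s \<epsilon>) \<phi> - h \<phi>) \<le> G * c) \<and>
    (\<forall>\<epsilon>. 0 < \<epsilon> \<and> \<epsilon> \<le> 1 \<longrightarrow>
      ky_fan_antinorm (CARD('n) - CARD('k)) (M_matrix M (distr_of (s \<epsilon>))) \<le> C * \<epsilon>\<^sup>2) \<and>
    (M_defined M h \<longrightarrow>
      ((\<lambda>\<epsilon>. trace (M_matrix M (distr_of (s \<epsilon>)))) \<longlongrightarrow> trace (M_matrix M h)) (at_right 0))"
proof -
  obtain g U where g: "h = rotate_distr U (tensor_delta \<iota> (distr_of g))" "g \<in> schwartz_space"
    and U: "orthogonal_matrix U"
    using h unfolding G_schwartz_def by blast
  obtain B where B: "B \<ge> 0" "\<And>x y. norm (M x y) \<le> B" using proper_kernel_bounded[OF M] by blast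
  note Mm = proper_kernel_measurable[OF M]
  define L where "L y = transpose U *v pad_zero \<iota> y" for y
  have L: "linear L" unfolding L_def[abs_def] by (rule linear_embedding)
  have Lle: "norm (L y) \<le> norm y" for y
    unfolding L_def norm_transpose_orthogonal[OF U] norm_pad_zero[OF \<iota>] by (rule order_refl)
  have happ: "h \<phi> = (LINT y|lborel. g y * \<phi> (L y))" if "\<phi> \<in> schwartz_space" for \<phi>
    unfolding g(1) L_def by (rule rotate_tensor_distr_of_apply[OF \<iota> U g(2) that])
  let ?s = "smoothing L g" and ?n = "\<lambda>f. LINT x|lborel. norm (f x :: complex)"
  obtain C0 where C0: "C0 \<ge> 0" "\<And>\<epsilon> v. 0 < \<epsilon> \<Longrightarrow> \<epsilon> \<le> 1 \<Longrightarrow> norm v \<le> 1 \<Longrightarrow>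
      (LINT z|lborel. norm (of_real (v \<bullet> z) * gauss \<epsilon> (z :: real^'n))) \<le> C0 * \<epsilon>"
    using gaussian_first_moment[where 'n = 'n] by blast
  define G where "G = ?n g"
  have G0: "G \<ge> 0" by (simp add: G_def)
  have s: "?s \<epsilon> \<in> schwartz_space" if "\<epsilon> > 0" for \<epsilon>
    by (rule smoothing_schwartz[OF L Lle g(2) that])
  let ?p = "\<lambda>v y. of_real (v \<bullet> L y) * g y"
  have p: "?p v \<in> schwartz_space" for v by (rule inner_mult_pullback_schwartz[OF L Lle g(2)])
  have comm: "?n (\<lambda>x. of_real (v \<bullet> x) * ?s \<epsilon> x - smoothing L (?p v) \<epsilon> x) \<le> G * (C0 * \<epsilon>)"
    if "0 < \<epsilon>" "\<epsilon> \<le> 1" "norm v \<le> 1" for v \<epsilon>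
    unfolding G_def by (rule inner_mult_smoothing_L1[OF L Lle g(2) that(1) C0(2)[OF that]])
  have small: "ky_fan_antinorm (CARD('n) - CARD('k)) (M_matrix M (distr_of (?s \<epsilon>))) \<le>
      (card (- range \<iota>) * (B * (G * C0)\<^sup>2)) * \<epsilon>\<^sup>2" if e: "0 < \<epsilon>" "\<epsilon> \<le> 1" for \<epsilon>
  proof -
    let ?A = "M_matrix M (distr_of (?s \<epsilon>))"
    have "row j U \<bullet> (?A *v row j U) \<le> B * (G * C0)\<^sup>2 * \<epsilon>\<^sup>2" if j: "j \<in> - range \<iota>" for j
    proof -
      let ?u = "\<lambda>x. of_real (row j U \<bullet> x) * ?s \<epsilon> x"
      have u: "?u \<in> schwartz_space" by (intro schwartz_inner_mult s e)
      \<comment> \<open>The image of the embedding is orthogonal to the rows outside the range of the injection.\<close>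
      have "row j U \<bullet> L y = 0" for y
      proof -
        have "row j U \<bullet> L y = (U *v (transpose U *v pad_zero \<iota> y)) $ j"
          by (simp only: L_def) (simp add: matrix_vector_mult_def[of U] row_def inner_vec_def)
        also have "\<dots> = 0" unfolding orthogonal_matrix_inverse(2)[OF U] using j by (simp add: pad_zero_def)
        finally show ?thesis .
      qed
      hence "smoothing L (?p (row j U)) \<epsilon> = (\<lambda>x. 0)" by (simp add: smoothing_def conv_def fun_eq_iff)
      moreover have "norm (row j U) \<le> 1" using U by (simp add: orthogonal_matrix_orthonormal_rows)
      ultimately have un: "?n ?u \<le> G * (C0 * \<epsilon>)" using comm[OF e, of "row j U"] by simp
      have "row j U \<bullet> (?A *v row j U) = Re (kernel_form_fun M ?u ?u)"
        by (rule M_matrix_quadratic_form[OF M s[OF e(1)]])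
      also have "\<dots> \<le> norm (kernel_form_fun M ?u ?u)" by (rule complex_Re_le_cmod)
      also have "\<dots> \<le> B * (?n ?u * ?n ?u)"
        by (intro kernel_form_fun_bound[OF Mm B] schwartz_integrable u)
      also have "\<dots> \<le> B * ((G * (C0 * \<epsilon>)) * (G * (C0 * \<epsilon>)))"
        using un B(1) G0 C0(1) e by (intro mult_left_mono mult_mono) auto
      finally show ?thesis by (simp add: power2_eq_square mult_ac)
    qed
    hence "(\<Sum>j\<in>- range \<iota>. row j U \<bullet> (?A *v row j U)) \<le> (\<Sum>j\<in>- range \<iota>. B * (G * C0)\<^sup>2 * \<epsilon>\<^sup>2)"
      by (rule sum_mono)
    with ky_fan_antinorm_le[OF M_matrix_psd(1)[OF M s[OF e(1)]] U, of "- range \<iota>"]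
    show ?thesis by (simp add: card_compl_range[OF \<iota>] mult.assoc)
  qed
  have tr: "((\<lambda>\<epsilon>. trace (M_matrix M (distr_of (?s \<epsilon>)))) \<longlongrightarrow> trace (M_matrix M h)) (at_right 0)"
    if def: "M_defined M h"
  proof -
    have "((\<lambda>\<epsilon>. Re (kernel_form_fun M (\<lambda>x. of_real (x $ i) * ?s \<epsilon> x) (\<lambda>x. of_real (x $ i) * ?s \<epsilon> x)))
        \<longlongrightarrow> M_matrix M h $ i $ i) (at_right 0)" for i
    proof -
      let ?v = "axis i 1 :: real^'n"
      \<comment> \<open>\<open>?F\<close> multiplies by the coordinate before smoothing, as in the definition of the matrix of
        \<open>h\<close>; \<open>?u\<close> multiplies afterwards, as in the matrix of the smoothed function. They differ by
        \<open>O(\<epsilon>)\<close> in the \<open>L\<^sub>1\<close> norm.\<close>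
      let ?F = "\<lambda>\<epsilon>. smoothing L (?p ?v) \<epsilon>" and ?u = "\<lambda>\<epsilon> x. of_real (?v \<bullet> x) * ?s \<epsilon> x"
      have F: "?F \<epsilon> \<in> schwartz_space" if "\<epsilon> > 0" for \<epsilon>
        by (rule smoothing_schwartz[OF L Lle p that])
      have Fi: "integrable lborel (?F \<epsilon>)" if "\<epsilon> > 0" for \<epsilon> by (rule schwartz_integrable[OF F[OF that]])
      have Fd: "distr_of (?F \<epsilon>) = convolve (mult_coord i h) (gaussian \<epsilon>)" if e: "\<epsilon> > 0" for \<epsilon>
      proof (rule distr_of_eqI[OF schwartz_borel_measurable[OF F[OF e]]])
        fix \<phi> :: "real^'n \<Rightarrow> complex" assume \<phi>: "\<phi> \<in> schwartz_space"
        note m = mollify_schwartz[OF e \<phi>]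
        have "(LINT x|lborel. ?F \<epsilon> x * \<phi> x) = (LINT y|lborel. ?p ?v y * mollify \<epsilon> \<phi> (L y))"
          unfolding smoothing_def by (rule integral_conv_gauss_mult[OF L schwartz_integrable[OF p] e \<phi>])
        also have "\<dots> = mult_coord i h (mollify \<epsilon> \<phi>)"
          using m happ[OF schwartz_coord_mult[OF m, of i]]
          by (simp add: mult_coord_def inner_axis' mult_ac)
        finally show "(LINT x|lborel. ?F \<epsilon> x * \<phi> x) = convolve (mult_coord i h) (gaussian \<epsilon>) \<phi>"
          unfolding convolve_gaussian[OF e \<phi>] .
      qed (simp add: convolve_def)
      from def obtain l where "has_kernel_form M (mult_coord i h) (mult_coord i h) l"
        unfolding M_defined_def by blast
      hence l: "((\<lambda>\<epsilon>. kernel_form_fun M (?F \<epsilon>) (?F \<epsilon>)) \<longlongrightarrow> l) (at_right 0)"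
        using has_kernel_form_iff[OF Mm B Fi Fd Fi Fd] by blast
      have lM: "M_matrix M h $ i $ i = Re l"
        unfolding M_matrix_def using kernel_form_eqI[OF Mm B Fi Fd Fi Fd l] by simp
      let ?P = "?n (?p ?v)"
      have "\<forall>\<^sub>F \<epsilon> in at_right 0. norm (kernel_form_fun M (?u \<epsilon>) (?u \<epsilon>) - kernel_form_fun M (?F \<epsilon>) (?F \<epsilon>)) \<le>
          B * ((G * (C0 * \<epsilon>)) * (G * (C0 * \<epsilon>) + ?P)) + B * (?P * (G * (C0 * \<epsilon>)))"
        using eventually_at_right_less[of "0::real"] eventually_at_right_real[of 0 "1::real", simplified]
      proof eventually_elim
        case (elim \<epsilon>)
        hence e: "0 < \<epsilon>" "\<epsilon> \<le> 1" by auto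
        have u: "integrable lborel (?u \<epsilon>)" by (intro schwartz_integrable schwartz_inner_mult s e)
        note Fi' = Fi[OF e(1)]
        have d: "?n (\<lambda>x. ?u \<epsilon> x - ?F \<epsilon> x) \<le> G * (C0 * \<epsilon>)" by (rule comm[OF e]) simp
        have FP: "?n (?F \<epsilon>) \<le> ?P" by (rule smoothing_L1[OF L Lle g(2) e(1) p])
        have "?n (?u \<epsilon>) \<le> (LINT x|lborel. norm (?u \<epsilon> x - ?F \<epsilon> x) + norm (?F \<epsilon> x))"
          using u Fi' norm_triangle_sub[of "?u \<epsilon> x" "?F \<epsilon> x" for x]
          by (intro integral_mono Bochner_Integration.integrable_add integrable_norm Bochner_Integration.integrable_diff)
             (auto simp: add.commute)
        also have "\<dots> = ?n (\<lambda>x. ?u \<epsilon> x - ?F \<epsilon> x) + ?n (?F \<epsilon>)"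
          by (intro Bochner_Integration.integral_add integrable_norm Bochner_Integration.integrable_diff u Fi')
        finally have un: "?n (?u \<epsilon>) \<le> G * (C0 * \<epsilon>) + ?P" using d FP by linarith
        have "norm (kernel_form_fun M (?u \<epsilon>) (?u \<epsilon>) - kernel_form_fun M (?F \<epsilon>) (?F \<epsilon>)) \<le>
            B * (?n (\<lambda>x. ?u \<epsilon> x - ?F \<epsilon> x) * ?n (?u \<epsilon>)) + B * (?n (?F \<epsilon>) * ?n (\<lambda>x. ?u \<epsilon> x - ?F \<epsilon> x))"
          by (rule kernel_form_fun_diff_bound[OF Mm B u u Fi' Fi'])
        also have "\<dots> \<le> B * ((G * (C0 * \<epsilon>)) * (G * (C0 * \<epsilon>) + ?P)) + B * (?P * (G * (C0 * \<epsilon>)))"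
          using B(1) G0 C0(1) e d un FP
          by (intro add_mono mult_left_mono mult_mono) auto
        finally show ?case .
      qed
      moreover have "((\<lambda>\<epsilon>. B * ((G * (C0 * \<epsilon>)) * (G * (C0 * \<epsilon>) + ?P)) + B * (?P * (G * (C0 * \<epsilon>)))) \<longlongrightarrow>
          B * ((G * (C0 * 0)) * (G * (C0 * 0) + ?P)) + B * (?P * (G * (C0 * 0)))) (at_right 0)"
        by (intro tendsto_intros)
      hence "((\<lambda>\<epsilon>. B * ((G * (C0 * \<epsilon>)) * (G * (C0 * \<epsilon>) + ?P)) + B * (?P * (G * (C0 * \<epsilon>)))) \<longlongrightarrow> 0) (at_right 0)"
        by simp
      ultimately have "((\<lambda>\<epsilon>. kernel_form_fun M (?u \<epsilon>) (?u \<epsilon>) - kernel_form_fun M (?F \<epsilon>) (?F \<epsilon>)) \<longlongrightarrow> 0) (at_right 0)"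
        by (rule Lim_null_comparison)
      from tendsto_add[OF this l]
      have "((\<lambda>\<epsilon>. kernel_form_fun M (?u \<epsilon>) (?u \<epsilon>)) \<longlongrightarrow> l) (at_right 0)" by simp
      from tendsto_Re[OF this] show ?thesis unfolding lM by (simp add: inner_axis')
    qed
    hence "((\<lambda>\<epsilon>. \<Sum>i\<in>UNIV. Re (kernel_form_fun M (\<lambda>x. of_real (x $ i) * ?s \<epsilon> x) (\<lambda>x. of_real (x $ i) * ?s \<epsilon> x)))
        \<longlongrightarrow> trace (M_matrix M h)) (at_right 0)"
      unfolding trace_def by (intro tendsto_sum)
    moreover have "\<forall>\<^sub>F \<epsilon> in at_right 0. (\<Sum>i\<in>UNIV. Re (kernel_form_fun M (\<lambda>x. of_real (x $ i) * ?s \<epsilon> x)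
        (\<lambda>x. of_real (x $ i) * ?s \<epsilon> x))) = trace (M_matrix M (distr_of (?s \<epsilon>)))"
      using eventually_at_right_less[of "0::real"]
      by eventually_elim (simp add: trace_def M_matrix_schwartz[OF M s])
    ultimately show ?thesis by (rule Lim_transform_eventually)
  qed
  have close: "norm (distr_of (?s \<epsilon>) \<phi> - h \<phi>) \<le> G * c"
    if "0 < \<epsilon>" "\<phi> \<in> schwartz_space" "\<And>x. norm (mollify \<epsilon> \<phi> x - \<phi> x) \<le> c" for \<epsilon> \<phi> c
    unfolding happ[OF that(2)] G_def by (rule smoothing_difference[OF L Lle g(2) that(2,1,3)])
  have nn: "0 \<le> card (- range \<iota>) * (B * (G * C0)\<^sup>2)" using B(1) by simp
  have 1: "\<forall>\<epsilon>>0. ?s \<epsilon> \<in> schwartz_space" by (intro allI impI s)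
  have 2: "\<forall>\<epsilon> \<phi> c. 0 < \<epsilon> \<and> \<phi> \<in> schwartz_space \<and> (\<forall>x. norm (mollify \<epsilon> \<phi> x - \<phi> x) \<le> c) \<longrightarrow>
      norm (distr_of (?s \<epsilon>) \<phi> - h \<phi>) \<le> G * c"
    by (intro allI impI, elim conjE, rule close) simp_all
  have 3: "\<forall>\<epsilon>. 0 < \<epsilon> \<and> \<epsilon> \<le> 1 \<longrightarrow>
      ky_fan_antinorm (CARD('n) - CARD('k)) (M_matrix M (distr_of (?s \<epsilon>))) \<le>
        (card (- range \<iota>) * (B * (G * C0)\<^sup>2)) * \<epsilon>\<^sup>2"
    by (intro allI impI, elim conjE, rule small)
  have 4: "M_defined M h \<longrightarrow>
      ((\<lambda>\<epsilon>. trace (M_matrix M (distr_of (?s \<epsilon>)))) \<longlongrightarrow> trace (M_matrix M h)) (at_right 0)"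
    by (intro impI tr)
  show ?thesis
    by (rule exI[of _ ?s], rule exI[of _ G], rule exI[of _ "card (- range \<iota>) * (B * (G * C0)\<^sup>2)"],
        rule conjI[OF G0 conjI[OF nn conjI[OF 1 conjI[OF 2 conjI[OF 3 4]]]]])
qed

text \<open>For each index, one width of smoothing serves all requirements at once, however fast \<open>lam\<close>
  grows. The distance to \<open>h j\<close> is measured uniformly in the test functions, relative to the rate at
  which mollification converges on them.\<close>

lemma recovery_sequence:
  fixes \<iota> :: "'k::finite \<Rightarrow> 'n::finite" and h :: "nat \<Rightarrow> 'n distr" and lam :: "nat \<Rightarrow> real"
  assumes \<iota>: "inj \<iota>" and M: "proper_kernel M" and h: "\<And>j. h j \<in> G_schwartz \<iota>"
    and lim: "limitin weak_topology h T sequentially"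
  shows "\<exists>s. (\<forall>j. s j \<in> schwartz_space) \<and> limitin weak_topology (\<lambda>j. distr_of (s j)) T sequentially \<and>
    (\<lambda>j. lam j * ky_fan_antinorm (CARD('n) - CARD('k)) (M_matrix M (distr_of (s j)))) \<longlonglongrightarrow> 0 \<and>
    (\<forall>j. M_defined M (h j) \<longrightarrow> trace (M_matrix M (distr_of (s j))) \<le> trace (M_matrix M (h j)) + 1)"
proof -
  let ?R = "\<lambda>f. ky_fan_antinorm (CARD('n) - CARD('k)) (M_matrix M (distr_of f))"
  let ?\<delta> = "\<lambda>j::nat. inverse (real (Suc j))"
  have \<delta>: "?\<delta> j > 0" for j by simp
  \<comment> \<open>Naming the requirements separates the choice of the width for one index from the choice of the
    sequence.\<close>
  define P where "P j f \<longleftrightarrow> f \<in> schwartz_space \<and> \<bar>lam j * ?R f\<bar> \<le> ?\<delta> j \<and>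
    (M_defined M (h j) \<longrightarrow> trace (M_matrix M (distr_of f)) \<le> trace (M_matrix M (h j)) + 1) \<and>
    (\<forall>\<phi> c. \<phi> \<in> schwartz_space \<and> c \<ge> 0 \<and>
      (\<forall>\<epsilon> x. 0 < \<epsilon> \<and> \<epsilon> \<le> 1 \<longrightarrow> norm (mollify \<epsilon> \<phi> x - \<phi> x) \<le> c * \<epsilon>) \<longrightarrow>
      norm (distr_of f \<phi> - h j \<phi>) \<le> c * ?\<delta> j)" for j f
  have "\<exists>f. P j f" for j
  proof -
    from smoothing_G_schwartz[OF \<iota> M h[of j]] obtain s G C where *: "G \<ge> 0" "C \<ge> 0"
      "\<forall>\<epsilon>>0. s \<epsilon> \<in> schwartz_space"
      "\<forall>\<epsilon> \<phi> c. 0 < \<epsilon> \<and> \<phi> \<in> schwartz_space \<and> (\<forall>x. norm (mollify \<epsilon> \<phi> x - \<phi> x) \<le> c) \<longrightarrow>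
        norm (distr_of (s \<epsilon>) \<phi> - h j \<phi>) \<le> G * c"
      "\<forall>\<epsilon>. 0 < \<epsilon> \<and> \<epsilon> \<le> 1 \<longrightarrow> ?R (s \<epsilon>) \<le> C * \<epsilon>\<^sup>2"
      "M_defined M (h j) \<longrightarrow>
        ((\<lambda>\<epsilon>. trace (M_matrix M (distr_of (s \<epsilon>)))) \<longlongrightarrow> trace (M_matrix M (h j))) (at_right 0)"
      by (elim exE conjE) (rule that)
    have e1: "\<forall>\<^sub>F \<epsilon> in at_right 0. G * \<epsilon> < ?\<delta> j"
    proof (rule order_tendstoD(2))
      have "((\<lambda>\<epsilon>. G * \<epsilon>) \<longlongrightarrow> G * 0) (at_right 0)" by (intro tendsto_intros)
      thus "((\<lambda>\<epsilon>. G * \<epsilon>) \<longlongrightarrow> 0) (at_right 0)" by simp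
    qed (rule \<delta>)
    have e2: "\<forall>\<^sub>F \<epsilon> in at_right 0. \<bar>lam j\<bar> * (C * \<epsilon>\<^sup>2) < ?\<delta> j"
    proof (rule order_tendstoD(2))
      have "((\<lambda>\<epsilon>. \<bar>lam j\<bar> * (C * \<epsilon>\<^sup>2)) \<longlongrightarrow> \<bar>lam j\<bar> * (C * 0\<^sup>2)) (at_right 0)" by (intro tendsto_intros)
      thus "((\<lambda>\<epsilon>. \<bar>lam j\<bar> * (C * \<epsilon>\<^sup>2)) \<longlongrightarrow> 0) (at_right 0)" by simp
    qed (rule \<delta>)
    have e3: "\<forall>\<^sub>F \<epsilon> in at_right 0. M_defined M (h j) \<longrightarrow>
        trace (M_matrix M (distr_of (s \<epsilon>))) < trace (M_matrix M (h j)) + 1"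
    proof (cases "M_defined M (h j)")
      case True
      from order_tendstoD(2)[OF *(6)[rule_format, OF True], of "trace (M_matrix M (h j)) + 1"]
      show ?thesis by (simp add: True)
    qed simp
    have "\<forall>\<^sub>F \<epsilon> in at_right 0. 0 < \<epsilon> \<and> \<epsilon> \<le> 1 \<and> G * \<epsilon> < ?\<delta> j \<and> \<bar>lam j\<bar> * (C * \<epsilon>\<^sup>2) < ?\<delta> j \<and>
        (M_defined M (h j) \<longrightarrow> trace (M_matrix M (distr_of (s \<epsilon>))) < trace (M_matrix M (h j)) + 1)"
      using eventually_at_right_less[of "0::real"] eventually_at_right_real[of 0 "1::real", simplified] e1 e2 e3
      by eventually_elim auto
    from eventually_happens'[OF trivial_limit_at_right_real this] obtain \<epsilon> where e: "0 < \<epsilon>" "\<epsilon> \<le> 1"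
      "G * \<epsilon> < ?\<delta> j" "\<bar>lam j\<bar> * (C * \<epsilon>\<^sup>2) < ?\<delta> j"
      "M_defined M (h j) \<longrightarrow> trace (M_matrix M (distr_of (s \<epsilon>))) < trace (M_matrix M (h j)) + 1"
      by (elim exE conjE) (rule that)
    have s: "s \<epsilon> \<in> schwartz_space" using *(3) e(1) by blast
    have R0: "0 \<le> ?R (s \<epsilon>)"
      by (intro ky_fan_antinorm_nonneg M_matrix_psd[OF M s]) simp
    have "\<bar>lam j * ?R (s \<epsilon>)\<bar> \<le> \<bar>lam j\<bar> * (C * \<epsilon>\<^sup>2)"
      unfolding abs_mult using R0 *(5) e(1,2) by (intro mult_left_mono) auto
    hence "\<bar>lam j * ?R (s \<epsilon>)\<bar> \<le> ?\<delta> j" using e(4) by linarith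
    moreover have "norm (distr_of (s \<epsilon>) \<phi> - h j \<phi>) \<le> c * ?\<delta> j"
      if "\<phi> \<in> schwartz_space" "c \<ge> 0" "\<forall>\<epsilon> x. 0 < \<epsilon> \<and> \<epsilon> \<le> 1 \<longrightarrow> norm (mollify \<epsilon> \<phi> x - \<phi> x) \<le> c * \<epsilon>" for \<phi> c
    proof -
      have "norm (distr_of (s \<epsilon>) \<phi> - h j \<phi>) \<le> G * (c * \<epsilon>)" using *(4) that e(1,2) by blast
      also have "\<dots> = c * (G * \<epsilon>)" by (simp only: mult.left_commute)
      also have "\<dots> \<le> c * ?\<delta> j" using e(3) that(2) by (intro mult_left_mono) auto
      finally show ?thesis .
    qed
    moreover have "M_defined M (h j) \<longrightarrow> trace (M_matrix M (distr_of (s \<epsilon>))) \<le> trace (M_matrix M (h j)) + 1"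
      using e(5) by (intro impI less_imp_le) (erule mp)
    ultimately have "P j (s \<epsilon>)" unfolding P_def using s by (intro conjI allI impI; (elim conjE)?) simp_all
    thus ?thesis by blast
  qed
  then obtain s where P: "\<And>j. P j (s j)" by metis
  have s: "s j \<in> schwartz_space" for j using P[of j] by (simp add: P_def)
  have R: "\<bar>lam j * ?R (s j)\<bar> \<le> ?\<delta> j" for j using P[of j] unfolding P_def by blast
  have "(\<lambda>j. lam j * ?R (s j)) \<longlonglongrightarrow> 0"
    by (rule Lim_null_comparison[OF always_eventually LIMSEQ_inverse_real_of_nat], rule allI)
       (simp only: real_norm_def R)
  moreover have "limitin weak_topology (\<lambda>j. distr_of (s j)) T sequentially"
    unfolding limitin_weak_topology
  proof (intro conjI ballI)
    show "T \<in> tempered" using lim by (simp add: limitin_weak_topology)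
    show "\<forall>\<^sub>F j in sequentially. distr_of (s j) \<in> tempered"
      by (intro always_eventually allI distr_of_tempered s)
    fix \<phi> :: "real^'n \<Rightarrow> complex" assume \<phi>: "\<phi> \<in> schwartz_space"
    obtain c where c: "c \<ge> 0" "\<forall>\<epsilon> x. 0 < \<epsilon> \<and> \<epsilon> \<le> 1 \<longrightarrow> norm (mollify \<epsilon> \<phi> x - \<phi> x) \<le> c * \<epsilon>"
      using mollify_weighted_close[OF \<phi>, of 0] by auto
    have b: "norm (distr_of (s j) \<phi> - h j \<phi>) \<le> c * ?\<delta> j" for j
      using P[of j] \<phi> c unfolding P_def by blast
    have "(\<lambda>j. c * ?\<delta> j) \<longlonglongrightarrow> c * 0" by (intro tendsto_mult tendsto_const LIMSEQ_inverse_real_of_nat)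
    hence l: "(\<lambda>j. c * ?\<delta> j) \<longlonglongrightarrow> 0" by (simp only: mult_zero_right)
    have "(\<lambda>j. distr_of (s j) \<phi> - h j \<phi>) \<longlonglongrightarrow> 0"
      by (rule Lim_null_comparison[OF always_eventually l]) (rule allI, rule b)
    moreover have "(\<lambda>j. h j \<phi>) \<longlonglongrightarrow> T \<phi>" using lim \<phi> by (simp add: limitin_weak_topology)
    ultimately have "(\<lambda>j. (distr_of (s j) \<phi> - h j \<phi>) + h j \<phi>) \<longlonglongrightarrow> 0 + T \<phi>" by (rule tendsto_add)
    thus "(\<lambda>j. distr_of (s j) \<phi>) \<longlonglongrightarrow> T \<phi>" by simp
  qed
  moreover have "M_defined M (h j) \<longrightarrow> trace (M_matrix M (distr_of (s j))) \<le> trace (M_matrix M (h j)) + 1" for j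
    using P[of j] unfolding P_def by (elim conjE)
  ultimately show ?thesis using s by (intro exI[of _ s] conjI allI)
qed

lemma G_tempered_approximation:
  fixes \<iota> :: "'k::finite \<Rightarrow> 'n::finite"
  assumes \<iota>: "inj \<iota>" and h: "h \<in> G_tempered \<iota>"
  shows "\<exists>t. (\<forall>j. t j \<in> G_schwartz \<iota>) \<and> limitin weak_topology t h sequentially"
proof -
  obtain g U where g: "h = rotate_distr U (tensor_delta \<iota> g)" "g \<in> tempered" and U: "orthogonal_matrix U"
    using h unfolding G_tempered_def by blast
  obtain s where s: "\<And>j. s j \<in> schwartz_space" "limitin weak_topology (\<lambda>j. distr_of (s j)) g sequentially"
    using schwartz_sequentially_dense[OF g(2)] by blast
  define t where "t j = rotate_distr U (tensor_delta \<iota> (distr_of (s j)))" for j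
  have t: "t j \<in> G_schwartz \<iota>" for j unfolding G_schwartz_def t_def using s(1) U by blast
  have "limitin weak_topology t h sequentially"
    unfolding limitin_weak_topology
  proof (intro conjI ballI always_eventually allI)
    show "h \<in> tempered" by (rule G_tempered_tempered[OF \<iota> h])
    show "t j \<in> tempered" for j using t G_schwartz_subset G_tempered_tempered[OF \<iota>] by blast
    fix \<phi> :: "real^'n \<Rightarrow> complex" assume \<phi>: "\<phi> \<in> schwartz_space"
    show "(\<lambda>j. t j \<phi>) \<longlonglongrightarrow> h \<phi>"
      unfolding t_def g(1) rotate_tensor_apply[OF U \<phi>]
      using s(2) continuous_op_mem[OF continuous_op_embedding[OF \<iota> U] \<phi>]
      unfolding limitin_weak_topology by blast
  qed
  thus ?thesis using t by blast
qed

section \<open>The penalized problem\<close>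

text \<open>An element of the regular solution set is already the limit of a full sequence of almost
  minimizers, since the parameters may be thinned out together with the functions.\<close>

lemma regular_solution_subsequence:
  fixes I R :: "'n::finite distr \<Rightarrow> real"
  assumes "T \<in> rsol M I R"
  shows "\<exists>f eps lam. (\<forall>i::nat. f i \<in> schwartz_space) \<and> eps \<longlonglongrightarrow> (0::real) \<and>
    filterlim lam at_top sequentially \<and>
    (\<forall>i. \<forall>h\<in>schwartz_space. I (distr_of (f i)) + lam i * R (distr_of (f i)) \<le>
      I (distr_of h) + lam i * R (distr_of h) + eps i) \<and>
    limitin weak_topology (\<lambda>i. distr_of (f i)) T sequentially"
proof -
  obtain f where f: "regularly_solves M I R f" and T: "T \<in> Lim_set (\<lambda>i. distr_of (f i))"
    using assms unfolding rsol_def by blast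
  obtain r where r: "strict_mono r" "limitin weak_topology ((\<lambda>i. distr_of (f i)) \<circ> r) T sequentially"
    using T unfolding Lim_set_def by blast
  obtain eps lam where el: "filterlim eps (at_right 0) sequentially" "filterlim lam at_top sequentially"
    "\<And>i. ereal (I (distr_of (f i)) + lam i * R (distr_of (f i)))
              \<le> (INF h\<in>schwartz_space. ereal (I (distr_of h) + lam i * R (distr_of h))) + ereal (eps i)"
    and fs: "\<And>i. f i \<in> schwartz_space"
    using f unfolding regularly_solves_def by auto
  have le: "I (distr_of (f i)) + lam i * R (distr_of (f i)) \<le> I (distr_of h) + lam i * R (distr_of h) + eps i"
    if "h \<in> schwartz_space" for i h
  proof -
    have "ereal (I (distr_of (f i)) + lam i * R (distr_of (f i))) \<le>
        ereal (I (distr_of h) + lam i * R (distr_of h)) + ereal (eps i)"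
      by (rule order_trans[OF el(3) add_right_mono[OF INF_lower[OF that]]])
    thus ?thesis by simp
  qed
  have "eps \<longlonglongrightarrow> 0" using el(1) by (rule filterlim_mono[OF _ at_within_le_nhds order_refl])
  hence "(\<lambda>i. eps (r i)) \<longlonglongrightarrow> 0" using LIMSEQ_subseq_LIMSEQ[OF _ r(1)] by (auto simp: comp_def)
  moreover have "filterlim (\<lambda>i. lam (r i)) at_top sequentially"
    by (rule filterlim_compose[OF el(2) filterlim_subseq[OF r(1)]])
  ultimately show ?thesis using fs le r(2)
    by (intro exI[of _ "\<lambda>i. f (r i)"] exI[of _ "\<lambda>i. eps (r i)"] exI[of _ "\<lambda>i. lam (r i)"]) (auto simp: comp_def)
qed

lemma regularly_solvesI:
  assumes "\<And>i. f i \<in> schwartz_space" "filterlim eps (at_right 0) sequentially" "filterlim lam at_top sequentially"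
    and "\<And>i. ereal (I (distr_of (f i)) + lam i * R (distr_of (f i)))
          \<le> (INF h\<in>schwartz_space. ereal (I (distr_of h) + lam i * R (distr_of h))) + ereal (eps i)"
    and "bounded (range (\<lambda>i. trace (M_matrix M (distr_of (f i)))))"
  shows "regularly_solves M I R f"
  unfolding regularly_solves_def by (intro conjI allI exI; fact assms)

lemma M_matrix_zero:
  assumes "proper_kernel M"
  shows "M_matrix M (distr_of (\<lambda>x. 0)) = 0"
  by (simp add: vec_eq_iff M_matrix_schwartz[OF assms schwartz_zero] kernel_form_fun_eq)

lemma ky_fan_antinorm_zero: "ky_fan_antinorm (CARD('n) - m) (0 :: real^'n^'n) = 0"
proof -
  have "\<exists>K :: 'n set. card K = CARD('n) - m"
    using obtain_subset_with_card_n[of "CARD('n) - m" "UNIV :: 'n set"] by auto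
  then obtain K :: "'n set" where K: "card K = CARD('n) - m" by blast
  have "ky_fan_antinorm (card K) (0 :: real^'n^'n) \<le> 0"
    using ky_fan_antinorm_le[of "0 :: real^'n^'n" "mat 1" K] by (simp add: transpose_def vec_eq_iff orthogonal_matrix_id)
  moreover have "0 \<le> ky_fan_antinorm (card K) (0 :: real^'n^'n)"
    by (rule ky_fan_antinorm_nonneg) (auto simp: transpose_def vec_eq_iff K)
  ultimately show ?thesis by (simp add: K)
qed

theorem theorem7:
  fixes \<iota> :: "'k::finite \<Rightarrow> 'n::finite"
    and M :: "real^'n \<Rightarrow> real^'n \<Rightarrow> complex"
    and I R :: "'n distr \<Rightarrow> real"
  assumes "inj \<iota>"
    and "proper_kernel M"
    and "\<And>f. R f = ky_fan_antinorm (CARD('n) - CARD('k)) (M_matrix M f)"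
    and "\<And>f. f \<in> G_tempered \<iota> \<union> distr_of ` schwartz_space \<Longrightarrow> 0 \<le> I f"
    and "\<And>s f. \<lbrakk>\<And>i. s i \<in> schwartz_space; f \<in> G_tempered \<iota>;
           limitin weak_topology (\<lambda>i. distr_of (s i)) f sequentially\<rbrakk>
           \<Longrightarrow> (\<lambda>i::nat. I (distr_of (s i))) \<longlonglongrightarrow> I f"
    and "Arg_min_set I (G_tempered \<iota>) \<subseteq> B_set M \<iota>"
    and "rsol M I R \<noteq> {}"
  shows "rsol M I R = Arg_min_set I (G_tempered \<iota>)"
proof -
  note \<iota> = assms(1) and M = assms(2) and Rdef = assms(3) and Icont = assms(5)
  let ?G = "G_tempered \<iota>"
  have R0: "0 \<le> R (distr_of f)" if "f \<in> schwartz_space" for f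
    unfolding Rdef by (intro ky_fan_antinorm_nonneg M_matrix_psd[OF M that]) simp
  have I0: "0 \<le> I (distr_of f)" if "f \<in> schwartz_space" for f using assms(4) that by blast
  have Rz: "R (distr_of (\<lambda>x. 0)) = 0" unfolding Rdef M_matrix_zero[OF M] by (rule ky_fan_antinorm_zero)

  \<comment> \<open>Comparison with the zero function forces the penalty to vanish along almost minimizers.\<close>
  have limit: "T \<in> ?G"
    if f: "\<And>i. f i \<in> schwartz_space" and eps: "eps \<longlonglongrightarrow> 0" and lam: "filterlim lam at_top sequentially"
      and le: "\<And>i h. h \<in> schwartz_space \<Longrightarrow> I (distr_of (f i)) + lam i * R (distr_of (f i)) \<le>
        I (distr_of h) + lam i * R (distr_of h) + eps i"
      and T: "limitin weak_topology (\<lambda>i. distr_of (f i)) T sequentially"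
    for f :: "nat \<Rightarrow> real^'n \<Rightarrow> complex" and eps lam T
  proof (rule vanishing_antinorm_limit[OF \<iota> M f T])
    let ?z = "I (distr_of (\<lambda>x. 0))"
    have "(\<lambda>i. (?z + eps i) / lam i) \<longlonglongrightarrow> 0"
      by (rule tendsto_divide_0[OF tendsto_add[OF tendsto_const eps]])
         (rule filterlim_at_top_imp_at_infinity[OF lam])
    moreover have "\<forall>\<^sub>F i in sequentially. norm (R (distr_of (f i))) \<le> (?z + eps i) / lam i"
      using filterlim_at_top_dense[THEN iffD1, OF lam, rule_format, of 0]
    proof eventually_elim
      case (elim i)
      have "lam i * R (distr_of (f i)) \<le> ?z + eps i"
        using le[OF schwartz_zero, of i] I0[OF f[of i]] by (simp add: Rz)
      thus ?case using elim R0[OF f[of i]] by (simp add: field_simps)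
    qed
    ultimately have "(\<lambda>i. R (distr_of (f i))) \<longlonglongrightarrow> 0" by (rule Lim_null_comparison[rotated])
    thus "(\<lambda>i. ky_fan_antinorm (CARD('n) - CARD('k)) (M_matrix M (distr_of (f i)))) \<longlonglongrightarrow> 0"
      unfolding Rdef .
  qed

  show ?thesis
  proof (intro equalityI subsetI)
    \<comment> \<open>Limits of almost minimizers are minimizers: compare with a recovery sequence of a competitor.\<close>
    fix T assume "T \<in> rsol M I R"
    from regular_solution_subsequence[OF this] obtain f eps lam
      where f: "\<forall>i. f i \<in> schwartz_space" and eps: "eps \<longlonglongrightarrow> 0" and lam: "filterlim lam at_top sequentially"
        and le: "\<forall>i. \<forall>h\<in>schwartz_space. I (distr_of (f i)) + lam i * R (distr_of (f i)) \<le>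
          I (distr_of h) + lam i * R (distr_of h) + eps i"
        and lim: "limitin weak_topology (\<lambda>i. distr_of (f i)) T sequentially"
      by (elim exE conjE) (rule that)
    have T: "T \<in> ?G" by (rule limit[OF spec[OF f] eps lam bspec[OF spec[OF le]] lim])
    have "I T \<le> I h" if h: "h \<in> ?G" for h
    proof -
      from G_tempered_approximation[OF \<iota> h]
      obtain t where t: "\<forall>j. t j \<in> G_schwartz \<iota>" "limitin weak_topology t h sequentially"
        by (elim exE conjE) (rule that)
      from recovery_sequence[OF \<iota> M spec[OF t(1)] t(2), of lam, folded Rdef]
      obtain s where s0: "\<forall>j. s j \<in> schwartz_space"
        and slim: "limitin weak_topology (\<lambda>j. distr_of (s j)) h sequentially"
        and sR: "(\<lambda>j. lam j * R (distr_of (s j))) \<longlonglongrightarrow> 0"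
        by (elim exE conjE) (rule that)
      note s = spec[OF s0] slim sR
      have "(\<lambda>j. I (distr_of (s j)) + lam j * R (distr_of (s j)) + eps j) \<longlonglongrightarrow> I h + 0 + 0"
        by (rule tendsto_add[OF tendsto_add[OF Icont[OF s(1) h s(2)] s(3)] eps])
      moreover have "(\<lambda>j. I (distr_of (f j))) \<longlonglongrightarrow> I T" by (rule Icont[OF spec[OF f] T lim])
      moreover have "\<forall>\<^sub>F j in sequentially. I (distr_of (f j)) \<le> I (distr_of (s j)) + lam j * R (distr_of (s j)) + eps j"
        using filterlim_at_top_dense[THEN iffD1, OF lam, rule_format, of 0]
      proof eventually_elim
        case (elim j)
        have "0 \<le> lam j * R (distr_of (f j))" using elim R0 f by simp
        moreover have "I (distr_of (f j)) + lam j * R (distr_of (f j)) \<le>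
            I (distr_of (s j)) + lam j * R (distr_of (s j)) + eps j" by (rule bspec[OF spec[OF le] s(1)])
        ultimately show ?case by linarith
      qed
      ultimately have "I T \<le> I h + 0 + 0" by (rule tendsto_le[OF sequentially_bot])
      thus ?thesis by simp
    qed
    thus "T \<in> Arg_min_set I ?G" using T by (simp add: Arg_min_set_def is_arg_min_linorder)
  next
    \<comment> \<open>A minimizer is the limit of a regular solution: its recovery sequence is almost minimizing,
      since the given regular solution \<open>f\<close> bounds the infima of the penalized problems from below.\<close>
    fix h assume h: "h \<in> Arg_min_set I ?G"
    hence hG: "h \<in> ?G" and hmin: "\<And>T. T \<in> ?G \<Longrightarrow> I h \<le> I T"
      by (simp_all add: Arg_min_set_def is_arg_min_linorder)
    from assms(7) obtain T where "T \<in> rsol M I R" by blast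
    from regular_solution_subsequence[OF this] obtain f eps lam
      where f: "\<forall>i. f i \<in> schwartz_space" and eps: "eps \<longlonglongrightarrow> 0" and lam: "filterlim lam at_top sequentially"
        and le: "\<forall>i. \<forall>h\<in>schwartz_space. I (distr_of (f i)) + lam i * R (distr_of (f i)) \<le>
          I (distr_of h) + lam i * R (distr_of h) + eps i"
        and lim: "limitin weak_topology (\<lambda>i. distr_of (f i)) T sequentially"
      by (elim exE conjE) (rule that)
    have T: "T \<in> ?G" by (rule limit[OF spec[OF f] eps lam bspec[OF spec[OF le]] lim])
    from h assms(6) have "h \<in> B_set M \<iota>" by blast
    then obtain C where "h \<in> seq_closure {f \<in> G_schwartz \<iota>. M_defined M f \<and> trace (M_matrix M f) \<le> C}"
      unfolding B_set_def by (elim UN_E)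
    then obtain t where t0: "\<forall>j. t j \<in> {f \<in> G_schwartz \<iota>. M_defined M f \<and> trace (M_matrix M f) \<le> C}"
      and tlim: "limitin weak_topology t h sequentially"
      unfolding seq_closure_def mem_Collect_eq[of h] by (elim exE conjE) (rule that)
    have t: "t j \<in> G_schwartz \<iota>" "M_defined M (t j)" "trace (M_matrix M (t j)) \<le> C" for j
      using spec[OF t0, of j] by simp_all
    from recovery_sequence[OF \<iota> M t(1) tlim, of lam, folded Rdef]
    obtain s where s0: "\<forall>j. s j \<in> schwartz_space"
      and slim: "limitin weak_topology (\<lambda>j. distr_of (s j)) h sequentially"
      and sR: "(\<lambda>j. lam j * R (distr_of (s j))) \<longlonglongrightarrow> 0"
      and str: "\<forall>j. M_defined M (t j) \<longrightarrow> trace (M_matrix M (distr_of (s j))) \<le> trace (M_matrix M (t j)) + 1"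
      by (elim exE conjE) (rule that)
    note s = spec[OF s0] slim sR mp[OF spec[OF str] t(2)]
    \<comment> \<open>\<open>?b\<close> is a lower bound of the penalized infimum and \<open>?d\<close> the excess of the recovery sequence over
      it; the last summand of \<open>?e\<close> makes the error strictly positive, as regular solutions require.\<close>
    let ?b = "\<lambda>j. I (distr_of (f j)) + lam j * R (distr_of (f j)) - eps j"
    let ?d = "\<lambda>j. I (distr_of (s j)) + lam j * R (distr_of (s j)) - ?b j"
    let ?e = "\<lambda>j. max 0 (?d j) + inverse (real (Suc j))"
    have "(\<lambda>j. max 0 (?d j)) \<longlonglongrightarrow> 0"
    proof (rule tendsto_sandwich[OF _ _ tendsto_const])
      have "(\<lambda>j. I (distr_of (s j)) + lam j * R (distr_of (s j)) - I (distr_of (f j)) + eps j) \<longlonglongrightarrow> I h + 0 - I T + 0"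
        by (rule tendsto_add[OF tendsto_diff[OF tendsto_add[OF Icont[OF s(1) hG s(2)] s(3)] Icont[OF spec[OF f] T lim]] eps])
      hence "(\<lambda>j. max 0 (I (distr_of (s j)) + lam j * R (distr_of (s j)) - I (distr_of (f j)) + eps j)) \<longlonglongrightarrow> max 0 (I h + 0 - I T + 0)"
        by (rule tendsto_max[OF tendsto_const])
      thus "(\<lambda>j. max 0 (I (distr_of (s j)) + lam j * R (distr_of (s j)) - I (distr_of (f j)) + eps j)) \<longlonglongrightarrow> 0"
        using hmin[OF T] by simp
      show "\<forall>\<^sub>F j in sequentially. max 0 (?d j) \<le>
          max 0 (I (distr_of (s j)) + lam j * R (distr_of (s j)) - I (distr_of (f j)) + eps j)"
        using filterlim_at_top_dense[THEN iffD1, OF lam, rule_format, of 0]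
      proof eventually_elim
        case (elim j)
        have "0 \<le> lam j * R (distr_of (f j))" using elim R0 f by simp
        thus ?case by simp
      qed
      show "\<forall>\<^sub>F j in sequentially. 0 \<le> max 0 (?d j)" by simp
    qed
    from tendsto_add[OF this LIMSEQ_inverse_real_of_nat] have e0: "?e \<longlonglongrightarrow> 0" by simp
    have epos: "?e j > 0" for j by (simp add: add_nonneg_pos)
    have "regularly_solves M I R s"
    proof (rule regularly_solvesI[OF s(1) _ lam])
      show "filterlim ?e (at_right 0) sequentially"
        by (rule tendsto_imp_filterlim_at_right[OF e0]) (intro always_eventually allI epos)
      show "ereal (I (distr_of (s i)) + lam i * R (distr_of (s i)))
          \<le> (INF h\<in>schwartz_space. ereal (I (distr_of h) + lam i * R (distr_of h))) + ereal (?e i)" for i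
      proof -
        have "ereal (?b i) \<le> (INF h\<in>schwartz_space. ereal (I (distr_of h) + lam i * R (distr_of h)))"
        proof (rule INF_greatest)
          fix h :: "real^'n \<Rightarrow> complex" assume "h \<in> schwartz_space"
          from bspec[OF spec[OF le] this] have "I (distr_of (f i)) + lam i * R (distr_of (f i)) \<le>
              I (distr_of h) + lam i * R (distr_of h) + eps i" .
          thus "ereal (?b i) \<le> ereal (I (distr_of h) + lam i * R (distr_of h))" by simp
        qed
        from add_right_mono[OF this, of "ereal (?e i)"]
        have "ereal (?b i + ?e i) \<le> (INF h\<in>schwartz_space. ereal (I (distr_of h) + lam i * R (distr_of h))) + ereal (?e i)"
          by simp
        moreover have "?d i \<le> ?e i" using max.cobounded2[of "?d i" 0] by (simp add: add_increasing2)
        hence "ereal (I (distr_of (s i)) + lam i * R (distr_of (s i))) \<le> ereal (?b i + ?e i)" by simp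
        ultimately show ?thesis by (rule order_trans[rotated])
      qed
      have "norm (trace (M_matrix M (distr_of (s i)))) \<le> C + 1" for i
      proof -
        have "0 \<le> M_matrix M (distr_of (s i)) $ j $ j" for j
          using M_matrix_psd(2)[OF M s(1)[of i], of "axis j 1"]
          by (simp add: inner_axis' matrix_vector_mult_basis column_def)
        hence "0 \<le> trace (M_matrix M (distr_of (s i)))" unfolding trace_def by (intro sum_nonneg)
        moreover have "trace (M_matrix M (distr_of (s i))) \<le> C + 1" using s(4)[of i] t(3)[of i] by linarith
        ultimately show ?thesis by simp
      qed
      thus "bounded (range (\<lambda>i. trace (M_matrix M (distr_of (s i)))))" by (auto simp: bounded_iff)
    qed
    moreover have "h \<in> Lim_set (\<lambda>i. distr_of (s i))"
      unfolding Lim_set_def using s(2) by (intro CollectI exI[of _ id]) (auto simp: strict_mono_def)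
    ultimately show "h \<in> rsol M I R" unfolding rsol_def by blast
  qed
qed

end
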